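(* Let $\mathbb{K}$ be a field of characteristic $0$. For all $0<\epsilon<1$, as $n\to\infty$: $$\mathrm{ssGap}_{\mathbb K}\,rMo_n^T=\Omega\big((4-\epsilon)^n\big),\qquad \mathrm{ssGap}_{\mathbb K}\,rMo_n^T=O\big((4+\epsilon)^n\big),\qquad \mathrm{Gap}_{\mathbb K}\,Mo_n^T=\Omega\big((9-\epsilon)^n\big),$$ and consequently $\mathrm{ssGap}_{\mathbb K}\,rMo_n^T<\mathrm{Gap}_{\mathbb K}\,Mo_n^T$ for all sufficiently large $n$. Moreover $$\mathrm{ssRatio}_{\mathbb K}\,rMo_n^T=\Omega\big((1-\epsilon)^n\big),\qquad \mathrm{ssRatio}_{\mathbb K}\,rMo_n^T=O\big((1+\epsilon)^n\big),\qquad \mathrm{Ratio}_{\mathbb K}\,Mo_n^T=O\big((1+\epsilon)^n\big).$$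
   Context: Diagrams. The rigid Motzkin monoid $rMo_n$: let $W=1\,2\,1\,2\cdots 1\,2$ (length $2n$) label $2n$ top points and $2n$ bottom points from left to right. Elements are planar partitions of these $4n$ points into blocks of size $1$ (dots) or $2$, where a block of size $2$ is a through strand (joining a top and a bottom point with the same letter), a cup (joining two top points with letters, left to right, $1,2$), or a cap (joining two bottom points with letters, left to right, $2,1$). The (pivotal) Motzkin monoid $Mo_n$ consists of all planar partitions of $2n$ top and $2n$ bottom points into blocks of size $1$ or $2$ (no labels, so no letter restrictions). In both, the product $ab$ stacks $a$ on top of $b$, follows strings, and removes all pieces not connected to outer points (an outer point whose string ends in a dot becomes a dot). Truncation. $rMo_n^T$ and $Mo_n^T$ consist of the diagrams with $k$ through strands, $0\le k\le 2\sqrt{2n}$, together with an adjoined unit if the identity is not already included. Cells. In a finite monoid, $a\le_r b$ iff $b=ac$ for some $c$; $a\le_{lr}b$ iff $b=cad$ for some $c,d$; right cells and $J$-cells are the classes of the associated equivalence relations. The apex of a simple representation is the $\le_{lr}$-maximal $J$-cell not annihilated by it. Gaps. A representation is trivial if it is isomorphic to the one-dimensional representation where units act by $1$ and all other elements by $0$, or the one where all elements act by $1$. $\mathrm{Gap}_{\mathbb K}(M)$ is the smallest dimension of a nontrivial simple representation. $\mathrm{ssGap}_{\mathbb K}(M)$ is the smallest semisimple dimension of a nontrivial simple representation, where the semisimple dimension of a simple with apex $J$ is the size of a right cell contained in $J$. Ratios: $\mathrm{ssRatio}_{\mathbb K}(rMo_n^T)=\mathrm{ssGap}_{\mathbb K}(rMo_n^T)/\sqrt{|rMo_n^T|}$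 and $\mathrm{Ratio}_{\mathbb K}(Mo_n^T)=\mathrm{Gap}_{\mathbb K}(Mo_n^T)/\sqrt{|Mo_n|}$ (size of the full monoid $Mo_n$, following the paper's convention). *)

theory Defs
  imports
    "HOL-Library.Landau_Symbols"
    "HOL-Library.Disjoint_Sets"
    "Jordan_Normal_Form.VS_Connect"
begin

text \<open>A diagram with \<open>2n\<close> top and \<open>2n\<close> bottom points is the set of its blocks; dots are
  singleton blocks. Points in each row are numbered from left to right, starting with 1.\<close>

datatype point = Top nat | Bot nat

type_synonym diagram = "point set set"

definition points :: "nat \<Rightarrow> point set" where
  "points n = Top ` {1..2 * n} \<union> Bot ` {1..2 * n}"

text \<open>Position on the boundary of the rectangle: top row from left to right, then bottom row
  from right to left.\<close>

fun boundary_pos :: "nat \<Rightarrow> point \<Rightarrow> nat" where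
  "boundary_pos n (Top i) = i"
| "boundary_pos n (Bot i) = 4 * n + 1 - i"

definition planar :: "nat \<Rightarrow> diagram \<Rightarrow> bool" where
  "planar n P \<longleftrightarrow>
     \<not> (\<exists>B\<in>P. \<exists>C\<in>P. B \<noteq> C \<and> (\<exists>a\<in>B. \<exists>b\<in>C. \<exists>c\<in>B. \<exists>d\<in>C.
          boundary_pos n a < boundary_pos n b \<and>
          boundary_pos n b < boundary_pos n c \<and>
          boundary_pos n c < boundary_pos n d))"

definition motzkin_diagrams :: "nat \<Rightarrow> diagram set" where
  "motzkin_diagrams n =
     {P. partition_on (points n) P \<and> (\<forall>B\<in>P. card B = 1 \<or> card B = 2) \<and> planar n P}"

text \<open>The letter at place \<open>i\<close> of the word \<open>1 2 1 2 \<dots> 1 2\<close>.\<close>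

definition letter :: "nat \<Rightarrow> nat" where
  "letter i = (if odd i then 1 else 2)"

definition rigid_block :: "point set \<Rightarrow> bool" where
  "rigid_block B \<longleftrightarrow>
     (\<forall>i j. B = {Top i, Bot j} \<longrightarrow> letter i = letter j) \<and>
     (\<forall>i j. B = {Top i, Top j} \<and> i < j \<longrightarrow> letter i = 1 \<and> letter j = 2) \<and>
     (\<forall>i j. B = {Bot i, Bot j} \<and> i < j \<longrightarrow> letter i = 2 \<and> letter j = 1)"

definition rigid_motzkin_diagrams :: "nat \<Rightarrow> diagram set" where
  "rigid_motzkin_diagrams n = {P \<in> motzkin_diagrams n. \<forall>B\<in>P. rigid_block B}"

text \<open>To form \<open>ab\<close>, the diagram \<open>a\<close> is stacked on top of \<open>b\<close>: the bottom row of \<open>a\<close> and the top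
  row of \<open>b\<close> become a common middle row. The blocks of \<open>ab\<close> are the traces of the connected
  components on the outer points. Thus pieces that meet no outer point vanish, and an outer
  point whose string ends in a dot forms a singleton block.\<close>

datatype site = Upper nat | Middle nat | Lower nat

fun site_above :: "point \<Rightarrow> site" where
  "site_above (Top i) = Upper i"
| "site_above (Bot i) = Middle i"

fun site_below :: "point \<Rightarrow> site" where
  "site_below (Top i) = Middle i"
| "site_below (Bot i) = Lower i"

fun site_outer :: "point \<Rightarrow> site" where
  "site_outer (Top i) = Upper i"
| "site_outer (Bot i) = Lower i"

definition stack_links :: "diagram \<Rightarrow> diagram \<Rightarrow> site rel" where
  "stack_links a b =
     {(site_above p, site_above q) | p q. \<exists>B\<in>a. p \<in> B \<and> q \<in> B} \<union>
     {(site_below p, site_below q) | p q. \<exists>B\<in>b. p \<in> B \<and> q \<in> B}"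

definition diagram_mult :: "nat \<Rightarrow> diagram \<Rightarrow> diagram \<Rightarrow> diagram" where
  "diagram_mult n a b =
     points n // {(p, q). p \<in> points n \<and> q \<in> points n \<and>
                          (site_outer p, site_outer q) \<in> (stack_links a b)\<^sup>*}"

definition diagram_one :: "nat \<Rightarrow> diagram" where
  "diagram_one n = (\<lambda>i. {Top i, Bot i}) ` {1..2 * n}"

definition Mo :: "nat \<Rightarrow> diagram monoid" where
  "Mo n = \<lparr>carrier = motzkin_diagrams n, mult = diagram_mult n, one = diagram_one n\<rparr>"

definition rMo :: "nat \<Rightarrow> diagram monoid" where
  "rMo n = \<lparr>carrier = rigid_motzkin_diagrams n, mult = diagram_mult n, one = diagram_one n\<rparr>"

definition through_strands :: "diagram \<Rightarrow> nat" where
  "through_strands P = card {B \<in> P. \<exists>i j. B = {Top i, Bot j}}"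

text \<open>The identity diagram serves as the adjoined unit. If it has too many through strands, then
  inserting it is, up to isomorphism, the same as adjoining an abstract unit.\<close>

definition truncate_diagrams :: "nat \<Rightarrow> diagram monoid \<Rightarrow> diagram monoid" where
  "truncate_diagrams n M =
     M\<lparr>carrier := insert \<one>\<^bsub>M\<^esub>
         {a \<in> carrier M. real (through_strands a) \<le> 2 * sqrt (2 * real n)}\<rparr>"

definition MoT :: "nat \<Rightarrow> diagram monoid" where
  "MoT n = truncate_diagrams n (Mo n)"

definition rMoT :: "nat \<Rightarrow> diagram monoid" where
  "rMoT n = truncate_diagrams n (rMo n)"

text \<open>In this convention the unit is the least element and products are larger than their
  factors.\<close>

definition le_r :: "('m, 'b) monoid_scheme \<Rightarrow> 'm \<Rightarrow> 'm \<Rightarrow> bool" where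
  "le_r M a b \<longleftrightarrow> (\<exists>c\<in>carrier M. b = a \<otimes>\<^bsub>M\<^esub> c)"

definition le_lr :: "('m, 'b) monoid_scheme \<Rightarrow> 'm \<Rightarrow> 'm \<Rightarrow> bool" where
  "le_lr M a b \<longleftrightarrow> (\<exists>c\<in>carrier M. \<exists>d\<in>carrier M. b = c \<otimes>\<^bsub>M\<^esub> a \<otimes>\<^bsub>M\<^esub> d)"

definition right_cells :: "('m, 'b) monoid_scheme \<Rightarrow> 'm set set" where
  "right_cells M =
     carrier M // {(a, b). a \<in> carrier M \<and> b \<in> carrier M \<and> le_r M a b \<and> le_r M b a}"

definition J_cells :: "('m, 'b) monoid_scheme \<Rightarrow> 'm set set" where
  "J_cells M =
     carrier M // {(a, b). a \<in> carrier M \<and> b \<in> carrier M \<and> le_lr M a b \<and> le_lr M b a}"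

definition J_cell_le :: "('m, 'b) monoid_scheme \<Rightarrow> 'm set \<Rightarrow> 'm set \<Rightarrow> bool" where
  "J_cell_le M J J' \<longleftrightarrow> (\<forall>a\<in>J. \<forall>b\<in>J'. le_lr M a b)"

text \<open>A representation of dimension \<open>d\<close> is given by matrices acting on column vectors. Values
  outside the carrier are irrelevant. A simple representation of a finite monoid is
  finite-dimensional, so matrices suffice.\<close>

definition representation ::
    "('m, 'b) monoid_scheme \<Rightarrow> nat \<Rightarrow> ('m \<Rightarrow> 'k::field mat) \<Rightarrow> bool" where
  "representation M d \<rho> \<longleftrightarrow>
     (\<forall>x\<in>carrier M. \<rho> x \<in> carrier_mat d d) \<and>
     \<rho> \<one>\<^bsub>M\<^esub> = 1\<^sub>m d \<and>
     (\<forall>x\<in>carrier M. \<forall>y\<in>carrier M. \<rho> (x \<otimes>\<^bsub>M\<^esub> y) = \<rho> x * \<rho> y)"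

definition simple_representation ::
    "('m, 'b) monoid_scheme \<Rightarrow> nat \<Rightarrow> ('m \<Rightarrow> 'k::field mat) \<Rightarrow> bool" where
  "simple_representation M d \<rho> \<longleftrightarrow>
     representation M d \<rho> \<and> 0 < d \<and>
     (\<forall>W. subspace class_ring W (module_vec TYPE('k) d) \<and>
          (\<forall>x\<in>carrier M. \<forall>w\<in>W. \<rho> x *\<^sub>v w \<in> W) \<longrightarrow>
          W = {0\<^sub>v d} \<or> W = carrier_vec d)"

definition isomorphic_representations ::
    "('m, 'b) monoid_scheme \<Rightarrow> nat \<Rightarrow> ('m \<Rightarrow> 'k::field mat) \<Rightarrow> nat \<Rightarrow> ('m \<Rightarrow> 'k mat) \<Rightarrow> bool" where
  "isomorphic_representations M d \<rho> d' \<sigma> \<longleftrightarrow>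
     d = d' \<and> (\<exists>P Q. \<forall>x\<in>carrier M. similar_mat_wit (\<rho> x) (\<sigma> x) P Q)"

definition trivial_representation ::
    "('m, 'b) monoid_scheme \<Rightarrow> nat \<Rightarrow> ('m \<Rightarrow> 'k::field mat) \<Rightarrow> bool" where
  "trivial_representation M d \<rho> \<longleftrightarrow>
     isomorphic_representations M d \<rho> 1 (\<lambda>x. if x \<in> Units M then 1\<^sub>m 1 else 0\<^sub>m 1 1) \<or>
     isomorphic_representations M d \<rho> 1 (\<lambda>x. 1\<^sub>m 1)"

definition annihilates :: "nat \<Rightarrow> ('m \<Rightarrow> 'k::field mat) \<Rightarrow> 'm set \<Rightarrow> bool" where
  "annihilates d \<rho> J \<longleftrightarrow> (\<forall>x\<in>J. \<rho> x = 0\<^sub>m d d)"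

definition is_apex ::
    "('m, 'b) monoid_scheme \<Rightarrow> nat \<Rightarrow> ('m \<Rightarrow> 'k::field mat) \<Rightarrow> 'm set \<Rightarrow> bool" where
  "is_apex M d \<rho> J \<longleftrightarrow>
     J \<in> J_cells M \<and> \<not> annihilates d \<rho> J \<and>
     (\<forall>J'\<in>J_cells M. \<not> annihilates d \<rho> J' \<and> J_cell_le M J J' \<longrightarrow> J' = J)"

text \<open>If there is no nontrivial simple representation, then both minima below are unspecified.\<close>

definition Gap :: "'k::field itself \<Rightarrow> ('m, 'b) monoid_scheme \<Rightarrow> nat" where
  "Gap K M = (LEAST d. \<exists>\<rho> :: 'm \<Rightarrow> 'k mat.
     simple_representation M d \<rho> \<and> \<not> trivial_representation M d \<rho>)"

text \<open>All right cells in a J-cell of a finite monoid have the same size, so that the choice of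
  \<open>R\<close> is immaterial.\<close>

definition ssGap :: "'k::field itself \<Rightarrow> ('m, 'b) monoid_scheme \<Rightarrow> nat" where
  "ssGap K M = (LEAST s. \<exists>d. \<exists>\<rho> :: 'm \<Rightarrow> 'k mat. \<exists>J R.
     simple_representation M d \<rho> \<and> \<not> trivial_representation M d \<rho> \<and>
     is_apex M d \<rho> J \<and> R \<in> right_cells M \<and> R \<subseteq> J \<and> s = card R)"

definition ssRatio_rMoT :: "'k::field itself \<Rightarrow> nat \<Rightarrow> real" where
  "ssRatio_rMoT K n = real (ssGap K (rMoT n)) / sqrt (real (card (carrier (rMoT n))))"

text \<open>The denominator here refers to the full monoid, not to the truncated one.\<close>

definition Ratio_MoT :: "'k::field itself \<Rightarrow> nat \<Rightarrow> real" where
  "Ratio_MoT K n = real (Gap K (MoT n)) / sqrt (real (card (carrier (Mo n))))"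

end

(* A diagram is the same thing as a planar involution of its boundary points, and a product follows
   the orbits of two such involutions. Write e_k for the diagram with k straight through strands on
   the left and dots elsewhere.

   Upper bounds. The corner e_1 M e_1 is {e_1, e_0}. Hence the pairing of e_1 M with M e_1 with
   values in this corner, divided by its radical, gives a nontrivial simple representation with apex
   the cell of e_1; its dimension is at most |M e_1|, and the right cell of e_1 lies in e_1 M.

   Lower bound for Gap. Let rho be simple and nontrivial and let k be the least number of through
   strands of a non-unit with rho <> 0. If k = 0, then rho is trivial, because e_0 M e_0 = {e_0}.
   Otherwise rho(e_k) <> 0, and half-diagrams whose first k-1 strands are straight pair to rho(e_k)
   or to 0. This pairing is nondegenerate over a field of characteristic 0 for every size, so the
   dimension is at least the number of these half-diagrams.

   Lower bound for ssGap. Right multiplication replaces the bottom half of a diagram, so a right cell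
   contains a copy of all rigid bottom halves to the right of 2k positions.

   Half-diagrams are ballot words over an alphabet of 9 (Motzkin) or 4 (rigid) letters per pair of
   points; pigeonhole and cyclic rotation show that the number of ballot words is exponentially the
   number of all words. The at most 2 sqrt(2n) through strands only cost subexponential factors. *)

theory Submission
  imports Defs "HOL-Library.FuncSet" "HOL-Real_Asymp.Real_Asymp"
begin

section \<open>Noncrossing matchings\<close>

text \<open>The obstacle is nondegeneracy. Loops and closed pieces count 1, so the Gram matrix of
  half-diagrams is a fixed 0-1 matrix without a parameter that could be made generic. Straightening
  all strands but one leaves matchings with a single defect. Contractions of a radical vector are
  radical for fewer points, so they vanish by induction; subtracting the relations for dots from
  those for joined neighbours makes closed loops count 0 among matchings without dots. At loop value
  0 an arc can be read as an antisymmetric two-tensor with alternating signs. The relations force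
  the tensor of a radical vector to be constant, up to explicit signs, on index sets of equal size,
  while suitable functionals annihilate the tensor of every matching. On the constant such a
  functional gives -1 or q^2 - (N + 3) with q in -1, 0, 1, a nonzero integer: here characteristic 0
  decides. Since diagrams are concrete partitions, the monoid laws need arguments of their own: a
  parity count for planarity of products, an orientation of strings for rigidity, a gluing of paths
  for associativity.\<close>

text \<open>A partial matching is encoded by an involution, whose fixed points may lie below arcs. The last
  condition says that no arc separates the ends of another arc.\<close>

definition noncrossing :: "nat set \<Rightarrow> (nat \<Rightarrow> nat) set" where
  "noncrossing A = {f. (\<forall>x. f (f x) = x) \<and> (\<forall>x. x \<notin> A \<longrightarrow> f x = x) \<and>
     (\<forall>x y. y \<noteq> x \<longrightarrow> y \<noteq> f x \<longrightarrow> ((y < x) \<noteq> (y < f x)) = ((f y < x) \<noteq> (f y < f x)))}"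

lemma noncrossing_invol: "f \<in> noncrossing A \<Longrightarrow> f (f x) = x"
  and noncrossing_outside: "f \<in> noncrossing A \<Longrightarrow> x \<notin> A \<Longrightarrow> f x = x"
  and noncrossing_cond: "f \<in> noncrossing A \<Longrightarrow> y \<noteq> x \<Longrightarrow> y \<noteq> f x \<Longrightarrow>
     ((y < x) \<noteq> (y < f x)) = ((f y < x) \<noteq> (f y < f x))"
  unfolding noncrossing_def by auto

lemma noncrossing_in: "f \<in> noncrossing A \<Longrightarrow> x \<in> A \<Longrightarrow> f x \<in> A"
  by (metis noncrossing_invol noncrossing_outside)

lemma noncrossing_mono: "A \<subseteq> B \<Longrightarrow> noncrossing A \<subseteq> noncrossing B"
  unfolding noncrossing_def by auto

lemma noncrossing_smaller: "f \<in> noncrossing A \<Longrightarrow> (\<And>x. x \<in> A - B \<Longrightarrow> f x = x) \<Longrightarrow> f \<in> noncrossing B"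
  unfolding noncrossing_def by auto

lemma noncrossing_eq_iff: "f \<in> noncrossing A \<Longrightarrow> f x = f y \<longleftrightarrow> x = y"
  by (metis noncrossing_invol)

lemma finite_noncrossing: assumes "finite A" shows "finite (noncrossing A)"
proof (rule inj_on_finite)
  show "inj_on (\<lambda>f. restrict f A) (noncrossing A)"
  proof (rule inj_onI, rule ext)
    fix f g x assume *: "f \<in> noncrossing A" "g \<in> noncrossing A" "restrict f A = restrict g A"
    show "f x = g x"
      by (cases "x \<in> A") (metis * restrict_apply, metis * noncrossing_outside)
  qed
  show "(\<lambda>f. restrict f A) ` noncrossing A \<subseteq> A \<rightarrow>\<^sub>E A"
    using noncrossing_in by (auto simp: PiE_iff)
  show "finite (A \<rightarrow>\<^sub>E A)"
    using assms by (simp add: finite_PiE)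
qed

text \<open>The point \<open>0\<close> lies to the left of all points of \<open>A\<close>, and its partner is the foot of the strand
  that leaves the matching.\<close>

definition one_defect :: "nat set \<Rightarrow> (nat \<Rightarrow> nat) set" where
  "one_defect A = {f \<in> noncrossing (insert 0 A). f 0 \<noteq> 0}"

section \<open>Contractions of matchings and the pairing of matchings with one defect\<close>

definition dot :: "nat \<Rightarrow> (nat \<Rightarrow> nat) \<Rightarrow> nat \<Rightarrow> nat" where
  "dot i f = (\<lambda>x. if x = i \<or> f x = i then x else f x)"

text \<open>Gluing an extra arc onto \<open>a\<close> and \<open>b\<close> merges the arcs at these
  points into one arc between their partners. A dot at one of the two points turns the partner of
  the other into a dot, and an arc from \<open>a\<close> to \<open>b\<close> is swallowed as a
  closed loop.\<close>

definition cap :: "nat \<Rightarrow> nat \<Rightarrow> (nat \<Rightarrow> nat) \<Rightarrow> nat \<Rightarrow> nat" where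
  "cap a b f = (\<lambda>x. if x = a \<or> x = b then x
     else if f x = a then (if f b = b then x else f b)
     else if f x = b then (if f a = a then x else f a)
     else f x)"

text \<open>Steps to or from \<open>0\<close> are left out: when two matchings are glued along their
  common points, each keeps a point \<open>0\<close> of its own, and a path must not jump from one
  to the other.\<close>

definition link :: "(nat \<Rightarrow> nat) \<Rightarrow> nat rel" where
  "link f = {(x, f x) | x. x \<noteq> 0 \<and> f x \<noteq> 0}"

text \<open>The glued picture has two free ends, the point \<open>0\<close> of \<open>f\<close> and
  that of \<open>g\<close>; the question is whether one string joins them.\<close>

definition meets :: "(nat \<Rightarrow> nat) \<Rightarrow> (nat \<Rightarrow> nat) \<Rightarrow> bool" where
  "meets g f \<longleftrightarrow> f 0 \<noteq> 0 \<and> g 0 \<noteq> 0 \<and> (f 0, g 0) \<in> (link f \<union> link g)\<^sup>*"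

lemma dot_noncrossing:
  assumes f: "f \<in> noncrossing A" shows "dot i f \<in> noncrossing (A - {i})"
proof -
  note inv = noncrossing_invol[OF f] and nc = noncrossing_cond[OF f] and eqi = noncrossing_eq_iff[OF f]
  have 1: "dot i f (dot i f x) = x" for x
    unfolding dot_def by (auto simp: inv)
  have 2: "dot i f x = x" if "x \<notin> A - {i}" for x
    using that noncrossing_outside[OF f, of x] unfolding dot_def by auto
  have 3: "((y < x) \<noteq> (y < dot i f x)) = ((dot i f y < x) \<noteq> (dot i f y < dot i f x))"
    if "y \<noteq> x" "y \<noteq> dot i f x" for x y
    using that nc[of y x] unfolding dot_def by (auto simp: inv split: if_splits)
  show ?thesis unfolding noncrossing_def using 1 2 3 by blast
qed

text \<open>Neighbours \<open>a\<close> and \<open>b\<close> lie on the same side of any other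
  point, so whether the pair \<open>f a\<close>, \<open>f b\<close> separates \<open>z\<close> from
  its partner is the exclusive or of the two statements for the arcs at \<open>a\<close> and at
  \<open>b\<close>. \<open>arc\<close> and \<open>arc'\<close> are this computation with the new arc
  in either role.\<close>

lemma cap_noncrossing:
  assumes f: "f \<in> noncrossing A" and ab: "a < b" and cons: "\<And>x. x \<in> A \<Longrightarrow> \<not> (a < x \<and> x < b)"
  shows "cap a b f \<in> noncrossing (A - {a, b})"
proof -
  note inv = noncrossing_invol[OF f] and nc = noncrossing_cond[OF f] and eqi = noncrossing_eq_iff[OF f]
  let ?c = "cap a b f"
  have c1: "?c x = x" if "x = a \<or> x = b" for x using that unfolding cap_def by auto
  have c2: "?c x = f x" if "x \<noteq> a" "x \<noteq> b" "f x \<noteq> a" "f x \<noteq> b" for x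
    using that unfolding cap_def by auto
  have 1: "?c (?c x) = x" for x
    unfolding cap_def by (auto simp: inv eqi)
  have 2: "?c x = x" if "x \<notin> A - {a, b}" for x
    using that noncrossing_outside[OF f, of x] unfolding cap_def by auto
  have adj: "x < a \<longleftrightarrow> x < b" if "x \<in> A" "x \<noteq> a" for x
    using that cons[of x] ab by (meson linorder_neqE_nat order.strict_trans)
  have arc: "((z < f a) \<noteq> (z < f b)) = ((f z < f a) \<noteq> (f z < f b))"
    if "z \<in> A" "z \<notin> {a, b, f a, f b}" for z
  proof -
    have "((z < a) \<noteq> (z < f a)) = ((f z < a) \<noteq> (f z < f a))"
      "((z < b) \<noteq> (z < f b)) = ((f z < b) \<noteq> (f z < f b))"
      using that nc[of z a] nc[of z b] by auto
    moreover have "f z \<in> A" "f z \<noteq> a" using that noncrossing_in[OF f] inv by auto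
    ultimately show ?thesis using adj[of z] adj[of "f z"] that by auto
  qed
  have arc': "((f a < u) \<noteq> (f a < f u)) = ((f b < u) \<noteq> (f b < f u))"
    if "u \<in> A" "u \<notin> {a, b, f a, f b}" for u
  proof -
    have fu: "f u \<in> A" "f u \<noteq> a" "f u \<noteq> b" "f u \<noteq> u \<longrightarrow> f u \<noteq> f a"
      using that noncrossing_in[OF f] inv by (auto, metis inv)
    have "((a < u) \<noteq> (a < f u)) = ((f a < u) \<noteq> (f a < f u))"
      "((b < u) \<noteq> (b < f u)) = ((f b < u) \<noteq> (f b < f u))"
      using that fu nc[of a u] nc[of b u] by auto
    moreover have "(a < u) = (b < u)" "(a < f u) = (b < f u)"
      using adj[of u] adj[of "f u"] that fu by auto
    ultimately show ?thesis by auto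
  qed
  have 3: "((y < x) \<noteq> (y < ?c x)) = ((?c y < x) \<noteq> (?c y < ?c x))"
    if yx: "y \<noteq> x" "y \<noteq> ?c x" for x y
  proof (cases "?c x = x \<or> ?c y = y")
    case False
    then have x: "x \<in> A" "y \<in> A" "x \<noteq> a" "x \<noteq> b" "y \<noteq> a" "y \<noteq> b"
      using 2 by blast+
    have ca: "?c (f a) = f b" if "f a \<noteq> a" "f a \<noteq> b" "?c (f a) \<noteq> f a"
      using that inv[of a] unfolding cap_def by (auto split: if_splits)
    have cb: "?c (f b) = f a" if "f b \<noteq> a" "f b \<noteq> b" "?c (f b) \<noteq> f b"
      using that inv[of b] ab unfolding cap_def by (auto split: if_splits)
    have sw: "{z, ?c z} = {f a, f b}"
      if z: "z \<in> {f a, f b}" "z \<noteq> a" "z \<noteq> b" "?c z \<noteq> z" for z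
    proof (cases "z = f a")
      case True
      then show ?thesis using ca z by metis
    next
      case False
      then have "z = f b" using z by blast
      then show ?thesis using cb z by (metis insert_commute)
    qed
    consider "x \<in> {f a, f b}" "y \<in> {f a, f b}" | "x \<in> {f a, f b}" "y \<notin> {f a, f b}"
      | "x \<notin> {f a, f b}" "y \<in> {f a, f b}" | "x \<notin> {f a, f b}" "y \<notin> {f a, f b}" by blast
    then show ?thesis
    proof cases
      case 1
      then show ?thesis using yx False sw[of x] x by blast
    next
      case 2
      have cy: "?c y = f y" by (metis 2(2) c2 x inv insertCI)
      have A: "((y < f a) \<noteq> (y < f b)) = ((f y < f a) \<noteq> (f y < f b))"
        using arc[of y] x 2 by blast
      have "{x, ?c x} = {f a, f b}" using sw[of x] 2 x False by blast
      then consider "x = f a" "?c x = f b" | "x = f b" "?c x = f a" by (metis doubleton_eq_iff)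
      then show ?thesis
      proof cases
        case 1
        show ?thesis unfolding cy 1(2) unfolding 1(1) using A by blast
      next
        case 2
        show ?thesis unfolding cy 2(2) unfolding 2(1) using A by blast
      qed
    next
      case 3
      have cx: "?c x = f x" by (metis 3(1) c2 x inv insertCI)
      have A: "((f a < x) \<noteq> (f a < f x)) = ((f b < x) \<noteq> (f b < f x))"
        using arc'[of x] x 3 by blast
      have "{y, ?c y} = {f a, f b}" using sw[of y] 3 x False by blast
      then consider "y = f a" "?c y = f b" | "y = f b" "?c y = f a" by (metis doubleton_eq_iff)
      then show ?thesis
      proof cases
        case 1
        show ?thesis unfolding cx 1(2) unfolding 1(1) using A by blast
      next
        case 2
        show ?thesis unfolding cx 2(2) unfolding 2(1) using A by blast
      qed
    next
      case 4
      have cx: "?c x = f x" by (metis 4(1) c2 x inv insertCI)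
      have cy: "?c y = f y" by (metis 4(2) c2 x inv insertCI)
      show ?thesis using nc[of y x] yx unfolding cx cy by blast
    qed
  qed auto
  show ?thesis unfolding noncrossing_def using 1 2 3 by blast
qed

lemma link_iff: "(x, y) \<in> link f \<longleftrightarrow> x \<noteq> 0 \<and> y \<noteq> 0 \<and> y = f x"
  unfolding link_def by auto

text \<open>A string that enters \<open>i\<close> along an arc of \<open>f\<close> ends there, since
  \<open>g\<close> has a dot at \<open>i\<close>. Cutting that arc is invisible to strings that run
  from end to end: dotting \<open>f\<close> is adjoint to leaving \<open>i\<close> unmatched in
  \<open>g\<close>.\<close>

lemma meets_dot:
  assumes f: "\<And>x. f (f x) = x" and g: "\<And>x. g (g x) = x" and i: "g i = i" "i \<noteq> 0"
  shows "meets g f \<longleftrightarrow> meets g (dot i f)"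
proof (cases "f 0 = i")
  case True
  have "x = i" if "(f 0, x) \<in> (link f \<union> link g)\<^sup>*" for x
    using that
  proof (induction rule: rtrancl_induct)
    case (step y z)
    then show ?case using True i f[of 0] by (auto simp: link_iff)
  qed (use True in auto)
  moreover have "g 0 \<noteq> i" using i g[of 0] by auto
  moreover have "dot i f 0 = 0" using True by (simp add: dot_def)
  ultimately show ?thesis unfolding meets_def by auto
next
  case False
  let ?L = "link f \<union> link g" and ?M = "link (dot i f) \<union> link g"
  have start: "dot i f 0 = f 0" using False i unfolding dot_def by auto
  have sub: "?M \<subseteq> ?L \<union> Id" unfolding dot_def link_def by auto
  have backw: "(f 0, x) \<in> ?L\<^sup>*" if "(f 0, x) \<in> ?M\<^sup>*" for x
  proof -
    have "?M\<^sup>* \<subseteq> (?L \<union> Id)\<^sup>*" using sub rtrancl_mono by blast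
    then show ?thesis using that by auto
  qed
  \<comment> \<open>At \<open>i\<close> the only way on is back along \<open>f\<close>, so the
    invariant remembers that \<open>f i\<close> has already been reached.\<close>
  have forw: "(x \<noteq> i \<longrightarrow> (f 0, x) \<in> ?M\<^sup>*) \<and> (x = i \<longrightarrow> f i \<noteq> i \<longrightarrow> f i \<noteq> 0 \<longrightarrow> (f 0, f i) \<in> ?M\<^sup>*)"
    if "(f 0, x) \<in> ?L\<^sup>*" for x
    using that
  proof (induction rule: rtrancl_induct)
    case base
    then show ?case using False by auto
  next
    case (step y z)
    show ?case
    proof (cases "y = i")
      case True
      then show ?thesis using step i by (auto simp: link_iff)
    next
      case y: False
      then have fy: "(f 0, y) \<in> ?M\<^sup>*" using step by auto
      from step(2) consider "y \<noteq> 0" "z \<noteq> 0" "z = f y" | "y \<noteq> 0" "z \<noteq> 0" "z = g y" by (auto simp: link_iff)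
      then show ?thesis
      proof cases
        case 1
        show ?thesis
        proof (cases "z = i")
          case True
          then show ?thesis using 1 f fy by auto
        next
          case False
          then have "(y, z) \<in> ?M" using 1 y by (auto simp: link_iff dot_def)
          then show ?thesis using fy False by (meson rtrancl.rtrancl_into_rtrancl)
        qed
      next
        case 2
        then have "z \<noteq> i" using i y g by metis
        moreover have "(y, z) \<in> ?M" using 2 by (auto simp: link_iff)
        ultimately show ?thesis using fy by (meson rtrancl.rtrancl_into_rtrancl)
      qed
    qed
  qed
  have "g 0 \<noteq> i" using i g[of 0] by auto
  then show ?thesis unfolding meets_def start using backw forw by auto
qed

text \<open>Both sides describe the same glued picture; on the left the small arc from
  \<open>a\<close> to \<open>b\<close> belongs to \<open>g\<close>, on the right it has been
  absorbed into \<open>f\<close>. Paths are translated by contracting a passage \<open>f a\<close>,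
  \<open>a\<close>, \<open>b\<close>, \<open>f b\<close> to one step.\<close>

lemma meets_cap:
  assumes f: "\<And>x. f (f x) = x" and g: "\<And>x. g (g x) = x"
    and ab: "g a = a" "g b = b" "a \<noteq> 0" "b \<noteq> 0" "a \<noteq> b"
  shows "meets (g(a := b, b := a)) f \<longleftrightarrow> meets g (cap a b f)"
proof -
  let ?c = "cap a b f" and ?h = "g(a := b, b := a)"
  let ?L = "link f \<union> link ?h" and ?M = "link ?c \<union> link g"
  have h0: "?h 0 = g 0" using ab by auto
  have g0: "g 0 \<noteq> a" "g 0 \<noteq> b" using ab g[of 0] by auto
  \<comment> \<open>In the contracted graph \<open>a\<close> and \<open>b\<close> are isolated;
    arrival at one of them is replaced by having reached the outer ends of both arcs.\<close>
  have forw: "(x \<notin> {a, b} \<longrightarrow> (?c 0, x) \<in> ?M\<^sup>*) \<and>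
      (x \<in> {a, b} \<longrightarrow> (\<forall>y \<in> {f a, f b} - {0, a, b}. (?c 0, y) \<in> ?M\<^sup>*))"
    if "(f 0, x) \<in> ?L\<^sup>*" for x
    using that
  proof (induction rule: rtrancl_induct)
    case base
    have "f a = 0 \<longleftrightarrow> f 0 = a" "f b = 0 \<longleftrightarrow> f 0 = b" by (metis f)+
    then show ?case using ab unfolding cap_def by auto
  next
    case (step y z)
    show ?case
    proof (cases "y \<in> {a, b}")
      case True
      then show ?thesis using step ab by (auto simp: link_iff split: if_splits)
    next
      case y: False
      then have fy: "(?c 0, y) \<in> ?M\<^sup>*" using step by auto
      from step(2) consider "y \<noteq> 0" "z \<noteq> 0" "z = f y" | "y \<noteq> 0" "z \<noteq> 0" "z = g y"
        using y by (auto simp: link_iff split: if_splits)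
      then show ?thesis
      proof cases
        case 1
        show ?thesis
        proof (cases "z \<in> {a, b}")
          case True
          have "(?c 0, w) \<in> ?M\<^sup>*" if w: "w \<in> {f a, f b} - {0, a, b}" for w
          proof (cases "w = y")
            case False
            have "?c y = w"
            proof (cases "z = a")
              case True
              then have "f y = a" "y = f a" using 1 f[of y] by auto
              then show ?thesis using w False y unfolding cap_def by auto
            next
              case False
              then have "f y = b" "y = f b" using \<open>z \<in> {a, b}\<close> 1 f[of y] by auto
              then show ?thesis using w \<open>w \<noteq> y\<close> y ab unfolding cap_def by auto
            qed
            then have "(y, w) \<in> ?M" using w 1 by (auto simp: link_iff)
            then show ?thesis using fy by (meson rtrancl.rtrancl_into_rtrancl)
          qed (use fy in simp)
          then have "\<forall>w \<in> {f a, f b} - {0, a, b}. (?c 0, w) \<in> ?M\<^sup>*" by (rule ballI)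
          then show ?thesis using True by metis
        next
          case False
          then have "?c y = z" using 1 y unfolding cap_def by auto
          then have "(y, z) \<in> ?M" using 1 by (auto simp: link_iff)
          then show ?thesis using fy False by (meson rtrancl.rtrancl_into_rtrancl)
        qed
      next
        case 2
        then have "z \<notin> {a, b}" using ab y g by (metis insertE empty_iff insertI1 insertI2)
        moreover have "(y, z) \<in> ?M" using 2 by (auto simp: link_iff)
        ultimately show ?thesis using fy by (meson rtrancl.rtrancl_into_rtrancl)
      qed
    qed
  qed
  have hop: "(x, f b) \<in> ?L\<^sup>*" if "x = a" "f b \<noteq> 0" for x
  proof -
    have "(a, b) \<in> ?L" "(b, f b) \<in> ?L" using that ab by (auto simp: link_iff)
    then show ?thesis using that by (meson converse_rtrancl_into_rtrancl r_into_rtrancl)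
  qed
  have hop': "(x, f a) \<in> ?L\<^sup>*" if "x = b" "f a \<noteq> 0" for x
  proof -
    have "(b, a) \<in> ?L" "(a, f a) \<in> ?L" using that ab by (auto simp: link_iff)
    then show ?thesis using that by (meson converse_rtrancl_into_rtrancl r_into_rtrancl)
  qed
  have stepb: "(x, y) \<in> ?L\<^sup>*" if "(x, y) \<in> ?M" for x y
  proof -
    from that consider "x \<noteq> 0" "y \<noteq> 0" "y = ?c x" | "x \<noteq> 0" "y \<noteq> 0" "y = g x" by (auto simp: link_iff)
    then show ?thesis
    proof cases
      case 1
      consider "y = x" | "y = f x" "x \<noteq> a" "x \<noteq> b" | "f x = a" "y = f b" | "f x = b" "y = f a"
        using 1 unfolding cap_def by (auto split: if_splits)
      then show ?thesis
      proof cases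
        case 2
        then have "(x, y) \<in> ?L" using 1 by (auto simp: link_iff)
        then show ?thesis by auto
      next
        case 3
        then have "(x, a) \<in> ?L" using 1 ab by (auto simp: link_iff)
        then show ?thesis using hop[of a] 3 1 by (meson converse_rtrancl_into_rtrancl)
      next
        case 4
        then have "(x, b) \<in> ?L" using 1 ab by (auto simp: link_iff)
        then show ?thesis using hop'[of b] 4 1 by (meson converse_rtrancl_into_rtrancl)
      qed auto
    next
      case 2
      show ?thesis
      proof (cases "x = a \<or> x = b")
        case False
        then have "(x, y) \<in> ?L" using 2 by (auto simp: link_iff)
        then show ?thesis by auto
      qed (use 2 ab in auto)
    qed
  qed
  have backw: "(x, y) \<in> ?L\<^sup>*" if "(x, y) \<in> ?M\<^sup>*" for x y
    using that
  proof (induction rule: rtrancl_induct)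
    case (step y z)
    show ?case using step(3) stepb[OF step(2)] by (rule rtrancl_trans)
  qed simp
  have start: "(f 0, ?c 0) \<in> ?L\<^sup>*" "f 0 \<noteq> 0" if nz: "?c 0 \<noteq> 0"
  proof -
    have "?c 0 = f 0 \<or> f 0 = a \<and> ?c 0 = f b \<or> f 0 = b \<and> ?c 0 = f a"
      using nz ab unfolding cap_def by (auto split: if_splits)
    then show "(f 0, ?c 0) \<in> ?L\<^sup>*"
    proof (elim disjE conjE)
      assume "f 0 = a" "?c 0 = f b"
      then show ?thesis using hop[of "f 0"] nz by metis
    next
      assume "f 0 = b" "?c 0 = f a"
      then show ?thesis using hop'[of "f 0"] nz by metis
    qed (metis rtrancl.rtrancl_refl)
    show "f 0 \<noteq> 0" using nz ab unfolding cap_def by (auto split: if_splits)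
  qed
  have zero: "x = 0" if "(0, x) \<in> ?M\<^sup>*" for x
    using that by (induction rule: rtrancl_induct) (auto simp: link_iff)
  show ?thesis
  proof
    assume "meets ?h f"
    then have m: "g 0 \<noteq> 0" "(f 0, g 0) \<in> ?L\<^sup>*" unfolding meets_def h0 by blast+
    then have c: "(?c 0, g 0) \<in> ?M\<^sup>*" using forw[of "g 0"] g0 by simp
    then have "?c 0 \<noteq> 0" using zero[of "g 0"] m(1) by metis
    then show "meets g ?c" unfolding meets_def using c m(1) by blast
  next
    assume m: "meets g ?c"
    then have c: "?c 0 \<noteq> 0" and "g 0 \<noteq> 0" and "(?c 0, g 0) \<in> ?M\<^sup>*" unfolding meets_def by blast+
    then have "(f 0, g 0) \<in> ?L\<^sup>*" using start(1)[OF c] backw rtrancl_trans by metis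
    then show "meets ?h f" unfolding meets_def h0 using start(2)[OF c] \<open>g 0 \<noteq> 0\<close> by blast
  qed
qed

section \<open>Nondegeneracy of the pairing of matchings with one defect\<close>

lemma even_card_fixpoint_free_involution:
  assumes "finite S" "\<And>x. x \<in> S \<Longrightarrow> f x \<in> S" "\<And>x. x \<in> S \<Longrightarrow> f (f x) = x" "\<And>x. x \<in> S \<Longrightarrow> f x \<noteq> x"
  shows "even (card S)"
  using assms
proof (induction "card S" arbitrary: S rule: less_induct)
  case less
  show ?case
  proof (cases "S = {}")
    case False
    then obtain x where x: "x \<in> S" by blast
    let ?T = "S - {x, f x}"
    have xs: "{x, f x} \<subseteq> S" "card {x, f x} = 2" using x less.prems by (auto simp: eq_commute)
    then have cd: "card S = card ?T + 2"
      using less.prems(1) by (metis card_Diff_subset card_mono finite.emptyI finite_insert le_add_diff_inverse2)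
    have "even (card ?T)"
    proof (rule less.hyps)
      show "card ?T < card S" using cd by simp
      show "finite ?T" using less.prems(1) by simp
      show "f y \<in> ?T" if "y \<in> ?T" for y
        using that x less.prems(2)[of y] less.prems(3)[of y] less.prems(3)[of x] by (metis DiffD1 DiffD2 DiffI insert_iff singletonD)
    qed (use less.prems in auto)
    then show ?thesis using cd by simp
  qed simp
qed

text \<open>If \<open>T\<close> is adjoint to \<open>h\<close> for the pairing, then the sums of a
  radical vector over the fibres of \<open>T\<close> form a radical vector for the set
  \<open>B\<close>, and nondegeneracy there makes them vanish. This is applied to \<open>dot\<close>
  and to \<open>cap\<close>.\<close>

lemma contraction_relation:
  fixes c :: "(nat \<Rightarrow> nat) \<Rightarrow> 'k :: field_char_0"
  assumes fin: "finite A" "finite B"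
    and rad: "\<And>g. g \<in> one_defect A \<Longrightarrow> (\<Sum>f\<in>{f \<in> one_defect A. meets g f}. c f) = 0"
    and nondeg: "\<forall>c'. (\<forall>g\<in>one_defect B. (\<Sum>f\<in>{f \<in> one_defect B. meets g f}. c' f) = (0 :: 'k)) \<longrightarrow> (\<forall>f\<in>one_defect B. c' f = 0)"
    and T: "\<And>f. f \<in> one_defect A \<Longrightarrow> T f \<in> noncrossing (insert 0 B)"
    and h: "\<And>g. g \<in> one_defect B \<Longrightarrow> h g \<in> one_defect A"
    and meets: "\<And>f g. f \<in> one_defect A \<Longrightarrow> g \<in> one_defect B \<Longrightarrow> meets (h g) f \<longleftrightarrow> meets g (T f)"
    and f': "f' \<in> one_defect B"
  shows "(\<Sum>f\<in>{f \<in> one_defect A. T f = f'}. c f) = 0"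
proof -
  have finP: "finite (one_defect A)" "finite (one_defect B)"
    unfolding one_defect_def using finite_noncrossing[of "insert 0 A"] finite_noncrossing[of "insert 0 B"] fin by auto
  have "(\<Sum>f'\<in>{f \<in> one_defect B. meets g f}. \<Sum>f\<in>{f \<in> one_defect A. T f = f'}. c f) = 0" if g: "g \<in> one_defect B" for g
  proof -
  let ?S = "{f \<in> one_defect A. meets (h g) f}" and ?T = "{f \<in> one_defect B. meets g f}"
  have "(\<Sum>f'\<in>?T. \<Sum>f\<in>{f \<in> ?S. T f = f'}. c f) = (\<Sum>f\<in>?S. c f)"
  proof (rule sum.group)
    show "T ` ?S \<subseteq> ?T"
      using T meets[OF _ g] unfolding one_defect_def meets_def by fastforce
  qed (use finP in auto)
  moreover have "{f \<in> ?S. T f = f'} = {f \<in> one_defect A. T f = f'}" if "f' \<in> ?T" for f'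
    using that meets[OF _ g] by auto
  ultimately show ?thesis
    using rad[OF h[OF g]] by simp
  qed
  with nondeg[rule_format, where c' = "\<lambda>f'. \<Sum>f\<in>{f \<in> one_defect A. T f = f'}. c f"] f'
  show ?thesis by blast
qed

lemma one_defectD: "f \<in> one_defect A \<Longrightarrow> f \<in> noncrossing (insert 0 A)" "f \<in> one_defect A \<Longrightarrow> f 0 \<noteq> 0" "f \<in> one_defect A \<Longrightarrow> f 0 \<in> A"
  unfolding one_defect_def using noncrossing_in[of f "insert 0 A" 0] by auto

text \<open>No point of \<open>A\<close> lies between \<open>a\<close> and \<open>b\<close>, so the
  new arc encloses nothing that could be matched to the outside, and any old arc has both of its
  ends on the same side.\<close>

lemma noncrossing_insert_arc:
  assumes g: "g \<in> noncrossing (A - {a, b})" and ab: "a \<in> A" "b \<in> A" "a < b"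
    and adjacent: "\<And>x. x \<in> A \<Longrightarrow> \<not> (a < x \<and> x < b)"
  shows "g(a := b, b := a) \<in> noncrossing A"
proof -
  let ?h = "g(a := b, b := a)"
  note inv = noncrossing_invol[OF g] and nc = noncrossing_cond[OF g]
  have gab: "g a = a" "g b = b" using noncrossing_outside[OF g] by auto
  have gne: "g x \<noteq> a \<longleftrightarrow> x \<noteq> a" "g x \<noteq> b \<longleftrightarrow> x \<noteq> b" for x using gab inv by metis+
  have h: "?h x = g x" if "x \<noteq> a" "x \<noteq> b" for x using that by simp
  have hab: "?h a = b" "?h b = a" using ab by auto
  have out: "x < a \<longleftrightarrow> x < b" "a < x \<longleftrightarrow> b < x" if "g x \<noteq> x" "x \<noteq> a" "x \<noteq> b" for x
    using noncrossing_outside[OF g, of x] adjacent[of x] that ab by (metis DiffD1 linorder_neqE_nat order.strict_trans)+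
  have gout: "g (g x) \<noteq> g x" if "g x \<noteq> x" for x using that inv by simp
  have 1: "?h (?h x) = x" for x
    using ab by (cases "x = a"; cases "x = b") (auto simp: gne inv)
  have 2: "?h x = x" if "x \<notin> A" for x
    using that noncrossing_outside[OF g, of x] ab h[of x] by auto
  have 3: "((y < x) \<noteq> (y < ?h x)) = ((?h y < x) \<noteq> (?h y < ?h x))"
    if yx: "y \<noteq> x" "y \<noteq> ?h x" for x y
  proof (cases "x = a \<or> x = b")
    case True
    then have xs: "x = a \<and> ?h x = b \<or> x = b \<and> ?h x = a" and y: "y \<noteq> a" "y \<noteq> b" using hab yx by auto
    show ?thesis
    proof (cases "g y = y")
      case False
      have "(y < a) = (y < b)" "(g y < a) = (g y < b)"
        using out(1)[OF False y] out(1)[OF gout[OF False]] gne y by blast+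
      then show ?thesis using xs unfolding h[OF y] by auto
    qed (unfold h[OF y], simp)
  next
    case x: False
    show ?thesis
    proof (cases "y = a \<or> y = b")
      case True
      then have ys: "y = a \<and> ?h y = b \<or> y = b \<and> ?h y = a" using hab by auto
      show ?thesis
      proof (cases "g x = x")
        case False
        have "(a < x) = (b < x)" "(a < g x) = (b < g x)"
          using out(2)[OF False] out(2)[OF gout[OF False]] gne x by blast+
        then show ?thesis using ys x by auto
      qed (use x in simp)
    next
      case False
      then show ?thesis using x nc[of y x] yx by simp
    qed
  qed
  show ?thesis unfolding noncrossing_def using 1 2 3 by blast
qed

text \<open>Vectors in the radical of the pairing \<open>meets\<close> satisfy \<open>D\<close> and \<open>C\<close> if the pairing is nondegenerate
  for smaller sets, since dotting or joining neighbours in one argument can be moved to the other.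
  The weights \<open>w f J\<close> below are the coefficients of a product of one antisymmetric tensor per arc of
  \<open>f\<close>. By \<open>C\<close>, the sums of \<open>c\<close> against them are determined up to sign by \<open>card J\<close>.\<close>

locale radical_vector =
  fixes A :: "nat set" and c :: "(nat \<Rightarrow> nat) \<Rightarrow> 'k :: field_char_0"
  assumes fin: "finite A" and zero: "0 \<notin> A"
    and D: "i \<in> A \<Longrightarrow> f' \<in> one_defect (A - {i}) \<Longrightarrow> (\<Sum>f\<in>{f \<in> one_defect A. dot i f = f'}. c f) = 0"
    and C: "a \<in> A \<Longrightarrow> b \<in> A \<Longrightarrow> a < b \<Longrightarrow> (\<And>x. x \<in> A \<Longrightarrow> \<not> (a < x \<and> x < b)) \<Longrightarrow>
      f' \<in> one_defect (A - {a, b}) \<Longrightarrow> (\<Sum>f\<in>{f \<in> one_defect A. cap a b f = f'}. c f) = 0"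
begin

definition adjacent :: "nat \<Rightarrow> nat \<Rightarrow> bool" where
  "adjacent a b \<longleftrightarrow> a \<in> A \<and> b \<in> A \<and> a < b \<and> (\<forall>x\<in>A. \<not> (a < x \<and> x < b))"

definition undotted :: "(nat \<Rightarrow> nat) set" where
  "undotted = {f \<in> one_defect A. \<forall>x\<in>A. f x \<noteq> x}"

lemma finite_P: "finite (one_defect A)"
  unfolding one_defect_def using finite_noncrossing[of "insert 0 A"] fin by auto

lemma finite_U: "finite undotted"
  unfolding undotted_def using finite_P by auto

lemma U_D: assumes "f \<in> undotted"
  shows "f \<in> noncrossing (insert 0 A)" "f (f x) = x" "x \<in> insert 0 A \<Longrightarrow> f x \<in> insert 0 A"
    "x \<in> insert 0 A \<Longrightarrow> f x \<noteq> x" "x \<in> A \<Longrightarrow> x \<noteq> f 0 \<Longrightarrow> f x \<in> A"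
proof -
  show f: "f \<in> noncrossing (insert 0 A)" using assms one_defectD unfolding undotted_def by blast
  show inv: "f (f x) = x" for x using noncrossing_invol[OF f] .
  show in': "x \<in> insert 0 A \<Longrightarrow> f x \<in> insert 0 A" for x using noncrossing_in[OF f] .
  show "x \<in> insert 0 A \<Longrightarrow> f x \<noteq> x" using assms one_defectD(2)[of f A] unfolding undotted_def by auto
  show "x \<in> A \<Longrightarrow> x \<noteq> f 0 \<Longrightarrow> f x \<in> A" using in'[of x] inv[of x] by auto
qed

text \<open>The fibre of \<open>cap a b\<close> over \<open>f'\<close> consists of the undotted
  matchings without the arc from \<open>a\<close> to \<open>b\<close>, of \<open>f'\<close> itself
  and of \<open>f'\<close> with that arc added. The last two are exactly the fibre of
  \<open>dot a\<close>, so subtracting \<open>D\<close> from \<open>C\<close> removes them: a closed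
  loop now counts 0 instead of 1.\<close>

lemma C_undotted:
  assumes ab: "adjacent a b" and f': "f' \<in> one_defect (A - {a, b})" and und: "\<And>x. x \<in> A - {a, b} \<Longrightarrow> f' x \<noteq> x"
  shows "(\<Sum>f\<in>{f \<in> undotted. f a \<noteq> b \<and> cap a b f = f'}. c f) = 0"
proof -
  have a: "a \<in> A" "b \<in> A" "a < b" "\<And>x. x \<in> A \<Longrightarrow> \<not> (a < x \<and> x < b)"
    using ab unfolding adjacent_def by auto
  have ab0: "a \<noteq> 0" "b \<noteq> 0" using a zero by metis+
  let ?h = "f'(a := b, b := a)"
  let ?V = "{f \<in> undotted. f a \<noteq> b \<and> cap a b f = f'}"
  have f'N: "f' \<in> noncrossing (insert 0 A - {a, b})"
    using one_defectD(1)[OF f'] ab0 by (simp add: insert_Diff_if)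
  have f'P: "f' \<in> one_defect A" "f' \<in> one_defect (A - {a})"
    using one_defectD[OF f'] noncrossing_mono[of "insert 0 (A - {a, b})" "insert 0 A"]
      noncrossing_mono[of "insert 0 (A - {a, b})" "insert 0 (A - {a})"] unfolding one_defect_def by auto
  have f'ab: "f' a = a" "f' b = b" using noncrossing_outside[OF f'N] by auto
  have inv': "f' (f' x) = x" for x using noncrossing_invol[OF f'N] .
  have f'ne: "f' x \<noteq> a" "f' x \<noteq> b" if "x \<noteq> a" "x \<noteq> b" for x using inv'[of x] f'ab that by metis+
  have hP: "?h \<in> one_defect A"
  proof -
    have "?h \<in> noncrossing (insert 0 A)"
      by (rule noncrossing_insert_arc[OF f'N]) (use a in auto)
    then show ?thesis using one_defectD(2)[OF f'] ab0 unfolding one_defect_def by auto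
  qed
  have hf: "?h \<noteq> f'" using f'ab a by (metis fun_upd_apply less_irrefl)
  have hV: "?h \<notin> ?V" "f' \<notin> ?V" using a f'ab unfolding undotted_def by auto
  have capf: "cap a b f' = f'" "cap a b ?h = f'"
    using f'ab a f'ne unfolding cap_def by (auto simp: fun_eq_iff)
  have 1: "{f \<in> one_defect A. cap a b f = f'} = ?V \<union> {f', ?h}"
  proof (intro equalityI subsetI)
    fix f assume "f \<in> {f \<in> one_defect A. cap a b f = f'}"
    then have f: "f \<in> one_defect A" "cap a b f = f'" by auto
    note inv = noncrossing_invol[OF one_defectD(1)[OF f(1)]]
    have fx: "f' x = (if x = a \<or> x = b then x
       else if f x = a then (if f b = b then x else f b)
       else if f x = b then (if f a = a then x else f a)
       else f x)" for x using f(2) unfolding cap_def by (auto simp: fun_eq_iff)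
    have nd: "f x \<noteq> x" if "x \<in> A" "x \<noteq> a" "x \<noteq> b" for x
      using fx[of x] und[of x] that by auto
    have one: "f y \<noteq> y \<and> y \<in> insert 0 A - {a, b} \<Longrightarrow> f' y \<noteq> y" for y
      using und[of y] one_defectD(2)[OF f'] by auto
    have fin': "f a \<in> insert 0 A" "f b \<in> insert 0 A" using noncrossing_in[OF one_defectD(1)[OF f(1)]] a by auto
    show "f \<in> ?V \<union> {f', ?h}"
    proof (cases "f a = b")
      case True
      then have fb: "f b = a" using inv[of a] by simp
      have "f x = ?h x" for x
        using fx[of x] True fb inv[of x] by (cases "x = a"; cases "x = b") auto
      then show ?thesis by auto
    next
      case ne: False
      show ?thesis
      proof (cases "f a = a")
        case fa: True
        have fb: "f b = b"
        proof (rule ccontr)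
          assume n: "f b \<noteq> b"
          let ?y = "f b"
          have "?y \<noteq> a" using inv[of b] fa a by auto
          then have "f' ?y = ?y" using fx[of ?y] n inv[of b] fa a by auto
          then show False using one[of ?y] fin' n inv[of b] \<open>?y \<noteq> a\<close> by auto
        qed
        have "f x = f' x" for x using fx[of x] fa fb inv[of x] by (cases "x = a"; cases "x = b") auto
        then show ?thesis by auto
      next
        case fa: False
        have fb: "f b \<noteq> b"
        proof
          assume n: "f b = b"
          let ?y = "f a"
          have "?y \<noteq> b" using inv[of a] n a by auto
          then have "f' ?y = ?y" using fx[of ?y] n inv[of a] fa a by auto
          then show False using one[of ?y] fin' fa inv[of a] \<open>?y \<noteq> b\<close> by auto
        qed
        have "f \<in> undotted" using f nd fa fb unfolding undotted_def by auto
        then show ?thesis using f ne by auto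
      qed
    qed
  next
    fix f assume "f \<in> ?V \<union> {f', ?h}"
    then show "f \<in> {f \<in> one_defect A. cap a b f = f'}"
      using f'P hP capf unfolding undotted_def by blast
  qed
  have 2: "{f \<in> one_defect A. dot a f = f'} = {f', ?h}"
  proof (intro equalityI subsetI)
    fix f assume "f \<in> {f \<in> one_defect A. dot a f = f'}"
    then have f: "f \<in> one_defect A" "dot a f = f'" by auto
    note inv = noncrossing_invol[OF one_defectD(1)[OF f(1)]]
    have fx: "f' x = (if x = a \<or> f x = a then x else f x)" for x
      using f(2) unfolding dot_def by auto
    show "f \<in> {f', ?h}"
    proof (cases "f a = a")
      case True
      then have "f x = f' x" for x using fx[of x] inv[of x] by auto
      then show ?thesis by auto
    next
      case False
      have "f' (f a) = f a" using fx[of "f a"] inv by auto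
      moreover have "f a \<in> insert 0 A" using noncrossing_in[OF one_defectD(1)[OF f(1)]] a by auto
      ultimately have fb: "f a = b" using und[of "f a"] False one_defectD(2)[OF f'] by auto
      have "f x = ?h x" for x using fx[of x] fb inv[of x] inv[of a] by (cases "x = a"; cases "x = b") auto
      then show ?thesis by auto
    qed
  next
    fix f assume "f \<in> {f', ?h}"
    moreover have "f' x = a \<longleftrightarrow> x = a" "f' x = b \<longleftrightarrow> x = b" for x using inv'[of x] f'ab by metis+
    then have "dot a f' = f'" "dot a ?h = f'"
      using a unfolding dot_def by (auto simp: fun_eq_iff f'ab)
    ultimately show "f \<in> {f \<in> one_defect A. dot a f = f'}" using f'P hP by blast
  qed
  have "(\<Sum>f\<in>?V \<union> {f', ?h}. c f) = (\<Sum>f\<in>?V. c f) + (\<Sum>f\<in>{f', ?h}. c f)"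
    by (rule sum.union_disjoint) (use hV finite_U in auto)
  then show ?thesis
    using C[OF a f'] D[OF a(1) f'P(2)] unfolding 1 2 by simp
qed

section \<open>Tensor weights and their behaviour under contraction\<close>

definition rk :: "nat \<Rightarrow> nat" where
  "rk x = card {y \<in> insert 0 A. y < x}"

definition sg :: "nat \<Rightarrow> 'k" where
  "sg x = (-1) ^ rk x"

text \<open>An arc stands for the two-tensor with one end in state 1 and the other in state 0, its
  two terms having the coefficients 1 and \<open>sg x\<close>. \<open>J\<close> lists the points of
  \<open>A\<close> in state 1, and \<open>0\<close> is always in that state. The sign alternates
  with the position of the left end, as for fermions.\<close>

definition fac :: "nat set \<Rightarrow> nat \<Rightarrow> nat \<Rightarrow> 'k" where
  "fac J x y = (if (x \<in> insert 0 J) = (y \<in> insert 0 J) then 0 else if y \<in> insert 0 J then sg x else 1)"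

text \<open>The points \<open>V\<close> are a parameter because a contraction removes two of them,
  while the signs remain those of the positions in \<open>A\<close>.\<close>

definition W :: "nat set \<Rightarrow> (nat \<Rightarrow> nat) \<Rightarrow> nat set \<Rightarrow> 'k" where
  "W V f J = (\<Prod>x\<in>{x \<in> V. x < f x}. fac J x (f x))"

abbreviation w :: "(nat \<Rightarrow> nat) \<Rightarrow> nat set \<Rightarrow> 'k" where
  "w f J \<equiv> W (insert 0 A) f J"

definition weight_sum :: "nat set \<Rightarrow> 'k" where
  "weight_sum J = (\<Sum>f\<in>undotted. c f * w f J)"

lemma sg_square: "sg x * sg x = 1"
  unfolding sg_def by (simp flip: power_add)

lemma rk_less:
  assumes "x \<in> insert 0 A" "x < y"
  shows "rk y = rk x + 1 + card {z \<in> A. x < z \<and> z < y}"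
proof -
  have "{z \<in> insert 0 A. z < y} = insert x ({z \<in> insert 0 A. z < x} \<union> {z \<in> A. x < z \<and> z < y})"
    using assms by auto
  moreover have "card \<dots> = Suc (card {z \<in> insert 0 A. z < x} + card {z \<in> A. x < z \<and> z < y})"
    using fin by (subst card_insert_disjoint) (auto intro!: card_Un_disjoint)
  ultimately show ?thesis unfolding rk_def by simp
qed

lemma A_pos: "x \<in> A \<Longrightarrow> 0 < x"
  using zero by (metis gr0I)

lemma cons_in: "adjacent a b \<Longrightarrow> a \<in> A" "adjacent a b \<Longrightarrow> b \<in> A" "adjacent a b \<Longrightarrow> a < b" "adjacent a b \<Longrightarrow> a \<noteq> 0"
  "adjacent a b \<Longrightarrow> b \<noteq> 0" "adjacent a b \<Longrightarrow> x \<in> A \<Longrightarrow> \<not> (a < x \<and> x < b)"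
  using A_pos unfolding adjacent_def by auto

lemma cons_rk: assumes "adjacent a b" shows "rk b = rk a + 1"
proof -
  have "{z \<in> A. a < z \<and> z < b} = {}" using assms unfolding adjacent_def by auto
  then show ?thesis using rk_less[of a b] cons_in[OF assms] by (simp del: Collect_empty_eq)
qed

lemma cons_sg: "adjacent a b \<Longrightarrow> sg b = - sg a"
  unfolding sg_def by (simp add: cons_rk)

lemma arc_between:
  assumes "f \<in> undotted" "x \<in> insert 0 A" "x < z" "z < f x" "z \<in> A"
  shows "x < f z" "f z < f x" "f z \<in> A" "f z \<noteq> z"
proof -
  have "((z < x) \<noteq> (z < f x)) = ((f z < x) \<noteq> (f z < f x))"
    by (rule noncrossing_cond[OF U_D(1)[OF assms(1)]]) (use assms in auto)
  moreover have "f z \<noteq> x" using U_D(2)[OF assms(1), of z] assms by auto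
  ultimately show 1: "x < f z" "f z < f x" using assms by auto
  show "f z \<noteq> z" using U_D(4)[OF assms(1)] assms by auto
  show "f z \<in> A" using U_D(3)[OF assms(1), of z] 1 assms by auto
qed

text \<open>The points under an arc are matched among themselves, so their number is even and the
  ranks of the two ends differ by an odd number.\<close>

lemma arc_sg: assumes f: "f \<in> undotted" and x: "x \<in> insert 0 A" shows "sg (f x) = - sg x"
proof -
  have *: "sg (f x) = - sg x" if "x \<in> insert 0 A" "x < f x" for x
  proof -
    have "even (card {z \<in> A. x < z \<and> z < f x})"
      by (rule even_card_fixpoint_free_involution[where f = f])
        (use fin arc_between[OF f that(1)] U_D(2)[OF f] in auto)
    then show ?thesis using rk_less[OF that] unfolding sg_def by (simp add: power_add)
  qed
  show ?thesis
  proof (cases "x < f x")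
    case False
    then have "sg (f (f x)) = - sg (f x)" using U_D[OF f] x *[of "f x"]
      by (metis linorder_neqE_nat)
    then show ?thesis using U_D(2)[OF f] by simp
  qed (use * x in auto)
qed

lemma w_zero:
  assumes f: "f \<in> undotted" and x: "x \<in> insert 0 A" "(x \<in> insert 0 J) = (f x \<in> insert 0 J)"
  shows "w f J = 0"
proof -
  have "\<exists>y \<in> {x \<in> insert 0 A. x < f x}. fac J y (f y) = 0"
  proof (cases "x < f x")
    case True
    then show ?thesis using x unfolding fac_def by (intro bexI[of _ x]) auto
  next
    case False
    then have "f x < f (f x)" "f x \<in> insert 0 A" using U_D[OF f] x by (metis linorder_neqE_nat, blast)
    then show ?thesis using x U_D(2)[OF f] unfolding fac_def by (intro bexI[of _ "f x"]) auto
  qed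
  then show ?thesis unfolding W_def using fin by (intro prod_zero) auto
qed

text \<open>Of all factors only that of the arc from \<open>a\<close> to \<open>b\<close> sees the
  exchange; it changes from 1 to \<open>sg a\<close>.\<close>

lemma w_swap_arc:
  assumes f: "f \<in> undotted" and ab: "adjacent a b" "f a = b" and J: "J \<subseteq> A - {a, b}"
  shows "w f (insert b J) = sg a * w f (insert a J)"
proof -
  let ?V = "{x \<in> insert 0 A. x < f x}"
  note c = cons_in[OF ab(1)]
  have aV: "a \<in> ?V" using c ab by auto
  have "fac (insert b J) x (f x) = fac (insert a J) x (f x)" if "x \<in> ?V - {a}" for x
  proof -
    have "x \<noteq> b" "f x \<noteq> a" "f x \<noteq> b" using that U_D(2)[OF f] ab c by (metis DiffD1 DiffD2 less_asym mem_Collect_eq singletonI)+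
    then show ?thesis using that unfolding fac_def by auto
  qed
  moreover have "fac (insert b J) a b = sg a" "fac (insert a J) a b = 1"
    using J c unfolding fac_def by auto
  moreover have "w f K = fac K a b * (\<Prod>x\<in>?V - {a}. fac K x (f x))" for K
    unfolding W_def using prod.remove[OF _ aV, of "\<lambda>x. fac K x (f x)"] fin ab by simp
  moreover have "(\<Prod>x\<in>?V - {a}. fac (insert b J) x (f x)) = (\<Prod>x\<in>?V - {a}. fac (insert a J) x (f x))"
    by (rule prod.cong) (use calculation(1) in auto)
  ultimately show ?thesis by simp
qed

lemma cap_U:
  assumes f: "f \<in> undotted" and ab: "adjacent a b" "f a \<noteq> b"
  shows "cap a b f \<in> one_defect (A - {a, b})" "x \<in> A - {a, b} \<Longrightarrow> cap a b f x \<noteq> x"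
    "cap a b f (f a) = f b" "cap a b f (f b) = f a"
    "x \<notin> {a, b, f a, f b} \<Longrightarrow> cap a b f x = f x"
proof -
  note c = cons_in[OF ab(1)] and inv = U_D(2)[OF f]
  have ne: "f a \<noteq> a" "f b \<noteq> b" "f b \<noteq> a" "f a \<noteq> f b" using U_D(4)[OF f, of a] U_D(4)[OF f, of b] c(1-3) ab inv[of a] inv[of b] by auto
  show 1: "cap a b f (f a) = f b" using ne ab inv unfolding cap_def by simp
  show 2: "cap a b f (f b) = f a" using ne ab inv c unfolding cap_def by simp
  show 3: "cap a b f x = f x" if "x \<notin> {a, b, f a, f b}" for x
    using that inv[of x] unfolding cap_def by auto
  have 4: "cap a b f x \<noteq> x" if "x \<in> insert 0 A" "x \<noteq> a" "x \<noteq> b" for x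
  proof (cases "x \<in> {a, b, f a, f b}")
    case True
    then have "x = f a \<or> x = f b" using that by auto
    then show ?thesis using 1 2 ne by metis
  next
    case False
    then show ?thesis using 3[OF False] U_D(4)[OF f that(1)] by simp
  qed
  then show "cap a b f x \<noteq> x" if "x \<in> A - {a, b}" using that by auto
  have "cap a b f \<in> noncrossing (insert 0 A - {a, b})"
    by (rule cap_noncrossing[OF U_D(1)[OF f]]) (use c in auto)
  moreover have "insert 0 A - {a, b} = insert 0 (A - {a, b})" using c by auto
  ultimately show "cap a b f \<in> one_defect (A - {a, b})" unfolding one_defect_def using 4[of 0] c by auto
qed

text \<open>Contracting the legs \<open>a\<close> and \<open>b\<close> with an alternating two-form
  straightens the arcs at \<open>a\<close> and \<open>b\<close> into one arc between their other
  ends, up to the sign \<open>- sg a\<close>: this is the zigzag identity for these tensors. All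
  other factors are common to both sides.\<close>

lemma w_cap:
  assumes f: "f \<in> undotted" and ab: "adjacent a b" "f a \<noteq> b" and J: "J \<subseteq> A - {a, b}"
  shows "w f (insert a J) - sg a * w f (insert b J) = - sg a * W (insert 0 A - {a, b}) (cap a b f) J"
proof -
  note c = cons_in[OF ab(1)] and inv = U_D(2)[OF f] and cu = cap_U[OF f ab]
  let ?x = "f a" and ?y = "f b"
  let ?O = "{x \<in> insert 0 A. x < f x \<and> x \<notin> {a, b, ?x, ?y}}"
  \<comment> \<open>\<open>fac\<close> expects the left end first; \<open>F\<close> sorts its two
    points.\<close>
  define F where "F K x y = (if x < y then fac K x y else fac K y x)" for K x y
  have ne: "?x \<noteq> a" "?y \<noteq> b" "?y \<noteq> a" "?x \<noteq> ?y" using U_D(4)[OF f, of a] U_D(4)[OF f, of b] c(1-3) ab inv[of a] inv[of b] by auto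
  have mem: "?x \<in> insert 0 A" "?y \<in> insert 0 A" using U_D(3)[OF f] c by auto
  have finO: "finite ?O" using fin by simp
  have V1: "{x \<in> insert 0 A. x < f x} = insert (min a ?x) (insert (min b ?y) ?O)" (is "?L = ?R")
  proof (rule Set.set_eqI)
    fix x
    have i: "f (f a) = a" "f (f b) = b" by (rule inv)+
    show "x \<in> ?L \<longleftrightarrow> x \<in> ?R"
    proof (cases "x \<in> {a, b, ?x, ?y}")
      case True
      then show ?thesis using ne ab mem i c(1-3) by (elim insertE) (auto simp: min_def)
    next
      case False
      then show ?thesis by (auto simp: min_def)
    qed
  qed
  have n1: "min a ?x \<notin> insert (min b ?y) ?O" "min b ?y \<notin> ?O"
  proof -
    have m: "min a ?x \<in> {a, ?x}" "min b ?y \<in> {b, ?y}" by (simp_all add: min_def)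
    have "{a, ?x} \<inter> {b, ?y} = {}" using ne ab c(3) by auto
    then have "min a ?x \<noteq> min b ?y" using m by (metis IntI empty_iff)
    then show "min a ?x \<notin> insert (min b ?y) ?O" "min b ?y \<notin> ?O" using m by blast+
  qed
  have V2: "{x \<in> insert 0 A - {a, b}. x < cap a b f x} = insert (min ?x ?y) ?O" (is "?L = ?R")
  proof (rule Set.set_eqI)
    fix x
    show "x \<in> ?L \<longleftrightarrow> x \<in> ?R"
    proof (cases "x \<in> {a, b, ?x, ?y}")
      case True
      then have nO: "x \<notin> ?O" by blast
      have b: "?x \<noteq> b" using ab by simp
      from True consider "x = a \<or> x = b" | "x = ?x" | "x = ?y" by blast
      then show ?thesis
      proof cases
        case 1
        moreover have "x \<noteq> min ?x ?y" using 1 ne b by (simp add: min_def) metis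
        moreover have "x \<notin> ?L" using 1 by blast
        ultimately show ?thesis using nO by (metis (no_types, lifting) insert_iff)
      next
        case 2
        have "x \<in> ?L \<longleftrightarrow> ?x < ?y" using mem(1) ne(1) b cu(3) unfolding 2 by simp
        moreover have "x = min ?x ?y \<longleftrightarrow> ?x < ?y" using ne(4) unfolding 2 by (simp add: min_def)
        ultimately show ?thesis using nO by (metis (no_types, lifting) insert_iff)
      next
        case 3
        have "x \<in> ?L \<longleftrightarrow> ?y < ?x" using mem(2) ne(2,3) cu(4) unfolding 3 by simp
        moreover have "x = min ?x ?y \<longleftrightarrow> ?y < ?x" using ne(4) unfolding 3 by (simp add: min_def)
        ultimately show ?thesis using nO by (metis (no_types, lifting) insert_iff)
      qed
    next
      case False
      then show ?thesis using cu(5)[OF False] by (auto simp: min_def)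
    qed
  qed
  have n2: "min ?x ?y \<notin> ?O" by (auto simp: min_def)
  have ga: "fac K (min a ?x) (f (min a ?x)) = F K a ?x" and gb: "fac K (min b ?y) (f (min b ?y)) = F K b ?y" for K
    using ne inv unfolding F_def by (auto simp: min_def)
  have gc: "fac K (min ?x ?y) (cap a b f (min ?x ?y)) = F K ?x ?y" for K
    using ne cu(3,4) unfolding F_def by (auto simp: min_def)
  have w1: "w f K = F K a ?x * (F K b ?y * (\<Prod>x\<in>?O. fac K x (f x)))" for K
    unfolding W_def V1
    by (simp only: prod.insert[OF finO n1(2)] prod.insert[OF finite.insertI[OF finO] n1(1)] ga gb)
  have "(\<Prod>x\<in>?O. fac K x (cap a b f x)) = (\<Prod>x\<in>?O. fac K x (f x))" for K
    by (rule prod.cong) (use cu(5) in \<open>simp_all\<close>)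
  then have w2: "W (insert 0 A - {a, b}) (cap a b f) K = F K ?x ?y * (\<Prod>x\<in>?O. fac K x (f x))" for K
    unfolding W_def V2 by (simp only: prod.insert[OF finO n2] gc)
  have fO: "fac (insert a J) x (f x) = fac J x (f x)" "fac (insert b J) x (f x) = fac J x (f x)" if "x \<in> ?O" for x
  proof -
    have "x \<noteq> a" "x \<noteq> b" "f x \<noteq> a" "f x \<noteq> b" using that inv[of x] by auto
    then show "fac (insert a J) x (f x) = fac J x (f x)" "fac (insert b J) x (f x) = fac J x (f x)"
      unfolding fac_def by auto
  qed
  have pO: "(\<Prod>x\<in>?O. fac (insert a J) x (f x)) = (\<Prod>x\<in>?O. fac J x (f x))"
    "(\<Prod>x\<in>?O. fac (insert b J) x (f x)) = (\<Prod>x\<in>?O. fac J x (f x))"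
    using fO by (auto intro: prod.cong)
  have J': "a \<notin> insert 0 J" "b \<notin> insert 0 J" using J c by auto
  have sx: "sg ?x = - sg a" "sg ?y = sg a" "sg b = - sg a"
    using arc_sg[OF f] c cons_sg[OF ab(1)] by auto
  have nc: "(b < ?x) = ((?y < a) \<noteq> (?y < ?x))"
    using noncrossing_cond[OF U_D(1)[OF f], of b a] c ab by auto
  have s1: "sg a = 1 \<or> sg a = -1" unfolding sg_def by (metis neg_one_even_power neg_one_odd_power)
  have key: "F (insert a J) a ?x * F (insert a J) b ?y - sg a * (F (insert b J) a ?x * F (insert b J) b ?y)
      = - sg a * F J ?x ?y"
  proof -
    have out: "?x < a \<or> b < ?x" "?y < a \<or> b < ?y"
      using mem c(6)[of ?x] c(6)[of ?y] ne ab c by (metis insertE linorder_neqE_nat neq0_conv)+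
    \<comment> \<open>Noncrossing leaves three relative positions of the two arcs: side by side,
      nested to the right of \<open>a\<close> and \<open>b\<close>, and nested to their
      left.\<close>
    then consider "?x < a" "b < ?y" | "b < ?y" "?y < ?x" | "?y < ?x" "?x < a"
      using nc c ne by linarith
    then show ?thesis
    proof cases
      case 1
      then show ?thesis using J' s1 c ne ab unfolding F_def fac_def sx by auto
    next
      case 2
      then show ?thesis using J' s1 c ne ab unfolding F_def fac_def sx by auto
    next
      case 3
      then show ?thesis using J' s1 c ne ab unfolding F_def fac_def sx by auto
    qed
  qed
  have "w f (insert a J) - sg a * w f (insert b J) =
     (F (insert a J) a ?x * F (insert a J) b ?y - sg a * (F (insert b J) a ?x * F (insert b J) b ?y))
       * (\<Prod>x\<in>?O. fac J x (f x))"
    unfolding w1 pO by (simp add: algebra_simps)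
  then show ?thesis unfolding key w2 by simp
qed

text \<open>Applied to all of \<open>c\<close>, the contraction annihilates the matchings with the
  arc from \<open>a\<close> to \<open>b\<close>; \<open>w_cap\<close> groups the others into fibres
  of \<open>cap a b\<close>, over which \<open>c\<close> sums to zero by
  \<open>C_undotted\<close>.\<close>

lemma X_swap:
  assumes ab: "adjacent a b" and J: "J \<subseteq> A - {a, b}"
  shows "weight_sum (insert a J) = sg a * weight_sum (insert b J)"
proof -
  let ?S = "{f \<in> undotted. f a \<noteq> b}"
  let ?T = "cap a b ` ?S"
  let ?W = "\<lambda>f. W (insert 0 A - {a, b}) f J"
  have 0: "w f (insert a J) - sg a * w f (insert b J) = 0" if "f \<in> undotted" "f a = b" for f
    using w_swap_arc[OF that(1) ab that(2) J] sg_square[of a] by (simp flip: mult.assoc)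
  have "weight_sum (insert a J) - sg a * weight_sum (insert b J) = (\<Sum>f\<in>undotted. c f * (w f (insert a J) - sg a * w f (insert b J)))"
    unfolding weight_sum_def by (simp add: sum_distrib_left algebra_simps sum_subtractf)
  also have "\<dots> = (\<Sum>f\<in>?S. c f * (w f (insert a J) - sg a * w f (insert b J)))"
    by (rule sum.mono_neutral_right) (use finite_U 0 in auto)
  also have "\<dots> = (\<Sum>f\<in>?S. - sg a * (c f * ?W (cap a b f)))"
    by (rule sum.cong) (use w_cap[OF _ ab _ J] in auto)
  also have "\<dots> = - sg a * (\<Sum>f\<in>?S. c f * ?W (cap a b f))"
    by (simp add: sum_distrib_left)
  also have "(\<Sum>f\<in>?S. c f * ?W (cap a b f)) = (\<Sum>f'\<in>?T. \<Sum>f\<in>{f \<in> ?S. cap a b f = f'}. c f * ?W (cap a b f))"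
    using finite_U by (intro sum.group[symmetric]) auto
  also have "\<dots> = (\<Sum>f'\<in>?T. ?W f' * (\<Sum>f\<in>{f \<in> undotted. f a \<noteq> b \<and> cap a b f = f'}. c f))"
    by (rule sum.cong[OF refl]) (auto simp: sum_distrib_left mult.commute intro!: sum.cong)
  also have "\<dots> = 0"
  proof (rule sum.neutral, rule ballI)
    fix f' assume "f' \<in> ?T"
    then obtain f where f: "f \<in> undotted" "f a \<noteq> b" "f' = cap a b f" by auto
    have "(\<Sum>f\<in>{f \<in> undotted. f a \<noteq> b \<and> cap a b f = f'}. c f) = 0"
      using C_undotted[OF ab] cap_U[OF f(1) ab f(2)] f(3) by blast
    then show "?W f' * (\<Sum>f\<in>{f \<in> undotted. f a \<noteq> b \<and> cap a b f = f'}. c f) = 0" by simp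
  qed
  finally show ?thesis by simp
qed

end

text \<open>The last left end \<open>a\<close> must be joined to the first right end
  \<open>b\<close> after it: otherwise the partner of \<open>b\<close> lies before \<open>a\<close>,
  and the arc of \<open>b\<close> crosses that of \<open>a\<close>. Removing the arc from
  \<open>a\<close> to \<open>b\<close> leaves one arc less.\<close>

lemma noncrossing_determined:
  assumes "f \<in> noncrossing A" "g \<in> noncrossing A"
    and "{x. x < f x} = {x. x < g x}" "{x. f x < x} = {x. g x < x}" and fin: "finite A"
  shows "f = g"
  using assms(1-4)
proof (induction "card {x. x < f x}" arbitrary: f g)
  case 0
  have "{x. x < f x} \<subseteq> A" using noncrossing_outside[OF 0(2)] by force
  then have "{x. x < f x} = {}" using 0(1) fin finite_subset by (metis card_0_eq)
  then have "\<not> x < f x" "\<not> x < g x" for x using 0 by auto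
  then have "f x = x" "g x = x" for x
    using noncrossing_invol[OF 0(2), of x] noncrossing_invol[OF 0(3), of x] by (metis linorder_neqE_nat)+
  then show ?case by auto
next
  case (Suc n)
  let ?O = "{x. x < f x}" and ?C = "{x. f x < x}"
  have sub: "?O \<subseteq> A" using noncrossing_outside[OF Suc(3)] by force
  have finO: "finite ?O" using sub fin finite_subset by blast
  have ne: "?O \<noteq> {}" using Suc(2) by (metis card.empty nat.distinct(1))
  define a where "a = Max ?O"
  have a: "a < f a" using Max_in[OF finO ne] unfolding a_def by simp
  have amax: "x \<le> a" if "x < f x" for x using that finO unfolding a_def by simp
  have "f a \<in> ?C" using a noncrossing_invol[OF Suc(3), of a] by simp
  define b where "b = (LEAST x. x \<in> ?C \<and> a < x)"
  have b: "b \<in> ?C" "a < b"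
    using LeastI[of "\<lambda>x. x \<in> ?C \<and> a < x" "f a"] \<open>f a \<in> ?C\<close> a unfolding b_def by auto
  have bmin: "b \<le> x" if "f x < x" "a < x" for x
    unfolding b_def using that by (intro Least_le) auto
  have partner: "h a = b" if h: "h \<in> noncrossing A" and O: "{x. x < f x} = {x. x < h x}" and C: "{x. f x < x} = {x. h x < x}" for h
  proof (rule ccontr)
    assume n: "h a \<noteq> b"
    have ha: "a < h a" using a O by blast
    have hb: "h b < b" using b C by blast
    have "f (h a) < h a" using C ha noncrossing_invol[OF h, of a] by (metis (mono_tags, lifting) mem_Collect_eq)
    then have "b < h a" using bmin[of "h a"] ha n by auto
    have "h b < h (h b)" using hb noncrossing_invol[OF h, of b] by simp
    then have "h b \<le> a" using O amax by (metis (mono_tags, lifting) mem_Collect_eq)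
    moreover have "h b \<noteq> a" using n noncrossing_invol[OF h, of b] by metis
    ultimately have "h b < a" by simp
    then show False
      using noncrossing_cond[OF h, of b a] n b(2) \<open>b < h a\<close> by auto
  qed
  have fa: "f a = b" "g a = b" using partner Suc(3-6) by blast+
  have fb: "f b = a" "g b = a" using noncrossing_invol[OF Suc(3), of a] noncrossing_invol[OF Suc(4), of a] fa by auto
  have red: "h(a := a, b := b) \<in> noncrossing A" "{x. x < (h(a := a, b := b)) x} = {x. x < h x} - {a}"
     "{x. (h(a := a, b := b)) x < x} = {x. h x < x} - {b}"
    if h: "h \<in> noncrossing A" "h a = b" for h
  proof -
    have hb: "h b = a" using noncrossing_invol[OF h(1), of a] h(2) by simp
    have eq: "h(a := a, b := b) = dot a h"
      unfolding dot_def using hb h noncrossing_invol[OF h(1)] by (auto simp: fun_eq_iff) (metis)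
    show "h(a := a, b := b) \<in> noncrossing A"
      unfolding eq using dot_noncrossing[OF h(1), of a] noncrossing_mono[of "A - {a}" A] by blast
    show "{x. x < (h(a := a, b := b)) x} = {x. x < h x} - {a}"
      "{x. (h(a := a, b := b)) x < x} = {x. h x < x} - {b}"
      using hb h b by auto
  qed
  have "f(a := a, b := b) = g(a := a, b := b)"
  proof (rule Suc(1))
    show "n = card {x. x < (f(a := a, b := b)) x}"
      unfolding red(2)[OF Suc(3) fa(1)] using Suc(2) finO a by simp
  qed (use red[OF Suc(3) fa(1)] red[OF Suc(4) fa(2)] Suc(5,6) in auto)
  then have "f x = g x" if "x \<noteq> a" "x \<noteq> b" for x using that by (metis fun_upd_other)
  then show ?case using fa fb by (metis ext)
qed

lemma alternating_sum: "(\<Sum>t\<in>{a..b}. (-1) ^ t :: int) \<in> {-1, 0, 1}" for a b :: nat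
proof (cases "a \<le> b")
  case True
  then have "(\<Sum>t\<in>{a..b}. (-1) ^ t :: int) = (if even (b - a) then (-1) ^ a else 0)"
  proof (induction b rule: dec_induct)
    case (step n)
    then show ?case by (cases "even a"; cases "even n") (auto simp: even_Suc Suc_diff_le)
  qed simp
  then show ?thesis by (cases "even a") auto
qed simp

section \<open>Sums against the weights depend only on the size of the index set\<close>

context radical_vector
begin

text \<open>Exchanging a point of the set with a free neighbour just below it pushes every set down
  to an initial segment of \<open>A\<close>, and two initial segments of the same size are
  equal.\<close>

lemma swap_invariant_const:
  assumes h: "\<And>a b J. adjacent a b \<Longrightarrow> J \<subseteq> A - {a, b} \<Longrightarrow> h (insert a J) = h (insert b J)"
    and J: "J \<subseteq> A" "J' \<subseteq> A" "card J = card J'"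
  shows "h J = h J'"
proof -
  define down where "down J \<longleftrightarrow> J \<subseteq> A \<and> (\<forall>x\<in>J. \<forall>y\<in>A. y < x \<longrightarrow> y \<in> J)" for J
  have ex: "\<exists>I. down I \<and> card I = card J \<and> h I = h J" if "J \<subseteq> A" for J
    using that
  proof (induction "\<Sum>J" arbitrary: J rule: less_induct)
    case less
    have finJ: "finite J" using less.prems fin finite_subset by blast
    show ?case
    proof (cases "down J")
      case False
      then obtain x0 y0 where xy0: "x0 \<in> J" "y0 \<in> A" "y0 < x0" "y0 \<notin> J"
        unfolding down_def using less.prems by blast
      have JA: "J \<subseteq> A" using less.prems .
      have "\<exists>x y. x \<in> J \<and> y \<in> A \<and> y < x \<and> y \<notin> J \<and> adjacent y x"
        if "x \<in> J" "y \<in> A" "y < x" "y \<notin> J" for x y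
        using that
      proof (induction "x - y" arbitrary: x y rule: less_induct)
        case (less x y)
        show ?case
        proof (cases "adjacent y x")
          case False
          then obtain z where z: "z \<in> A" "y < z" "z < x" using less.prems JA unfolding adjacent_def by blast
          have "x - z < x - y" "z - y < x - y" using z by auto
          then show ?thesis
            using less.hyps[of z y] less.hyps[of x z] less.prems z by (cases "z \<in> J") blast+
        next
          case True
          then show ?thesis using less.prems by blast
        qed
      qed
      from this[OF xy0]
      obtain x y where xy: "x \<in> J" "y \<in> A" "y < x" "y \<notin> J" "adjacent y x" by blast
      let ?K = "J - {x}"
      have K: "J = insert x ?K" "?K \<subseteq> A - {y, x}" using xy less.prems by auto
      have sum: "\<Sum>J = x + \<Sum>?K" "\<Sum>(insert y ?K) = y + \<Sum>?K"
        using finJ xy by (auto simp: sum.remove)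
      have cd: "card (insert y ?K) = card J"
        using finJ xy by (metis K(1) card_insert_disjoint finite_Diff DiffD1 Diff_iff insertI1)
      obtain I where "down I" "card I = card (insert y ?K)" "h I = h (insert y ?K)"
        using less.hyps[of "insert y ?K"] sum xy K by auto
      then show ?thesis using h[OF xy(5) K(2)] K(1) cd by metis
    qed (use less in blast)
  qed
  have uniq: "I = I'" if "down I" "down I'" "card I = card I'" for I I'
  proof -
    have "finite I" "finite I'" using that fin finite_subset unfolding down_def by blast+
    moreover have "I \<subseteq> I' \<or> I' \<subseteq> I"
    proof (rule ccontr)
      assume "\<not> ?thesis"
      then obtain x y where xy: "x \<in> I" "x \<notin> I'" "y \<in> I'" "y \<notin> I" by blast
      then have "x \<in> A" "y \<in> A" using that unfolding down_def by blast+
      moreover have "x < y \<or> y < x" using xy by (metis linorder_neqE_nat)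
      ultimately show False using that xy unfolding down_def by blast
    qed
    ultimately show ?thesis using that(3) by (metis card_subset_eq)
  qed
  obtain I I' where "down I" "card I = card J" "h I = h J" "down I'" "card I' = card J'" "h I' = h J'"
    using ex[OF J(1)] ex[OF J(2)] by blast
  then show ?thesis using uniq[of I I'] J(3) by simp
qed

text \<open>The exponents are triangular numbers because these grow by \<open>rk a\<close> from
  \<open>a\<close> to the next point: \<open>kap\<close> absorbs the sign \<open>sg a\<close> by
  which \<open>weight_sum\<close> changes when neighbours are exchanged.\<close>

definition kap :: "nat set \<Rightarrow> 'k" where
  "kap J = (\<Prod>x\<in>J. (-1) ^ (rk x * (rk x - 1) div 2))"

lemma kap_swap:
  assumes ab: "adjacent a b" and J: "J \<subseteq> A - {a, b}"
  shows "kap (insert b J) = sg a * kap (insert a J)"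
proof -
  have "finite J" "a \<notin> J" "b \<notin> J" using J fin finite_subset by auto
  moreover have "(rk a + 1) * rk a div 2 = rk a * (rk a - 1) div 2 + rk a"
  proof (cases "rk a")
    case (Suc r)
    have "(Suc (Suc r)) * Suc r = Suc r * r + 2 * Suc r" by (simp add: algebra_simps)
    then show ?thesis unfolding Suc by simp
  qed simp
  ultimately show ?thesis unfolding kap_def sg_def by (simp add: cons_rk[OF ab] power_add)
qed

lemma kap_nonzero: "kap J \<noteq> 0"
  unfolding kap_def by (cases "finite J") auto

lemma kap_w_swap:
  assumes f: "f \<in> undotted" and ab: "adjacent a b" "f a = b" and J: "J \<subseteq> A - {a, b}"
  shows "kap (insert b J) * w f (insert b J) = kap (insert a J) * w f (insert a J)"
proof -
  have "kap (insert b J) * w f (insert b J) = (sg a * sg a) * (kap (insert a J) * w f (insert a J))"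
    unfolding kap_swap[OF ab(1) J] w_swap_arc[OF f ab J] by (simp add: algebra_simps)
  then show ?thesis by (simp add: sg_square)
qed

text \<open>A shortest arc inside \<open>T\<close> works: points of \<open>A\<close> under an arc
  have their own arcs under it, and they belong to \<open>T\<close> because \<open>T\<close> is
  closed upwards.\<close>

lemma short_arc_above:
  assumes f: "f \<in> undotted" and T: "T \<subseteq> A" "\<And>x y. x \<in> T \<Longrightarrow> y \<in> A \<Longrightarrow> x \<le> y \<Longrightarrow> y \<in> T"
    and x: "x \<in> T" "f x \<in> T"
  shows "\<exists>a b. adjacent a b \<and> a \<in> T \<and> b \<in> T \<and> f a = b"
proof -
  have "\<exists>a b. adjacent a b \<and> a \<in> T \<and> b \<in> T \<and> f a = b" if "x < f x" "x \<in> T" "f x \<in> T" for x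
    using that
  proof (induction "f x - x" arbitrary: x rule: less_induct)
    case (less x)
    show ?case
    proof (cases "adjacent x (f x)")
      case False
      then obtain z where z: "z \<in> A" "x < z" "z < f x" using less.prems T unfolding adjacent_def by auto
      note fz = arc_between[OF f _ z(2,3,1)]
      have xA: "x \<in> insert 0 A" using less.prems T by auto
      have "z \<in> T" "f z \<in> T" using T(2)[OF less.prems(2)] z fz[OF xA] by auto
      show ?thesis
      proof (cases "z < f z")
        case True
        then show ?thesis using less.hyps[of z] \<open>z \<in> T\<close> \<open>f z \<in> T\<close> fz[OF xA] z by auto
      next
        case False
        then have "f z < z" using fz[OF xA] by auto
        then show ?thesis using less.hyps[of "f z"] \<open>z \<in> T\<close> \<open>f z \<in> T\<close> fz[OF xA] z U_D(2)[OF f, of z] by auto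
      qed
    qed (use less in blast)
  qed
  moreover have "x < f x \<or> f x < f (f x)" using x T U_D(2,4)[OF f] by (metis insertI2 linorder_neqE_nat subsetD)
  ultimately show ?thesis using x U_D(2)[OF f] by metis
qed

text \<open>The two functionals that follow kill every \<^term>\<open>w f\<close>: after a choice of an innermost arc
  inside \<open>T\<close>, exchanging its ends changes the sign of each summand.\<close>

lemma functional1:
  assumes f: "f \<in> undotted" and A: "card A \<ge> 2"
  shows "(\<Sum>i\<in>A. sg i * (kap {i} * w f {i})) = 0"
proof -
  have "\<exists>x\<in>A. x \<noteq> f 0"
  proof (rule ccontr)
    assume "\<not> ?thesis"
    then have "card A \<le> 1" using card_mono[of "{f 0}" A] by auto
    then show False using A by simp
  qed
  then obtain x where x: "x \<in> A" "f x \<in> A" using U_D(5)[OF f] by blast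
  obtain a b where ab: "adjacent a b" "f a = b" using short_arc_above[OF f _ _ x] by blast
  note c = cons_in[OF ab(1)]
  have 0: "w f {i} = 0" if "i \<in> A - {a, b}" for i
    by (rule w_zero[OF f, of a]) (use that c ab in auto)
  have "(\<Sum>i\<in>A. sg i * (kap {i} * w f {i})) = (\<Sum>i\<in>{a, b}. sg i * (kap {i} * w f {i}))"
    by (rule sum.mono_neutral_right) (use 0 c fin in auto)
  also have "\<dots> = 0"
    using kap_w_swap[OF f ab, of "{}"] cons_sg[OF ab(1)] c by simp
  finally show ?thesis .
qed

lemma functional2:
  assumes f: "f \<in> undotted" and T: "T \<subseteq> A" "\<And>x y. x \<in> T \<Longrightarrow> y \<in> A \<Longrightarrow> x \<le> y \<Longrightarrow> y \<in> T"
  shows "(\<Sum>i\<in>T. \<Sum>j\<in>T - {i}. sg i * sg j * (kap (A - T \<union> {i, j}) * w f (A - T \<union> {i, j}))) = 0"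
proof -
  define t where "t i j = sg i * sg j * (kap (A - T \<union> {i, j}) * w f (A - T \<union> {i, j}))" for i j
  have "(\<Sum>i\<in>T. \<Sum>j\<in>T - {i}. t i j) = 0"
proof (cases "\<exists>x\<in>T. f x \<in> T")
  case False
  have "t i j = 0" if ij: "i \<in> T" "j \<in> T - {i}" for i j
  proof -
    let ?J = "A - T \<union> {i, j}"
    have "f i \<notin> T" "i \<in> A" "f i \<in> insert 0 A" using False ij T U_D(3)[OF f, of i] by auto
    then have "w f ?J = 0" by (intro w_zero[OF f, of i]) (use ij in auto)
    then show ?thesis unfolding t_def by simp
  qed
  then show ?thesis by (intro sum.neutral ballI) auto
next
  case True
  then obtain x where "x \<in> T" "f x \<in> T" by blast
  with short_arc_above[OF f T(1), of x] T(2)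
  obtain a b where ab: "adjacent a b" "a \<in> T" "b \<in> T" "f a = b" by metis
  note c = cons_in[OF ab(1)]
  have finT: "finite T" by (rule finite_subset[OF T(1) fin])
  define s where "s x = (if x = a then b else if x = b then a else x)" for x
  have ss: "s (s x) = x" for x unfolding s_def by auto
  have sT: "s x \<in> T \<longleftrightarrow> x \<in> T" for x unfolding s_def using ab by auto
  have anti: "t (s i) (s j) = - t i j" if ij: "i \<in> T" "j \<in> T" "i \<noteq> j" for i j
  proof -
    \<comment> \<open>If none or both of the ends of the innermost arc belong to the index set, the
      weight itself vanishes; only mixed pairs remain to be exchanged.\<close>
    have t0: "t i j = 0" if "(i \<in> {a, b}) = (j \<in> {a, b})" "i \<noteq> j" "i \<in> T" "j \<in> T" for i j
    proof -
      have "w f (A - T \<union> {i, j}) = 0"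
        by (rule w_zero[OF f, of a]) (use that c ab in auto)
      then show ?thesis unfolding t_def by simp
    qed
    have t1: "t b j = - t a j" if "j \<in> T - {a, b}" for j
    proof -
      have "A - T \<union> {b, j} = insert b (A - T \<union> {j})" "A - T \<union> {a, j} = insert a (A - T \<union> {j})" by auto
      moreover have "A - T \<union> {j} \<subseteq> A - {a, b}" using that ab T by auto
      ultimately show ?thesis using kap_w_swap[OF f ab(1,4), of "A - T \<union> {j}"] cons_sg[OF ab(1)] unfolding t_def by simp
    qed
    have sym: "t i j = t j i" for i j unfolding t_def by (simp add: insert_commute mult.commute[of "sg i"])
    show ?thesis
    proof (cases "(i \<in> {a, b}) = (j \<in> {a, b})")
      case True
      have "(s i \<in> {a, b}) = (s j \<in> {a, b})" "s i \<noteq> s j" using True ij ss unfolding s_def by auto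
      then show ?thesis using t0[OF True ij(3,1,2)] t0[of "s i" "s j"] sT ij by simp
    next
      case False
      then consider "i = a" "j \<in> T - {a, b}" | "i = b" "j \<in> T - {a, b}" | "j = a" "i \<in> T - {a, b}" | "j = b" "i \<in> T - {a, b}"
        using ij by auto
      then show ?thesis
      proof cases
        case 1
        then have "s i = b" "s j = j" unfolding s_def by auto
        then show ?thesis using t1[OF 1(2)] 1 by simp
      next
        case 2
        then have "s i = a" "s j = j" using c unfolding s_def by auto
        then show ?thesis using t1[OF 2(2)] 2 by simp
      next
        case 3
        then have "s j = b" "s i = i" unfolding s_def by auto
        then show ?thesis using t1[OF 3(2)] 3 sym[of i] by simp
      next
        case 4
        then have "s j = a" "s i = i" using c unfolding s_def by auto
        then show ?thesis using t1[OF 4(2)] 4 sym[of i] by simp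
      qed
    qed
  qed
  let ?S = "\<Sum>i\<in>T. \<Sum>j\<in>T - {i}. t i j"
  have "?S = (\<Sum>i\<in>T. \<Sum>j\<in>T - {s i}. t (s i) j)"
    by (rule sum.reindex_bij_witness[of _ s s]) (use ss sT in auto)
  also have "\<dots> = (\<Sum>i\<in>T. \<Sum>j\<in>T - {i}. t (s i) (s j))"
    by (rule sum.cong[OF refl], rule sum.reindex_bij_witness[of _ s s]) (use ss sT in \<open>auto, metis+\<close>)
  also have "\<dots> = (\<Sum>i\<in>T. \<Sum>j\<in>T - {i}. - t i j)"
    using anti by (intro sum.cong refl) auto
  also have "\<dots> = - ?S" by (simp add: sum_negf)
  finally show ?thesis by simp
  qed
  then show ?thesis unfolding t_def .
qed

end

context radical_vector
begin

section \<open>Vanishing of radical vectors\<close>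

lemma rk_bij: "bij_betw rk A {1..card A}"
proof -
  have mono: "rk x < rk y" if "x \<in> A" "x < y" for x y
    using rk_less[of x y] that by simp
  have inj: "inj_on rk A"
    by (rule linorder_inj_onI') (use mono in \<open>metis less_irrefl\<close>)
  have "rk ` A \<subseteq> {1..card A}"
  proof
    fix r assume "r \<in> rk ` A"
    then obtain x where x: "x \<in> A" "r = rk x" by auto
    have "{y \<in> insert 0 A. y < x} = insert 0 {y \<in> A. y < x}" using A_pos[OF x(1)] by auto
    moreover have "0 \<notin> {y \<in> A. y < x}" using zero by simp
    ultimately have "rk x = Suc (card {y \<in> A. y < x})" unfolding rk_def using fin by simp
    moreover have "card {y \<in> A. y < x} < card A" by (rule psubset_card_mono) (use fin x in auto)
    ultimately show "r \<in> {1..card A}" using x by simp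
  qed
  moreover have "card (rk ` A) = card {1..card A}" using inj by (simp add: card_image)
  ultimately show ?thesis using inj unfolding bij_betw_def by (metis card_subset_eq finite_atLeastAtMost)
qed

text \<open>A nonzero weight makes \<open>f\<close> exchange \<open>insert 0 J\<close> with its
  complement, so both have the same size.\<close>

lemma w_card:
  assumes f: "f \<in> undotted" and J: "J \<subseteq> A" "w f J \<noteq> 0"
  shows "card A = 2 * card J + 1"
proof -
  let ?I = "insert 0 J" and ?V = "insert 0 A"
  have ex: "(x \<in> ?I) \<noteq> (f x \<in> ?I)" if "x \<in> ?V" for x
    using w_zero[OF f that] J by blast
  have "f ` ?I = ?V - ?I"
  proof (intro equalityI subsetI)
    fix y assume "y \<in> f ` ?I"
    then obtain x where x: "x \<in> ?I" "y = f x" by blast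
    then have xV: "x \<in> ?V" using J by blast
    have "f x \<notin> ?I" using ex[OF xV] x(1) by metis
    then show "y \<in> ?V - ?I" using U_D(3)[OF f xV] x(2) by (metis DiffI)
  next
    fix y assume y: "y \<in> ?V - ?I"
    then have "f y \<in> ?I" using ex[of y] by (metis DiffD1 DiffD2)
    then show "y \<in> f ` ?I" using U_D(2)[OF f, of y] by (metis imageI)
  qed
  moreover have "inj_on f ?I" by (rule inj_onI) (metis U_D(2)[OF f])
  ultimately have "card (?V - ?I) = card ?I" by (metis card_image)
  moreover have "card (?V - ?I) = card ?V - card ?I"
    using J fin by (intro card_Diff_subset) (auto intro: finite_subset)
  moreover have "card ?V = card A + 1" "card ?I = card J + 1"
    using fin zero J finite_subset[OF J(1)] by (auto simp: card_insert_if)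
  ultimately show ?thesis by simp
qed

lemma kap_X_const:
  assumes "J \<subseteq> A" "J' \<subseteq> A" "card J = card J'"
  shows "kap J * weight_sum J = kap J' * weight_sum J'"
proof (rule swap_invariant_const[where h = "\<lambda>J. kap J * weight_sum J", OF _ assms])
  fix a b J assume ab: "adjacent a b" "J \<subseteq> A - {a, b}"
  show "kap (insert a J) * weight_sum (insert a J) = kap (insert b J) * weight_sum (insert b J)"
    unfolding X_swap[OF ab] kap_swap[OF ab] by (simp add: algebra_simps)
qed

text \<open>By \<open>kap_X_const\<close> the product \<open>kap J * weight_sum J\<close> has one
  value \<open>l\<close> for all \<open>J\<close> of the same size. A functional that annihilates
  \<open>kap J * w f J\<close> for every \<open>f\<close> annihilates this constant function as
  well, and its value there is \<open>l\<close> times an integer. The two functionals are chosen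
  such that the integer is nonzero.\<close>

lemma X_zero:
  assumes A: "card A \<ge> 2" and J: "J \<subseteq> A"
  shows "weight_sum J = 0"
proof (rule ccontr)
  assume nz: "weight_sum J \<noteq> 0"
  define N where "N = card J"
  have "\<exists>f\<in>undotted. w f J \<noteq> 0"
    using nz unfolding weight_sum_def by (metis (no_types, lifting) mult_zero_right sum.neutral)
  then have cA: "card A = 2 * N + 1" using w_card J unfolding N_def by blast
  define l where "l = kap J * weight_sum J"
  have l: "kap I * weight_sum I = l" if "I \<subseteq> A" "card I = N" for I
    unfolding l_def by (rule kap_X_const) (use that J N_def in auto)
  have "l \<noteq> 0" unfolding l_def using nz kap_nonzero by simp
  have lX: "(\<Sum>f\<in>undotted. c f * (kap I * w f I)) = l" if "I \<subseteq> A" "card I = N" for I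
    unfolding l[OF that, symmetric] weight_sum_def by (simp add: sum_distrib_left mult.left_commute)
  have sgsum: "(\<Sum>i\<in>{x \<in> A. m \<le> rk x}. sg i) = of_int (\<Sum>t\<in>{m..2 * N + 1}. (-1) ^ t)"
    and cardT: "card {x \<in> A. m \<le> rk x} = 2 * N + 2 - m" if "1 \<le> m" for m
  proof -
    have b: "bij_betw rk {x \<in> A. m \<le> rk x} {m..2 * N + 1}"
    proof (rule bij_betw_subset[OF rk_bij])
      have "rk ` {x \<in> A. m \<le> rk x} = {t \<in> rk ` A. m \<le> t}" by auto
      also have "\<dots> = {m..2 * N + 1}" using rk_bij that unfolding bij_betw_def cA by auto
      finally show "rk ` {x \<in> A. m \<le> rk x} = {m..2 * N + 1}" .
    qed auto
    show "(\<Sum>i\<in>{x \<in> A. m \<le> rk x}. sg i) = of_int (\<Sum>t\<in>{m..2 * N + 1}. (-1) ^ t)"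
      unfolding sg_def using sum.reindex_bij_betw[OF b, of "\<lambda>t. (-1 :: 'k) ^ t"] by simp
    show "card {x \<in> A. m \<le> rk x} = 2 * N + 2 - m"
      using bij_betw_same_card[OF b] by simp
  qed
  show False
  proof (cases "N = 1")
    \<comment> \<open>Here \<open>A\<close> has three points, too few for the four that the
      quadratic functional would use; the linear one gives \<open>l\<close> times -1.\<close>
    case True
    have "(\<Sum>i\<in>A. sg i * l) = (\<Sum>i\<in>A. sg i * (\<Sum>f\<in>undotted. c f * (kap {i} * w f {i})))"
      by (rule sum.cong[OF refl], subst lX) (use True in auto)
    also have "\<dots> = (\<Sum>f\<in>undotted. c f * (\<Sum>i\<in>A. sg i * (kap {i} * w f {i})))"
      unfolding sum_distrib_left by (subst sum.swap) (simp add: mult.left_commute)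
    also have "\<dots> = 0" using functional1[OF _ A] by simp
    finally have "(\<Sum>i\<in>A. sg i) * l = 0" by (simp add: sum_distrib_right)
    moreover have "{x \<in> A. 1 \<le> rk x} = A" using rk_bij unfolding bij_betw_def by fastforce
    then have "(\<Sum>i\<in>A. sg i) = of_int (\<Sum>t\<in>{1..3}. (-1) ^ t)" using sgsum[of 1] True by simp
    moreover have "{1..3 :: nat} = {1, 2, 3}" by auto
    ultimately show False using \<open>l \<noteq> 0\<close> by simp
  next
    case False
    have "N \<ge> 2" using False A cA by linarith
    \<comment> \<open>These are the top \<open>N + 3\<close> points: \<open>N - 2\<close> points
      remain below, and two further ones complete them to a set of size \<open>N\<close>.\<close>
    define T where "T = {x \<in> A. N - 1 \<le> rk x}"
    have T: "T \<subseteq> A" "\<And>x y. x \<in> T \<Longrightarrow> y \<in> A \<Longrightarrow> x \<le> y \<Longrightarrow> y \<in> T"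
    proof -
      fix x y assume xy: "x \<in> T" "y \<in> A" "x \<le> y"
      have "rk x \<le> rk y" using rk_less[of x y] xy unfolding T_def by (cases "x = y") auto
      then show "y \<in> T" using xy unfolding T_def by auto
    qed (auto simp: T_def)
    have finT: "finite T" by (rule finite_subset[OF T(1) fin])
    define q where "q = (\<Sum>t\<in>{N - 1..2 * N + 1}. (-1) ^ t :: int)"
    have q: "(\<Sum>i\<in>T. sg i) = of_int q"
      using sgsum[of "N - 1"] \<open>N \<ge> 2\<close> unfolding T_def q_def by simp
    have q1: "q \<in> {-1, 0, 1}" unfolding q_def by (rule alternating_sum)
    have cT: "card T = N + 3" using cardT[of "N - 1"] \<open>N \<ge> 2\<close> unfolding T_def by simp
    have cAT: "card (A - T) = N - 2"
      using card_Diff_subset[OF finT T(1)] cT cA by simp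
    have cI: "A - T \<union> {i, j} \<subseteq> A" "card (A - T \<union> {i, j}) = N" if "i \<in> T" "j \<in> T - {i}" for i j
    proof -
      show "A - T \<union> {i, j} \<subseteq> A" using that T by auto
      have "card (A - T \<union> {i, j}) = card (A - T) + card {i, j}"
        by (rule card_Un_disjoint) (use that fin in auto)
      then show "card (A - T \<union> {i, j}) = N" using that cAT \<open>N \<ge> 2\<close> by (auto simp: card_insert_if)
    qed
    let ?t = "\<lambda>f i j. sg i * sg j * (kap (A - T \<union> {i, j}) * w f (A - T \<union> {i, j}))"
    have "(\<Sum>i\<in>T. \<Sum>j\<in>T - {i}. sg i * sg j * l) = (\<Sum>i\<in>T. \<Sum>j\<in>T - {i}. \<Sum>f\<in>undotted. c f * ?t f i j)"
    proof (intro sum.cong refl)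
      fix i j assume "i \<in> T" "j \<in> T - {i}"
      then show "sg i * sg j * l = (\<Sum>f\<in>undotted. c f * ?t f i j)"
        by (subst lX[OF cI, symmetric]) (auto simp: sum_distrib_left mult.left_commute mult.assoc)
    qed
    also have "\<dots> = (\<Sum>f\<in>undotted. c f * (\<Sum>i\<in>T. \<Sum>j\<in>T - {i}. ?t f i j))"
    proof -
      have "(\<Sum>i\<in>T. \<Sum>j\<in>T - {i}. \<Sum>f\<in>undotted. c f * ?t f i j) = (\<Sum>i\<in>T. \<Sum>f\<in>undotted. \<Sum>j\<in>T - {i}. c f * ?t f i j)"
        by (rule sum.cong[OF refl], rule sum.swap)
      also have "\<dots> = (\<Sum>f\<in>undotted. \<Sum>i\<in>T. \<Sum>j\<in>T - {i}. c f * ?t f i j)" by (rule sum.swap)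
      finally show ?thesis by (simp only: sum_distrib_left)
    qed
    also have "\<dots> = 0" using functional2[OF _ T] by (simp del: Un_insert_right)
    finally have z: "(\<Sum>i\<in>T. \<Sum>j\<in>T - {i}. sg i * sg j) * l = 0" by (simp add: sum_distrib_right)
    have "(\<Sum>j\<in>T - {i}. sg i * sg j) = sg i * (\<Sum>j\<in>T. sg j) - 1" if "i \<in> T" for i
    proof -
      have "(\<Sum>j\<in>T. sg j) = sg i + (\<Sum>j\<in>T - {i}. sg j)" by (rule sum.remove[OF finT that])
      then show ?thesis by (simp add: distrib_left sg_square flip: sum_distrib_left)
    qed
    then have "(\<Sum>i\<in>T. \<Sum>j\<in>T - {i}. sg i * sg j) = (\<Sum>i\<in>T. sg i * (\<Sum>j\<in>T. sg j) - 1)" by simp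
    also have "\<dots> = (\<Sum>i\<in>T. sg i) * (\<Sum>i\<in>T. sg i) - of_nat (N + 3)"
      by (simp add: sum_subtractf sum_distrib_right cT)
    \<comment> \<open>The ordered pairs contribute the square of \<open>q\<close>, from which the
      diagonal \<open>N + 3\<close> is removed. As \<open>q\<close> is -1, 0 or 1, the integer is
      negative, and characteristic 0 keeps it nonzero in the field.\<close>
    also have "\<dots> = of_int (q\<^sup>2 - int (N + 3))"
      unfolding q by (simp add: power2_eq_square)
    also have "\<dots> \<noteq> 0"
      using q1 by (subst of_int_eq_0_iff) auto
    finally show False using z \<open>l \<noteq> 0\<close> by simp
  qed
qed

text \<open>Triangularity: in the support of \<open>c\<close> take \<open>f\<close> with the
  smallest sum of left ends, and let \<open>J\<close> consist of its left ends other than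
  \<open>0\<close>. A matching \<open>g\<close> of the support with nonzero weight at
  \<open>J\<close> has exactly one end of each arc among the left ends of \<open>f\<close>. Passing
  to the left ends of \<open>g\<close> can only decrease the sum, so both have the same left ends
  and \<open>g = f\<close>. Hence \<open>weight_sum J = c f\<close>, contrary to
  \<open>X_zero\<close>.\<close>

lemma c_zero_undotted:
  assumes A: "card A \<ge> 2" and f: "f \<in> undotted"
  shows "c f = 0"
proof (rule ccontr)
  assume "c f \<noteq> 0"
  let ?V = "insert 0 A"
  define op where "op f = {x \<in> ?V. x < f x}" for f :: "nat \<Rightarrow> nat"
  let ?wt = "\<lambda>f. \<Sum>(op f)"
  obtain f where f: "f \<in> undotted" "c f \<noteq> 0" and least: "\<And>g. g \<in> undotted \<Longrightarrow> c g \<noteq> 0 \<Longrightarrow> ?wt f \<le> ?wt g"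
    using arg_min_nat_lemma[of "\<lambda>f. f \<in> undotted \<and> c f \<noteq> 0" f ?wt] \<open>c f \<noteq> 0\<close> assms(2) by blast
  let ?J = "op f - {0}"
  have f0: "0 \<in> op f" using U_D(4)[OF f(1), of 0] unfolding op_def by simp
  have J: "insert 0 ?J = op f" "?J \<subseteq> A" using f0 unfolding op_def by auto
  have finop: "finite (op g)" for g unfolding op_def using fin by simp
  have other: "w g ?J = 0" if g: "g \<in> undotted" "c g \<noteq> 0" "g \<noteq> f" for g
  proof (rule ccontr)
    assume nz: "w g ?J \<noteq> 0"
    have ex: "(x \<in> op f) \<noteq> (g x \<in> op f)" if "x \<in> ?V" for x
      using w_zero[OF g(1) that, of ?J] nz J(1) by metis
    \<comment> \<open>The left end of the arc of \<open>g\<close> at \<open>x\<close>; since each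
      arc of \<open>g\<close> has one end in \<open>op f\<close>, this matches \<open>op f\<close>
      with \<open>op g\<close>.\<close>
    define m where "m x = min x (g x)" for x
    have inv: "g (g x) = x" for x using U_D(2)[OF g(1)] .
    have "bij_betw m (op f) (op g)"
    proof (rule bij_betwI')
      fix x y assume xy: "x \<in> op f" "y \<in> op f"
      show "(m x = m y) = (x = y)"
      proof
        assume "m x = m y"
        then have "x = y \<or> x = g y \<or> g x = y \<or> g x = g y" unfolding m_def by (auto simp: min_def split: if_splits)
        then have "x = y \<or> x = g y" using inv by metis
        then show "x = y" using ex[of y] xy unfolding op_def by auto
      qed simp
    next
      fix x assume "x \<in> op f"
      then have x: "x \<in> ?V" unfolding op_def by simp
      show "m x \<in> op g"
      proof (cases "x < g x")
        case True
        then show ?thesis using x unfolding op_def m_def by (simp add: min_def)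
      next
        case False
        then have "g x < x" using U_D(4)[OF g(1) x] by simp
        then show ?thesis using U_D(3)[OF g(1) x] inv unfolding op_def m_def by (simp add: min_def)
      qed
    next
      fix y assume y: "y \<in> op g"
      then have "y \<in> ?V" "y < g y" unfolding op_def by auto
      then have "y = m y" "y = m (g y)" "y \<in> op f \<or> g y \<in> op f"
        using ex[of y] inv[of y] unfolding m_def by (auto simp: min_def)
      then show "\<exists>x\<in>op f. y = m x" by blast
    qed
    then have eq: "?wt g = (\<Sum>x\<in>op f. m x)" using sum.reindex_bij_betw[of m "op f" "op g" "\<lambda>x. x"] by simp
    then have "(\<Sum>x\<in>op f. m x) = ?wt f"
      using least[OF g(1,2)] sum_mono[of "op f" m "\<lambda>x. x"] unfolding m_def by simp
    then have "\<forall>x\<in>op f. m x = x"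
      using sum_mono_inv[of m "op f" "\<lambda>x. x"] finop unfolding m_def by (metis min.cobounded1)
    then have m: "m ` op f = op f" by simp
    have "op g = op f" using bij_betw_imp_surj_on[OF \<open>bij_betw m (op f) (op g)\<close>] m by simp
    have opf: "op h = {x. x < h x}" "{x. h x < x} = ?V - op h" if h: "h \<in> undotted" for h
    proof -
      have hx: "h x \<noteq> x \<longleftrightarrow> x \<in> ?V" for x
        using U_D(4)[OF h, of x] noncrossing_outside[OF U_D(1)[OF h], of x] by blast
      show "op h = {x. x < h x}"
        by (rule Set.set_eqI, unfold op_def mem_Collect_eq) (metis hx less_irrefl)
      show "{x. h x < x} = ?V - op h"
        by (rule Set.set_eqI, unfold op_def Diff_iff mem_Collect_eq) (metis hx less_irrefl less_asym linorder_neqE_nat)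
    qed
    have "g = f"
      by (rule noncrossing_determined[OF U_D(1)[OF g(1)] U_D(1)[OF f(1)]])
        (use opf[OF g(1)] opf[OF f(1)] \<open>op g = op f\<close> fin in auto)
    then show False using g by simp
  qed
  have "w f ?J = 1"
    unfolding W_def J(1) fac_def using U_D(2)[OF f(1)] by (intro prod.neutral) (auto simp: op_def)
  have "weight_sum ?J = (\<Sum>g\<in>{f}. c g * w g ?J)"
    unfolding weight_sum_def by (rule sum.mono_neutral_right) (use finite_U f other in auto)
  then have "weight_sum ?J = c f" using \<open>w f ?J = 1\<close> by simp
  then show False using X_zero[OF A J(2)] f by simp
qed

text \<open>Induction over the number of dots. If \<open>f\<close> has a dot at \<open>i\<close>,
  every other matching in the fibre of \<open>dot i\<close> over \<open>f\<close> has fewer dots, so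
  \<open>D\<close> leaves only the term \<open>c f\<close>.\<close>

lemma c_zero:
  assumes A: "card A \<ge> 2" and f: "f \<in> one_defect A"
  shows "c f = 0"
  using f
proof (induction "card {x \<in> A. f x = x}" arbitrary: f rule: less_induct)
  case less
  note fP = less.prems
  note inv = noncrossing_invol[OF one_defectD(1)[OF fP]]
  show ?case
  proof (cases "f \<in> undotted")
    case False
    then obtain i where i: "i \<in> A" "f i = i" using fP unfolding undotted_def by auto
    have f'P: "f \<in> one_defect (A - {i})"
      using fP i noncrossing_smaller[of f "insert 0 A" "insert 0 (A - {i})"] unfolding one_defect_def by auto
    have dot: "dot i f = f" using i inv unfolding dot_def by (auto simp: fun_eq_iff)
    have "c g = 0" if g: "g \<in> {g \<in> one_defect A. dot i g = f} - {f}" for g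
    proof (rule less.hyps)
      show gP: "g \<in> one_defect A" using g by simp
      note ginv = noncrossing_invol[OF one_defectD(1)[OF gP]]
      have fx: "f x = (if x = i \<or> g x = i then x else g x)" for x
        using g unfolding dot_def by (auto simp: fun_eq_iff)
      have gi: "g i \<noteq> i"
      proof
        assume "g i = i"
        then have "g x = f x" for x using fx[of x] ginv[of x] by auto
        then show False using g by auto
      qed
      have "{x \<in> A. g x = x} \<subseteq> {x \<in> A. f x = x}" using fx by auto
      moreover have "i \<in> {x \<in> A. f x = x} - {x \<in> A. g x = x}" using i gi by auto
      ultimately show "card {x \<in> A. g x = x} < card {x \<in> A. f x = x}"
        using fin by (intro psubset_card_mono) auto
    qed
    moreover have "f \<in> {g \<in> one_defect A. dot i g = f}" using fP dot by simp
    ultimately have "(\<Sum>g\<in>{g \<in> one_defect A. dot i g = f}. c g) = c f"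
      using finite_P by (simp add: sum.remove)
    then show ?thesis using D[OF i(1) f'P] by simp
  qed (use c_zero_undotted[OF A] in blast)
qed

end

text \<open>Induction over the size of \<open>A\<close>: nondegeneracy for smaller sets turns the
  two adjunctions, of \<open>dot\<close> with the inclusion and of \<open>cap\<close> with the
  insertion of an arc, into the assumptions \<open>D\<close> and \<open>C\<close>. A one-element set
  has a single matching, which meets itself.\<close>

theorem meets_nondegenerate:
  fixes c :: "(nat \<Rightarrow> nat) \<Rightarrow> 'k :: field_char_0"
  assumes "finite A" "0 \<notin> A"
    and "\<And>g. g \<in> one_defect A \<Longrightarrow> (\<Sum>f\<in>{f \<in> one_defect A. meets g f}. c f) = 0"
    and "f \<in> one_defect A"
  shows "c f = 0"
  using assms
proof (induction "card A" arbitrary: A c f rule: less_induct)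
  case less
  note fP = less.prems(4)
  have "f 0 \<in> A" using one_defectD(3)[OF fP] .
  show ?case
  proof (cases "card A \<ge> 2")
    case False
    then have "A = {f 0}" using \<open>f 0 \<in> A\<close> less.prems(1)
      by (metis One_nat_def card_le_Suc0_iff_eq not_less_eq_eq numeral_2_eq_2 singleton_iff subsetI subset_antisym empty_subsetI insert_subset)
    have "g = f" if "g \<in> one_defect A" for g
    proof
      fix x
      have g0: "g 0 = f 0" using one_defectD(3)[OF that] \<open>A = {f 0}\<close> by blast
      show "g x = f x"
      proof (cases "x = 0 \<or> x = f 0")
        case True
        then show ?thesis using g0 noncrossing_invol[OF one_defectD(1)[OF that], of 0] noncrossing_invol[OF one_defectD(1)[OF fP], of 0] by auto
      next
        case False
        then show ?thesis using noncrossing_outside[OF one_defectD(1)[OF that], of x] noncrossing_outside[OF one_defectD(1)[OF fP], of x] \<open>A = {f 0}\<close>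
          by (metis insert_iff singleton_iff)
      qed
    qed
    moreover have "meets f f" using one_defectD(2)[OF fP] unfolding meets_def by simp
    ultimately have "{g \<in> one_defect A. meets f g} = {f}" using fP by blast
    then show ?thesis using less.prems(3)[OF fP] by simp
  next
    case True
    have IH: "c' f = 0" if "B \<subset> A" "\<And>g. g \<in> one_defect B \<Longrightarrow> (\<Sum>f\<in>{f \<in> one_defect B. meets g f}. c' f) = (0::'k)" "f \<in> one_defect B" for B c' f
    proof (rule less.hyps[OF _ _ _ that(2,3)])
      show "card B < card A" "finite B" "0 \<notin> B"
        using that(1) less.prems(1,2) psubset_card_mono finite_subset by blast+
    qed
    interpret radical_vector A c
    proof
      show "finite A" "0 \<notin> A" by fact+
      show "(\<Sum>f\<in>{f \<in> one_defect A. dot i f = f'}. c f) = 0" if i: "i \<in> A" and f': "f' \<in> one_defect (A - {i})" for i f'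
      proof (rule contraction_relation[where A = A and c = c and T = "dot i" and f' = f' and B = "A - {i}" and h = "\<lambda>g. g"])
        have i0: "i \<noteq> 0" using i less.prems(2) by metis
        show "dot i f \<in> noncrossing (insert 0 (A - {i}))" if "f \<in> one_defect A" for f
          using dot_noncrossing[OF one_defectD(1)[OF that], of i] i0 by (simp add: insert_Diff_if)
        show "g \<in> one_defect A" if "g \<in> one_defect (A - {i})" for g
          using that noncrossing_mono[of "insert 0 (A - {i})" "insert 0 A"] unfolding one_defect_def by auto
        show "meets g f \<longleftrightarrow> meets g (dot i f)" if "f \<in> one_defect A" "g \<in> one_defect (A - {i})" for f g
        proof (rule meets_dot)
          show "f (f x) = x" "g (g x) = x" for x
            using noncrossing_invol[OF one_defectD(1)[OF that(1)]] noncrossing_invol[OF one_defectD(1)[OF that(2)]] by auto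
          show "g i = i" using noncrossing_outside[OF one_defectD(1)[OF that(2)], of i] i0 by auto
        qed (fact i0)
        show "\<forall>c'. (\<forall>g\<in>one_defect (A - {i}). (\<Sum>f\<in>{f \<in> one_defect (A - {i}). meets g f}. c' f) = (0 :: 'k)) \<longrightarrow> (\<forall>f\<in>one_defect (A - {i}). c' f = 0)"
          using IH[of "A - {i}"] i by blast
        show "finite A" "finite (A - {i})" using less.prems(1) by auto
        show "(\<Sum>f\<in>{f \<in> one_defect A. meets g f}. c f) = 0" if "g \<in> one_defect A" for g by (rule less.prems(3)[OF that])
      qed (fact f')
      show "(\<Sum>f\<in>{f \<in> one_defect A. cap a b f = f'}. c f) = 0"
        if ab: "a \<in> A" "b \<in> A" "a < b" "\<And>x. x \<in> A \<Longrightarrow> \<not> (a < x \<and> x < b)" and f': "f' \<in> one_defect (A - {a, b})" for a b f'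
      proof (rule contraction_relation[where A = A and c = c and T = "cap a b" and f' = f' and B = "A - {a, b}" and h = "\<lambda>g. g(a := b, b := a)"])
        have 0: "a \<noteq> 0" "b \<noteq> 0" using ab less.prems(2) by metis+
        have ins: "insert 0 (A - {a, b}) = insert 0 A - {a, b}" using 0 by auto
        show "cap a b f \<in> noncrossing (insert 0 (A - {a, b}))" if "f \<in> one_defect A" for f
          unfolding ins by (rule cap_noncrossing[OF one_defectD(1)[OF that]]) (use ab in auto)
        show "g(a := b, b := a) \<in> one_defect A" if g: "g \<in> one_defect (A - {a, b})" for g
        proof -
          have "g(a := b, b := a) \<in> noncrossing (insert 0 A)"
            by (rule noncrossing_insert_arc) (use one_defectD(1)[OF g] ins ab in auto)
          then show ?thesis using one_defectD(2)[OF g] 0 unfolding one_defect_def by auto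
        qed
        show "meets (g(a := b, b := a)) f \<longleftrightarrow> meets g (cap a b f)" if "f \<in> one_defect A" "g \<in> one_defect (A - {a, b})" for f g
        proof (rule meets_cap)
          show "f (f x) = x" "g (g x) = x" for x
            using noncrossing_invol[OF one_defectD(1)[OF that(1)]] noncrossing_invol[OF one_defectD(1)[OF that(2)]] by auto
          show "g a = a" "g b = b"
            using noncrossing_outside[OF one_defectD(1)[OF that(2)], of a] noncrossing_outside[OF one_defectD(1)[OF that(2)], of b] 0 by auto
        qed (use 0 ab(3) in auto)
        show "\<forall>c'. (\<forall>g\<in>one_defect (A - {a, b}). (\<Sum>f\<in>{f \<in> one_defect (A - {a, b}). meets g f}. c' f) = (0 :: 'k)) \<longrightarrow> (\<forall>f\<in>one_defect (A - {a, b}). c' f = 0)"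
          using IH[of "A - {a, b}"] ab(1) by blast
        show "finite A" "finite (A - {a, b})" using less.prems(1) by auto
        show "(\<Sum>f\<in>{f \<in> one_defect A. meets g f}. c f) = 0" if "g \<in> one_defect A" for g by (rule less.prems(3)[OF that])
      qed (fact f')
    qed
    show ?thesis using c_zero[OF True fP] .
  qed
qed

section \<open>Diagrams as involutions\<close>

definition conn :: "('s \<Rightarrow> 's) \<Rightarrow> ('s \<Rightarrow> 's) \<Rightarrow> 's rel" where
  "conn \<alpha> \<beta> = ({(s, \<alpha> s) | s. True} \<union> {(s, \<beta> s) | s. True})\<^sup>*"

text \<open>Applying the same involution twice goes back, so an orbit is exhausted by alternation;
  \<beta> comes first because the starting points of interest are fixed by \<alpha>.\<close>

fun walk :: "('s \<Rightarrow> 's) \<Rightarrow> ('s \<Rightarrow> 's) \<Rightarrow> 's \<Rightarrow> nat \<Rightarrow> 's" where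
  "walk \<alpha> \<beta> u 0 = u"
| "walk \<alpha> \<beta> u (Suc i) = (if even i then \<beta> else \<alpha>) (walk \<alpha> \<beta> u i)"

lemma conn_commute: "conn \<alpha> \<beta> = conn \<beta> \<alpha>"
  unfolding conn_def by (simp add: Un_commute)

lemma conn_refl: "(u, u) \<in> conn \<alpha> \<beta>"
  unfolding conn_def by simp

lemma conn_trans: "(u, v) \<in> conn \<alpha> \<beta> \<Longrightarrow> (v, w) \<in> conn \<alpha> \<beta> \<Longrightarrow> (u, w) \<in> conn \<alpha> \<beta>"
  unfolding conn_def by (rule rtrancl_trans)

lemma conn_step: "(u, \<alpha> u) \<in> conn \<alpha> \<beta>" "(u, \<beta> u) \<in> conn \<alpha> \<beta>"
  unfolding conn_def by auto

lemma conn_sym: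
  assumes "\<And>s. \<alpha> (\<alpha> s) = s" "\<And>s. \<beta> (\<beta> s) = s" "(u, v) \<in> conn \<alpha> \<beta>"
  shows "(v, u) \<in> conn \<alpha> \<beta>"
  using assms(3) unfolding conn_def
proof (induction rule: rtrancl_induct)
  case (step y z)
  then have "z = \<alpha> y \<or> z = \<beta> y" by auto
  then have "y = \<alpha> z \<or> y = \<beta> z" using assms by metis
  then have "(z, y) \<in> {(s, \<alpha> s) |s. True} \<union> {(s, \<beta> s) |s. True}" by auto
  then show ?case using step(3) by (rule converse_rtrancl_into_rtrancl)
qed simp

lemma conn_invariant:
  assumes "(u, v) \<in> conn \<alpha> \<beta>" "Q u" "\<And>s. Q s \<Longrightarrow> Q (\<alpha> s)" "\<And>s. Q s \<Longrightarrow> Q (\<beta> s)"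
  shows "Q v"
  using assms(1,2) unfolding conn_def
  by (induction rule: rtrancl_induct) (use assms(3,4) in auto)

context
  fixes \<alpha> \<beta> :: "'s \<Rightarrow> 's" and u :: 's
  assumes inv: "\<And>s. \<alpha> (\<alpha> s) = s" "\<And>s. \<beta> (\<beta> s) = s" and u: "\<alpha> u = u"
begin

lemma walk_step:
  "\<exists>j. \<alpha> (walk \<alpha> \<beta> u i) = walk \<alpha> \<beta> u j" "\<exists>j. \<beta> (walk \<alpha> \<beta> u i) = walk \<alpha> \<beta> u j"
proof -
  have *: "\<alpha> (walk \<alpha> \<beta> u i) = (if even i then (if i = 0 then u else walk \<alpha> \<beta> u (i - 1)) else walk \<alpha> \<beta> u (Suc i))"
    "\<beta> (walk \<alpha> \<beta> u i) = (if even i then walk \<alpha> \<beta> u (Suc i) else walk \<alpha> \<beta> u (i - 1))"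
    by (cases i; simp add: inv u)+
  show "\<exists>j. \<alpha> (walk \<alpha> \<beta> u i) = walk \<alpha> \<beta> u j"
    unfolding *(1) by (metis walk.simps(1))
  show "\<exists>j. \<beta> (walk \<alpha> \<beta> u i) = walk \<alpha> \<beta> u j"
    unfolding *(2) by metis
qed

lemma walk_reaches:
  assumes "(u, w) \<in> conn \<alpha> \<beta>" shows "\<exists>i. w = walk \<alpha> \<beta> u i"
  using assms
proof (rule conn_invariant)
  show "\<exists>i. u = walk \<alpha> \<beta> u i" by (rule exI[of _ 0]) simp
qed (use walk_step in metis)+

text \<open>The alternating walk runs along a path until the first step \<open>j\<close> that does
  not move. Earlier sites other than the start are moved by both involutions, since a fixed one
  would have stopped the walk there; so the only ends are the start and the site at
  \<open>j\<close>.\<close>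

lemma walk_two_ends:
  assumes v: "(u, v) \<in> conn \<alpha> \<beta>" "u \<noteq> v" "\<alpha> v = v \<or> \<beta> v = v"
  shows "\<beta> u \<noteq> u" "(u, w) \<in> conn \<alpha> \<beta> \<Longrightarrow> \<alpha> w = w \<or> \<beta> w = w \<Longrightarrow> w = u \<or> w = v"
proof -
  let ?s = "walk \<alpha> \<beta> u"
  define stat where "stat j \<longleftrightarrow> ?s (Suc j) = ?s j" for j
  have near: "i = 0 \<and> \<alpha> (?s i) = u \<or> (if even i then \<beta> else \<alpha>) (?s i) = ?s (Suc i) \<and>
     (i \<noteq> 0 \<longrightarrow> (if even i then \<alpha> else \<beta>) (?s i) = ?s (i - 1))" for i
    by (cases i) (auto simp: inv u)
  have fixed: "stat i \<or> (i \<noteq> 0 \<and> stat (i - 1)) \<or> ?s i = u" if "\<alpha> (?s i) = ?s i \<or> \<beta> (?s i) = ?s i" for i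
    using near[of i] that unfolding stat_def by (cases i) (auto split: if_splits)
  obtain i where i: "v = ?s i" using walk_reaches[OF v(1)] by blast
  then have "\<exists>j. stat j" using fixed[of i] v by auto
  define j where "j = (LEAST j. stat j)"
  have j: "stat j" unfolding j_def by (rule LeastI_ex) fact
  have jmin: "\<not> stat i" if "i < j" for i using not_less_Least that unfolding j_def by blast
  have early: "\<exists>i\<le>j. w = ?s i" if "(u, w) \<in> conn \<alpha> \<beta>" for w
    using that
  proof (rule conn_invariant)
    show "\<exists>i\<le>j. u = ?s i" by (rule exI[of _ 0]) simp
    fix w assume "\<exists>i\<le>j. w = ?s i"
    then obtain i where i: "i \<le> j" "w = ?s i" by blast
    have nxt: "\<exists>k\<le>j. (if even i then \<beta> else \<alpha>) w = ?s k"
    proof (cases "i = j")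
      case True
      then show ?thesis using j i unfolding stat_def by auto
    next
      case False
      then show ?thesis using i by (intro exI[of _ "Suc i"]) auto
    qed
    have prv: "\<exists>k\<le>j. (if even i then \<alpha> else \<beta>) w = ?s k"
    proof (cases i)
      case 0
      then show ?thesis using i u by (intro exI[of _ 0]) auto
    next
      case (Suc k)
      then show ?thesis using i inv by (intro exI[of _ k]) auto
    qed
    show "\<exists>i\<le>j. \<alpha> w = ?s i" "\<exists>i\<le>j. \<beta> w = ?s i" using nxt prv by (auto split: if_splits)
  qed
  have ends: "w = u \<or> w = ?s j" if w: "(u, w) \<in> conn \<alpha> \<beta>" "\<alpha> w = w \<or> \<beta> w = w" for w
  proof -
    obtain i where i: "i \<le> j" "w = ?s i" using early[OF w(1)] by blast
    then have "stat i \<or> (i \<noteq> 0 \<and> stat (i - 1)) \<or> w = u" using fixed[of i] w by auto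
    moreover have "\<not> (i \<noteq> 0 \<and> stat (i - 1))"
    proof (cases i)
      case (Suc k)
      then show ?thesis using jmin[of k] i(1) by simp
    qed simp
    moreover have "i = j" if "stat i" using that jmin[of i] i by (metis le_neq_implies_less)
    ultimately show ?thesis using i by auto
  qed
  show "w = u \<or> w = v" if "(u, w) \<in> conn \<alpha> \<beta>" "\<alpha> w = w \<or> \<beta> w = w"
    using ends[OF that] ends[OF v(1,3)] v(2) by auto
  show "\<beta> u \<noteq> u"
  proof
    assume "\<beta> u = u"
    then have "stat 0" unfolding stat_def by simp
    then have "j = 0" using jmin[of 0] by auto
    then show False using ends[OF v(1,3)] v(2) by auto
  qed
qed

end

lemma two_ends:
  assumes inv: "\<And>s. \<alpha> (\<alpha> s) = s" "\<And>s. \<beta> (\<beta> s) = s"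
    and uv: "(u, v) \<in> conn \<alpha> \<beta>" "u \<noteq> v" "\<alpha> u = u \<or> \<beta> u = u" "\<alpha> v = v \<or> \<beta> v = v"
  shows "\<not> (\<alpha> u = u \<and> \<beta> u = u)"
    "(u, w) \<in> conn \<alpha> \<beta> \<Longrightarrow> \<alpha> w = w \<or> \<beta> w = w \<Longrightarrow> w = u \<or> w = v"
proof -
  show "\<not> (\<alpha> u = u \<and> \<beta> u = u)" using walk_two_ends(1)[of \<alpha> \<beta> u v] inv uv by blast
  show "(u, w) \<in> conn \<alpha> \<beta> \<Longrightarrow> \<alpha> w = w \<or> \<beta> w = w \<Longrightarrow> w = u \<or> w = v"
    using uv(3)
  proof
    assume "(u, w) \<in> conn \<alpha> \<beta>" "\<alpha> w = w \<or> \<beta> w = w" "\<alpha> u = u"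
    then show ?thesis using walk_two_ends(2)[of \<alpha> \<beta> u v w] inv uv by blast
  next
    assume "(u, w) \<in> conn \<alpha> \<beta>" "\<alpha> w = w \<or> \<beta> w = w" "\<beta> u = u"
    then show ?thesis using walk_two_ends(2)[of \<beta> \<alpha> u v w] inv uv conn_commute[of \<alpha> \<beta>] by auto
  qed
qed

section \<open>Planar involutions and Motzkin diagrams\<close>

lemma finite_points: "finite (points n)"
  unfolding points_def by simp

lemma points_iff [simp]: "Top i \<in> points n \<longleftrightarrow> 1 \<le> i \<and> i \<le> 2 * n" "Bot i \<in> points n \<longleftrightarrow> 1 \<le> i \<and> i \<le> 2 * n"
  unfolding points_def by auto

lemma boundary_pos_eq_iff:
  "p \<in> points n \<Longrightarrow> q \<in> points n \<Longrightarrow> boundary_pos n p = boundary_pos n q \<longleftrightarrow> p = q"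
  by (cases p; cases q) auto

text \<open>The involution exchanges the two points of every block of size 2 and fixes the dots.\<close>

definition planar_involutions :: "nat \<Rightarrow> (point \<Rightarrow> point) set" where
  "planar_involutions n = {\<phi>. (\<forall>p. \<phi> (\<phi> p) = p) \<and> (\<forall>p. p \<notin> points n \<longrightarrow> \<phi> p = p) \<and>
     (\<forall>p\<in>points n. \<forall>q\<in>points n. q \<noteq> p \<longrightarrow> q \<noteq> \<phi> p \<longrightarrow>
        ((boundary_pos n q < boundary_pos n p) \<noteq> (boundary_pos n q < boundary_pos n (\<phi> p))) =
        ((boundary_pos n (\<phi> q) < boundary_pos n p) \<noteq> (boundary_pos n (\<phi> q) < boundary_pos n (\<phi> p))))}"

definition diagram_of :: "nat \<Rightarrow> (point \<Rightarrow> point) \<Rightarrow> diagram" where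
  "diagram_of n \<phi> = (\<lambda>p. {p, \<phi> p}) ` points n"

lemma PI_D:
  assumes "\<phi> \<in> planar_involutions n"
  shows "\<phi> (\<phi> p) = p" "p \<notin> points n \<Longrightarrow> \<phi> p = p" "\<phi> p \<in> points n \<longleftrightarrow> p \<in> points n"
    "p \<in> points n \<Longrightarrow> q \<in> points n \<Longrightarrow> q \<noteq> p \<Longrightarrow> q \<noteq> \<phi> p \<Longrightarrow>
        ((boundary_pos n q < boundary_pos n p) \<noteq> (boundary_pos n q < boundary_pos n (\<phi> p))) =
        ((boundary_pos n (\<phi> q) < boundary_pos n p) \<noteq> (boundary_pos n (\<phi> q) < boundary_pos n (\<phi> p)))"
proof -
  show 1: "\<phi> (\<phi> p) = p" and 2: "p \<notin> points n \<Longrightarrow> \<phi> p = p" for p using assms unfolding planar_involutions_def by blast+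
  show "\<phi> p \<in> points n \<longleftrightarrow> p \<in> points n" using 1 2 by metis
qed (use assms in \<open>unfold planar_involutions_def, blast\<close>)

lemma dg_block: "\<phi> \<in> planar_involutions n \<Longrightarrow> B \<in> diagram_of n \<phi> \<Longrightarrow> p \<in> B \<Longrightarrow> B = {p, \<phi> p} \<and> p \<in> points n"
  unfolding diagram_of_def using PI_D(1,3)[of \<phi> n] by auto

lemma dg_memI: "p \<in> points n \<Longrightarrow> {p, \<phi> p} \<in> diagram_of n \<phi>"
  unfolding diagram_of_def by blast

lemma dg_motzkin:
  assumes \<phi>: "\<phi> \<in> planar_involutions n" shows "diagram_of n \<phi> \<in> motzkin_diagrams n"
proof -
  note D = PI_D[OF \<phi>]
  have "partition_on (points n) (diagram_of n \<phi>)"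
  proof (rule partition_onI)
    show "\<Union> (diagram_of n \<phi>) = points n" unfolding diagram_of_def using D(3) by auto
    show "disjnt B C" if "B \<in> diagram_of n \<phi>" "C \<in> diagram_of n \<phi>" "B \<noteq> C" for B C
    proof (rule ccontr)
      assume "\<not> disjnt B C"
      then obtain x where "x \<in> B" "x \<in> C" unfolding disjnt_def by blast
      then have "B = {x, \<phi> x}" "C = {x, \<phi> x}" using that(1,2) dg_block[OF \<phi>] by metis+
      then show False using that(3) by simp
    qed
    show "{} \<notin> diagram_of n \<phi>" unfolding diagram_of_def by blast
  qed
  moreover have "card {p, \<phi> p} = 1 \<or> card {p, \<phi> p} = 2" for p by (simp add: card_insert_if)
  then have "\<forall>B\<in>diagram_of n \<phi>. card B = 1 \<or> card B = 2" unfolding diagram_of_def by blast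
  moreover have "planar n (diagram_of n \<phi>)"
    unfolding planar_def
  proof (rule notI, elim bexE conjE)
    fix B C a b c d
    assume *: "B \<in> diagram_of n \<phi>" "C \<in> diagram_of n \<phi>" "B \<noteq> C" "a \<in> B" "b \<in> C" "c \<in> B" "d \<in> C"
      "boundary_pos n a < boundary_pos n b" "boundary_pos n b < boundary_pos n c" "boundary_pos n c < boundary_pos n d"
    note a = dg_block[OF \<phi> *(1,4)] and b = dg_block[OF \<phi> *(2,5)]
    have "c \<noteq> a" "d \<noteq> b" using *(8-10) by (metis less_asym less_trans)+
    then have c: "c = \<phi> a" "d = \<phi> b" using a b *(6,7) by blast+
    have "b \<noteq> a" "b \<noteq> \<phi> a" using *(8,9) c(1) by (metis less_irrefl)+
    then show False using D(4)[of a b] a b *(8-10) unfolding c by linarith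
  qed
  ultimately show ?thesis unfolding motzkin_diagrams_def by blast
qed

lemma motzkin_block_eq:
  assumes "P \<in> motzkin_diagrams n" "B \<in> P" "C \<in> P" "p \<in> B" "p \<in> C"
  shows "B = C"
  using assms unfolding motzkin_diagrams_def partition_on_def disjoint_def by blast

text \<open>The eight forbidden orders are all the ways in which the pairs \<open>a\<close>,
  \<open>a'\<close> and \<open>x\<close>, \<open>y\<close> can interleave.\<close>

lemma crossing_order:
  fixes a a' x y :: nat
  assumes "x \<noteq> a" "x \<noteq> a'" "y \<noteq> a" "y \<noteq> a'"
    and "\<not> (a < x \<and> x < a' \<and> a' < y)" "\<not> (a' < x \<and> x < a \<and> a < y)"
    and "\<not> (a < y \<and> y < a' \<and> a' < x)" "\<not> (a' < y \<and> y < a \<and> a < x)"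
    and "\<not> (x < a \<and> a < y \<and> y < a')" "\<not> (x < a' \<and> a' < y \<and> y < a)"
    and "\<not> (y < a \<and> a < x \<and> x < a')" "\<not> (y < a' \<and> a' < x \<and> x < a)"
  shows "((x < a) \<noteq> (x < a')) = ((y < a) \<noteq> (y < a'))"
  using assms by (smt (verit) linorder_neqE_nat)

lemma motzkin_dg:
  assumes P: "P \<in> motzkin_diagrams n"
  obtains \<phi> where "\<phi> \<in> planar_involutions n" "P = diagram_of n \<phi>"
proof -
  have part: "partition_on (points n) P" and cd: "\<And>B. B \<in> P \<Longrightarrow> card B = 1 \<or> card B = 2" and pl: "planar n P"
    using P unfolding motzkin_diagrams_def by blast+
  have ex: "\<exists>q. {p, q} \<in> P" if "p \<in> points n" for p
  proof -
    have "p \<in> \<Union> P" using that unfolding partition_onD1[OF part] .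
    then obtain B where B: "B \<in> P" "p \<in> B" by (rule UnionE)
    show ?thesis
    proof (cases "card B = 1")
      case True
      then have "B = {p, p}" using B(2) by (auto simp: card_1_singleton_iff)
      then show ?thesis using B by blast
    next
      case False
      then have "card B = 2" using cd[OF B(1)] by simp
      then obtain x y where "B = {x, y}" by (meson card_2_iff)
      then have "B = {p, x} \<or> B = {p, y}" using B(2) by auto
      then show ?thesis using B(1) by blast
    qed
  qed
  define \<phi> where "\<phi> p = (if p \<in> points n then SOME q. {p, q} \<in> P else p)" for p
  have mem: "{p, \<phi> p} \<in> P" if "p \<in> points n" for p
    using someI_ex[OF ex[OF that]] that unfolding \<phi>_def by simp
  have pts: "\<phi> p \<in> points n" if "p \<in> points n" for p
    using mem[OF that] partition_onD1[OF part] by blast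
  have inv: "\<phi> (\<phi> p) = p" for p
  proof (cases "p \<in> points n")
    case True
    have "{\<phi> p, \<phi> (\<phi> p)} = {p, \<phi> p}"
      by (rule motzkin_block_eq[OF P mem[OF pts[OF True]] mem[OF True], of "\<phi> p"]) auto
    then show ?thesis by (metis doubleton_eq_iff)
  qed (simp add: \<phi>_def)
  let ?b = "boundary_pos n"
  have sep: False if "p \<in> points n" "q \<in> points n" "q \<noteq> p" "q \<noteq> \<phi> p"
    "?b p < ?b q" "?b q < ?b (\<phi> p)" "?b (\<phi> p) < ?b (\<phi> q)" for p q
  proof -
    have "{p, \<phi> p} \<noteq> {q, \<phi> q}" using that by (metis doubleton_eq_iff)
    then have "\<exists>B\<in>P. \<exists>C\<in>P. B \<noteq> C \<and> (\<exists>a\<in>B. \<exists>b\<in>C. \<exists>c\<in>B. \<exists>d\<in>C. ?b a < ?b b \<and> ?b b < ?b c \<and> ?b c < ?b d)"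
      by (intro bexI[OF _ mem[OF that(1)]] bexI[OF _ mem[OF that(2)]] conjI bexI[of _ p] bexI[of _ q]
          bexI[of _ "\<phi> p"] bexI[of _ "\<phi> q"]) (use that(5-7) in simp_all)
    then show False using pl unfolding planar_def by (rule notE[rotated])
  qed
  have sepi: "\<not> (?b p < ?b q \<and> ?b q < ?b (\<phi> p) \<and> ?b (\<phi> p) < ?b (\<phi> q))"
     if "p \<in> points n" "q \<in> points n" "q \<noteq> p" "q \<noteq> \<phi> p" for p q
    by (rule notI, elim conjE, rule sep[OF that])
  have "((?b q < ?b p) \<noteq> (?b q < ?b (\<phi> p))) = ((?b (\<phi> q) < ?b p) \<noteq> (?b (\<phi> q) < ?b (\<phi> p)))"
    if pq: "p \<in> points n" "q \<in> points n" "q \<noteq> p" "q \<noteq> \<phi> p" for p q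
  proof -
    have ne: "\<phi> q \<noteq> p" "\<phi> q \<noteq> \<phi> p" "\<phi> p \<noteq> q" using pq inv by metis+
    have dis: "?b q \<noteq> ?b p" "?b q \<noteq> ?b (\<phi> p)" "?b (\<phi> q) \<noteq> ?b p" "?b (\<phi> q) \<noteq> ?b (\<phi> p)"
      using pq ne pts boundary_pos_eq_iff by metis+
    have pts': "\<phi> p \<in> points n" "\<phi> q \<in> points n" using pts pq by blast+
    have ne': "p \<noteq> \<phi> q" "\<phi> p \<noteq> \<phi> q" "p \<noteq> q" using ne pq by metis+
    show ?thesis
      by (rule crossing_order[OF dis sepi[of p q] sepi[of "\<phi> p" q, unfolded inv] sepi[of p "\<phi> q", unfolded inv]
          sepi[of "\<phi> p" "\<phi> q", unfolded inv] sepi[of q p] sepi[of q "\<phi> p", unfolded inv]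
          sepi[of "\<phi> q" p, unfolded inv] sepi[of "\<phi> q" "\<phi> p", unfolded inv]])
        (use pq ne ne' pts' in simp_all)
  qed
  then have "\<phi> \<in> planar_involutions n" unfolding planar_involutions_def using inv by (auto simp: \<phi>_def)
  moreover have "P = diagram_of n \<phi>"
  proof (intro equalityI subsetI)
    fix B assume B: "B \<in> P"
    then have "B \<noteq> {}" using partition_onD3[OF part] by blast
    then obtain p where p: "p \<in> B" "p \<in> points n" using B partition_onD1[OF part] by blast
    have "B = {p, \<phi> p}" by (rule motzkin_block_eq[OF P B mem[OF p(2)] p(1)]) simp
    then show "B \<in> diagram_of n \<phi>" using dg_memI[OF p(2)] by simp
  qed (use mem in \<open>auto simp: diagram_of_def\<close>)
  ultimately show ?thesis using that by blast
qed

section \<open>Products of diagrams\<close>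

text \<open>Sites that a factor does not touch are fixed. So an outer site is always fixed by one of
  the two involutions and is an end of its orbit; the other end is a second outer site or a
  dot.\<close>

definition above_inv :: "(point \<Rightarrow> point) \<Rightarrow> site \<Rightarrow> site" where
  "above_inv \<phi> s = (case s of Upper i \<Rightarrow> site_above (\<phi> (Top i)) | Middle i \<Rightarrow> site_above (\<phi> (Bot i)) | Lower i \<Rightarrow> Lower i)"

definition below_inv :: "(point \<Rightarrow> point) \<Rightarrow> site \<Rightarrow> site" where
  "below_inv \<psi> s = (case s of Upper i \<Rightarrow> Upper i | Middle i \<Rightarrow> site_below (\<psi> (Top i)) | Lower i \<Rightarrow> site_below (\<psi> (Bot i)))"

lemma above_inv_simps [simp]: "above_inv \<phi> (site_above p) = site_above (\<phi> p)"
  "above_inv \<phi> (Upper i) = site_above (\<phi> (Top i))" "above_inv \<phi> (Middle i) = site_above (\<phi> (Bot i))"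
  "above_inv \<phi> (Lower i) = Lower i"
  by (cases p) (auto simp: above_inv_def)

lemma below_inv_simps [simp]: "below_inv \<psi> (site_below p) = site_below (\<psi> p)"
  "below_inv \<psi> (Upper i) = Upper i" "below_inv \<psi> (Middle i) = site_below (\<psi> (Top i))"
  "below_inv \<psi> (Lower i) = site_below (\<psi> (Bot i))"
  by (cases p) (auto simp: below_inv_def)

lemma site_eq_iff [simp]: "site_above p = site_above q \<longleftrightarrow> p = q" "site_below p = site_below q \<longleftrightarrow> p = q"
  "site_outer p = site_outer q \<longleftrightarrow> p = q"
  by (cases p; cases q; simp)+

lemma site_cases:
  obtains p where "s = site_above p" | i where "s = Lower i"
  by (cases s) (metis site_above.simps)+

lemma site_cases':
  obtains p where "s = site_below p" | i where "s = Upper i"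
  by (cases s) (metis site_below.simps)+

lemma stack_links_conn:
  assumes \<phi>: "\<phi> \<in> planar_involutions n" and \<psi>: "\<psi> \<in> planar_involutions n"
  shows "(stack_links (diagram_of n \<phi>) (diagram_of n \<psi>))\<^sup>* = conn (above_inv \<phi>) (below_inv \<psi>)"
proof -
  let ?R = "stack_links (diagram_of n \<phi>) (diagram_of n \<psi>)" and ?C = "conn (above_inv \<phi>) (below_inv \<psi>)"
  let ?L = "{(s, above_inv \<phi> s) |s. True} \<union> {(s, below_inv \<psi> s) |s. True}"
  have "?R \<subseteq> ?C"
  proof (rule subrelI)
    fix s t assume "(s, t) \<in> ?R"
    then consider p q B where "s = site_above p" "t = site_above q" "B \<in> diagram_of n \<phi>" "p \<in> B" "q \<in> B"
      | p q B where "s = site_below p" "t = site_below q" "B \<in> diagram_of n \<psi>" "p \<in> B" "q \<in> B"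
      unfolding stack_links_def by blast
    then show "(s, t) \<in> ?C"
    proof cases
      case 1
      then have "q = p \<or> q = \<phi> p" using dg_block[OF \<phi> 1(3,4)] by blast
      then show ?thesis
        using 1(1,2) conn_refl[of s] conn_step(1)[of "site_above p" "above_inv \<phi>" "below_inv \<psi>", unfolded above_inv_simps]
        by blast
    next
      case 2
      then have "q = p \<or> q = \<psi> p" using dg_block[OF \<psi> 2(3,4)] by blast
      then show ?thesis
        using 2(1,2) conn_refl[of s] conn_step(2)[of "site_below p" "below_inv \<psi>" "above_inv \<phi>", unfolded below_inv_simps]
        by blast
    qed
  qed
  moreover have "?L \<subseteq> ?R\<^sup>*"
  proof (rule subrelI)
    fix s t assume "(s, t) \<in> ?L"
    then have "t = above_inv \<phi> s \<or> t = below_inv \<psi> s" by blast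
    then show "(s, t) \<in> ?R\<^sup>*"
    proof
      assume t: "t = above_inv \<phi> s"
      show ?thesis
      proof (cases s rule: site_cases)
        case (1 p)
        show ?thesis
        proof (cases "p \<in> points n")
          case True
          have "(s, t) \<in> ?R" unfolding stack_links_def t 1 above_inv_simps
            by (intro UnI1 CollectI exI[of _ p] exI[of _ "\<phi> p"] conjI refl bexI[OF _ dg_memI[OF True]]) simp_all
          then show ?thesis by blast
        qed (use t 1 PI_D(2)[OF \<phi>, of p] in simp)
      qed (use t in simp)
    next
      assume t: "t = below_inv \<psi> s"
      show ?thesis
      proof (cases s rule: site_cases')
        case (1 p)
        show ?thesis
        proof (cases "p \<in> points n")
          case True
          have "(s, t) \<in> ?R" unfolding stack_links_def t 1 below_inv_simps
            by (intro UnI2 CollectI exI[of _ p] exI[of _ "\<psi> p"] conjI refl bexI[OF _ dg_memI[OF True]]) simp_all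
          then show ?thesis by blast
        qed (use t 1 PI_D(2)[OF \<psi>, of p] in simp)
      qed (use t in simp)
    qed
  qed
  ultimately show ?thesis
    unfolding conn_def by (meson rtrancl_subset_rtrancl subset_antisym)
qed

text \<open>The points of \<open>E\<close> between \<open>q\<close> and \<open>\<phi> q\<close> are
  paired among themselves, because no arc crosses the arc of \<open>q\<close>, and the two counts
  differ in just these points.\<close>

lemma even_card_between:
  assumes \<phi>: "\<phi> \<in> planar_involutions n" and E: "E \<subseteq> points n" "\<And>r. r \<in> E \<Longrightarrow> \<phi> r \<in> E \<and> \<phi> r \<noteq> r"
    and q: "q \<in> points n" "q \<notin> E"
  shows "even (card {r \<in> E. boundary_pos n r < boundary_pos n q} + card {r \<in> E. boundary_pos n r < boundary_pos n (\<phi> q)})"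
proof -
  let ?b = "boundary_pos n"
  let ?A = "{r \<in> E. ?b r < ?b q}" and ?B = "{r \<in> E. ?b r < ?b (\<phi> q)}"
  let ?S = "{r \<in> E. (?b r < ?b q) \<noteq> (?b r < ?b (\<phi> q))}"
  have fin: "finite E" using E(1) finite_points finite_subset by blast
  have ev: "even (card ?S)"
  proof (rule even_card_fixpoint_free_involution[where f = \<phi>])
    show "finite ?S" using fin by simp
    show "\<phi> r \<in> ?S" if "r \<in> ?S" for r
    proof -
      have r: "r \<in> E" "r \<in> points n" using that E(1) by auto
      have "r \<noteq> q" "r \<noteq> \<phi> q" using q r E(2)[of r] PI_D(1)[OF \<phi>, of q] E(2)[of "\<phi> q"] by auto
      from PI_D(4)[OF \<phi> q(1) r(2) this] show ?thesis using that E(2)[OF r(1)] by blast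
    qed
    show "\<phi> (\<phi> r) = r" for r by (rule PI_D(1)[OF \<phi>])
    show "\<phi> r \<noteq> r" if "r \<in> ?S" for r using that E(2) by blast
  qed
  have "card ?S = card (?A - ?B) + card (?B - ?A)"
  proof -
    have "?S = (?A - ?B) \<union> (?B - ?A)" by blast
    moreover have "card ((?A - ?B) \<union> (?B - ?A)) = card (?A - ?B) + card (?B - ?A)"
      by (rule card_Un_disjoint) (use fin in auto)
    ultimately show ?thesis by (simp only:)
  qed
  moreover have "card ?A = card (?A \<inter> ?B) + card (?A - ?B)" "card ?B = card (?B \<inter> ?A) + card (?B - ?A)"
    by (rule card_Int_Diff; use fin in simp)+
  ultimately have "card ?A + card ?B = 2 * card (?A \<inter> ?B) + card ?S" by (simp add: Int_commute)
  then show ?thesis using ev by simp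
qed

section \<open>Strings in a stack of two diagrams\<close>

locale stacked =
  fixes n :: nat and \<phi> \<psi> :: "point \<Rightarrow> point"
  assumes \<phi>: "\<phi> \<in> planar_involutions n" and \<psi>: "\<psi> \<in> planar_involutions n"
begin

abbreviation "al \<equiv> above_inv \<phi>"
abbreviation "be \<equiv> below_inv \<psi>"
abbreviation "C \<equiv> conn al be"
abbreviation "ou \<equiv> site_outer"

lemma inv: "al (al s) = s" "be (be s) = s"
  by (cases s rule: site_cases; simp add: PI_D(1)[OF \<phi>]) (cases s rule: site_cases'; simp add: PI_D(1)[OF \<psi>])

lemma C_sym: "(u, v) \<in> C \<Longrightarrow> (v, u) \<in> C"
  by (rule conn_sym[OF inv])

lemma ou_end: "al (ou p) = ou p \<or> be (ou p) = ou p"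
  by (cases p) auto

lemma site_in_range:
  assumes "(ou p, s) \<in> C" "p \<in> points n"
  shows "case s of Upper i \<Rightarrow> Top i \<in> points n | Middle i \<Rightarrow> Top i \<in> points n | Lower i \<Rightarrow> Bot i \<in> points n"
    (is "?Q s")
proof (rule conn_invariant[OF assms(1), of ?Q])
  show "?Q (ou p)" using assms(2) by (cases p) auto
  have above: "?Q (site_above r) \<longleftrightarrow> r \<in> points n" and below: "?Q (site_below r) \<longleftrightarrow> r \<in> points n" for r
    by (cases r; simp)+
  show "?Q (al s)" if "?Q s" for s
    using that above PI_D(3)[OF \<phi>] by (cases s rule: site_cases) simp_all
  show "?Q (be s)" if "?Q s" for s
    using that below PI_D(3)[OF \<psi>] by (cases s rule: site_cases') simp_all
qed

lemma two_outer:
  assumes "(ou p, ou q) \<in> C" "p \<noteq> q"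
  shows "\<not> (al (ou p) = ou p \<and> be (ou p) = ou p)"
    "(ou p, s) \<in> C \<Longrightarrow> al s = s \<or> be s = s \<Longrightarrow> s = ou p \<or> s = ou q"
  using two_ends[OF inv assms(1) _ ou_end ou_end] assms(2) by auto

text \<open>A string has at most two outer ends, so the choice is unique; a point whose string has
  no second outer end becomes a dot of the product.\<close>

definition mu :: "point \<Rightarrow> point" where
  "mu p = (if \<exists>q. q \<noteq> p \<and> (ou p, ou q) \<in> C then (SOME q. q \<noteq> p \<and> (ou p, ou q) \<in> C) else p)"

lemma mu_conn: "(ou p, ou (mu p)) \<in> C"
proof (cases "\<exists>q. q \<noteq> p \<and> (ou p, ou q) \<in> C")
  case True
  then show ?thesis unfolding mu_def using someI_ex[OF True] by simp
next
  case False
  then have "mu p = p" unfolding mu_def by (simp only: if_False)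
  then show ?thesis by (simp only: conn_refl)
qed

lemma mu_unique:
  assumes "(ou p, ou q) \<in> C" "q \<noteq> p" shows "mu p = q"
proof -
  have ex: "\<exists>q. q \<noteq> p \<and> (ou p, ou q) \<in> C" using assms by blast
  then have m: "mu p \<noteq> p" "(ou p, ou (mu p)) \<in> C" unfolding mu_def using someI_ex[OF ex] by auto
  then show ?thesis using two_outer(2)[OF assms(1), of "ou (mu p)"] assms(2) ou_end by auto
qed

lemma C_outer_iff: "(ou p, ou q) \<in> C \<longleftrightarrow> q = p \<or> q = mu p"
  using mu_unique mu_conn conn_refl by metis

lemma mu_mu: "mu (mu p) = p"
proof (cases "mu p = p")
  case False
  then show ?thesis using mu_unique[of "mu p" p] C_sym[OF mu_conn] by auto
qed simp

text \<open>A dot in the middle row is an end of its string, and together with \<open>p\<close> it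
  uses up the two ends.\<close>

lemma mu_dead: "(ou p, Middle m) \<in> C \<Longrightarrow> al (Middle m) = Middle m \<or> be (Middle m) = Middle m \<Longrightarrow> mu p = p"
proof (rule ccontr)
  assume *: "(ou p, Middle m) \<in> C" "al (Middle m) = Middle m \<or> be (Middle m) = Middle m" "mu p \<noteq> p"
  then have "Middle m = ou p \<or> Middle m = ou (mu p)" using two_outer(2)[OF mu_conn] by metis
  then show False by (metis site.distinct site_outer.elims)
qed

lemma mu_points: "mu p \<in> points n \<longleftrightarrow> p \<in> points n"
proof -
  have *: "mu p \<in> points n" if "p \<in> points n" for p
    using site_in_range[OF mu_conn that] by (cases "mu p") auto
  show ?thesis using *[of p] *[of "mu p"] mu_mu by auto
qed

lemma mu_outside: "p \<notin> points n \<Longrightarrow> mu p = p"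
proof (rule ccontr)
  assume p: "p \<notin> points n" "mu p \<noteq> p"
  have "al (ou p) = ou p \<and> be (ou p) = ou p"
    using PI_D(2)[OF \<phi> p(1)] PI_D(2)[OF \<psi> p(1)] by (cases p) auto
  then show False using two_outer(1)[OF mu_conn p(2)[symmetric]] by blast
qed

text \<open>The invariant is a parity: along the string of \<open>q\<close>, count the points of the string of \<open>p\<close> that
  come before the current point.\<close>

lemma mu_noncrossing:
  assumes p: "p \<in> points n" "mu p \<noteq> p" and q: "q \<in> points n" "q \<noteq> p" "q \<noteq> mu p"
  shows "((boundary_pos n q < boundary_pos n p) \<noteq> (boundary_pos n q < boundary_pos n (mu p))) =
    ((boundary_pos n (mu q) < boundary_pos n p) \<noteq> (boundary_pos n (mu q) < boundary_pos n (mu p)))"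
proof -
  let ?b = "boundary_pos n"
  let ?p = "mu p"
  \<comment> \<open>The string of \<open>p\<close>; \<open>E\<close> and \<open>F\<close> below are
    its points as seen in the upper and in the lower diagram.\<close>
  define K where "K = {s. (ou p, s) \<in> C}"
  have K_step: "al s \<in> K \<longleftrightarrow> s \<in> K" "be s \<in> K \<longleftrightarrow> s \<in> K" for s
  proof -
    have st: "(s, al s) \<in> C" "(s, be s) \<in> C" by (rule conn_step)+
    have cl: "y \<in> K" if "x \<in> K" "(x, y) \<in> C" for x y
      using that unfolding K_def mem_Collect_eq by (rule conn_trans)
    show "al s \<in> K \<longleftrightarrow> s \<in> K" using cl[OF _ st(1)] cl[OF _ C_sym[OF st(1)]] by blast
    show "be s \<in> K \<longleftrightarrow> s \<in> K" using cl[OF _ st(2)] cl[OF _ C_sym[OF st(2)]] by blast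
  qed
  have K_ou: "ou r \<in> K \<longleftrightarrow> r = p \<or> r = ?p" for r
    unfolding K_def mem_Collect_eq by (rule C_outer_iff)
  have ends: "s = ou p \<or> s = ou ?p" if "s \<in> K" "al s = s \<or> be s = s" for s
  proof -
    have "(ou p, s) \<in> C" using that(1) unfolding K_def mem_Collect_eq .
    then show ?thesis using two_outer(2)[OF mu_conn p(2)[symmetric], of s] that(2) by blast
  qed
  have one: "\<not> (al (ou r) = ou r \<and> be (ou r) = ou r)" if "ou r \<in> K" for r
  proof -
    have "r = p \<or> r = ?p" using that K_ou by simp
    then show ?thesis
      using two_outer(1)[OF mu_conn p(2)[symmetric]] two_outer(1)[OF C_sym[OF mu_conn] p(2)] by blast
  qed
  define E where "E = {r \<in> points n. site_above r \<in> K}"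
  define F where "F = {r \<in> points n. site_below r \<in> K}"
  have E: "E \<subseteq> points n" "\<And>r. r \<in> E \<Longrightarrow> \<phi> r \<in> E \<and> \<phi> r \<noteq> r"
  proof -
    fix r assume r: "r \<in> E"
    then have rK: "site_above r \<in> K" "r \<in> points n" unfolding E_def by auto
    have "\<phi> r \<in> E" using K_step(1)[of "site_above r"] rK PI_D(3)[OF \<phi>] unfolding E_def by simp
    moreover have "\<phi> r \<noteq> r"
    proof
      assume "\<phi> r = r"
      then have fx: "al (site_above r) = site_above r" by simp
      then have "site_above r = ou p \<or> site_above r = ou ?p" using ends rK by blast
      then obtain x where x: "site_above r = ou x" by blast
      then have "be (ou x) = ou x" by (cases r; cases x) auto
      then show False using one[of x] fx rK(1) unfolding x by blast
    qed
    ultimately show "\<phi> r \<in> E \<and> \<phi> r \<noteq> r" ..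
  qed (auto simp: E_def)
  have F: "F \<subseteq> points n" "\<And>r. r \<in> F \<Longrightarrow> \<psi> r \<in> F \<and> \<psi> r \<noteq> r"
  proof -
    fix r assume r: "r \<in> F"
    then have rK: "site_below r \<in> K" "r \<in> points n" unfolding F_def by auto
    have "\<psi> r \<in> F" using K_step(2)[of "site_below r"] rK PI_D(3)[OF \<psi>] unfolding F_def by simp
    moreover have "\<psi> r \<noteq> r"
    proof
      assume "\<psi> r = r"
      then have fx: "be (site_below r) = site_below r" by simp
      then have "site_below r = ou p \<or> site_below r = ou ?p" using ends rK by blast
      then obtain x where x: "site_below r = ou x" by blast
      then have "al (ou x) = ou x" by (cases r; cases x) auto
      then show False using one[of x] fx rK(1) unfolding x by blast
    qed
    ultimately show "\<psi> r \<in> F \<and> \<psi> r \<noteq> r" ..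
  qed (auto simp: F_def)
  have finE: "finite E" "finite F" using E(1) F(1) finite_points finite_subset by blast+
  define ce where "ce r = card {x \<in> E. ?b x < ?b r}" for r
  define cf where "cf r = card {x \<in> F. ?b x < ?b r}" for r
  define u where "u = card {i. Top i \<in> E}"
  define m where "m = card {i. Top i \<in> F}"
  \<comment> \<open>The number of points of \<open>E\<close> or of \<open>F\<close> that precede a
    site on the boundary. The two rows glued in the middle have opposite boundary orders, so the two
    counts of a middle site add up to \<open>u + m\<close>, which is \<open>mid\<close>; with the
    summand \<open>u + m\<close> they agree modulo 2 across the middle row.\<close>
  define col where "col s = (case s of Upper i \<Rightarrow> ce (Top i) | Middle i \<Rightarrow> ce (Bot i) | Lower i \<Rightarrow> cf (Bot i) + u + m)" for s
  have col_above: "col (site_above r) = ce r" for r unfolding col_def by (cases r) auto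
  have EF: "Bot i \<in> E \<longleftrightarrow> Top i \<in> F" for i unfolding E_def F_def by simp
  have fin_top: "finite {i. Top i \<in> E}" "finite {i. Top i \<in> F}" "finite {i. Bot i \<in> F}"
    by (rule finite_subset[of _ "{..2 * n}"]; use E(1) F(1) in fastforce)+
  have mid: "ce (Bot i) + cf (Top i) = u + m" if i: "Top i \<in> points n" "Middle i \<notin> K" for i
  proof -
    have eqE: "{x \<in> E. ?b x < ?b (Bot i)} = Top ` {j. Top j \<in> E} \<union> Bot ` {j. Top j \<in> F \<and> i < j}"
    proof (rule Set.set_eqI)
      fix x show "x \<in> {x \<in> E. ?b x < ?b (Bot i)} \<longleftrightarrow> x \<in> Top ` {j. Top j \<in> E} \<union> Bot ` {j. Top j \<in> F \<and> i < j}"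
      proof (cases x)
        case (Top j)
        have "Top j \<in> E \<Longrightarrow> j < 4 * n + 1 - i" using E(1) i(1) by (auto dest!: subsetD)
        then show ?thesis using Top by auto
      next
        case (Bot j)
        have "Bot j \<in> E \<Longrightarrow> j \<le> 2 * n" using E(1) by (auto dest!: subsetD)
        then have "Bot j \<in> E \<Longrightarrow> (4 * n + 1 - j < 4 * n + 1 - i) = (i < j)" using i(1) by auto
        then show ?thesis using Bot EF by auto
      qed
    qed
    have "ce (Bot i) = card (Top ` {j. Top j \<in> E}) + card (Bot ` {j. Top j \<in> F \<and> i < j})"
      unfolding ce_def eqE by (rule card_Un_disjoint) (use fin_top in auto)
    also have "\<dots> = u + card {j. Top j \<in> F \<and> i < j}"
      unfolding u_def by (simp add: card_image inj_on_def)
    finally have 1: "ce (Bot i) = u + card {j. Top j \<in> F \<and> i < j}" .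
    have "{x \<in> F. ?b x < ?b (Top i)} = Top ` {j. Top j \<in> F \<and> j < i}"
    proof (rule Set.set_eqI)
      fix x show "x \<in> {x \<in> F. ?b x < ?b (Top i)} \<longleftrightarrow> x \<in> Top ` {j. Top j \<in> F \<and> j < i}"
      proof (cases x)
        case (Bot j)
        have "Bot j \<in> F \<Longrightarrow> j \<le> 2 * n" using F(1) by (auto dest!: subsetD)
        then show ?thesis using Bot i(1) by auto
      qed auto
    qed
    then have 2: "cf (Top i) = card {j. Top j \<in> F \<and> j < i}"
      unfolding cf_def by (simp add: card_image inj_on_def)
    have "Top i \<notin> F" using i(2) unfolding F_def by simp
    then have "{j. Top j \<in> F} = {j. Top j \<in> F \<and> i < j} \<union> {j. Top j \<in> F \<and> j < i}"
      by (auto, metis linorder_neqE_nat)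
    then have "m = card ({j. Top j \<in> F \<and> i < j} \<union> {j. Top j \<in> F \<and> j < i})"
      unfolding m_def by (rule arg_cong[of _ _ card])
    also have "\<dots> = card {j. Top j \<in> F \<and> i < j} + card {j. Top j \<in> F \<and> j < i}"
      by (rule card_Un_disjoint) (use fin_top(2) in auto)
    finally show ?thesis using 1 2 by simp
  qed
  define good where "good s \<longleftrightarrow> s \<notin> K \<and> even (col s + col (ou q)) \<and>
     (case s of Upper i \<Rightarrow> Top i \<in> points n | Middle i \<Rightarrow> Top i \<in> points n | Lower i \<Rightarrow> Bot i \<in> points n)" for s
  have range_above: "(case site_above r of Upper i \<Rightarrow> Top i \<in> points n | Middle i \<Rightarrow> Top i \<in> points n | Lower i \<Rightarrow> Bot i \<in> points n) \<longleftrightarrow> r \<in> points n" for r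
    by (cases r) auto
  have range_below: "(case site_below r of Upper i \<Rightarrow> Top i \<in> points n | Middle i \<Rightarrow> Top i \<in> points n | Lower i \<Rightarrow> Bot i \<in> points n) \<longleftrightarrow> r \<in> points n" for r
    by (cases r) auto
  have col_below: "even (col (site_below r) + cf r + u + m)" if "r \<in> points n" "site_below r \<notin> K" for r
  proof (cases r)
    case (Top i)
    then have "ce (Bot i) + cf (Top i) = u + m" using mid[of i] that by simp
    then have "col (site_below r) + cf r + u + m = 2 * (u + m)" unfolding Top col_def by simp
    then show ?thesis by (simp only: dvd_triv_left)
  next
    case (Bot i)
    then have "col (site_below r) + cf r + u + m = 2 * (cf r + u + m)" unfolding col_def by simp
    then show ?thesis by (simp only: dvd_triv_left)
  qed
  have "good (ou (mu q))"
  proof (rule conn_invariant[OF mu_conn[of q]])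
    show "good (ou q)" unfolding good_def using K_ou[of q] q by (cases q) auto
    show "good (al s)" if s: "good s" for s
    proof (cases s rule: site_cases)
      case (1 r)
      have r: "r \<in> points n" "r \<notin> E" using s range_above[of r] unfolding good_def 1 E_def by auto
      have "even (ce r + ce (\<phi> r))" unfolding ce_def by (rule even_card_between[OF \<phi> E r])
      moreover have "\<phi> r \<in> points n" using PI_D(3)[OF \<phi>] r(1) by simp
      moreover have "al s \<notin> K" using s K_step(1)[of s] unfolding good_def by blast
      moreover have "even (ce r + col (ou q))" using s unfolding good_def 1 col_above by blast
      moreover from this have "even (ce (\<phi> r) + col (ou q))"
        using \<open>even (ce r + ce (\<phi> r))\<close> by presburger
      ultimately show ?thesis
        using range_above[of "\<phi> r"] unfolding good_def 1 above_inv_simps col_above by blast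
    qed (use s in simp)
    show "good (be s)" if s: "good s" for s
    proof (cases s rule: site_cases')
      case (1 r)
      have r: "r \<in> points n" "r \<notin> F" using s range_below[of r] unfolding good_def 1 F_def by auto
      have e: "even (cf r + cf (\<psi> r))" unfolding cf_def by (rule even_card_between[OF \<psi> F r])
      have p: "\<psi> r \<in> points n" using PI_D(3)[OF \<psi>] r(1) by simp
      have nK: "be s \<notin> K" "s \<notin> K" using s K_step(2)[of s] unfolding good_def by blast+
      have "even (col (site_below r) + col (site_below (\<psi> r)))"
      proof -
        have "even (col (site_below r) + cf r + u + m)" using col_below[OF r(1)] nK(2) unfolding 1 by blast
        moreover have "even (col (site_below (\<psi> r)) + cf (\<psi> r) + u + m)"
          using col_below[OF p] nK(1) unfolding 1 below_inv_simps by blast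
        ultimately show ?thesis using e by presburger
      qed
      moreover have "even (col (site_below r) + col (ou q))" using s unfolding good_def 1 by blast
      ultimately have "even (col (site_below (\<psi> r)) + col (ou q))" by presburger
      then show ?thesis
        using nK(1) range_below[of "\<psi> r"] p unfolding good_def 1 below_inv_simps by blast
    qed (use s in simp)
  qed
  then have ev: "even (col (ou (mu q)) + col (ou q))" unfolding good_def by blast
  \<comment> \<open>On outer points the parity of \<open>col\<close> is that of the number of ends
    of the string of \<open>p\<close> that come before, which is what the noncrossing condition
    speaks about.\<close>
  define cnt where "cnt r = card {x \<in> {p, ?p}. ?b x < ?b r}" for r
  have pp: "?p \<in> points n" using mu_points p(1) by simp
  have cnt: "even (col (ou r) + cnt r)" if r: "r \<in> points n" for r
  proof (cases r)
    case (Top i)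
    have "{x \<in> E. ?b x < ?b (Top i)} = {x \<in> {p, ?p}. ?b x < ?b (Top i)}"
    proof (rule Set.set_eqI)
      fix x show "x \<in> {x \<in> E. ?b x < ?b (Top i)} \<longleftrightarrow> x \<in> {x \<in> {p, ?p}. ?b x < ?b (Top i)}"
      proof (cases x)
        case x: (Top j)
        have "Top j \<in> E \<longleftrightarrow> Top j = p \<or> Top j = ?p"
          using K_ou[of "Top j"] p(1) pp unfolding E_def mem_Collect_eq site_above.simps site_outer.simps by metis
        then show ?thesis unfolding x by blast
      next
        case x: (Bot j)
        have "\<not> ?b x < ?b (Top i)" if "x \<in> points n" using that r Top x by auto
        then show ?thesis using E(1) p(1) pp by blast
      qed
    qed
    then have "col (ou r) = cnt r" unfolding col_def ce_def cnt_def Top by simp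
    then show ?thesis by simp
  next
    case (Bot i)
    have 1: "{x \<in> F. ?b x < ?b (Bot i)} = Top ` {j. Top j \<in> F} \<union> {x \<in> {p, ?p}. (\<exists>j. x = Bot j) \<and> ?b x < ?b (Bot i)}" (is "?L = ?R")
    proof (rule Set.set_eqI)
      fix x show "x \<in> ?L \<longleftrightarrow> x \<in> ?R"
      proof (cases x)
        case x: (Top j)
        have "?b (Top j) < ?b (Bot i)" if "Top j \<in> points n" using that r Bot by auto
        then show ?thesis using F(1) unfolding x by blast
      next
        case x: (Bot j)
        have "Bot j \<in> F \<longleftrightarrow> Bot j = p \<or> Bot j = ?p"
          using K_ou[of "Bot j"] p(1) pp unfolding F_def mem_Collect_eq site_below.simps site_outer.simps by metis
        then show ?thesis unfolding x by blast
      qed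
    qed
    have 2: "{x \<in> {p, ?p}. ?b x < ?b (Bot i)} = Top ` {j. Top j \<in> E} \<union> {x \<in> {p, ?p}. (\<exists>j. x = Bot j) \<and> ?b x < ?b (Bot i)}" (is "?L' = ?R'")
    proof (rule Set.set_eqI)
      fix x show "x \<in> ?L' \<longleftrightarrow> x \<in> ?R'"
      proof (cases x)
        case x: (Top j)
        have "?b (Top j) < ?b (Bot i)" if "Top j \<in> points n" using that r Bot by auto
        moreover have "Top j \<in> E \<longleftrightarrow> Top j = p \<or> Top j = ?p"
          using K_ou[of "Top j"] p(1) pp unfolding E_def mem_Collect_eq site_above.simps site_outer.simps by metis
        ultimately show ?thesis using E(1) unfolding x by blast
      next
        case x: (Bot j)
        then show ?thesis by blast
      qed
    qed
    let ?Z = "{x \<in> {p, ?p}. (\<exists>j. x = Bot j) \<and> ?b x < ?b (Bot i)}"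
    have finZ: "finite ?Z" by simp
    have "cf (Bot i) = card (Top ` {j. Top j \<in> F}) + card ?Z"
      unfolding cf_def 1 by (rule card_Un_disjoint) (use fin_top finZ in auto)
    moreover have "cnt (Bot i) = card (Top ` {j. Top j \<in> E}) + card ?Z"
      unfolding cnt_def 2 by (rule card_Un_disjoint) (use fin_top finZ in auto)
    moreover have "card (Top ` {j. Top j \<in> F}) = m" "card (Top ` {j. Top j \<in> E}) = u"
      unfolding m_def u_def by (simp_all add: card_image inj_on_def)
    ultimately have "col (ou r) + cnt r = 2 * (m + u + card ?Z)" unfolding Bot col_def by simp
    then show ?thesis by (simp only: dvd_triv_left)
  qed
  have mq: "mu q \<in> points n" "mu q \<noteq> p" "mu q \<noteq> ?p"
    using mu_points[of q] mu_mu[of q] mu_mu[of p] q by auto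
  have parity: "even (cnt r) \<longleftrightarrow> \<not> ((?b r < ?b p) \<noteq> (?b r < ?b ?p))"
    if r: "r \<in> points n" "r \<noteq> p" "r \<noteq> ?p" for r
  proof -
    have d: "?b r \<noteq> ?b p" "?b r \<noteq> ?b ?p" using r p(1) pp boundary_pos_eq_iff by metis+
    have "{x \<in> {p, ?p}. ?b x < ?b r} = (if ?b p < ?b r then {p} else {}) \<union> (if ?b ?p < ?b r then {?p} else {})" by auto
    then have "cnt r = (if ?b p < ?b r then 1 else 0) + (if ?b ?p < ?b r then 1 else 0)"
      unfolding cnt_def using p(2) by (auto simp: card_insert_if)
    then show ?thesis using d by (auto split: if_splits)
  qed
  have "even (cnt q) \<longleftrightarrow> even (cnt (mu q))" using ev cnt[OF q(1)] cnt[OF mq(1)] by presburger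
  then show ?thesis using parity[OF q] parity[OF mq] by blast
qed

lemma mu_PI: "mu \<in> planar_involutions n"
  unfolding planar_involutions_def
proof (intro CollectI conjI allI impI ballI)
  show "mu (mu p) = p" for p by (rule mu_mu)
  show "p \<notin> points n \<Longrightarrow> mu p = p" for p by (rule mu_outside)
  fix p q assume "p \<in> points n" "q \<in> points n" "q \<noteq> p" "q \<noteq> mu p"
  then show "((boundary_pos n q < boundary_pos n p) \<noteq> (boundary_pos n q < boundary_pos n (mu p))) =
    ((boundary_pos n (mu q) < boundary_pos n p) \<noteq> (boundary_pos n (mu q) < boundary_pos n (mu p)))"
    by (cases "mu p = p") (simp, rule mu_noncrossing)
qed

lemma mult_dg: "diagram_mult n (diagram_of n \<phi>) (diagram_of n \<psi>) = diagram_of n mu"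
proof -
  have "{(p, q). p \<in> points n \<and> q \<in> points n \<and> (ou p, ou q) \<in> (stack_links (diagram_of n \<phi>) (diagram_of n \<psi>))\<^sup>*} `` {p} = {p, mu p}"
    if "p \<in> points n" for p
    unfolding stack_links_conn[OF \<phi> \<psi>] C_outer_iff using that mu_points by auto
  then show ?thesis unfolding diagram_mult_def quotient_def diagram_of_def by blast
qed

lemma mu_Top: assumes "\<phi> (Top i) = Top j" shows "mu (Top i) = Top j"
proof (cases "i = j")
  case True
  show ?thesis
  proof (rule ccontr)
    assume "mu (Top i) \<noteq> Top j"
    then have "Top i \<noteq> mu (Top i)" using True by auto
    then have "\<not> (al (ou (Top i)) = ou (Top i) \<and> be (ou (Top i)) = ou (Top i))"
      by (rule two_outer(1)[OF mu_conn])
    then show False using assms True by simp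
  qed
next
  case False
  have "(ou (Top i), ou (Top j)) \<in> C" using conn_step(1)[of "Upper i" al be] assms by simp
  then show ?thesis using mu_unique False by auto
qed

lemma mu_Bot: assumes "\<psi> (Bot i) = Bot j" shows "mu (Bot i) = Bot j"
proof (cases "i = j")
  case True
  show ?thesis
  proof (rule ccontr)
    assume "mu (Bot i) \<noteq> Bot j"
    then have "Bot i \<noteq> mu (Bot i)" using True by auto
    then have "\<not> (al (ou (Bot i)) = ou (Bot i) \<and> be (ou (Bot i)) = ou (Bot i))"
      by (rule two_outer(1)[OF mu_conn])
    then show False using assms True by simp
  qed
next
  case False
  have "(ou (Bot i), ou (Bot j)) \<in> C" using conn_step(2)[of "Lower i" be al] assms by simp
  then show ?thesis using mu_unique False by auto
qed

lemma mu_through: assumes "\<phi> (Top i) = Bot m" "\<psi> (Top m) = Bot j" shows "mu (Top i) = Bot j"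
proof -
  have "(Upper i, Middle m) \<in> C" using conn_step(1)[of "Upper i" al be] assms by simp
  moreover have "(Middle m, Lower j) \<in> C" using conn_step(2)[of "Middle m" be al] assms by simp
  ultimately have "(ou (Top i), ou (Bot j)) \<in> C" using conn_trans by fastforce
  then show ?thesis using mu_unique by auto
qed

lemma mu_Top_dead: assumes "\<phi> (Top i) = Bot m" "\<psi> (Top m) = Top m" shows "mu (Top i) = Top i"
  by (rule mu_dead[of _ m]) (use conn_step(1)[of "Upper i" al be] assms in simp_all)

lemma mu_Bot_dead: assumes "\<psi> (Bot i) = Top m" "\<phi> (Bot m) = Bot m" shows "mu (Bot i) = Bot i"
  by (rule mu_dead[of _ m]) (use conn_step(2)[of "Lower i" be al] assms in simp_all)

end

section \<open>Associativity by stacking on levels\<close>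

fun wide :: "nat \<Rightarrow> nat \<Rightarrow> point \<Rightarrow> nat \<times> nat" where
  "wide k l (Top i) = (k, i)"
| "wide k l (Bot i) = (l, i)"

fun levels :: "nat \<Rightarrow> nat \<Rightarrow> nat \<Rightarrow> site \<Rightarrow> nat \<times> nat" where
  "levels k l m (Upper i) = (k, i)"
| "levels k l m (Middle i) = (l, i)"
| "levels k l m (Lower i) = (m, i)"

text \<open>Rows are labelled by heights, so that the blocks of several stacked diagrams become
  relations on one set of points and can be united.\<close>

definition blk :: "nat \<Rightarrow> nat \<Rightarrow> diagram \<Rightarrow> (nat \<times> nat) rel" where
  "blk k l x = {(wide k l p, wide k l q) | p q. \<exists>B\<in>x. p \<in> B \<and> q \<in> B}"

lemma levels_site: "levels k l m (site_above p) = wide k l p" "levels k l m (site_below p) = wide l m p"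
  "levels k l m (site_outer p) = wide k m p"
  by (cases p; simp)+

lemma levels_inj: "k \<noteq> l \<Longrightarrow> l \<noteq> m \<Longrightarrow> k \<noteq> m \<Longrightarrow> levels k l m s = levels k l m t \<longleftrightarrow> s = t"
  by (cases s; cases t) auto

lemma stack_links_iff: "(s, t) \<in> stack_links a b \<longleftrightarrow>
  (\<exists>p q B. s = site_above p \<and> t = site_above q \<and> B \<in> a \<and> p \<in> B \<and> q \<in> B) \<or>
  (\<exists>p q B. s = site_below p \<and> t = site_below q \<and> B \<in> b \<and> p \<in> B \<and> q \<in> B)"
  unfolding stack_links_def by blast

lemma blk_iff: "(x, y) \<in> blk k l a \<longleftrightarrow> (\<exists>p q B. x = wide k l p \<and> y = wide k l q \<and> B \<in> a \<and> p \<in> B \<and> q \<in> B)"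
  unfolding blk_def by blast

lemma stack_links_levels:
  assumes "k \<noteq> l" "l \<noteq> m" "k \<noteq> m"
  shows "(s, t) \<in> (stack_links a b)\<^sup>* \<longleftrightarrow> (levels k l m s, levels k l m t) \<in> (blk k l a \<union> blk l m b)\<^sup>*"
proof
  let ?h = "levels k l m"
  have hstep: "(?h s, ?h t) \<in> blk k l a \<union> blk l m b" if "(s, t) \<in> stack_links a b" for s t
    using that unfolding stack_links_iff Un_iff blk_iff by (elim disjE exE conjE) (metis levels_site(1), metis levels_site(2))
  show "(?h s, ?h t) \<in> (blk k l a \<union> blk l m b)\<^sup>*" if "(s, t) \<in> (stack_links a b)\<^sup>*"
    using that
  proof (induction rule: rtrancl_induct)
    case (step y z)
    show ?case by (rule rtrancl.rtrancl_into_rtrancl[OF step(3)]) (rule hstep[OF step(2)])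
  qed simp
  have pull: "\<exists>t. y = ?h t \<and> (s, t) \<in> stack_links a b" if xy: "(?h s, y) \<in> blk k l a \<union> blk l m b" for s y
  proof -
    from xy consider p q B where "?h s = wide k l p" "y = wide k l q" "B \<in> a" "p \<in> B" "q \<in> B"
      | p q B where "?h s = wide l m p" "y = wide l m q" "B \<in> b" "p \<in> B" "q \<in> B"
      unfolding Un_iff blk_iff by blast
    then show ?thesis
    proof cases
      case 1
      then have "s = site_above p" using levels_inj[OF assms, of s "site_above p"] levels_site(1) by metis
      then show ?thesis using 1 levels_site(1) stack_links_iff by metis
    next
      case 2
      then have "s = site_below p" using levels_inj[OF assms, of s "site_below p"] levels_site(2) by metis
      then show ?thesis using 2 levels_site(2) stack_links_iff by metis
    qed
  qed
  have "\<exists>t. y = ?h t \<and> (s, t) \<in> (stack_links a b)\<^sup>*" if "(?h s, y) \<in> (blk k l a \<union> blk l m b)\<^sup>*" for y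
    using that
  proof (induction rule: rtrancl_induct)
    case (step y z)
    then obtain t where t: "y = ?h t" "(s, t) \<in> (stack_links a b)\<^sup>*" by blast
    obtain t' where t': "z = ?h t'" "(t, t') \<in> stack_links a b" using pull step(2) t(1) by blast
    have "(s, t') \<in> (stack_links a b)\<^sup>*" by (rule rtrancl.rtrancl_into_rtrancl[OF t(2) t'(2)])
    then show ?case using t'(1) by blast
  qed blast
  then show "(s, t) \<in> (stack_links a b)\<^sup>*" if "(?h s, ?h t) \<in> (blk k l a \<union> blk l m b)\<^sup>*"
    using that levels_inj[OF assms] by metis
qed

lemma stack_links_sym: "(s, t) \<in> (stack_links a b)\<^sup>* \<Longrightarrow> (t, s) \<in> (stack_links a b)\<^sup>*"
proof -
  have "sym (stack_links a b)" unfolding sym_def stack_links_iff by blast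
  then show "(s, t) \<in> (stack_links a b)\<^sup>* \<Longrightarrow> (t, s) \<in> (stack_links a b)\<^sup>*" by (metis symD sym_rtrancl)
qed

lemma diagram_mult_block_iff:
  "(\<exists>B\<in>diagram_mult n a b. p \<in> B \<and> q \<in> B) \<longleftrightarrow>
    p \<in> points n \<and> q \<in> points n \<and> (site_outer p, site_outer q) \<in> (stack_links a b)\<^sup>*" (is "?L \<longleftrightarrow> ?R")
proof
  assume ?L
  then obtain B where B: "B \<in> diagram_mult n a b" "p \<in> B" "q \<in> B" by blast
  from B(1) obtain x where "B = {(p, q). p \<in> points n \<and> q \<in> points n \<and>
      (site_outer p, site_outer q) \<in> (stack_links a b)\<^sup>*} `` {x}"
    unfolding diagram_mult_def by (rule quotientE)
  then have x: "p \<in> points n" "q \<in> points n"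
    "(site_outer x, site_outer p) \<in> (stack_links a b)\<^sup>*" "(site_outer x, site_outer q) \<in> (stack_links a b)\<^sup>*"
    using B(2,3) by simp_all
  then show ?R using rtrancl_trans[OF stack_links_sym[OF x(3)] x(4)] by (intro conjI)
next
  assume R: ?R
  let ?E = "{(p, q). p \<in> points n \<and> q \<in> points n \<and> (site_outer p, site_outer q) \<in> (stack_links a b)\<^sup>*}"
  have "p \<in> ?E `` {p}" "q \<in> ?E `` {p}" using R by simp_all
  moreover have "?E `` {p} \<in> diagram_mult n a b"
    unfolding diagram_mult_def by (rule quotientI) (use R in simp)
  ultimately show ?L by (intro bexI[of _ "?E `` {p}"] conjI)
qed

lemma blk_mult:
  assumes "k \<noteq> l" "l \<noteq> m" "k \<noteq> m"
  shows "blk k m (diagram_mult n a b) = (blk k l a \<union> blk l m b)\<^sup>* \<inter> (wide k m ` points n) \<times> (wide k m ` points n)"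
proof (intro equalityI subsetI)
  fix z assume "z \<in> blk k m (diagram_mult n a b)"
  then obtain p q B where z: "z = (wide k m p, wide k m q)" "B \<in> diagram_mult n a b" "p \<in> B" "q \<in> B"
    unfolding blk_def by blast
  then have "\<exists>B\<in>diagram_mult n a b. p \<in> B \<and> q \<in> B" by blast
  then have "p \<in> points n" "q \<in> points n" "(site_outer p, site_outer q) \<in> (stack_links a b)\<^sup>*"
    unfolding diagram_mult_block_iff by blast+
  then show "z \<in> (blk k l a \<union> blk l m b)\<^sup>* \<inter> (wide k m ` points n) \<times> (wide k m ` points n)"
    unfolding stack_links_levels[OF assms] levels_site z(1) by (intro IntI SigmaI imageI)
next
  fix z assume "z \<in> (blk k l a \<union> blk l m b)\<^sup>* \<inter> (wide k m ` points n) \<times> (wide k m ` points n)"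
  then obtain p q where z: "z = (wide k m p, wide k m q)" "p \<in> points n" "q \<in> points n"
    "(wide k m p, wide k m q) \<in> (blk k l a \<union> blk l m b)\<^sup>*" by blast
  then have "(site_outer p, site_outer q) \<in> (stack_links a b)\<^sup>*"
    unfolding stack_links_levels[OF assms] levels_site by (intro z)
  then obtain B where "B \<in> diagram_mult n a b" "p \<in> B" "q \<in> B"
    using z(2,3) diagram_mult_block_iff[of n a b p q] by blast
  then show "z \<in> blk k m (diagram_mult n a b)" unfolding blk_def z(1) by blast
qed

text \<open>\<open>V\<close> is the interface through which \<open>R1\<close> communicates with
  \<open>R2\<close>. A maximal stretch of a path inside \<open>R1\<close> is trivial or starts and
  ends in \<open>V\<close>, so it may be replaced by a single shortcut.\<close>

lemma rtrancl_glue: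
  assumes int: "Field R2 \<inter> Field R1 \<subseteq> V" and x: "x \<in> V \<or> x \<notin> Field R1" and y: "y \<in> V \<or> y \<notin> Field R1"
  shows "(x, y) \<in> ((R1\<^sup>* \<inter> V \<times> V) \<union> R2)\<^sup>* \<longleftrightarrow> (x, y) \<in> (R1 \<union> R2)\<^sup>*"
proof
  let ?T = "(R1\<^sup>* \<inter> V \<times> V) \<union> R2"
  have "?T \<subseteq> (R1 \<union> R2)\<^sup>*" using rtrancl_mono[of R1 "R1 \<union> R2"] by blast
  then show "(x, y) \<in> ?T\<^sup>* \<Longrightarrow> (x, y) \<in> (R1 \<union> R2)\<^sup>*" by (meson rtrancl_subset_rtrancl subsetD)
  have in_field: "z = w \<or> (z \<in> Field R1 \<and> w \<in> Field R1)" if "(z, w) \<in> R1\<^sup>*" for z w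
    using that by (induction rule: rtrancl_induct) (auto simp: Field_def)
  have final: "(x, w) \<in> ?T\<^sup>*" if "(x, z) \<in> ?T\<^sup>*" "(z, w) \<in> R1\<^sup>*" "z \<in> V \<or> z \<notin> Field R1" "w \<in> V \<or> w \<notin> Field R1" for z w
  proof (cases "z = w")
    case False
    then have "(z, w) \<in> ?T" using in_field[OF that(2)] that(2-4) by blast
    then show ?thesis using that(1) by (meson rtrancl.rtrancl_into_rtrancl)
  qed (use that in simp)
  have "\<exists>z. (z \<in> V \<or> z \<notin> Field R1) \<and> (x, z) \<in> ?T\<^sup>* \<and> (z, w) \<in> R1\<^sup>*" if "(x, w) \<in> (R1 \<union> R2)\<^sup>*" for w
    using that
  proof (induction rule: rtrancl_induct)
    case base
    then show ?case using x by blast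
  next
    case (step w w')
    then obtain z where z: "z \<in> V \<or> z \<notin> Field R1" "(x, z) \<in> ?T\<^sup>*" "(z, w) \<in> R1\<^sup>*" by blast
    from step(2) show ?case
    proof
      assume "(w, w') \<in> R1"
      then show ?thesis using z by (meson rtrancl.rtrancl_into_rtrancl)
    next
      assume w: "(w, w') \<in> R2"
      then have "w \<in> Field R2" "w' \<in> Field R2" unfolding Field_def by auto
      then have good: "w \<in> V \<or> w \<notin> Field R1" "w' \<in> V \<or> w' \<notin> Field R1" using int by blast+
      have "(x, w) \<in> ?T\<^sup>*" by (rule final[OF z(2,3,1) good(1)])
      then have "(x, w') \<in> ?T\<^sup>*" using w by (meson UnI2 rtrancl.rtrancl_into_rtrancl)
      then show ?thesis using good(2) by blast
    qed
  qed
  then show "(x, y) \<in> (R1 \<union> R2)\<^sup>* \<Longrightarrow> (x, y) \<in> ?T\<^sup>*" using final y by blast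
qed

lemma Field_blk: "\<Union> a \<subseteq> points n \<Longrightarrow> Field (blk k l a) \<subseteq> wide k l ` points n"
  unfolding blk_def Field_def by blast

text \<open>With \<open>a\<close>, \<open>b\<close>, \<open>c\<close> placed between the levels 0,
  1, 2 and 3, contracting level 1 or level 2 in advance does not change connectivity between the
  outer rows, by \<open>rtrancl_glue\<close>. Both products are therefore read off from the union of
  the same three relations.\<close>

lemma diagram_mult_assoc:
  assumes a: "\<Union> a \<subseteq> points n" and b: "\<Union> b \<subseteq> points n" and c: "\<Union> c \<subseteq> points n"
  shows "diagram_mult n (diagram_mult n a b) c = diagram_mult n a (diagram_mult n b c)"
proof -
  let ?A = "blk 0 1 a" and ?B = "blk 1 2 b" and ?C = "blk 2 3 c"
  have fA: "Field ?A \<subseteq> wide 0 1 ` points n" and fB: "Field ?B \<subseteq> wide 1 2 ` points n" and fC: "Field ?C \<subseteq> wide 2 3 ` points n"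
    using Field_blk a b c by blast+
  have w: "x \<in> wide k l ` points n \<longleftrightarrow> (fst x = k \<or> fst x = l) \<and> 1 \<le> snd x \<and> snd x \<le> 2 * n" for x k l
  proof -
    obtain x1 x2 where x: "x = (x1, x2)" by (cases x)
    show ?thesis unfolding x points_def image_Un by (force simp: image_iff)
  qed
  have "(site_outer p, site_outer q) \<in> (stack_links (diagram_mult n a b) c)\<^sup>* \<longleftrightarrow>
        (site_outer p, site_outer q) \<in> (stack_links a (diagram_mult n b c))\<^sup>*"
    if pq: "p \<in> points n" "q \<in> points n" for p q
  proof -
    have W: "wide 0 3 r \<in> wide 0 3 ` points n" if "r \<in> points n" for r using that by blast
    have 1: "(wide 0 3 p, wide 0 3 q) \<in> (((?A \<union> ?B)\<^sup>* \<inter> (wide 0 2 ` points n) \<times> (wide 0 2 ` points n)) \<union> ?C)\<^sup>*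
        \<longleftrightarrow> (wide 0 3 p, wide 0 3 q) \<in> ((?A \<union> ?B) \<union> ?C)\<^sup>*"
    proof (rule rtrancl_glue)
      show "Field ?C \<inter> Field (?A \<union> ?B) \<subseteq> wide 0 2 ` points n"
      proof
        fix x assume "x \<in> Field ?C \<inter> Field (?A \<union> ?B)"
        then have "x \<in> wide 2 3 ` points n" "x \<in> wide 0 1 ` points n \<or> x \<in> wide 1 2 ` points n"
          using fA fB fC by (auto simp: Field_Un)
        then show "x \<in> wide 0 2 ` points n" unfolding w by auto
      qed
      have "wide 0 3 r \<in> wide 0 2 ` points n \<or> wide 0 3 r \<notin> Field (?A \<union> ?B)" if "r \<in> points n" for r
      proof (cases r)
        case (Bot i)
        have "(3, i) \<notin> wide 0 1 ` points n" "(3, i) \<notin> wide 1 2 ` points n" unfolding w by auto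
        then show ?thesis unfolding Bot wide.simps using fA fB by (auto simp: Field_Un)
      qed (use that in \<open>auto simp: w\<close>)
      then show "wide 0 3 p \<in> wide 0 2 ` points n \<or> wide 0 3 p \<notin> Field (?A \<union> ?B)"
        "wide 0 3 q \<in> wide 0 2 ` points n \<or> wide 0 3 q \<notin> Field (?A \<union> ?B)" using pq by blast+
    qed
    have 2: "(wide 0 3 p, wide 0 3 q) \<in> (((?B \<union> ?C)\<^sup>* \<inter> (wide 1 3 ` points n) \<times> (wide 1 3 ` points n)) \<union> ?A)\<^sup>*
        \<longleftrightarrow> (wide 0 3 p, wide 0 3 q) \<in> ((?B \<union> ?C) \<union> ?A)\<^sup>*"
    proof (rule rtrancl_glue)
      show "Field ?A \<inter> Field (?B \<union> ?C) \<subseteq> wide 1 3 ` points n"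
      proof
        fix x assume "x \<in> Field ?A \<inter> Field (?B \<union> ?C)"
        then have "x \<in> wide 0 1 ` points n" "x \<in> wide 2 3 ` points n \<or> x \<in> wide 1 2 ` points n"
          using fA fB fC by (auto simp: Field_Un)
        then show "x \<in> wide 1 3 ` points n" unfolding w by auto
      qed
      have "wide 0 3 r \<in> wide 1 3 ` points n \<or> wide 0 3 r \<notin> Field (?B \<union> ?C)" if "r \<in> points n" for r
      proof (cases r)
        case (Top i)
        have "(0, i) \<notin> wide 1 2 ` points n" "(0, i) \<notin> wide 2 3 ` points n" unfolding w by auto
        then show ?thesis unfolding Top wide.simps using fB fC by (auto simp: Field_Un)
      qed (use that in \<open>auto simp: w\<close>)
      then show "wide 0 3 p \<in> wide 1 3 ` points n \<or> wide 0 3 p \<notin> Field (?B \<union> ?C)"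
        "wide 0 3 q \<in> wide 1 3 ` points n \<or> wide 0 3 q \<notin> Field (?B \<union> ?C)" using pq by blast+
    qed
    have "(site_outer p, site_outer q) \<in> (stack_links (diagram_mult n a b) c)\<^sup>* \<longleftrightarrow>
       (wide 0 3 p, wide 0 3 q) \<in> (blk 0 2 (diagram_mult n a b) \<union> ?C)\<^sup>*"
      using stack_links_levels[of 0 2 3 "site_outer p" "site_outer q"] by (simp add: levels_site)
    also have "\<dots> \<longleftrightarrow> (wide 0 3 p, wide 0 3 q) \<in> ((?A \<union> ?B) \<union> ?C)\<^sup>*"
      using 1 blk_mult[of 0 1 2 n a b] by simp
    also have "\<dots> \<longleftrightarrow> (wide 0 3 p, wide 0 3 q) \<in> (?A \<union> blk 1 3 (diagram_mult n b c))\<^sup>*"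
      using 2 blk_mult[of 1 2 3 n b c] by (simp add: Un_ac)
    also have "\<dots> \<longleftrightarrow> (site_outer p, site_outer q) \<in> (stack_links a (diagram_mult n b c))\<^sup>*"
      using stack_links_levels[of 0 1 3 "site_outer p" "site_outer q"] by (simp add: levels_site)
    finally show ?thesis .
  qed
  then have "{(p, q). p \<in> points n \<and> q \<in> points n \<and> (site_outer p, site_outer q) \<in> (stack_links (diagram_mult n a b) c)\<^sup>*} =
    {(p, q). p \<in> points n \<and> q \<in> points n \<and> (site_outer p, site_outer q) \<in> (stack_links a (diagram_mult n b c))\<^sup>*}"
    by blast
  then show ?thesis unfolding diagram_mult_def[of n "diagram_mult n a b"] diagram_mult_def[of n a "diagram_mult n b c"] by (rule arg_cong)
qed

section \<open>Half-diagrams\<close>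

lemma dg_inject:
  assumes "\<phi> \<in> planar_involutions n" "\<psi> \<in> planar_involutions n" "diagram_of n \<phi> = diagram_of n \<psi>" shows "\<phi> = \<psi>"
proof
  fix p
  show "\<phi> p = \<psi> p"
  proof (cases "p \<in> points n")
    case True
    then have "{p, \<phi> p} \<in> diagram_of n \<psi>" using dg_memI assms(3) by metis
    then have "{p, \<phi> p} = {p, \<psi> p}" using dg_block[OF assms(2)] by blast
    then show ?thesis by (metis doubleton_eq_iff)
  qed (use assms PI_D(2) in metis)
qed

text \<open>Planarity allows a through strand to end at \<open>i\<close> only if \<open>i\<close>
  carries no arc and lies under none.\<close>

definition free_at :: "(nat \<Rightarrow> nat) \<Rightarrow> nat \<Rightarrow> bool" where
  "free_at f i \<longleftrightarrow> f i = i \<and> (\<forall>x. x < i \<longleftrightarrow> f x < i)"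

text \<open>A diagram consists of partial matchings \<open>f\<close> and \<open>g\<close> of its top and bottom row, which fix the ends of
  the through strands, the set \<open>I\<close> of upper ends, and the map \<open>\<sigma>\<close> from upper to lower ends.\<close>

definition strand_map :: "(nat \<Rightarrow> nat) \<Rightarrow> (nat \<Rightarrow> nat) \<Rightarrow> nat set \<Rightarrow> (nat \<Rightarrow> nat) \<Rightarrow> point \<Rightarrow> point" where
  "strand_map f g I \<sigma> p = (case p of
      Top i \<Rightarrow> (if i \<in> I then Bot (\<sigma> i) else Top (f i))
    | Bot j \<Rightarrow> (if j \<in> \<sigma> ` I then Top (inv_into I \<sigma> j) else Bot (g j)))"

definition half_diagrams :: "nat \<Rightarrow> (nat \<Rightarrow> nat) \<Rightarrow> (nat \<Rightarrow> nat) \<Rightarrow> nat set \<Rightarrow> (nat \<Rightarrow> nat) \<Rightarrow> bool" where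
  "half_diagrams n f g I \<sigma> \<longleftrightarrow> f \<in> noncrossing {1..2 * n} \<and> g \<in> noncrossing {1..2 * n} \<and>
     I \<subseteq> {1..2 * n} \<and> \<sigma> ` I \<subseteq> {1..2 * n} \<and> (\<forall>x\<in>I. \<forall>y\<in>I. x < y \<longrightarrow> \<sigma> x < \<sigma> y) \<and>
     (\<forall>i\<in>I. free_at f i \<and> free_at g (\<sigma> i))"

lemma data_D:
  assumes "half_diagrams n f g I \<sigma>"
  shows "f \<in> noncrossing {1..2 * n}" "g \<in> noncrossing {1..2 * n}" "I \<subseteq> {1..2 * n}" "\<sigma> ` I \<subseteq> {1..2 * n}"
    "inj_on \<sigma> I" "x \<in> I \<Longrightarrow> y \<in> I \<Longrightarrow> x < y \<longleftrightarrow> \<sigma> x < \<sigma> y"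
    "i \<in> I \<Longrightarrow> free_at f i" "i \<in> I \<Longrightarrow> free_at g (\<sigma> i)" "finite I"
proof -
  show "f \<in> noncrossing {1..2 * n}" "g \<in> noncrossing {1..2 * n}" and I: "I \<subseteq> {1..2 * n}" and "\<sigma> ` I \<subseteq> {1..2 * n}"
    "i \<in> I \<Longrightarrow> free_at f i" "i \<in> I \<Longrightarrow> free_at g (\<sigma> i)"
    using assms unfolding half_diagrams_def by blast+
  have m: "\<sigma> x < \<sigma> y" if "x \<in> I" "y \<in> I" "x < y" for x y using assms that unfolding half_diagrams_def by blast
  show "x \<in> I \<Longrightarrow> y \<in> I \<Longrightarrow> x < y \<longleftrightarrow> \<sigma> x < \<sigma> y" using m[of x y] m[of y x] by (metis linorder_neqE_nat less_asym)
  show "inj_on \<sigma> I" by (rule inj_onI) (metis m linorder_neqE_nat less_irrefl)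
  show "finite I" using I finite_subset by blast
qed

lemma mk_simps:
  "i \<in> I \<Longrightarrow> strand_map f g I \<sigma> (Top i) = Bot (\<sigma> i)" "i \<notin> I \<Longrightarrow> strand_map f g I \<sigma> (Top i) = Top (f i)"
  "j \<notin> \<sigma> ` I \<Longrightarrow> strand_map f g I \<sigma> (Bot j) = Bot (g j)"
  unfolding strand_map_def by auto

lemma mk_Bot: "inj_on \<sigma> I \<Longrightarrow> i \<in> I \<Longrightarrow> strand_map f g I \<sigma> (Bot (\<sigma> i)) = Top i"
  unfolding strand_map_def by simp

lemma free_at_less: "free_at f i \<Longrightarrow> x < i \<longleftrightarrow> f x < i" "free_at f i \<Longrightarrow> f i = i"
  unfolding free_at_def by blast+

lemma free_at_greater: assumes "free_at f i" "f (f x) = x" shows "i < x \<longleftrightarrow> i < f x"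
proof -
  have "x = i \<longleftrightarrow> f x = i" using assms free_at_less(2) by metis
  then show ?thesis using free_at_less(1)[OF assms(1), of x] by (metis linorder_neqE_nat less_asym)
qed

text \<open>The noncrossing condition for \<open>p\<close> and \<open>q\<close> does not change when
  either point is replaced by its partner. Every block has an end that is not the lower end of a
  strand, by \<open>rep\<close>, which reduces the verification to four combinations of
  rows.\<close>

lemma mk_PI:
  assumes d: "half_diagrams n f g I \<sigma>" shows "strand_map f g I \<sigma> \<in> planar_involutions n"
proof -
  let ?m = "strand_map f g I \<sigma>" and ?b = "boundary_pos n"
  note D = data_D[OF d]
  have finv: "f (f x) = x" and ginv: "g (g x) = x" for x
    using noncrossing_invol[OF D(1)] noncrossing_invol[OF D(2)] by blast+
  have fI: "f x \<in> I \<longleftrightarrow> x \<in> I" for x using free_at_less(2)[OF D(7)] finv by metis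
  have gI: "g x \<in> \<sigma> ` I \<longleftrightarrow> x \<in> \<sigma> ` I" for x
    using free_at_less(2)[OF D(8)] ginv by (metis imageE)
  have bot_cases: "(\<exists>i\<in>I. j = \<sigma> i \<and> ?m (Bot j) = Top i) \<or> (j \<notin> \<sigma> ` I \<and> ?m (Bot j) = Bot (g j))" for j
    using mk_Bot[OF D(5)] mk_simps(3) by (metis imageE)
  have inv: "?m (?m p) = p" for p
  proof (cases p)
    case (Top i)
    show ?thesis
    proof (cases "i \<in> I")
      case True
      then show ?thesis using mk_simps(1)[OF True] mk_Bot[OF D(5) True] Top by metis
    next
      case False
      then show ?thesis using mk_simps(2)[OF False] mk_simps(2)[of "f i" I] fI[of i] finv[of i] Top by metis
    qed
  next
    case (Bot j)
    show ?thesis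
    proof (cases "j \<in> \<sigma> ` I")
      case True
      then show ?thesis using bot_cases[of j] mk_simps(1) Bot by metis
    next
      case False
      then show ?thesis using mk_simps(3)[OF False] mk_simps(3)[of "g j"] gI[of j] ginv[of j] Bot by metis
    qed
  qed
  have out: "?m p = p" if "p \<notin> points n" for p
  proof (cases p)
    case (Top i)
    then have "i \<notin> {1..2 * n}" using that by auto
    then have "i \<notin> I" "f i = i" using D(3) noncrossing_outside[OF D(1)] by blast+
    then show ?thesis using mk_simps(2) Top by metis
  next
    case (Bot j)
    then have "j \<notin> {1..2 * n}" using that by auto
    then have "j \<notin> \<sigma> ` I" "g j = j" using D(4) noncrossing_outside[OF D(2)] by blast+
    then show ?thesis using mk_simps(3) Bot by metis
  qed
  have frange: "1 \<le> f x \<and> f x \<le> 2 * n" if "1 \<le> x" "x \<le> 2 * n" for x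
    using noncrossing_in[OF D(1), of x] that by simp
  have grange: "1 \<le> g x \<and> g x \<le> 2 * n" if "1 \<le> x" "x \<le> 2 * n" for x
    using noncrossing_in[OF D(2), of x] that by simp
  have Irange: "1 \<le> x \<and> x \<le> 2 * n \<and> 1 \<le> \<sigma> x \<and> \<sigma> x \<le> 2 * n" if "x \<in> I" for x
  proof -
    have "x \<in> {1..2 * n}" "\<sigma> x \<in> {1..2 * n}" using D(3,4) that by blast+
    then show ?thesis by simp
  qed
  define Q where "Q p q \<longleftrightarrow> ((?b q < ?b p) \<noteq> (?b q < ?b (?m p))) = ((?b (?m q) < ?b p) \<noteq> (?b (?m q) < ?b (?m p)))" for p q
  have Qsym: "Q p q \<longleftrightarrow> Q (?m p) q" "Q p q \<longleftrightarrow> Q p (?m q)" for p q unfolding Q_def inv by blast+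
  have TT: "Q (Top i) (Top x)" if "Top i \<in> points n" "Top x \<in> points n" "x \<noteq> i" "Top x \<noteq> ?m (Top i)" for i x
  proof -
    have r: "1 \<le> i" "i \<le> 2 * n" "1 \<le> x" "x \<le> 2 * n" using that by auto
    show ?thesis
    proof (cases "i \<in> I"; cases "x \<in> I")
      assume *: "i \<in> I" "x \<in> I"
      have "x < i \<longleftrightarrow> \<sigma> x < \<sigma> i" "\<sigma> x \<noteq> \<sigma> i" using D(6) * that(3) D(5) by (blast, metis inj_onD)
      then show ?thesis using Irange[OF *(1)] Irange[OF *(2)] unfolding Q_def mk_simps(1)[OF *(1)] mk_simps(1)[OF *(2)] by auto
    next
      assume *: "i \<in> I" "x \<notin> I"
      have "x < i \<longleftrightarrow> f x < i" using free_at_less(1)[OF D(7)] * by blast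
      then show ?thesis using Irange[OF *(1)] frange[OF r(3,4)] r unfolding Q_def mk_simps(1)[OF *(1)] mk_simps(2)[OF *(2)] by auto
    next
      assume *: "i \<notin> I" "x \<in> I"
      have "x < i \<longleftrightarrow> x < f i" using free_at_greater[OF D(7) finv] * by blast
      then show ?thesis using Irange[OF *(2)] frange[OF r(1,2)] r unfolding Q_def mk_simps(2)[OF *(1)] mk_simps(1)[OF *(2)] by auto
    next
      assume *: "i \<notin> I" "x \<notin> I"
      have "x \<noteq> f i" using that(4) unfolding mk_simps(2)[OF *(1)] by simp
      then show ?thesis using noncrossing_cond[OF D(1) that(3)] unfolding Q_def mk_simps(2)[OF *(1)] mk_simps(2)[OF *(2)] by simp
    qed
  qed
  have BB: "Q (Bot i) (Bot x)" if "Bot i \<in> points n" "Bot x \<in> points n" "x \<noteq> i" "Bot x \<noteq> ?m (Bot i)"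
    "i \<notin> \<sigma> ` I" "x \<notin> \<sigma> ` I" for i x
  proof -
    have r: "1 \<le> i" "i \<le> 2 * n" "1 \<le> x" "x \<le> 2 * n" using that by auto
    have "g x \<noteq> i" using that(4) ginv[of x] unfolding mk_simps(3)[OF that(5)] by metis
    have c: "x \<noteq> g i" using that(4) unfolding mk_simps(3)[OF that(5)] by simp
    have ne: "g x \<noteq> g i" using that(3) noncrossing_eq_iff[OF D(2)] by blast
    have "((x < i) \<noteq> (x < g i)) = ((g x < i) \<noteq> (g x < g i))" using noncrossing_cond[OF D(2) that(3) c] .
    then have "((i < x) \<noteq> (g i < x)) = ((i < g x) \<noteq> (g i < g x))"
      using that(3) c \<open>g x \<noteq> i\<close> ne by (metis linorder_neqE_nat less_asym)
    moreover have "(4 * n + 1 - y < 4 * n + 1 - z) = (z < y)" if "y \<le> 2 * n" "z \<le> 2 * n" for y z using that by auto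
    ultimately show ?thesis using r grange[OF r(1,2)] grange[OF r(3,4)]
      unfolding Q_def mk_simps(3)[OF that(5)] mk_simps(3)[OF that(6)] boundary_pos.simps by simp
  qed
  have BT: "Q (Bot i) (Top x)" if "Bot i \<in> points n" "Top x \<in> points n" "i \<notin> \<sigma> ` I" for i x
  proof -
    have r: "1 \<le> i" "i \<le> 2 * n" "1 \<le> x" "x \<le> 2 * n" using that by auto
    note gi = grange[OF r(1,2)]
    show ?thesis
    proof (cases "x \<in> I")
      case True
      have "\<sigma> x < i \<longleftrightarrow> \<sigma> x < g i" using free_at_greater[OF D(8)[OF True] ginv, of i] .
      moreover have "\<sigma> x \<noteq> i" "\<sigma> x \<noteq> g i" using that(3) gI[of i] True by (blast, metis imageI)
      ultimately show ?thesis using Irange[OF True] r gi unfolding Q_def mk_simps(3)[OF that(3)] mk_simps(1)[OF True] by auto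
    next
      case False
      then show ?thesis using frange[OF r(3,4)] r gi unfolding Q_def mk_simps(3)[OF that(3)] mk_simps(2)[OF False] by auto
    qed
  qed
  have TB: "Q (Top i) (Bot x)" if "Top i \<in> points n" "Bot x \<in> points n" "x \<notin> \<sigma> ` I" for i x
  proof -
    have r: "1 \<le> i" "i \<le> 2 * n" "1 \<le> x" "x \<le> 2 * n" using that by auto
    note gx = grange[OF r(3,4)]
    show ?thesis
    proof (cases "i \<in> I")
      case True
      have "\<sigma> i < x \<longleftrightarrow> \<sigma> i < g x" using free_at_greater[OF D(8)[OF True] ginv, of x] .
      moreover have "\<sigma> i \<noteq> x" "\<sigma> i \<noteq> g x" using that(3) gI[of x] True by (blast, metis imageI)
      ultimately show ?thesis using Irange[OF True] r gx unfolding Q_def mk_simps(3)[OF that(3)] mk_simps(1)[OF True] by auto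
    next
      case False
      then show ?thesis using frange[OF r(1,2)] r gx unfolding Q_def mk_simps(3)[OF that(3)] mk_simps(2)[OF False] by auto
    qed
  qed
  have pts: "?m p \<in> points n" if "p \<in> points n" for p using out[of "?m p"] inv[of p] that by metis
  define rep where "rep p \<longleftrightarrow> (\<forall>j. p = Bot j \<longrightarrow> j \<notin> \<sigma> ` I)" for p
  have rep: "rep p \<or> rep (?m p)" for p
  proof (cases p)
    case (Bot j)
    then show ?thesis using bot_cases[of j] unfolding rep_def by (metis point.distinct(1) point.inject(2))
  qed (simp add: rep_def)
  have Qrep: "Q p q" if "p \<in> points n" "q \<in> points n" "q \<noteq> p" "q \<noteq> ?m p" "rep p" "rep q" for p q
  proof (cases p)
    case p: (Top i)
    show ?thesis
    proof (cases q)
      case (Top x)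
      have "x \<noteq> i" "Top x \<noteq> ?m (Top i)" using that(3,4) unfolding p Top by blast+
      then show ?thesis using TT that(1,2) unfolding p Top by blast
    next
      case (Bot x)
      then show ?thesis using TB that(1,2,6) unfolding p Bot rep_def by blast
    qed
  next
    case p: (Bot i)
    show ?thesis
    proof (cases q)
      case (Top x)
      then show ?thesis using BT that(1,2,5) unfolding p Top rep_def by blast
    next
      case (Bot x)
      have "x \<noteq> i" "Bot x \<noteq> ?m (Bot i)" using that(3,4) unfolding p Bot by blast+
      then show ?thesis using BB that(1,2,5,6) unfolding p Bot rep_def by blast
    qed
  qed
  have "Q p q" if pq: "p \<in> points n" "q \<in> points n" "q \<noteq> p" "q \<noteq> ?m p" for p q
  proof -
    have q': "?m q \<noteq> p" "?m q \<noteq> ?m p" using pq inv by metis+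
    have A: "Q p q" if "p \<in> points n" "q \<noteq> p" "q \<noteq> ?m p" "?m q \<noteq> p" "?m q \<noteq> ?m p" "rep p" for p
      using rep[of q] Qrep[OF that(1) pq(2) that(2,3,6)] Qrep[OF that(1) pts[OF pq(2)] that(4,5,6)] Qsym(2)[of p q] by blast
    show ?thesis using rep[of p]
    proof
      assume "rep p"
      then show ?thesis using A[of p] pq q' by blast
    next
      assume "rep (?m p)"
      then have "Q (?m p) q" using A[of "?m p"] pts pq q' inv[of p] by simp
      then show ?thesis using Qsym(1) by blast
    qed
  qed
  then show ?thesis unfolding planar_involutions_def Q_def using inv out by blast
qed

lemma PI_through_mono:
  assumes \<phi>: "\<phi> \<in> planar_involutions n" and "\<phi> (Top i) = Bot j" "\<phi> (Top i') = Bot j'" "i < i'"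
  shows "j < j'"
proof -
  have ne: "Top i \<noteq> \<phi> (Top i)" "Top i' \<noteq> \<phi> (Top i')" using assms by auto
  have p: "Top i \<in> points n" "Top i' \<in> points n" using PI_D(2)[OF \<phi>] ne by metis+
  then have "Bot j \<in> points n" "Bot j' \<in> points n" using PI_D(3)[OF \<phi>] assms(2,3) by metis+
  moreover have "j \<noteq> j'" using assms PI_D(1)[OF \<phi>] by (metis less_irrefl point.inject(1))
  ultimately show ?thesis
    using PI_D(4)[OF \<phi> p] p assms by auto
qed

text \<open>Ends of through strands are made fixed points of \<open>f\<close> and \<open>g\<close>;
  planarity against these strands shows that they are free, and \<open>\<sigma>\<close> is
  increasing because strands do not cross one another.\<close>

lemma PI_eq_mk:
  assumes \<phi>: "\<phi> \<in> planar_involutions n"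
  obtains f g I \<sigma> where "half_diagrams n f g I \<sigma>" "\<phi> = strand_map f g I \<sigma>"
proof -
  define f where "f i = (case \<phi> (Top i) of Top j \<Rightarrow> j | Bot j \<Rightarrow> i)" for i
  define g where "g i = (case \<phi> (Bot i) of Top j \<Rightarrow> i | Bot j \<Rightarrow> j)" for i
  define I where "I = {i. \<exists>j. \<phi> (Top i) = Bot j}"
  define \<sigma> where "\<sigma> i = (case \<phi> (Top i) of Top j \<Rightarrow> j | Bot j \<Rightarrow> j)" for i
  note inv = PI_D(1)[OF \<phi>] and out = PI_D(2)[OF \<phi>]
  have ptI: "Top i \<in> points n" "Bot (\<sigma> i) \<in> points n" "\<phi> (Top i) = Bot (\<sigma> i)" "\<phi> (Bot (\<sigma> i)) = Top i" if iI: "i \<in> I" for i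
  proof -
    obtain j where j: "\<phi> (Top i) = Bot j" using iI unfolding I_def by blast
    show *: "\<phi> (Top i) = Bot (\<sigma> i)" unfolding \<sigma>_def j by simp
    show "\<phi> (Bot (\<sigma> i)) = Top i" using inv[of "Top i"] * by simp
    show "Top i \<in> points n" using out[of "Top i"] j by (metis point.distinct(1))
    then show "Bot (\<sigma> i) \<in> points n" using PI_D(3)[OF \<phi>] * by metis
  qed
  have notI: "\<phi> (Top i) = Top (f i)" if "i \<notin> I" for i
    using that unfolding I_def f_def by (cases "\<phi> (Top i)") auto
  have fI: "f i = i" if "i \<in> I" for i using ptI(3)[OF that] unfolding f_def by simp
  have bot: "\<phi> (Bot j) = Bot (g j)" if "j \<notin> \<sigma> ` I" for j
  proof (cases "\<phi> (Bot j)")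
    case (Top i)
    then have "\<phi> (Top i) = Bot j" using inv[of "Bot j"] by simp
    then have "i \<in> I" "j = \<sigma> i" unfolding I_def \<sigma>_def by auto
    then show ?thesis using that by blast
  qed (simp add: g_def)
  have gI: "g (\<sigma> i) = \<sigma> i" if "i \<in> I" for i using ptI(4)[OF that] unfolding g_def by simp
  have Top_f: "\<phi> (Top i) = Top j \<Longrightarrow> f i = j" for i j unfolding f_def by simp
  have Bot_g: "\<phi> (Bot i) = Bot j \<Longrightarrow> g i = j" for i j unfolding g_def by simp
  have finv: "f (f i) = i" for i
  proof (cases "i \<in> I")
    case True
    then show ?thesis using fI[OF True] by metis
  next
    case False
    have "\<phi> (Top (f i)) = Top i" using notI[OF False] inv[of "Top i"] by metis
    then show ?thesis by (rule Top_f)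
  qed
  have ginv: "g (g j) = j" for j
  proof (cases "j \<in> \<sigma> ` I")
    case True
    then obtain i where "i \<in> I" "j = \<sigma> i" by blast
    then show ?thesis using gI by metis
  next
    case False
    have "\<phi> (Bot (g j)) = Bot j" using bot[OF False] inv[of "Bot j"] by metis
    then show ?thesis by (rule Bot_g)
  qed
  have fout: "f i = i" if "i \<notin> {1..2 * n}" for i by (rule Top_f, rule out) (use that in auto)
  have gout: "g i = i" if "i \<notin> {1..2 * n}" for i by (rule Bot_g, rule out) (use that in auto)
  have fpt: "Top x \<in> points n" if "f x \<noteq> x" for x using fout[of x] that by auto
  have gpt: "Bot x \<in> points n" if "g x \<noteq> x" for x using gout[of x] that by auto
  have ffx: "f (f x) \<noteq> f x" if "f x \<noteq> x" for x using that finv by metis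
  have ggx: "g (g x) \<noteq> g x" if "g x \<noteq> x" for x using that ginv by metis
  have fN: "f \<in> noncrossing {1..2 * n}"
    unfolding noncrossing_def
  proof (intro CollectI conjI allI impI)
    fix x y assume xy: "y \<noteq> x" "y \<noteq> f x"
    show "((y < x) \<noteq> (y < f x)) = ((f y < x) \<noteq> (f y < f x))"
    proof (cases "f x = x \<or> f y = y")
      case False
      then have "x \<notin> I" "y \<notin> I" using fI by blast+
      then have *: "\<phi> (Top x) = Top (f x)" "\<phi> (Top y) = Top (f y)" using notI by blast+
      have "Top x \<in> points n" "Top y \<in> points n" using fpt False by blast+
      from PI_D(4)[OF \<phi> this] show ?thesis using xy unfolding * by simp
    qed auto
  qed (use finv fout in auto)
  have gN: "g \<in> noncrossing {1..2 * n}"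
    unfolding noncrossing_def
  proof (intro CollectI conjI allI impI)
    fix x y assume xy: "y \<noteq> x" "y \<noteq> g x"
    show "((y < x) \<noteq> (y < g x)) = ((g y < x) \<noteq> (g y < g x))"
    proof (cases "g x = x \<or> g y = y")
      case False
      then have "x \<notin> \<sigma> ` I" "y \<notin> \<sigma> ` I" using gI by blast+
      then have *: "\<phi> (Bot x) = Bot (g x)" "\<phi> (Bot y) = Bot (g y)" using bot by blast+
      have p: "Bot x \<in> points n" "Bot y \<in> points n" using gpt False by blast+
      have p': "Bot (g x) \<in> points n" "Bot (g y) \<in> points n" using gpt[OF ggx] False by blast+
      have ne: "g y \<noteq> x" "g y \<noteq> g x" using xy ginv by metis+
      have r: "(4 * n + 1 - z < 4 * n + 1 - w) = (w < z)" if "Bot w \<in> points n" "Bot z \<in> points n" for w z using that by auto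
      have "((x < y) \<noteq> (g x < y)) = ((x < g y) \<noteq> (g x < g y))"
        using PI_D(4)[OF \<phi> p] xy unfolding * boundary_pos.simps r[OF p(1,2)] r[OF p'(1) p(2)] r[OF p(1) p'(2)] r[OF p'(1,2)] by simp
      then show ?thesis using xy ne by (metis linorder_neqE_nat less_asym)
    qed auto
  qed (use ginv gout in auto)
  have free: "free_at f i \<and> free_at g (\<sigma> i)" if i: "i \<in> I" for i
  proof
    note pi = ptI[OF i]
    show "free_at f i" unfolding free_at_def
    proof (intro conjI allI)
      fix x show "x < i \<longleftrightarrow> f x < i"
      proof (cases "f x = x")
        case False
        then have xI: "x \<notin> I" using fI by blast
        note fx = notI[OF xI]
        have px: "Top x \<in> points n" "Top (f x) \<in> points n" using fpt[OF False] fpt[OF ffx[OF False]] by blast+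
        have "Top x \<noteq> Top i" using xI i by auto
        then show ?thesis using PI_D(4)[OF \<phi> pi(1) px(1)] pi(2) px unfolding pi(3) fx by auto
      qed simp
    qed (rule fI[OF i])
    show "free_at g (\<sigma> i)" unfolding free_at_def
    proof (intro conjI allI)
      fix x show "x < \<sigma> i \<longleftrightarrow> g x < \<sigma> i"
      proof (cases "g x = x")
        case False
        then have xI: "x \<notin> \<sigma> ` I" using gI by blast
        note gx = bot[OF xI]
        have px: "Bot x \<in> points n" "Bot (g x) \<in> points n" using gpt[OF False] gpt[OF ggx[OF False]] by blast+
        have ne: "x \<noteq> \<sigma> i" using xI i by auto
        have ne': "g x \<noteq> \<sigma> i" using ne ginv[of x] gI[OF i] by metis
        have "Bot x \<noteq> Top i" "Bot x \<noteq> \<phi> (Top i)" using ne unfolding pi(3) by auto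
        then have "((4 * n + 1 - x < i) \<noteq> (4 * n + 1 - x < 4 * n + 1 - \<sigma> i)) =
             ((4 * n + 1 - g x < i) \<noteq> (4 * n + 1 - g x < 4 * n + 1 - \<sigma> i))"
          using PI_D(4)[OF \<phi> pi(1) px(1)] unfolding pi(3) gx by simp
        then have "\<sigma> i < x \<longleftrightarrow> \<sigma> i < g x" using pi(1,2) px by auto
        then show ?thesis using ne ne' by auto
      qed simp
    qed (rule gI[OF i])
  qed
  have "half_diagrams n f g I \<sigma>"
    unfolding half_diagrams_def
  proof (intro conjI ballI impI)
    show "I \<subseteq> {1..2 * n}" using ptI(1) by fastforce
    show "\<sigma> ` I \<subseteq> {1..2 * n}" using ptI(2) by fastforce
    show "\<sigma> x < \<sigma> y" if "x \<in> I" "y \<in> I" "x < y" for x y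
      using PI_through_mono[OF \<phi> ptI(3)[OF that(1)] ptI(3)[OF that(2)] that(3)] .
  qed (use fN gN free in blast)+
  moreover have "\<phi> = strand_map f g I \<sigma>"
  proof
    fix p
    have inj: "inj_on \<sigma> I" using data_D(5)[OF calculation] .
    show "\<phi> p = strand_map f g I \<sigma> p"
    proof (cases p)
      case (Top i)
      then show ?thesis using ptI(3)[of i] notI[of i] mk_simps(1)[of i I] mk_simps(2)[of i I] by (cases "i \<in> I") auto
    next
      case (Bot j)
      show ?thesis
      proof (cases "j \<in> \<sigma> ` I")
        case True
        then obtain i where i: "i \<in> I" "j = \<sigma> i" by blast
        then show ?thesis using ptI(4)[OF i(1)] mk_Bot[OF inj i(1)] Bot by simp
      next
        case False
        then show ?thesis using bot[OF False] mk_simps(3)[OF False] Bot by simp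
      qed
    qed
  qed
  ultimately show ?thesis using that by blast
qed

section \<open>Rigid diagrams\<close>

text \<open>A string is traversed in one fixed direction: \<open>e\<close> tells which involution
  leads on from a site, and \<open>stop\<close> marks a final site. The next site is left through
  the other involution or is final and fixed by it, so forward steps exhaust the orbit and an
  invariant need not be checked backwards.\<close>

lemma directed_induct [consumes 1, case_names inv1 inv2 start1 start2 nonterm step1 step2 base step]:
  assumes w: "(u, w) \<in> conn \<alpha> \<beta>"
    and inv: "\<And>s. \<alpha> (\<alpha> s) = s" "\<And>s. \<beta> (\<beta> s) = s"
    and start: "e u \<Longrightarrow> \<beta> u = u" "\<not> e u \<Longrightarrow> \<alpha> u = u" and "\<not> stop u"
    and step1: "\<And>s. (u, s) \<in> conn \<alpha> \<beta> \<Longrightarrow> \<not> stop s \<Longrightarrow> e s \<Longrightarrow> (if stop (\<alpha> s) then \<beta> (\<alpha> s) = \<alpha> s else \<not> e (\<alpha> s))"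
    and step2: "\<And>s. (u, s) \<in> conn \<alpha> \<beta> \<Longrightarrow> \<not> stop s \<Longrightarrow> \<not> e s \<Longrightarrow> (if stop (\<beta> s) then \<alpha> (\<beta> s) = \<beta> s else e (\<beta> s))"
    and Q: "Q u" "\<And>s. (u, s) \<in> conn \<alpha> \<beta> \<Longrightarrow> Q s \<Longrightarrow> \<not> stop s \<Longrightarrow> Q (if e s then \<alpha> s else \<beta> s)"
  shows "Q w"
proof -
  define F where "F s = (if e s then \<alpha> s else \<beta> s)" for s
  define D where "D = {(s, F s) | s. \<not> stop s}"
  have Dc: "(u, s) \<in> conn \<alpha> \<beta>" if "(u, s) \<in> D\<^sup>*" for s
    using that
  proof (induction rule: rtrancl_induct)
    case (step s t)
    then have "t = \<alpha> s \<or> t = \<beta> s" unfolding D_def F_def by auto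
    then show ?case using step(3) conn_step conn_trans by metis
  qed (rule conn_refl)
  have DF: "(u, F s) \<in> D\<^sup>*" if "(u, s) \<in> D\<^sup>*" "\<not> stop s" for s
  proof -
    have "(s, F s) \<in> D" unfolding D_def using that(2) by blast
    then show ?thesis by (rule rtrancl.rtrancl_into_rtrancl[OF that(1)])
  qed
  have closed: "(u, \<alpha> s) \<in> D\<^sup>* \<and> (u, \<beta> s) \<in> D\<^sup>*" if s: "(u, s) \<in> D\<^sup>*" for s
    using s
  proof (cases rule: rtranclE)
    case base
    then show ?thesis
      using DF[OF s] start \<open>\<not> stop u\<close> s unfolding F_def base by (cases "e s") auto
  next
    case (step t)
    then have t: "\<not> stop t" "s = F t" "(u, t) \<in> D\<^sup>*" unfolding D_def by auto
    show ?thesis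
    proof (cases "e t")
      case True
      then have "s = \<alpha> t" using t(2) unfolding F_def by simp
      then have a: "\<alpha> s = t" using inv by simp
      have "if stop s then \<beta> s = s else \<not> e s"
        using step1[OF Dc[OF t(3)] t(1) True] \<open>s = \<alpha> t\<close> by simp
      then have "(u, \<beta> s) \<in> D\<^sup>*" using DF[OF s] s unfolding F_def by (cases "stop s") auto
      then show ?thesis using a t(3) by simp
    next
      case False
      then have "s = \<beta> t" using t(2) unfolding F_def by simp
      then have a: "\<beta> s = t" using inv by simp
      have "if stop s then \<alpha> s = s else e s"
        using step2[OF Dc[OF t(3)] t(1) False] \<open>s = \<beta> t\<close> by simp
      then have "(u, \<alpha> s) \<in> D\<^sup>*" using DF[OF s] s unfolding F_def by (cases "stop s") auto
      then show ?thesis using a t(3) by simp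
    qed
  qed
  have "(u, w) \<in> D\<^sup>*"
    by (rule conn_invariant[OF w, of "\<lambda>s. (u, s) \<in> D\<^sup>*"]) (use closed in blast)+
  then show ?thesis
  proof (induction rule: rtrancl_induct)
    case (step s t)
    then have "\<not> stop s" "t = F s" unfolding D_def by auto
    then show ?case using Q(2)[OF Dc[OF step(1)] step(3)] unfolding F_def by simp
  qed (rule Q(1))
qed

lemma site_ne [simp]: "site_above p \<noteq> Lower i" "site_below p \<noteq> Upper i"
  by (cases p; simp)+

text \<open>Odd positions carry the letter 1 and even ones the letter 2.\<close>

definition rigid_map :: "(point \<Rightarrow> point) \<Rightarrow> bool" where
  "rigid_map \<phi> \<longleftrightarrow> (\<forall>i j. \<phi> (Top i) = Bot j \<longrightarrow> odd i = odd j) \<and>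
     (\<forall>i j. \<phi> (Top i) = Top j \<longrightarrow> i < j \<longrightarrow> odd i \<and> even j) \<and>
     (\<forall>i j. \<phi> (Bot i) = Bot j \<longrightarrow> i < j \<longrightarrow> even i \<and> odd j)"

lemma dg_rigid_iff:
  assumes \<phi>: "\<phi> \<in> planar_involutions n" shows "diagram_of n \<phi> \<in> rigid_motzkin_diagrams n \<longleftrightarrow> rigid_map \<phi>"
proof
  assume "diagram_of n \<phi> \<in> rigid_motzkin_diagrams n"
  then have r: "rigid_block B" if "B \<in> diagram_of n \<phi>" for B using that unfolding rigid_motzkin_diagrams_def by blast
  have mem: "{p, q} \<in> diagram_of n \<phi>" if "\<phi> p = q" "p \<noteq> q" for p q
    using dg_memI[of p n \<phi>] PI_D(2)[OF \<phi>, of p] that by metis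
  show "rigid_map \<phi>"
    unfolding rigid_map_def
  proof (intro conjI allI impI)
    fix i j
    show "odd i = odd j" if "\<phi> (Top i) = Bot j"
      using r[OF mem[OF that]] unfolding rigid_block_def letter_def by (auto split: if_splits)
    show "odd i" "even j" if "\<phi> (Top i) = Top j" "i < j"
      using r[OF mem[OF that(1)]] that(2) unfolding rigid_block_def letter_def by (auto split: if_splits)
    show "even i" "odd j" if "\<phi> (Bot i) = Bot j" "i < j"
      using r[OF mem[OF that(1)]] that(2) unfolding rigid_block_def letter_def by (auto split: if_splits)
  qed
next
  assume rigid_map: "rigid_map \<phi>"
  have "rigid_block B" if B: "B \<in> diagram_of n \<phi>" for B
    unfolding rigid_block_def
  proof (intro conjI allI impI; (elim conjE)?)
    fix i j
    have eq: "\<phi> p = q" if "B = {p, q}" for p q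
      using dg_block[OF \<phi> B, of p] that PI_D(1)[OF \<phi>, of p] by (auto simp: doubleton_eq_iff)
    show "letter i = letter j" if "B = {Top i, Bot j}"
      using eq[OF that] rigid_map unfolding rigid_map_def letter_def by auto
    show "letter i = 1" "letter j = 2" if "B = {Top i, Top j}" "i < j"
      using eq[OF that(1)] that(2) rigid_map unfolding rigid_map_def letter_def by auto
    show "letter i = 2" "letter j = 1" if "B = {Bot i, Bot j}" "i < j"
      using eq[OF that(1)] that(2) rigid_map unfolding rigid_map_def letter_def by auto
  qed
  then show "diagram_of n \<phi> \<in> rigid_motzkin_diagrams n"
    unfolding rigid_motzkin_diagrams_def using dg_motzkin[OF \<phi>] by blast
qed

lemma rig_D:
  assumes "rigid_map \<phi>" "\<And>p. \<phi> (\<phi> p) = p"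
  shows "\<phi> (Top i) = Bot j \<Longrightarrow> odd i = odd j" "\<phi> (Bot j) = Top i \<Longrightarrow> odd i = odd j"
    "\<phi> (Top i) = Top j \<Longrightarrow> i \<noteq> j \<Longrightarrow> odd i \<noteq> odd j \<and> (odd i \<longrightarrow> i < j)"
    "\<phi> (Bot i) = Bot j \<Longrightarrow> i \<noteq> j \<Longrightarrow> odd i \<noteq> odd j \<and> (even i \<longrightarrow> i < j)"
proof -
  show tb: "odd i = odd j" if "\<phi> (Top i) = Bot j" for i j using assms(1) that unfolding rigid_map_def by blast
  show "odd i = odd j" if "\<phi> (Bot j) = Top i"
    using tb[of i j] assms(2)[of "Bot j"] that by simp
  show "odd i \<noteq> odd j \<and> (odd i \<longrightarrow> i < j)" if "\<phi> (Top i) = Top j" "i \<noteq> j"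
  proof -
    have "\<phi> (Top j) = Top i" using assms(2)[of "Top i"] that by simp
    then show ?thesis using assms(1) that unfolding rigid_map_def by (metis linorder_neqE_nat)
  qed
  show "odd i \<noteq> odd j \<and> (even i \<longrightarrow> i < j)" if "\<phi> (Bot i) = Bot j" "i \<noteq> j"
  proof -
    have "\<phi> (Bot j) = Bot i" using assms(2)[of "Bot i"] that by simp
    then show ?thesis using assms(1) that unfolding rigid_map_def by (metis linorder_neqE_nat)
  qed
qed

context stacked
begin

lemma mu_alive:
  assumes s: "(ou p, s) \<in> C" and p: "mu p \<noteq> p"
  shows "s = Upper i \<Longrightarrow> \<phi> (Top i) \<noteq> Top i" "s = Lower i \<Longrightarrow> \<psi> (Bot i) \<noteq> Bot i"
    "s = Middle i \<Longrightarrow> \<phi> (Bot i) \<noteq> Bot i" "s = Middle i \<Longrightarrow> \<psi> (Top i) \<noteq> Top i"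
proof -
  have one: "\<not> (al (ou r) = ou r \<and> be (ou r) = ou r)" if "(ou p, ou r) \<in> C" for r
  proof -
    have "r = p \<or> r = mu p" using that C_outer_iff by blast
    then show ?thesis
      using two_outer(1)[OF mu_conn p[symmetric]] two_outer(1)[OF C_sym[OF mu_conn] p] by blast
  qed
  show "\<phi> (Top i) \<noteq> Top i" if "s = Upper i" using one[of "Top i"] s that by auto
  show "\<psi> (Bot i) \<noteq> Bot i" if "s = Lower i" using one[of "Bot i"] s that by auto
  show "\<phi> (Bot i) \<noteq> Bot i" if "s = Middle i" using mu_dead[of p i] s that p by auto
  show "\<psi> (Top i) \<noteq> Top i" if "s = Middle i" using mu_dead[of p i] s that p by auto
qed

text \<open>In a rigid diagram strands can be oriented consistently such that the parity of a point says
  whether its strand passes it upwards or downwards.\<close>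

definition exits_above :: "bool \<Rightarrow> site \<Rightarrow> bool" where
  "exits_above b s = (case s of Upper i \<Rightarrow> True | Middle m \<Rightarrow> (even m \<longleftrightarrow> b) | Lower i \<Rightarrow> False)"

text \<open>\<open>b\<close> selects one of two opposite orientations. Every outer point is a sink
  for exactly one of them, so each string can be started at either end.\<close>

definition sink :: "bool \<Rightarrow> site \<Rightarrow> bool" where
  "sink b s = (case s of Upper i \<Rightarrow> (even i \<longleftrightarrow> b) | Middle m \<Rightarrow> False | Lower i \<Rightarrow> (odd i \<longleftrightarrow> b))"

lemma flow_simps [simp]: "exits_above b (Upper i)" "exits_above b (Middle m) \<longleftrightarrow> (even m \<longleftrightarrow> b)" "\<not> exits_above b (Lower i)"
  "sink b (Upper i) \<longleftrightarrow> (even i \<longleftrightarrow> b)" "\<not> sink b (Middle m)" "sink b (Lower i) \<longleftrightarrow> (odd i \<longleftrightarrow> b)"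
  unfolding exits_above_def sink_def by auto

context
  assumes rigs: "rigid_map \<phi>" "rigid_map \<psi>"
begin

lemmas rigid_map\<phi> = rig_D[OF rigs(1) PI_D(1)[OF \<phi>]]
lemmas rigid_map\<psi> = rig_D[OF rigs(2) PI_D(1)[OF \<psi>]]

text \<open>A rigid arc or strand leads to a site whose parity prescribes departure through the
  other diagram. Strings that end in a dot are excluded by \<open>mu p \<noteq> p\<close>.\<close>

lemma flow_step:
  assumes s: "(ou p, s) \<in> C" and p: "mu p \<noteq> p" "\<not> sink b s"
  shows "exits_above b s \<Longrightarrow> if sink b (al s) then be (al s) = al s else \<not> exits_above b (al s)"
    "\<not> exits_above b s \<Longrightarrow> if sink b (be s) then al (be s) = be s else exits_above b (be s)"
proof -
  note alive = mu_alive[OF s p(1)]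
  assume e: "exits_above b s"
  show "if sink b (al s) then be (al s) = al s else \<not> exits_above b (al s)"
  proof (cases s)
    case (Upper i)
    note a = alive(1)[OF Upper]
    show ?thesis
    proof (cases "\<phi> (Top i)")
      case (Top j)
      then have "i \<noteq> j" using a by auto
      then show ?thesis using rigid_map\<phi>(3)[OF Top] p(2) unfolding Upper above_inv_simps Top by auto
    next
      case (Bot j)
      then show ?thesis using rigid_map\<phi>(1)[OF Bot] p(2) unfolding Upper above_inv_simps Bot by auto
    qed
  next
    case (Middle i)
    note a = alive(3)[OF Middle]
    show ?thesis
    proof (cases "\<phi> (Bot i)")
      case (Top j)
      then show ?thesis using rigid_map\<phi>(2)[OF Top] e unfolding Middle above_inv_simps Top by auto
    next
      case (Bot j)
      then have "i \<noteq> j" using a by auto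
      then show ?thesis using rigid_map\<phi>(4)[OF Bot] e unfolding Middle above_inv_simps Bot by auto
    qed
  qed (use e in simp)
next
  note alive = mu_alive[OF s p(1)]
  assume e: "\<not> exits_above b s"
  show "if sink b (be s) then al (be s) = be s else exits_above b (be s)"
  proof (cases s)
    case (Lower i)
    note a = alive(2)[OF Lower]
    show ?thesis
    proof (cases "\<psi> (Bot i)")
      case (Top j)
      then show ?thesis using rigid_map\<psi>(2)[OF Top] p(2) unfolding Lower below_inv_simps Top by auto
    next
      case (Bot j)
      then have "i \<noteq> j" using a by auto
      then show ?thesis using rigid_map\<psi>(4)[OF Bot] p(2) unfolding Lower below_inv_simps Bot by auto
    qed
  next
    case (Middle i)
    note a = alive(4)[OF Middle]
    show ?thesis
    proof (cases "\<psi> (Top i)")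
      case (Top j)
      then have "i \<noteq> j" using a by auto
      then show ?thesis using rigid_map\<psi>(3)[OF Top] e unfolding Middle below_inv_simps Top by auto
    next
      case (Bot j)
      then show ?thesis using rigid_map\<psi>(1)[OF Bot] e unfolding Middle below_inv_simps Bot by auto
    qed
  qed (use e in simp)
qed

lemma flow_start: "exits_above b (ou p) \<Longrightarrow> be (ou p) = ou p" "\<not> exits_above b (ou p) \<Longrightarrow> al (ou p) = ou p"
  by (cases p; simp)+

lemma flow_induct:
  assumes p: "mu p \<noteq> p" "\<not> sink b (ou p)" and w: "(ou p, w) \<in> C"
    and Q: "Q (ou p)" "\<And>s. (ou p, s) \<in> C \<Longrightarrow> Q s \<Longrightarrow> \<not> sink b s \<Longrightarrow> Q (if exits_above b s then al s else be s)"
  shows "Q w"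
  using w
proof (rule directed_induct[where e = "exits_above b" and stop = "sink b"])
  show "al (al s) = s" "be (be s) = s" for s by (rule inv)+
  show "if sink b (al s) then be (al s) = al s else \<not> exits_above b (al s)"
    if "(ou p, s) \<in> C" "\<not> sink b s" "exits_above b s" for s
    using flow_step(1)[OF that(1) p(1) that(2,3)] .
  show "if sink b (be s) then al (be s) = be s else exits_above b (be s)"
    if "(ou p, s) \<in> C" "\<not> sink b s" "\<not> exits_above b s" for s
    using flow_step(2)[OF that(1) p(1) that(2,3)] .
qed (fact flow_start p(2) Q)+

text \<open>Between its start and a sink the oriented string passes only middle sites, so its second
  outer end is a sink; with \<open>b\<close> chosen by the parity of the start this determines the
  parity of the other end.\<close>

lemma mu_sink:
  assumes p: "mu p \<noteq> p" "\<not> sink b (ou p)" shows "sink b (ou (mu p))"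
proof -
  let ?Q = "\<lambda>s. s = ou p \<or> (\<exists>m. s = Middle m) \<or> sink b s"
  have "?Q (ou (mu p))"
  proof (rule flow_induct[OF p mu_conn, where Q = ?Q])
    fix s assume s: "(ou p, s) \<in> C" "\<not> sink b s"
    let ?t = "if exits_above b s then al s else be s"
    have "be ?t = ?t \<or> al ?t = ?t \<Longrightarrow> sink b ?t \<or> (exits_above b s \<longleftrightarrow> \<not> exits_above b ?t)"
      using flow_step[OF s(1) p(1) s(2)] by (auto split: if_splits)
    then show "?Q ?t"
      using flow_step[OF s(1) p(1) s(2)] by (cases "?t"; cases s) (auto split: if_splits)
  qed simp
  moreover have "ou (mu p) \<noteq> ou p" using p(1) by simp
  moreover have "ou (mu p) \<noteq> Middle m" for m by (cases "mu p") auto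
  ultimately show ?thesis by blast
qed

text \<open>In the middle row the oriented string only moves to the right: bottom arcs of the upper
  diagram run from even to odd, top arcs of the lower one from odd to even, both from left to right.
  Through strands keep their order, so the string returns to its outer row to the right of its
  start.\<close>

lemma mu_monotone:
  assumes "mu p = q" "p \<noteq> q"
  shows "p = Top i \<Longrightarrow> odd i \<Longrightarrow> q = Top j \<Longrightarrow> i < j" "p = Bot i \<Longrightarrow> even i \<Longrightarrow> q = Bot j \<Longrightarrow> i < j"
proof -
  assume p: "p = Top i" "odd i" "q = Top j"
  let ?Q = "\<lambda>s. s = Upper i \<or> (\<exists>m m1. s = Middle m \<and> \<phi> (Top i) = Bot m1 \<and> m1 \<le> m) \<or>
    (\<exists>j. s = Upper j \<and> i < j \<and> even j) \<or> (\<exists>j. s = Lower j \<and> odd j)"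
  have m: "mu p \<noteq> p" "\<not> sink True (ou p)" using assms p by auto
  have "?Q (ou (mu p))"
  proof (rule flow_induct[OF m mu_conn, where Q = ?Q])
    show "?Q (ou p)" using p by simp
    fix s assume s: "(ou p, s) \<in> C" "?Q s" "\<not> sink True s"
    note alive = mu_alive[OF s(1) m(1)]
    from s(2,3) consider "s = Upper i" | k k1 where "s = Middle k" "\<phi> (Top i) = Bot k1" "k1 \<le> k"
      by auto
    then show "?Q (if exits_above True s then al s else be s)"
    proof cases
      case 1
      show ?thesis
      proof (cases "\<phi> (Top i)")
        case (Top j)
        then have "i \<noteq> j" using alive(1)[OF 1] by auto
        then show ?thesis using rigid_map\<phi>(3)[OF Top] p(2) unfolding 1 by (simp add: Top)
      qed (simp add: 1)
    next
      case (2 k)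
      show ?thesis
      proof (cases "even k")
        case True
        show ?thesis
        proof (cases "\<phi> (Bot k)")
          case (Top j)
          then have Tj: "\<phi> (Top j) = Bot k" using PI_D(1)[OF \<phi>, of "Bot k"] by simp
          have "even j" using rigid_map\<phi>(1)[OF Tj] True by simp
          then have "i \<noteq> j" using p(2) by auto
          moreover have "\<not> j < i"
            using PI_through_mono[OF \<phi> Tj 2(2)] 2(3) by auto
          ultimately show ?thesis using True \<open>even j\<close> unfolding 2(1) by (simp add: Top)
        next
          case (Bot j)
          then have "k \<noteq> j" using alive(3)[OF 2(1)] by auto
          then have "k < j" using rigid_map\<phi>(4)[OF Bot] True by blast
          then show ?thesis using True 2 by (simp add: Bot)
        qed
      next
        case False
        show ?thesis
        proof (cases "\<psi> (Top k)")
          case (Top j)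
          then have "k \<noteq> j" using alive(4)[OF 2(1)] by auto
          then have "k < j" using rigid_map\<psi>(3)[OF Top] False by blast
          then show ?thesis using False 2 by (simp add: Top)
        next
          case (Bot j)
          then show ?thesis using rigid_map\<psi>(1)[OF Bot] False unfolding 2(1) by (simp add: Bot)
        qed
      qed
    qed
  qed
  then show "i < j" using assms p by auto
next
  assume p: "p = Bot i" "even i" "q = Bot j"
  let ?Q = "\<lambda>s. s = Lower i \<or> (\<exists>m m1. s = Middle m \<and> \<psi> (Bot i) = Top m1 \<and> m1 \<le> m) \<or>
    (\<exists>j. s = Lower j \<and> i < j \<and> odd j) \<or> (\<exists>j. s = Upper j \<and> even j)"
  have m: "mu p \<noteq> p" "\<not> sink True (ou p)" using assms p by auto
  have "?Q (ou (mu p))"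
  proof (rule flow_induct[OF m mu_conn, where Q = ?Q])
    show "?Q (ou p)" using p by simp
    fix s assume s: "(ou p, s) \<in> C" "?Q s" "\<not> sink True s"
    note alive = mu_alive[OF s(1) m(1)]
    from s(2,3) consider "s = Lower i" | k k1 where "s = Middle k" "\<psi> (Bot i) = Top k1" "k1 \<le> k"
      by auto
    then show "?Q (if exits_above True s then al s else be s)"
    proof cases
      case 1
      show ?thesis
      proof (cases "\<psi> (Bot i)")
        case (Bot j)
        then have "i \<noteq> j" using alive(2)[OF 1] by auto
        then show ?thesis using rigid_map\<psi>(4)[OF Bot] p(2) unfolding 1 by (simp add: Bot)
      qed (simp add: 1)
    next
      case (2 k)
      show ?thesis
      proof (cases "even k")
        case True
        show ?thesis
        proof (cases "\<phi> (Bot k)")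
          case (Top j)
          then show ?thesis using rigid_map\<phi>(2)[OF Top] True unfolding 2(1) by (simp add: Top)
        next
          case (Bot j)
          then have "k \<noteq> j" using alive(3)[OF 2(1)] by auto
          then have "k < j" using rigid_map\<phi>(4)[OF Bot] True by blast
          then show ?thesis using True 2 by (simp add: Bot)
        qed
      next
        case False
        show ?thesis
        proof (cases "\<psi> (Top k)")
          case (Top j)
          then have "k \<noteq> j" using alive(4)[OF 2(1)] by auto
          then have "k < j" using rigid_map\<psi>(3)[OF Top] False by blast
          then show ?thesis using False 2 by (simp add: Top)
        next
          case (Bot j)
          have "odd j" using rigid_map\<psi>(1)[OF Bot] False by simp
          then have "i \<noteq> j" using p(2) by auto
          have T: "\<psi> (Top k1) = Bot i" using PI_D(1)[OF \<psi>, of "Bot i"] 2(2) by simp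
          have "k1 \<noteq> k" using T Bot \<open>i \<noteq> j\<close> by auto
          then have "i < j" using PI_through_mono[OF \<psi> T Bot] 2(3) by auto
          then show ?thesis using False \<open>odd j\<close> unfolding 2(1) by (simp add: Bot)
        qed
      qed
    qed
  qed
  then show "i < j" using assms p by auto
qed

text \<open>The parities come from \<open>mu_sink\<close>. If the left end of an arc had the wrong
  parity, \<open>mu_monotone\<close> applied from the other end would reverse the order of the
  ends.\<close>

lemma mu_rig: "rigid_map mu"
  unfolding rigid_map_def
proof (intro conjI allI impI)
  fix i j
  show "odd i = odd j" if "mu (Top i) = Bot j"
  proof -
    have "sink (odd i) (ou (mu (Top i)))" by (rule mu_sink) (use that in auto)
    then show ?thesis using that by auto
  qed
  show "odd i" if m: "mu (Top i) = Top j" "i < j"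
  proof (rule ccontr)
    assume i: "\<not> odd i"
    have "sink (odd i) (ou (mu (Top i)))" by (rule mu_sink) (use m in auto)
    then have "odd j" using m i by auto
    moreover have "mu (Top j) = Top i" using mu_mu[of "Top i"] m by simp
    ultimately have "j < i" using mu_monotone(1)[of "Top j" "Top i"] m by auto
    then show False using m by simp
  qed
  then show "even j" if m: "mu (Top i) = Top j" "i < j"
  proof -
    have "sink (odd i) (ou (mu (Top i)))" by (rule mu_sink) (use m in auto)
    then show ?thesis using m \<open>\<lbrakk>mu (Top i) = Top j; i < j\<rbrakk> \<Longrightarrow> odd i\<close> by auto
  qed
  show "even i" if m: "mu (Bot i) = Bot j" "i < j"
  proof (rule ccontr)
    assume i: "\<not> even i"
    have "sink (even i) (ou (mu (Bot i)))" by (rule mu_sink) (use m in auto)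
    then have "even j" using m i by auto
    moreover have "mu (Bot j) = Bot i" using mu_mu[of "Bot i"] m by simp
    ultimately have "j < i" using mu_monotone(2)[of "Bot j" "Bot i"] m by auto
    then show False using m by simp
  qed
  then show "odd j" if m: "mu (Bot i) = Bot j" "i < j"
  proof -
    have "sink (even i) (ou (mu (Bot i)))" by (rule mu_sink) (use m in auto)
    then show ?thesis using m \<open>\<lbrakk>mu (Bot i) = Bot j; i < j\<rbrakk> \<Longrightarrow> even i\<close> by auto
  qed
qed

end

end

section \<open>The truncated monoids\<close>

context stacked
begin

lemma mu_cup:
  assumes "\<phi> (Top i) = Bot m" "\<psi> (Top m) = Top m'" "\<phi> (Top j) = Bot m'" "i \<noteq> j" shows "mu (Top i) = Top j"
proof -
  have "(Upper i, Middle m) \<in> C" using conn_step(1)[of "Upper i" al be] assms by simp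
  moreover have "(Middle m, Middle m') \<in> C" using conn_step(2)[of "Middle m" be al] assms by simp
  moreover have "(Middle m', Upper j) \<in> C" using conn_step(1)[of "Upper j" al be] assms C_sym by fastforce
  ultimately have "(Upper i, Upper j) \<in> C" by (metis conn_trans)
  then have "(ou (Top i), ou (Top j)) \<in> C" by simp
  then show ?thesis using mu_unique assms(4) by auto
qed

lemma mu_cap:
  assumes "\<psi> (Bot i) = Top m" "\<phi> (Bot m) = Bot m'" "\<psi> (Bot j) = Top m'" "i \<noteq> j" shows "mu (Bot i) = Bot j"
proof -
  have "(Lower i, Middle m) \<in> C" using conn_step(2)[of "Lower i" be al] assms by simp
  moreover have "(Middle m, Middle m') \<in> C" using conn_step(1)[of "Middle m" al be] assms by simp
  moreover have "(Middle m', Lower j) \<in> C" using conn_step(2)[of "Lower j" be al] assms C_sym by fastforce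
  ultimately have "(Lower i, Lower j) \<in> C" by (metis conn_trans)
  then have "(ou (Bot i), ou (Bot j)) \<in> C" by simp
  then show ?thesis using mu_unique assms(4) by auto
qed

end

definition through_tops :: "(point \<Rightarrow> point) \<Rightarrow> nat set" where
  "through_tops \<phi> = {i. \<exists>j. \<phi> (Top i) = Bot j}"

lemma finite_thr: assumes "\<phi> \<in> planar_involutions n" shows "finite (through_tops \<phi>)"
proof (rule finite_subset)
  have "1 \<le> i \<and> i \<le> 2 * n" if "i \<in> through_tops \<phi>" for i
  proof (rule ccontr)
    assume "\<not> ?thesis"
    then have "Top i \<notin> points n" by auto
    then have "\<phi> (Top i) = Top i" using PI_D(2)[OF assms] by blast
    then show False using that unfolding through_tops_def by auto
  qed
  then show "through_tops \<phi> \<subseteq> {1..2 * n}" by auto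
qed simp

lemma through_strands_dg:
  assumes \<phi>: "\<phi> \<in> planar_involutions n" shows "through_strands (diagram_of n \<phi>) = card (through_tops \<phi>)"
proof -
  have "{B \<in> diagram_of n \<phi>. \<exists>i j. B = {Top i, Bot j}} = (\<lambda>i. {Top i, \<phi> (Top i)}) ` through_tops \<phi>"
  proof (intro equalityI subsetI)
    fix B assume "B \<in> {B \<in> diagram_of n \<phi>. \<exists>i j. B = {Top i, Bot j}}"
    then obtain i j where B: "B \<in> diagram_of n \<phi>" "B = {Top i, Bot j}" by blast
    have "B = {Top i, \<phi> (Top i)}" using dg_block[OF \<phi> B(1), of "Top i"] B(2) by blast
    moreover from this have "\<phi> (Top i) = Bot j" using B(2) by (auto simp: doubleton_eq_iff)
    ultimately show "B \<in> (\<lambda>i. {Top i, \<phi> (Top i)}) ` through_tops \<phi>" unfolding through_tops_def by blast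
  next
    fix B assume "B \<in> (\<lambda>i. {Top i, \<phi> (Top i)}) ` through_tops \<phi>"
    then obtain i j where i: "B = {Top i, \<phi> (Top i)}" "\<phi> (Top i) = Bot j" unfolding through_tops_def by blast
    have "Top i \<in> points n" using PI_D(2)[OF \<phi>, of "Top i"] i(2) by auto
    then show "B \<in> {B \<in> diagram_of n \<phi>. \<exists>i j. B = {Top i, Bot j}}" using dg_memI[of "Top i" n \<phi>] i by auto
  qed
  moreover have "inj_on (\<lambda>i. {Top i, \<phi> (Top i)}) (through_tops \<phi>)"
    by (rule inj_onI) (auto simp: through_tops_def doubleton_eq_iff)
  ultimately show ?thesis unfolding through_strands_def by (simp add: card_image)
qed

context stacked
begin

lemma thr_mu_subset: "through_tops mu \<subseteq> through_tops \<phi>"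
proof
  fix i assume "i \<in> through_tops mu"
  then have "mu (Top i) \<noteq> Top j" for j unfolding through_tops_def by auto
  then have "\<phi> (Top i) \<noteq> Top j" for j using mu_Top by blast
  then show "i \<in> through_tops \<phi>" unfolding through_tops_def by (cases "\<phi> (Top i)") auto
qed

text \<open>A strand of the product starts as a strand of the upper factor and reaches the bottom
  row through a strand of the lower one; distinct strands use distinct ones.\<close>

lemma card_thr_mu: "card (through_tops mu) \<le> card (through_tops \<phi>)" "card (through_tops mu) \<le> card (through_tops \<psi>)"
proof -
  show "card (through_tops mu) \<le> card (through_tops \<phi>)" using card_mono[OF finite_thr[OF \<phi>] thr_mu_subset] .
  have ex: "\<exists>m. m \<in> through_tops \<psi> \<and> \<psi> (mu (Top i)) = Top m" if i: "i \<in> through_tops mu" for i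
  proof -
    obtain j where j: "mu (Top i) = Bot j" using i unfolding through_tops_def by blast
    have "mu (Bot j) = Top i" using mu_mu[of "Top i"] j by simp
    then obtain m where m: "\<psi> (Bot j) = Top m" using mu_Bot[of j] by (cases "\<psi> (Bot j)") auto
    then have "\<psi> (Top m) = Bot j" using PI_D(1)[OF \<psi>, of "Bot j"] by simp
    then show ?thesis unfolding through_tops_def using m j by auto
  qed
  define h where "h i = (SOME m. m \<in> through_tops \<psi> \<and> \<psi> (mu (Top i)) = Top m)" for i
  have h: "h i \<in> through_tops \<psi>" "\<psi> (mu (Top i)) = Top (h i)" if "i \<in> through_tops mu" for i
    using someI_ex[OF ex[OF that]] unfolding h_def by blast+
  have "inj_on h (through_tops mu)"
  proof (rule inj_onI)
    fix x y assume "x \<in> through_tops mu" "y \<in> through_tops mu" "h x = h y"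
    then have "\<psi> (mu (Top x)) = \<psi> (mu (Top y))" using h(2) by simp
    then have "mu (Top x) = mu (Top y)" using PI_D(1)[OF \<psi>] by metis
    then show "x = y" using mu_mu by (metis point.inject(1))
  qed
  then show "card (through_tops mu) \<le> card (through_tops \<psi>)"
    using card_inj_on_le[of h "through_tops mu" "through_tops \<psi>"] h(1) finite_thr[OF \<psi>] by blast
qed

end

lemma motzkin_mult:
  assumes "a \<in> motzkin_diagrams n" "b \<in> motzkin_diagrams n"
  shows "diagram_mult n a b \<in> motzkin_diagrams n" "through_strands (diagram_mult n a b) \<le> through_strands a"
    "through_strands (diagram_mult n a b) \<le> through_strands b"
    "a \<in> rigid_motzkin_diagrams n \<Longrightarrow> b \<in> rigid_motzkin_diagrams n \<Longrightarrow> diagram_mult n a b \<in> rigid_motzkin_diagrams n"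
proof -
  obtain \<phi> \<psi> where a: "\<phi> \<in> planar_involutions n" "a = diagram_of n \<phi>" and b: "\<psi> \<in> planar_involutions n" "b = diagram_of n \<psi>"
    using motzkin_dg assms by metis
  interpret stacked n \<phi> \<psi> by unfold_locales fact+
  have m: "diagram_mult n a b = diagram_of n mu" using mult_dg a(2) b(2) by simp
  show "diagram_mult n a b \<in> motzkin_diagrams n" unfolding m by (rule dg_motzkin[OF mu_PI])
  have "through_strands a = card (through_tops \<phi>)" "through_strands b = card (through_tops \<psi>)"
    using through_strands_dg a b by auto
  then show "through_strands (diagram_mult n a b) \<le> through_strands a" "through_strands (diagram_mult n a b) \<le> through_strands b"
    unfolding m through_strands_dg[OF mu_PI] by (simp_all add: card_thr_mu)
  assume "a \<in> rigid_motzkin_diagrams n" "b \<in> rigid_motzkin_diagrams n"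
  then have "rigid_map \<phi>" "rigid_map \<psi>" using dg_rigid_iff a b by blast+
  then have "rigid_map mu" by (rule mu_rig)
  then show "diagram_mult n a b \<in> rigid_motzkin_diagrams n" unfolding m using dg_rigid_iff[OF mu_PI] by blast
qed

lemma id_noncrossing: "id \<in> noncrossing A"
  unfolding noncrossing_def by auto

lemma data_id: "I \<subseteq> {1..2 * n} \<Longrightarrow> half_diagrams n id id I id"
  unfolding half_diagrams_def free_at_def by (auto simp: id_noncrossing)

abbreviation "diagram_from n f g I \<sigma> \<equiv> diagram_of n (strand_map f g I \<sigma>)"

lemma one_mkd: "diagram_one n = diagram_from n id id {1..2 * n} id"
proof -
  have t: "strand_map id id {1..2 * n} id (Top i) = Bot i" "strand_map id id {1..2 * n} id (Bot i) = Top i" if "i \<in> {1..2 * n}" for i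
    using mk_simps(1)[OF that, of id id id] mk_Bot[of id "{1..2 * n}" i id id] that by simp_all
  show ?thesis
  proof (rule Set.set_eqI)
    fix B
    have "B \<in> diagram_from n id id {1..2 * n} id \<longleftrightarrow> (\<exists>i\<in>{1..2 * n}. B = {Top i, Bot i} \<or> B = {Bot i, Top i})"
      unfolding diagram_of_def points_def using t by fastforce
    then show "B \<in> diagram_one n \<longleftrightarrow> B \<in> diagram_from n id id {1..2 * n} id"
      unfolding diagram_one_def by (auto simp: insert_commute)
  qed
qed

lemma one_mk: "i \<in> {1..2 * n} \<Longrightarrow> strand_map id id {1..2 * n} id (Top i) = Bot i \<and> strand_map id id {1..2 * n} id (Bot i) = Top i"
  using mk_simps(1)[of i "{1..2 * n}" id id id] mk_Bot[of id "{1..2 * n}" i id id] by simp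

text \<open>Each middle site is tied to the outer site with the same number, so a block of
  \<open>a\<close> is carried over by a string through at most two middle sites. The other outer row
  already belongs to \<open>a\<close>.\<close>

lemma mult_one:
  assumes "a \<in> motzkin_diagrams n"
  shows "diagram_mult n (diagram_one n) a = a" "diagram_mult n a (diagram_one n) = a"
proof -
  obtain \<phi> where a: "\<phi> \<in> planar_involutions n" "a = diagram_of n \<phi>" using motzkin_dg assms by metis
  define o1 where "o1 = strand_map id id {1..2 * n} id"
  have o: "o1 \<in> planar_involutions n" unfolding o1_def by (rule mk_PI[OF data_id]) simp
  have o1: "o1 (Top i) = Bot i" "o1 (Bot i) = Top i" if "1 \<le> i" "i \<le> 2 * n" for i
    unfolding o1_def using one_mk[of i n] that by auto
  have p: "\<phi> (Top i) = Top j \<Longrightarrow> 1 \<le> j \<and> j \<le> 2 * n" "\<phi> (Top i) = Bot j \<Longrightarrow> 1 \<le> j \<and> j \<le> 2 * n"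
    "\<phi> (Bot i) = Top j \<Longrightarrow> 1 \<le> j \<and> j \<le> 2 * n" "\<phi> (Bot i) = Bot j \<Longrightarrow> 1 \<le> j \<and> j \<le> 2 * n"
    if "1 \<le> i" "i \<le> 2 * n" for i j
    using PI_D(3)[OF a(1), of "Top i"] PI_D(3)[OF a(1), of "Bot i"] that by auto
  note invp = PI_D(1)[OF a(1)]
  have "stacked.mu o1 \<phi> = \<phi>"
  proof
    interpret stacked n o1 \<phi> by unfold_locales (use o a in auto)
    fix q
    show "mu q = \<phi> q"
    proof (cases "q \<in> points n")
      case False then show ?thesis using mu_outside PI_D(2)[OF a(1)] by simp
    next
      case True
      show ?thesis
      proof (cases q)
        case (Top i)
        then have i: "1 \<le> i" "i \<le> 2 * n" using True by auto
        show ?thesis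
        proof (cases "\<phi> (Top i)")
          case (Top j)
          show ?thesis
          proof (cases "i = j")
            case True
            then show ?thesis using mu_Top_dead[OF o1(1)[OF i]] Top \<open>q = Top i\<close> by simp
          next
            case False
            then show ?thesis using mu_cup[OF o1(1)[OF i] Top, of j] o1(1)[of j] p(1)[OF i Top] Top \<open>q = Top i\<close> by simp
          qed
        next
          case (Bot j)
          then show ?thesis using mu_through[OF o1(1)[OF i] Bot] Top by simp
        qed
      next
        case (Bot i)
        then have i: "1 \<le> i" "i \<le> 2 * n" using True by auto
        show ?thesis
        proof (cases "\<phi> (Bot i)")
          case (Top j)
          then have j: "1 \<le> j" "j \<le> 2 * n" using p(3)[OF i] by auto
          have "\<phi> (Top j) = Bot i" using invp[of "Bot i"] Top by simp
          then have "mu (Top j) = Bot i" using mu_through[OF o1(1)[OF j]] by simp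
          then have "mu (Bot i) = Top j" using mu_mu[of "Top j"] by simp
          then show ?thesis using Top Bot by simp
        next
          fix j assume "\<phi> (Bot i) = Bot j"
          then show ?thesis using mu_Bot Bot by simp
        qed
      qed
    qed
  qed
  then show "diagram_mult n (diagram_one n) a = a"
    using stacked.mult_dg[of n o1 \<phi>] o a unfolding stacked_def one_mkd o1_def[symmetric] by simp
  have "stacked.mu \<phi> o1 = \<phi>"
  proof
    interpret stacked n \<phi> o1 by unfold_locales (use o a in auto)
    fix q
    show "mu q = \<phi> q"
    proof (cases "q \<in> points n")
      case False then show ?thesis using mu_outside PI_D(2)[OF a(1)] by simp
    next
      case True
      show ?thesis
      proof (cases q)
        case (Bot i)
        then have i: "1 \<le> i" "i \<le> 2 * n" using True by auto
        show ?thesis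
        proof (cases "\<phi> (Bot i)")
          case (Bot j)
          show ?thesis
          proof (cases "i = j")
            case True
            then show ?thesis using mu_Bot_dead[OF o1(2)[OF i]] Bot \<open>q = Bot i\<close> by simp
          next
            case False
            then show ?thesis using mu_cap[OF o1(2)[OF i] Bot, of j] o1(2)[of j] p(4)[OF i Bot] Bot \<open>q = Bot i\<close> by simp
          qed
        next
          case (Top j)
          then have j: "1 \<le> j" "j \<le> 2 * n" using p(3)[OF i] by auto
          have "\<phi> (Top j) = Bot i" using invp[of "Bot i"] Top by simp
          then have "mu (Top j) = Bot i" using mu_through[of j i] o1(1)[OF i] by simp
          then have "mu (Bot i) = Top j" using mu_mu[of "Top j"] by simp
          then show ?thesis using Top Bot by simp
        qed
      next
        case (Top i)
        then have i: "1 \<le> i" "i \<le> 2 * n" using True by auto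
        show ?thesis
        proof (cases "\<phi> (Top i)")
          case (Bot j)
          then have "1 \<le> j" "j \<le> 2 * n" using p(2)[OF i] by auto
          then show ?thesis using mu_through[OF Bot o1(1)] Top Bot by simp
        next
          fix j assume "\<phi> (Top i) = Top j"
          then show ?thesis using mu_Top Top by simp
        qed
      qed
    qed
  qed
  then show "diagram_mult n a (diagram_one n) = a"
    using stacked.mult_dg[of n \<phi> o1] o a unfolding stacked_def one_mkd o1_def[symmetric] by simp
qed

lemma thr_mk: "through_tops (strand_map f g I \<sigma>) = I"
  unfolding through_tops_def strand_map_def by auto

lemma through_mkd: "half_diagrams n f g I \<sigma> \<Longrightarrow> through_strands (diagram_from n f g I \<sigma>) = card I"
  using through_strands_dg[OF mk_PI] thr_mk by simp

lemma mkd_motzkin: "half_diagrams n f g I \<sigma> \<Longrightarrow> diagram_from n f g I \<sigma> \<in> motzkin_diagrams n"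
  by (rule dg_motzkin[OF mk_PI])

lemma motzkin_mkd:
  assumes "a \<in> motzkin_diagrams n"
  obtains f g I \<sigma> where "half_diagrams n f g I \<sigma>" "a = diagram_from n f g I \<sigma>"
  using motzkin_dg[OF assms] PI_eq_mk by metis

lemma mkd_eq_D:
  assumes "half_diagrams n f g I \<sigma>" "half_diagrams n f' g' I' \<sigma>'" "diagram_from n f g I \<sigma> = diagram_from n f' g' I' \<sigma>'"
  shows "f = f'" "g = g'" "I = I'" "\<And>i. i \<in> I \<Longrightarrow> \<sigma> i = \<sigma>' i"
proof -
  have m: "strand_map f g I \<sigma> = strand_map f' g' I' \<sigma>'" by (rule dg_inject[OF mk_PI[OF assms(1)] mk_PI[OF assms(2)] assms(3)])
  show I: "I = I'" using m thr_mk by metis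
  show s: "\<And>i. i \<in> I \<Longrightarrow> \<sigma> i = \<sigma>' i" using m mk_simps(1) I by (metis point.inject(2))
  then have im: "\<sigma> ` I = \<sigma>' ` I'" using I by simp
  show "f = f'"
  proof
    fix i show "f i = f' i"
    proof (cases "i \<in> I")
      case True
      then show ?thesis using free_at_less(2)[OF data_D(7)[OF assms(1)]] free_at_less(2)[OF data_D(7)[OF assms(2)]] I by simp
    next
      case False
      then show ?thesis using m mk_simps(2) I by (metis point.inject(1))
    qed
  qed
  show "g = g'"
  proof
    fix j show "g j = g' j"
    proof (cases "j \<in> \<sigma> ` I")
      case True
      then have "j \<in> \<sigma>' ` I'" using im by simp
      then show ?thesis using True free_at_less(2)[OF data_D(8)[OF assms(1)]] free_at_less(2)[OF data_D(8)[OF assms(2)]] by force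
    next
      case False
      then show ?thesis using m mk_simps(3) im by (metis point.inject(2))
    qed
  qed
qed

text \<open>The strands of the upper factor end exactly where those of the lower factor begin, so
  they are composed; \<open>g\<close> and \<open>f'\<close> live in the middle row away from the
  strands and disappear.\<close>

lemma mult_mkd:
  assumes d: "half_diagrams n f g I \<sigma>" "half_diagrams n f' g' (\<sigma> ` I) \<sigma>'"
  shows "diagram_mult n (diagram_from n f g I \<sigma>) (diagram_from n f' g' (\<sigma> ` I) \<sigma>') = diagram_from n f g' I (\<sigma>' \<circ> \<sigma>)"
    "half_diagrams n f g' I (\<sigma>' \<circ> \<sigma>)"
proof -
  note D = data_D[OF d(1)] and D' = data_D[OF d(2)]
  have im: "(\<sigma>' \<circ> \<sigma>) ` I = \<sigma>' ` \<sigma> ` I" by (simp add: image_comp)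
  show d': "half_diagrams n f g' I (\<sigma>' \<circ> \<sigma>)"
    unfolding half_diagrams_def im using D D' by auto
  interpret stacked n "strand_map f g I \<sigma>" "strand_map f' g' (\<sigma> ` I) \<sigma>'" by unfold_locales (rule mk_PI[OF d(1)], rule mk_PI[OF d(2)])
  have "mu q = strand_map f g' I (\<sigma>' \<circ> \<sigma>) q" for q
  proof (cases q)
    case (Top i)
    show ?thesis
    proof (cases "i \<in> I")
      case True
      then have "mu (Top i) = Bot (\<sigma>' (\<sigma> i))" by (intro mu_through[of i "\<sigma> i"] mk_simps(1)) auto
      then show ?thesis using Top mk_simps(1)[OF True, of f g' "\<sigma>' \<circ> \<sigma>"] by simp
    next
      case False
      then show ?thesis using mu_Top[OF mk_simps(2)[OF False]] Top mk_simps(2)[OF False] by simp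
    qed
  next
    case (Bot j)
    show ?thesis
    proof (cases "j \<in> \<sigma>' ` \<sigma> ` I")
      case True
      then obtain i where i: "i \<in> I" "j = (\<sigma>' \<circ> \<sigma>) i" by auto
      have "mu (Top i) = Bot j" using i by (intro mu_through[of i "\<sigma> i"]) (auto simp: mk_simps(1))
      then have "mu (Bot j) = Top i" using mu_mu[of "Top i"] by simp
      then show ?thesis using Bot mk_Bot[OF data_D(5)[OF d'] i(1)] i(2) by simp
    next
      case False
      then show ?thesis using mu_Bot[OF mk_simps(3)[OF False]] Bot mk_simps(3)[of j "\<sigma>' \<circ> \<sigma>" I] im by simp
    qed
  qed
  then have "mu = strand_map f g' I (\<sigma>' \<circ> \<sigma>)" by blast
  then show "diagram_mult n (diagram_from n f g I \<sigma>) (diagram_from n f' g' (\<sigma> ` I) \<sigma>') = diagram_from n f g' I (\<sigma>' \<circ> \<sigma>)"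
    using mult_dg by simp
qed

lemma mk_cong: "(\<And>i. i \<in> I \<Longrightarrow> \<sigma> i = \<sigma>' i) \<Longrightarrow> half_diagrams n f g I \<sigma> \<Longrightarrow> half_diagrams n f g I \<sigma>' \<Longrightarrow> diagram_from n f g I \<sigma> = diagram_from n f g I \<sigma>'"
proof -
  assume s: "\<And>i. i \<in> I \<Longrightarrow> \<sigma> i = \<sigma>' i" and d: "half_diagrams n f g I \<sigma>" "half_diagrams n f g I \<sigma>'"
  have im: "\<sigma> ` I = \<sigma>' ` I" using s by simp
  have "strand_map f g I \<sigma> q = strand_map f g I \<sigma>' q" for q
  proof (cases q)
    case (Top i)
    then show ?thesis using s unfolding strand_map_def by simp
  next
    case (Bot j)
    show ?thesis
    proof (cases "j \<in> \<sigma> ` I")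
      case True
      then obtain i where i: "i \<in> I" "j = \<sigma> i" by blast
      then show ?thesis using mk_Bot[OF data_D(5)[OF d(1)] i(1)] mk_Bot[OF data_D(5)[OF d(2)] i(1)] s[OF i(1)] Bot by simp
    next
      case False
      then show ?thesis using Bot mk_simps(3) im by metis
    qed
  qed
  then show ?thesis by (metis ext)
qed

lemma data_cong: "(\<And>i. i \<in> I \<Longrightarrow> \<sigma> i = \<sigma>' i) \<Longrightarrow> half_diagrams n f g I \<sigma> \<Longrightarrow> half_diagrams n f g I \<sigma>'"
  unfolding half_diagrams_def by auto

definition rigid_top :: "(nat \<Rightarrow> nat) \<Rightarrow> bool" where
  "rigid_top f \<longleftrightarrow> (\<forall>x. x < f x \<longrightarrow> odd x \<and> even (f x))"

definition rigid_bot :: "(nat \<Rightarrow> nat) \<Rightarrow> bool" where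
  "rigid_bot g \<longleftrightarrow> (\<forall>x. x < g x \<longrightarrow> even x \<and> odd (g x))"

lemma mkd_rigid_iff:
  assumes d: "half_diagrams n f g I \<sigma>"
  shows "diagram_from n f g I \<sigma> \<in> rigid_motzkin_diagrams n \<longleftrightarrow> rigid_top f \<and> rigid_bot g \<and> (\<forall>i\<in>I. odd i = odd (\<sigma> i))"
proof -
  note D = data_D[OF d]
  have fI: "f i = i" if "i \<in> I" for i using free_at_less(2)[OF D(7)[OF that]] .
  have gI: "g i = i" if "i \<in> \<sigma> ` I" for i using free_at_less(2)[OF D(8)] that by blast
  have 1: "(\<forall>i j. strand_map f g I \<sigma> (Top i) = Bot j \<longrightarrow> odd i = odd j) \<longleftrightarrow> (\<forall>i\<in>I. odd i = odd (\<sigma> i))"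
    unfolding strand_map_def by auto
  have t: "strand_map f g I \<sigma> (Top i) = Top j \<longleftrightarrow> i \<notin> I \<and> j = f i" for i j unfolding strand_map_def by auto
  have bb: "strand_map f g I \<sigma> (Bot i) = Bot j \<longleftrightarrow> i \<notin> \<sigma> ` I \<and> j = g i" for i j unfolding strand_map_def by auto
  have "x \<notin> I" if "x < f x" for x using fI[of x] that by auto
  then have 2: "(\<forall>i j. strand_map f g I \<sigma> (Top i) = Top j \<longrightarrow> i < j \<longrightarrow> odd i \<and> even j) \<longleftrightarrow> rigid_top f"
    unfolding rigid_top_def t by blast
  have "x \<notin> \<sigma> ` I" if "x < g x" for x using gI[of x] that by auto
  then have 3: "(\<forall>i j. strand_map f g I \<sigma> (Bot i) = Bot j \<longrightarrow> i < j \<longrightarrow> even i \<and> odd j) \<longleftrightarrow> rigid_bot g"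
    unfolding rigid_bot_def bb by blast
  show ?thesis unfolding dg_rigid_iff[OF mk_PI[OF d]] rigid_map_def 1 2 3 by blast
qed

lemma motzkin_Union: "a \<in> motzkin_diagrams n \<Longrightarrow> \<Union> a \<subseteq> points n"
  unfolding motzkin_diagrams_def partition_on_def by auto

lemma one_rigid: "diagram_one n \<in> rigid_motzkin_diagrams n" "diagram_one n \<in> motzkin_diagrams n"
proof -
  have d: "half_diagrams n id id {1..2 * n} id" by (rule data_id) simp
  show "diagram_one n \<in> rigid_motzkin_diagrams n"
    unfolding one_mkd mkd_rigid_iff[OF d] by (simp add: rigid_top_def rigid_bot_def)
  show "diagram_one n \<in> motzkin_diagrams n" unfolding one_mkd by (rule mkd_motzkin[OF d])
qed

lemma finite_motzkin: "finite (motzkin_diagrams n)"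
proof (rule finite_subset)
  show "motzkin_diagrams n \<subseteq> Pow (Pow (points n))" using motzkin_Union by blast
qed (simp add: finite_points)

lemma MoT_simps [simp]:
  "carrier (MoT n) = insert (diagram_one n) {a \<in> motzkin_diagrams n. real (through_strands a) \<le> 2 * sqrt (2 * real n)}"
  "a \<otimes>\<^bsub>MoT n\<^esub> b = diagram_mult n a b" "\<one>\<^bsub>MoT n\<^esub> = diagram_one n"
  "carrier (rMoT n) = insert (diagram_one n) {a \<in> rigid_motzkin_diagrams n. real (through_strands a) \<le> 2 * sqrt (2 * real n)}"
  "a \<otimes>\<^bsub>rMoT n\<^esub> b = diagram_mult n a b" "\<one>\<^bsub>rMoT n\<^esub> = diagram_one n"
  unfolding MoT_def rMoT_def truncate_diagrams_def Mo_def rMo_def by simp_all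

lemma rMoT_subset: "carrier (rMoT n) \<subseteq> carrier (MoT n)"
  by (auto simp: rigid_motzkin_diagrams_def)

lemma MoT_motzkin: "a \<in> carrier (MoT n) \<Longrightarrow> a \<in> motzkin_diagrams n"
  using one_rigid by auto

lemma finite_MoT: "finite (carrier (MoT n))" "finite (carrier (rMoT n))"
proof -
  show "finite (carrier (MoT n))" by (rule finite_subset[OF _ finite_motzkin]) (use MoT_motzkin in blast)
  then show "finite (carrier (rMoT n))" using rMoT_subset finite_subset by blast
qed

lemma MoT_closed:
  assumes "a \<in> carrier (MoT n)" "b \<in> carrier (MoT n)" shows "diagram_mult n a b \<in> carrier (MoT n)"
proof (cases "a = diagram_one n")
  case True
  then show ?thesis using mult_one(1)[OF MoT_motzkin[OF assms(2)]] assms(2) by simp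
next
  case False
  note m = MoT_motzkin[OF assms(1)] MoT_motzkin[OF assms(2)]
  have "real (through_strands (diagram_mult n a b)) \<le> real (through_strands a)" using motzkin_mult(2)[OF m] by simp
  then show ?thesis using False assms(1) motzkin_mult(1)[OF m] by auto
qed

lemma rMoT_rigid: "a \<in> carrier (rMoT n) \<Longrightarrow> a \<in> rigid_motzkin_diagrams n"
  using one_rigid by auto

lemma rMoT_closed:
  assumes "a \<in> carrier (rMoT n)" "b \<in> carrier (rMoT n)" shows "diagram_mult n a b \<in> carrier (rMoT n)"
proof -
  have "diagram_mult n a b \<in> carrier (MoT n)" using MoT_closed assms rMoT_subset by blast
  moreover have "diagram_mult n a b \<in> rigid_motzkin_diagrams n"
    using motzkin_mult(4)[OF MoT_motzkin MoT_motzkin rMoT_rigid rMoT_rigid] assms rMoT_subset by blast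
  ultimately show ?thesis by auto
qed

lemma monoid_MoT: "monoid (MoT n)" "monoid (rMoT n)"
proof -
  note A = diagram_mult_assoc[OF motzkin_Union motzkin_Union motzkin_Union]
  show "monoid (MoT n)"
  proof (rule monoidI)
    fix x y z assume "x \<in> carrier (MoT n)" "y \<in> carrier (MoT n)" "z \<in> carrier (MoT n)"
    then have "x \<in> motzkin_diagrams n" "y \<in> motzkin_diagrams n" "z \<in> motzkin_diagrams n" using MoT_motzkin by blast+
    then show "x \<otimes>\<^bsub>MoT n\<^esub> y \<otimes>\<^bsub>MoT n\<^esub> z = x \<otimes>\<^bsub>MoT n\<^esub> (y \<otimes>\<^bsub>MoT n\<^esub> z)" using A by simp
  next
    show "x \<otimes>\<^bsub>MoT n\<^esub> y \<in> carrier (MoT n)" if "x \<in> carrier (MoT n)" "y \<in> carrier (MoT n)" for x y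
      using MoT_closed[OF that] unfolding MoT_simps(2) .
    show "\<one>\<^bsub>MoT n\<^esub> \<in> carrier (MoT n)" by simp
    show "\<one>\<^bsub>MoT n\<^esub> \<otimes>\<^bsub>MoT n\<^esub> x = x" "x \<otimes>\<^bsub>MoT n\<^esub> \<one>\<^bsub>MoT n\<^esub> = x" if "x \<in> carrier (MoT n)" for x
      unfolding MoT_simps(2,3) using mult_one MoT_motzkin[OF that] by blast+
  qed
  show "monoid (rMoT n)"
  proof (rule monoidI)
    fix x y z assume "x \<in> carrier (rMoT n)" "y \<in> carrier (rMoT n)" "z \<in> carrier (rMoT n)"
    then have "x \<in> motzkin_diagrams n" "y \<in> motzkin_diagrams n" "z \<in> motzkin_diagrams n"
      using MoT_motzkin rMoT_subset by blast+
    then show "x \<otimes>\<^bsub>rMoT n\<^esub> y \<otimes>\<^bsub>rMoT n\<^esub> z = x \<otimes>\<^bsub>rMoT n\<^esub> (y \<otimes>\<^bsub>rMoT n\<^esub> z)" using A by simp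
  next
    show "x \<otimes>\<^bsub>rMoT n\<^esub> y \<in> carrier (rMoT n)" if "x \<in> carrier (rMoT n)" "y \<in> carrier (rMoT n)" for x y
      using rMoT_closed[OF that] unfolding MoT_simps(5) .
    show "\<one>\<^bsub>rMoT n\<^esub> \<in> carrier (rMoT n)" by simp
    show "\<one>\<^bsub>rMoT n\<^esub> \<otimes>\<^bsub>rMoT n\<^esub> x = x" "x \<otimes>\<^bsub>rMoT n\<^esub> \<one>\<^bsub>rMoT n\<^esub> = x" if "x \<in> carrier (rMoT n)" for x
    proof -
      have "x \<in> motzkin_diagrams n" using MoT_motzkin rMoT_subset that by blast
      then show "\<one>\<^bsub>rMoT n\<^esub> \<otimes>\<^bsub>rMoT n\<^esub> x = x" "x \<otimes>\<^bsub>rMoT n\<^esub> \<one>\<^bsub>rMoT n\<^esub> = x"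
        using mult_one unfolding MoT_simps(5,6) by blast+
    qed
  qed
qed

section \<open>Representations of finite monoids\<close>

lemma vec_subspace_iff:
  "subspace class_ring W (module_vec TYPE('k::field) d) \<longleftrightarrow>
    W \<subseteq> carrier_vec d \<and> 0\<^sub>v d \<in> W \<and> (\<forall>v\<in>W. \<forall>w\<in>W. v + w \<in> W) \<and> (\<forall>c. \<forall>v\<in>W. c \<cdot>\<^sub>v v \<in> W)"
  (is "?L \<longleftrightarrow> ?R")
proof
  assume ?L
  then interpret subspace class_ring W "module_vec TYPE('k) d" .
  interpret submodule class_ring W "module_vec TYPE('k) d" by (rule submod)
  show ?R
    using subset m_closed zero_closed smult_closed by (simp add: module_vec_simps class_ring_simps)
next
  assume ?R
  interpret V: vec_space "TYPE('k)" d .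
  have "submodule class_ring W (module_vec TYPE('k) d)"
    by (rule submodule.intro) (use \<open>?R\<close> V.module_axioms in \<open>simp_all add: module_vec_simps class_ring_simps\<close>)
  then show ?L
    by (rule subspace.intro[OF V.vectorspace_axioms])
qed

text \<open>Elimination of the last coordinate: suitable multiples of one vector that is nonzero
  there are subtracted from the others, and these stay independent with one coordinate less.\<close>

lemma card_le_of_independent:
  fixes v :: "'i \<Rightarrow> nat \<Rightarrow> 'k :: field"
  assumes "finite X" "\<And>c. (\<And>t. t < d \<Longrightarrow> (\<Sum>i\<in>X. c i * v i t) = 0) \<Longrightarrow> \<forall>i\<in>X. c i = 0"
  shows "card X \<le> d"
  using assms
proof (induction d arbitrary: X v)
  case 0
  have "\<forall>i\<in>X. (1 :: 'k) = 0" by (rule 0(2)[of "\<lambda>_. 1"]) simp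
  then have "X = {}" by auto
  then show ?case by simp
next
  case (Suc d)
  show ?case
  proof (cases "\<exists>i\<in>X. v i d \<noteq> 0")
    case False
    have "card X \<le> d"
    proof (rule Suc.IH[OF Suc.prems(1), of v])
      fix c :: "'i \<Rightarrow> 'k" assume "\<And>t. t < d \<Longrightarrow> (\<Sum>i\<in>X. c i * v i t) = 0"
      then have "(\<Sum>i\<in>X. c i * v i t) = 0" if "t < Suc d" for t
        using False that by (cases "t = d") auto
      then show "\<forall>i\<in>X. c i = 0" by (rule Suc.prems(2))
    qed
    then show ?thesis by simp
  next
    case True
    then obtain a where a: "a \<in> X" "v a d \<noteq> 0" by blast
    have "card (X - {a}) \<le> d"
    proof (rule Suc.IH[of "X - {a}" "\<lambda>i t. v i t - v i d / v a d * v a t"])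
      show "finite (X - {a})" using Suc.prems(1) by simp
      fix c :: "'i \<Rightarrow> 'k"
      assume c: "\<And>t. t < d \<Longrightarrow> (\<Sum>i\<in>X - {a}. c i * (v i t - v i d / v a d * v a t)) = 0"
      \<comment> \<open>The coefficient of the pivot \<open>a\<close> is forced by the last
        coordinate.\<close>
      define c' where "c' i = (if i = a then - (\<Sum>i\<in>X - {a}. c i * v i d) / v a d else c i)" for i
      have "(\<Sum>i\<in>X. c' i * v i t) = 0" if "t < Suc d" for t
      proof -
        have "(\<Sum>i\<in>X. c' i * v i t) = c' a * v a t + (\<Sum>i\<in>X - {a}. c' i * v i t)"
          by (rule sum.remove[OF Suc.prems(1) a(1)])
        also have "(\<Sum>i\<in>X - {a}. c' i * v i t) = (\<Sum>i\<in>X - {a}. c i * v i t)"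
          by (rule sum.cong) (auto simp: c'_def)
        also have "c' a * v a t = - (\<Sum>i\<in>X - {a}. c i * (v i d / v a d * v a t))"
          unfolding c'_def using sum_distrib_right[of "\<lambda>i. c i * v i d" "X - {a}" "v a t / v a d"] by (simp add: mult.assoc)
        also have "\<dots> + (\<Sum>i\<in>X - {a}. c i * v i t) = (\<Sum>i\<in>X - {a}. c i * (v i t - v i d / v a d * v a t))"
          by (simp add: sum_subtractf right_diff_distrib)
        also have "\<dots> = 0"
          using c[of t] a(2) that by (cases "t = d") auto
        finally show ?thesis .
      qed
      then have z: "\<forall>i\<in>X. c' i = 0" by (rule Suc.prems(2))
      show "\<forall>i\<in>X - {a}. c i = 0"
      proof
        fix i assume i: "i \<in> X - {a}"
        then have "c' i = 0" using z by blast
        then show "c i = 0" using i unfolding c'_def by simp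
      qed
    qed
    then show ?thesis using a Suc.prems(1) by (simp add: card_Diff_singleton)
  qed
qed

lemma representation_D:
  assumes "representation M d \<rho>"
  shows "x \<in> carrier M \<Longrightarrow> \<rho> x \<in> carrier_mat d d" "\<rho> \<one>\<^bsub>M\<^esub> = 1\<^sub>m d"
    "x \<in> carrier M \<Longrightarrow> y \<in> carrier M \<Longrightarrow> \<rho> (x \<otimes>\<^bsub>M\<^esub> y) = \<rho> x * \<rho> y"
  using assms unfolding representation_def by auto

lemma simple_representation_D:
  assumes "simple_representation M d (\<rho> :: 'm \<Rightarrow> 'k::field mat)"
  shows "representation M d \<rho>" "0 < d"
    "W \<subseteq> carrier_vec d \<Longrightarrow> 0\<^sub>v d \<in> W \<Longrightarrow> (\<And>v w. v \<in> W \<Longrightarrow> w \<in> W \<Longrightarrow> v + w \<in> W) \<Longrightarrow>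
      (\<And>c v. v \<in> W \<Longrightarrow> c \<cdot>\<^sub>v v \<in> W) \<Longrightarrow> (\<And>x w. x \<in> carrier M \<Longrightarrow> w \<in> W \<Longrightarrow> \<rho> x *\<^sub>v w \<in> W) \<Longrightarrow>
      W = {0\<^sub>v d} \<or> W = carrier_vec d"
  using assms unfolding simple_representation_def vec_subspace_iff by auto

text \<open>Fix a nonzero entry \<open>(r, s)\<close> of \<open>\<rho> e\<close> and consider the
  columns \<open>s\<close> of the matrices \<open>\<rho> (x i)\<close>. Multiplying a linear
  relation between them by \<open>\<rho> (y j)\<close> and reading row \<open>r\<close> puts its
  coefficients into the radical of \<open>G\<close>, so these columns are independent vectors of
  length \<open>d\<close>.\<close>

lemma representation_dim_lower_bound:
  fixes \<rho> :: "'m \<Rightarrow> 'k::field mat"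
  assumes rep: "representation M d \<rho>" and e: "e \<in> carrier M" "\<rho> e \<noteq> 0\<^sub>m d d"
    and X: "finite X" "\<And>i. i \<in> X \<Longrightarrow> x i \<in> carrier M" and Y: "\<And>j. j \<in> Y \<Longrightarrow> y j \<in> carrier M"
    and G: "\<And>i j. i \<in> X \<Longrightarrow> j \<in> Y \<Longrightarrow> \<rho> (y j \<otimes>\<^bsub>M\<^esub> x i) = (if G j i then \<rho> e else 0\<^sub>m d d)"
    and nondeg: "\<And>c :: 'i \<Rightarrow> 'k. (\<And>j. j \<in> Y \<Longrightarrow> (\<Sum>i\<in>{i \<in> X. G j i}. c i) = 0) \<Longrightarrow> \<forall>i\<in>X. c i = 0"
  shows "card X \<le> d"
proof -
  note D = representation_D[OF rep]
  have "\<exists>r<d. \<exists>s<d. \<rho> e $$ (r, s) \<noteq> 0"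
  proof (rule ccontr)
    assume "\<not> ?thesis"
    then have "\<rho> e = 0\<^sub>m d d" using D(1)[OF e(1)] by (intro eq_matI) auto
    then show False using e(2) by simp
  qed
  then obtain r s where rs: "r < d" "s < d" "\<rho> e $$ (r, s) \<noteq> 0" by blast
  show ?thesis
  proof (rule card_le_of_independent[OF X(1), of d "\<lambda>i t. \<rho> (x i) $$ (t, s)"])
    fix c :: "'i \<Rightarrow> 'k"
    assume c: "\<And>t. t < d \<Longrightarrow> (\<Sum>i\<in>X. c i * \<rho> (x i) $$ (t, s)) = 0"
    show "\<forall>i\<in>X. c i = 0"
    proof (rule nondeg)
      fix j assume j: "j \<in> Y"
      have entry: "(if G j i then \<rho> e $$ (r, s) else 0) = (\<Sum>t\<in>{0..<d}. \<rho> (y j) $$ (r, t) * \<rho> (x i) $$ (t, s))"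
        if i: "i \<in> X" for i
      proof -
        have "(\<Sum>t\<in>{0..<d}. \<rho> (y j) $$ (r, t) * \<rho> (x i) $$ (t, s)) = (\<rho> (y j) * \<rho> (x i)) $$ (r, s)"
          using D(1)[OF X(2)[OF i]] D(1)[OF Y[OF j]] rs by (simp add: scalar_prod_def)
        also have "\<dots> = \<rho> (y j \<otimes>\<^bsub>M\<^esub> x i) $$ (r, s)" using D(3)[OF Y[OF j] X(2)[OF i]] by simp
        finally show ?thesis using G[OF i j] rs by simp
      qed
      have "(\<Sum>i\<in>X. c i * (if G j i then \<rho> e $$ (r, s) else 0)) =
          (\<Sum>i\<in>X. \<Sum>t\<in>{0..<d}. \<rho> (y j) $$ (r, t) * (c i * \<rho> (x i) $$ (t, s)))"
        by (rule sum.cong[OF refl]) (simp add: entry sum_distrib_left mult.left_commute)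
      also have "\<dots> = (\<Sum>t\<in>{0..<d}. \<rho> (y j) $$ (r, t) * (\<Sum>i\<in>X. c i * \<rho> (x i) $$ (t, s)))"
        by (subst sum.swap) (simp add: sum_distrib_left)
      also have "\<dots> = 0" using c by simp
      finally have 0: "(\<Sum>i\<in>X. c i * (if G j i then \<rho> e $$ (r, s) else 0)) = 0" .
      have "(\<Sum>i\<in>X. (if G j i then c i else 0)) * \<rho> e $$ (r, s) = (\<Sum>i\<in>X. c i * (if G j i then \<rho> e $$ (r, s) else 0))"
        unfolding sum_distrib_right by (rule sum.cong) auto
      then have "(\<Sum>i\<in>X. (if G j i then c i else 0)) * \<rho> e $$ (r, s) = 0" using 0 by simp
      then have "(\<Sum>i\<in>X. (if G j i then c i else 0)) = 0" using rs(3) by simp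
      then show "(\<Sum>i\<in>{i \<in> X. G j i}. c i) = 0" using X(1) by (simp add: sum.inter_filter)
    qed
  qed
qed

lemma vec_line:
  fixes v :: "'k::field vec"
  assumes v: "v \<in> carrier_vec d"
  defines "L \<equiv> {c \<cdot>\<^sub>v v | c. True}"
  shows "L \<subseteq> carrier_vec d" "0\<^sub>v d \<in> L" "v \<in> L" "u \<in> L \<Longrightarrow> w \<in> L \<Longrightarrow> u + w \<in> L" "u \<in> L \<Longrightarrow> c \<cdot>\<^sub>v u \<in> L"
proof -
  show "L \<subseteq> carrier_vec d" unfolding L_def using v by auto
  have "0\<^sub>v d = 0 \<cdot>\<^sub>v v" using v by auto
  then show "0\<^sub>v d \<in> L" unfolding L_def by blast
  have "v = 1 \<cdot>\<^sub>v v" by simp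
  then show "v \<in> L" unfolding L_def by blast
  show "u + w \<in> L" if uw: "u \<in> L" "w \<in> L"
  proof -
    obtain a b where "u = a \<cdot>\<^sub>v v" "w = b \<cdot>\<^sub>v v" using uw unfolding L_def by blast
    then have "u + w = (a + b) \<cdot>\<^sub>v v" by (simp add: add_smult_distrib_vec)
    then show ?thesis unfolding L_def by blast
  qed
  show "c \<cdot>\<^sub>v u \<in> L" if u: "u \<in> L"
  proof -
    obtain a where "u = a \<cdot>\<^sub>v v" using u unfolding L_def by blast
    then have "c \<cdot>\<^sub>v u = (c * a) \<cdot>\<^sub>v v" by (simp add: smult_smult_assoc)
    then show ?thesis unfolding L_def by blast
  qed
qed

lemma dim_one_of_line:
  fixes v :: "'k::field vec"
  assumes "v \<in> carrier_vec d" "{c \<cdot>\<^sub>v v | c. True} = carrier_vec d" "0 < d"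
  shows "d = 1"
proof (rule ccontr)
  assume "d \<noteq> 1"
  then have d: "0 < d" "1 < d" using assms(3) by auto
  have "unit_vec d 0 \<in> {c \<cdot>\<^sub>v v | c. True}" "unit_vec d 1 \<in> {c \<cdot>\<^sub>v v | c. True}"
    unfolding assms(2) by simp_all
  then obtain a b where "unit_vec d 0 = a \<cdot>\<^sub>v v" "unit_vec d 1 = b \<cdot>\<^sub>v v" by blast
  then have "a * v $ 0 = 1" "a * v $ 1 = 0" "b * v $ 0 = 0" "b * v $ 1 = 1"
    using d assms(1) by (metis carrier_vecD index_smult_vec(1) index_unit_vec(1) zero_neq_one)+
  then show False by (metis mult_eq_0_iff zero_neq_one)
qed

text \<open>All elements but the identity act by 0, so every line is invariant and a simple
  representation has dimension 1. A unit cannot act by 0, hence the identity is the only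
  unit.\<close>

lemma trivial_of_units_only:
  fixes \<rho> :: "'m \<Rightarrow> 'k::field mat"
  assumes M: "monoid M" and simple: "simple_representation M d \<rho>"
    and kill: "\<And>x. x \<in> carrier M \<Longrightarrow> x \<noteq> \<one>\<^bsub>M\<^esub> \<Longrightarrow> \<rho> x = 0\<^sub>m d d"
  shows "trivial_representation M d \<rho>"
proof -
  interpret monoid M by fact
  note S = simple_representation_D[OF simple] and R = representation_D[OF simple_representation_D(1)[OF simple]]
  let ?v = "unit_vec d 0 :: 'k vec"
  let ?W = "{c \<cdot>\<^sub>v ?v | c. True}"
  have "?W = {0\<^sub>v d} \<or> ?W = carrier_vec d"
  proof (rule S(3))
    have u: "?v \<in> carrier_vec d" by simp
    show "?W \<subseteq> carrier_vec d" "0\<^sub>v d \<in> ?W" by (rule vec_line(1)[OF u], rule vec_line(2)[OF u])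
    show "v + w \<in> ?W" if "v \<in> ?W" "w \<in> ?W" for v w by (rule vec_line(4)[OF u that])
    show "c \<cdot>\<^sub>v v \<in> ?W" if "v \<in> ?W" for c v by (rule vec_line(5)[OF u that])
    show "\<rho> x *\<^sub>v w \<in> ?W" if x: "x \<in> carrier M" and w: "w \<in> ?W" for x w
    proof -
      obtain a where a: "w = a \<cdot>\<^sub>v ?v" using w by blast
      have wc: "w \<in> carrier_vec d" unfolding a by simp
      show ?thesis
      proof (cases "x = \<one>\<^bsub>M\<^esub>")
        case True
        then have "\<rho> x *\<^sub>v w = w" using R(2) wc by simp
        then show ?thesis using w by simp
      next
        case False
        then have "\<rho> x *\<^sub>v w = 0 \<cdot>\<^sub>v ?v" using kill[OF x False] wc by auto
        then show ?thesis by blast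
      qed
    qed
  qed
  moreover have "?v \<noteq> 0\<^sub>v d" using S(2) by (metis index_unit_vec(1) index_zero_vec(1) zero_neq_one)
  moreover have "?v \<in> ?W" by (rule vec_line(3)[where d = d]) simp
  ultimately have "?W = carrier_vec d" by blast
  then have d: "d = 1" using dim_one_of_line[of ?v d] S(2) by simp
  have "similar_mat_wit (\<rho> x) (if x \<in> Units M then 1\<^sub>m 1 else 0\<^sub>m 1 1) (1\<^sub>m 1) (1\<^sub>m 1)" if x: "x \<in> carrier M" for x
  proof -
    have "\<rho> x = (if x \<in> Units M then 1\<^sub>m 1 else 0\<^sub>m 1 1)"
    proof (cases "x = \<one>\<^bsub>M\<^esub>")
      case True
      then show ?thesis using R(2) d by simp
    next
      case False
      have "x \<notin> Units M"
      proof
        assume "x \<in> Units M"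
        then have "\<rho> x * \<rho> (inv\<^bsub>M\<^esub> x) = 1\<^sub>m d" using R(2,3) by (metis Units_closed Units_inv_closed Units_r_inv)
        moreover have "\<rho> x * \<rho> (inv\<^bsub>M\<^esub> x) = 0\<^sub>m d d"
          using kill[OF x False] R(1)[OF Units_inv_closed[OF \<open>x \<in> Units M\<close>]] by simp
        ultimately have "(1\<^sub>m d :: 'k mat) $$ (0, 0) = 0\<^sub>m d d $$ (0, 0)" by simp
        then show False using S(2) by simp
      qed
      then show ?thesis using kill[OF x False] d by simp
    qed
    then show ?thesis unfolding similar_mat_wit_def Let_def by auto
  qed
  then show ?thesis unfolding trivial_representation_def isomorphic_representations_def using d by blast
qed

text \<open>The vectors that \<open>\<rho> z\<close> kills after every \<open>\<rho> x\<close> form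
  an invariant subspace \<open>?N\<close>. It misses a nonzero vector \<open>v\<close> with
  \<open>\<rho> z *\<^sub>v v = v\<close>, so it is zero. As \<open>z\<close> absorbs whatever
  stands between two copies of it, \<open>?N\<close> contains
  \<open>\<rho> x *\<^sub>v v - v\<close>; so every element fixes \<open>v\<close>, and
  \<open>v\<close> spans the representation.\<close>

lemma trivial_of_zero:
  fixes \<rho> :: "'m \<Rightarrow> 'k::field mat"
  assumes M: "monoid M" and simple: "simple_representation M d \<rho>"
    and z: "z \<in> carrier M" "\<And>x. x \<in> carrier M \<Longrightarrow> z \<otimes>\<^bsub>M\<^esub> x \<otimes>\<^bsub>M\<^esub> z = z" "\<rho> z \<noteq> 0\<^sub>m d d"
  shows "trivial_representation M d \<rho>"
proof -
  interpret monoid M by fact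
  note S = simple_representation_D[OF simple] and R = representation_D[OF simple_representation_D(1)[OF simple]]
  note zM = R(1)[OF z(1)]
  have RM: "\<rho> (x \<otimes>\<^bsub>M\<^esub> y) *\<^sub>v w = \<rho> x *\<^sub>v (\<rho> y *\<^sub>v w)" if "x \<in> carrier M" "y \<in> carrier M" "w \<in> carrier_vec d" for x y w
    using R(3)[OF that(1,2)] assoc_mult_mat_vec[OF R(1)[OF that(1)] R(1)[OF that(2)] that(3)] by simp
  have Rc: "\<rho> x *\<^sub>v w \<in> carrier_vec d" if "x \<in> carrier M" "w \<in> carrier_vec d" for x w
    using R(1)[OF that(1)] that(2) by (rule mult_mat_vec_carrier)
  have zz: "z \<otimes>\<^bsub>M\<^esub> z = z" using z(2)[OF one_closed] z(1) by simp
  let ?N = "{w \<in> carrier_vec d. \<forall>x\<in>carrier M. \<rho> z *\<^sub>v (\<rho> x *\<^sub>v w) = 0\<^sub>v d}"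
  have N: "?N = {0\<^sub>v d} \<or> ?N = carrier_vec d"
  proof (rule S(3))
    have "A *\<^sub>v 0\<^sub>v d = 0\<^sub>v d" if "A \<in> carrier_mat d d" for A :: "'k mat"
      using that by (intro eq_vecI) (auto simp: scalar_prod_def)
    then show "0\<^sub>v d \<in> ?N" using R(1) z(1) by simp
    show "v + w \<in> ?N" if "v \<in> ?N" "w \<in> ?N" for v w
    proof -
      have "\<rho> z *\<^sub>v (\<rho> x *\<^sub>v (v + w)) = 0\<^sub>v d" if x: "x \<in> carrier M" for x
      proof -
        have vw: "v \<in> carrier_vec d" "w \<in> carrier_vec d" using \<open>v \<in> ?N\<close> \<open>w \<in> ?N\<close> by auto
        have "\<rho> z *\<^sub>v (\<rho> x *\<^sub>v (v + w)) = \<rho> z *\<^sub>v (\<rho> x *\<^sub>v v) + \<rho> z *\<^sub>v (\<rho> x *\<^sub>v w)"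
          using mult_add_distrib_mat_vec[OF R(1)[OF x] vw] mult_add_distrib_mat_vec[OF zM Rc[OF x vw(1)] Rc[OF x vw(2)]] by simp
        then show ?thesis using \<open>v \<in> ?N\<close> \<open>w \<in> ?N\<close> x by auto
      qed
      then show ?thesis using that by auto
    qed
    show "c \<cdot>\<^sub>v v \<in> ?N" if "v \<in> ?N" for c v
    proof -
      have v: "v \<in> carrier_vec d" using that by auto
      have "\<rho> z *\<^sub>v (\<rho> x *\<^sub>v (c \<cdot>\<^sub>v v)) = 0\<^sub>v d" if x: "x \<in> carrier M" for x
        using mult_mat_vec[OF R(1)[OF x] v] mult_mat_vec[OF zM Rc[OF x v]] \<open>v \<in> ?N\<close> x by auto
      then show ?thesis using v by auto
    qed
    show "\<rho> x *\<^sub>v w \<in> ?N" if x: "x \<in> carrier M" and w: "w \<in> ?N" for x w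
    proof -
      have wc: "w \<in> carrier_vec d" using w by auto
      have "\<rho> z *\<^sub>v (\<rho> y *\<^sub>v (\<rho> x *\<^sub>v w)) = 0\<^sub>v d" if y: "y \<in> carrier M" for y
        using RM[OF y x wc] w m_closed[OF y x] by auto
      then show ?thesis using Rc[OF x wc] by auto
    qed
  qed auto
  have "\<exists>j<d. col (\<rho> z) j \<noteq> 0\<^sub>v d"
  proof (rule ccontr)
    assume *: "\<not> ?thesis"
    have "\<rho> z = 0\<^sub>m d d"
    proof (rule eq_matI)
      fix i j assume ij: "i < dim_row (0\<^sub>m d d :: 'k mat)" "j < dim_col (0\<^sub>m d d :: 'k mat)"
      then have "\<rho> z $$ (i, j) = col (\<rho> z) j $ i" using zM by simp
      then show "\<rho> z $$ (i, j) = 0\<^sub>m d d $$ (i, j)" using * ij by simp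
    qed (use zM in auto)
    then show False using z(3) by simp
  qed
  then obtain j where j: "j < d" "col (\<rho> z) j \<noteq> 0\<^sub>v d" by blast
  define v where "v = col (\<rho> z) j"
  have vc: "v \<in> carrier_vec d" unfolding v_def using zM by (metis carrier_matD(1) col_dim)
  have vz: "v = \<rho> z *\<^sub>v unit_vec d j" unfolding v_def using zM j by (intro eq_vecI) auto
  have zv: "\<rho> z *\<^sub>v v = v" using RM[OF z(1) z(1), of "unit_vec d j"] zz vz by simp
  have "v \<notin> ?N"
  proof
    assume "v \<in> ?N"
    then have "\<rho> z *\<^sub>v (\<rho> \<one>\<^bsub>M\<^esub> *\<^sub>v v) = 0\<^sub>v d" using one_closed by blast
    then show False using zv R(2) vc j(2) unfolding v_def[symmetric] by simp
  qed
  then have N0: "?N = {0\<^sub>v d}" using N vc by blast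
  have fix_v: "\<rho> x *\<^sub>v v = v" if x: "x \<in> carrier M" for x
  proof -
    let ?w = "\<rho> x *\<^sub>v v - v"
    have xv: "\<rho> x *\<^sub>v v \<in> carrier_vec d" by (rule Rc[OF x vc])
    have "?w \<in> ?N"
    proof (intro CollectI conjI ballI)
      show "?w \<in> carrier_vec d" using xv vc by simp
      fix y assume y: "y \<in> carrier M"
      have zyz: "\<rho> z *\<^sub>v (\<rho> u *\<^sub>v v) = v" if u: "u \<in> carrier M" for u
      proof -
        have "\<rho> z *\<^sub>v (\<rho> u *\<^sub>v v) = \<rho> (z \<otimes>\<^bsub>M\<^esub> u \<otimes>\<^bsub>M\<^esub> z) *\<^sub>v v"
          using RM[OF m_closed[OF z(1) u] z(1) vc] RM[OF z(1) u vc] zv by simp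
        then show ?thesis using z(2)[OF u] zv by simp
      qed
      have "\<rho> z *\<^sub>v (\<rho> y *\<^sub>v ?w) = \<rho> z *\<^sub>v (\<rho> y *\<^sub>v (\<rho> x *\<^sub>v v)) - \<rho> z *\<^sub>v (\<rho> y *\<^sub>v v)"
        using mult_minus_distrib_mat_vec[OF R(1)[OF y] xv vc] mult_minus_distrib_mat_vec[OF zM Rc[OF y xv] Rc[OF y vc]] by simp
      also have "\<dots> = v - v" using zyz[OF y] zyz[OF m_closed[OF y x]] RM[OF y x vc] by simp
      finally show "\<rho> z *\<^sub>v (\<rho> y *\<^sub>v ?w) = 0\<^sub>v d" using vc by simp
    qed
    then have "?w = 0\<^sub>v d" using N0 by blast
    show ?thesis
    proof (rule eq_vecI)
      fix i assume i: "i < dim_vec v"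
      have "?w $ i = 0" using \<open>?w = 0\<^sub>v d\<close> i vc by simp
      then show "(\<rho> x *\<^sub>v v) $ i = v $ i" using i vc xv by simp
    qed (use xv vc R(1)[OF x] in auto)
  qed
  let ?W = "{c \<cdot>\<^sub>v v | c. True}"
  have "?W = {0\<^sub>v d} \<or> ?W = carrier_vec d"
  proof (rule S(3))
    show "?W \<subseteq> carrier_vec d" "0\<^sub>v d \<in> ?W" by (rule vec_line(1)[OF vc], rule vec_line(2)[OF vc])
    show "u + w \<in> ?W" if "u \<in> ?W" "w \<in> ?W" for u w by (rule vec_line(4)[OF vc that])
    show "c \<cdot>\<^sub>v u \<in> ?W" if "u \<in> ?W" for c u by (rule vec_line(5)[OF vc that])
    show "\<rho> x *\<^sub>v w \<in> ?W" if x: "x \<in> carrier M" and w: "w \<in> ?W" for x w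
    proof -
      obtain a where a: "w = a \<cdot>\<^sub>v v" using w by blast
      have "\<rho> x *\<^sub>v w = w" unfolding a using mult_mat_vec[OF R(1)[OF x] vc] fix_v[OF x] by simp
      then show ?thesis using w by simp
    qed
  qed
  moreover have "v \<in> ?W" by (rule vec_line(3)[OF vc])
  ultimately have W: "?W = carrier_vec d" using j(2) unfolding v_def[symmetric] by blast
  have d: "d = 1" by (rule dim_one_of_line[OF vc W S(2)])
  have v0: "v $ 0 \<noteq> 0"
  proof
    assume "v $ 0 = 0"
    then have "v = 0\<^sub>v d" using vc d by (intro eq_vecI) auto
    then show False using j(2) unfolding v_def by simp
  qed
  have "\<rho> x = 1\<^sub>m 1" if x: "x \<in> carrier M" for x
  proof -
    have xc: "\<rho> x \<in> carrier_mat 1 1" using R(1)[OF x] d by simp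
    have "(\<rho> x *\<^sub>v v) $ 0 = \<rho> x $$ (0, 0) * v $ 0"
      using xc vc d by (simp add: scalar_prod_def)
    then have "\<rho> x $$ (0, 0) = 1" using fix_v[OF x] v0 by simp
    then show ?thesis using xc by (intro eq_matI) auto
  qed
  then have "similar_mat_wit (\<rho> x) (1\<^sub>m 1) (1\<^sub>m 1) (1\<^sub>m 1)" if "x \<in> carrier M" for x
    using that unfolding similar_mat_wit_def Let_def by auto
  then show ?thesis unfolding trivial_representation_def isomorphic_representations_def using d by blast
qed

section \<open>Cell preorders\<close>

lemma le_r_refl: "monoid M \<Longrightarrow> a \<in> carrier M \<Longrightarrow> le_r M a a"
  unfolding le_r_def by (metis monoid.one_closed monoid.r_one)

lemma le_r_trans:
  assumes "monoid M" "a \<in> carrier M" "le_r M a b" "le_r M b c" shows "le_r M a c"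
proof -
  interpret monoid M by fact
  obtain x y where "x \<in> carrier M" "b = a \<otimes>\<^bsub>M\<^esub> x" "y \<in> carrier M" "c = b \<otimes>\<^bsub>M\<^esub> y"
    using assms(3,4) unfolding le_r_def by blast
  then have "c = a \<otimes>\<^bsub>M\<^esub> (x \<otimes>\<^bsub>M\<^esub> y)" "x \<otimes>\<^bsub>M\<^esub> y \<in> carrier M" using assms(2) by (simp_all add: m_assoc)
  then show ?thesis unfolding le_r_def by blast
qed

lemma le_lr_refl: "monoid M \<Longrightarrow> a \<in> carrier M \<Longrightarrow> le_lr M a a"
  unfolding le_lr_def by (metis monoid.one_closed monoid.l_one monoid.r_one)

lemma le_lr_trans:
  assumes "monoid M" "a \<in> carrier M" "le_lr M a b" "le_lr M b c" shows "le_lr M a c"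
proof -
  interpret monoid M by fact
  obtain x y x' y' where xy: "x \<in> carrier M" "y \<in> carrier M" "b = x \<otimes>\<^bsub>M\<^esub> a \<otimes>\<^bsub>M\<^esub> y"
    "x' \<in> carrier M" "y' \<in> carrier M" "c = x' \<otimes>\<^bsub>M\<^esub> b \<otimes>\<^bsub>M\<^esub> y'"
    using assms(3,4) unfolding le_lr_def by blast
  then have "c = (x' \<otimes>\<^bsub>M\<^esub> x) \<otimes>\<^bsub>M\<^esub> a \<otimes>\<^bsub>M\<^esub> (y \<otimes>\<^bsub>M\<^esub> y')"
    using assms(2) by (simp add: m_assoc)
  moreover have "x' \<otimes>\<^bsub>M\<^esub> x \<in> carrier M" "y \<otimes>\<^bsub>M\<^esub> y' \<in> carrier M" using xy by simp_all
  ultimately show ?thesis unfolding le_lr_def by blast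
qed

lemma le_r_le_lr:
  assumes "monoid M" "a \<in> carrier M" "le_r M a b" shows "le_lr M a b"
proof -
  interpret monoid M by fact
  obtain x where x: "x \<in> carrier M" "b = a \<otimes>\<^bsub>M\<^esub> x" using assms(3) unfolding le_r_def by blast
  then have "b = \<one>\<^bsub>M\<^esub> \<otimes>\<^bsub>M\<^esub> a \<otimes>\<^bsub>M\<^esub> x" using assms(2) by simp
  then show ?thesis unfolding le_lr_def using x(1) by blast
qed

lemma J_cell_eq:
  assumes M: "monoid M" and J: "J \<in> J_cells M" and a: "a \<in> J"
  shows "J = {b \<in> carrier M. le_lr M a b \<and> le_lr M b a}" "a \<in> carrier M"
proof -
  obtain x where x: "x \<in> carrier M" "J = {b. b \<in> carrier M \<and> le_lr M x b \<and> le_lr M b x}"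
    using J unfolding J_cells_def quotient_def by auto
  then have ax: "a \<in> carrier M" "le_lr M x a" "le_lr M a x" using a by auto
  show "a \<in> carrier M" by fact
  show "J = {b \<in> carrier M. le_lr M a b \<and> le_lr M b a}"
    using x le_lr_trans[OF M x(1) ax(2)] le_lr_trans[OF M ax(1,3)]
      le_lr_trans[OF M _ _ ax(2)] le_lr_trans[OF M _ _ ax(3)] by blast
qed

lemma J_cell_of:
  assumes "a \<in> carrier M" shows "{b \<in> carrier M. le_lr M a b \<and> le_lr M b a} \<in> J_cells M"
  unfolding J_cells_def quotient_def using assms by auto

lemma right_cell_eq:
  assumes M: "monoid M" and R: "R \<in> right_cells M" and a: "a \<in> R"
  shows "R = {b \<in> carrier M. le_r M a b \<and> le_r M b a}" "a \<in> carrier M"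
proof -
  obtain x where x: "x \<in> carrier M" "R = {b. b \<in> carrier M \<and> le_r M x b \<and> le_r M b x}"
    using R unfolding right_cells_def quotient_def by auto
  then have ax: "a \<in> carrier M" "le_r M x a" "le_r M a x" using a by auto
  show "a \<in> carrier M" by fact
  show "R = {b \<in> carrier M. le_r M a b \<and> le_r M b a}"
    using x le_r_trans[OF M x(1) ax(2)] le_r_trans[OF M ax(1,3)]
      le_r_trans[OF M _ _ ax(2)] le_r_trans[OF M _ _ ax(3)] by blast
qed

lemma right_cell_of:
  assumes "a \<in> carrier M" shows "{b \<in> carrier M. le_r M a b \<and> le_r M b a} \<in> right_cells M"
  unfolding right_cells_def quotient_def using assms by auto

lemma right_cell_nonempty: "monoid M \<Longrightarrow> R \<in> right_cells M \<Longrightarrow> R \<noteq> {}"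
  unfolding right_cells_def quotient_def using le_r_refl by fastforce

section \<open>A simple representation from a corner with two elements\<close>

lemma finite_basis_exists:
  fixes g :: "'x \<Rightarrow> 'y \<Rightarrow> 'k :: field"
  assumes "finite X"
  obtains B where "B \<subseteq> X" "\<And>c. (\<And>y. (\<Sum>b\<in>B. c b * g b y) = 0) \<Longrightarrow> \<forall>b\<in>B. c b = 0"
    "\<And>x. x \<in> X \<Longrightarrow> \<exists>c. \<forall>y. g x y = (\<Sum>b\<in>B. c b * g b y)"
proof -
  define indep where "indep B \<longleftrightarrow> B \<subseteq> X \<and> (\<forall>c. (\<forall>y. (\<Sum>b\<in>B. c b * g b y) = 0) \<longrightarrow> (\<forall>b\<in>B. c b = 0))" for B
  have "indep {}" unfolding indep_def by simp
  moreover have "\<forall>B. indep B \<longrightarrow> card B < Suc (card X)"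
    unfolding indep_def using card_mono[OF assms] by (simp add: less_Suc_eq_le)
  ultimately obtain B where B: "indep B" "\<forall>B'. indep B' \<longrightarrow> card B' \<le> card B"
    using ex_has_greatest_nat[of indep "{}" card "Suc (card X)"] by blast
  have BX: "B \<subseteq> X" and ind: "\<And>c. (\<And>y. (\<Sum>b\<in>B. c b * g b y) = 0) \<Longrightarrow> \<forall>b\<in>B. c b = 0"
    using B(1) unfolding indep_def by blast+
  have finB: "finite B" using BX assms finite_subset by blast
  have "\<exists>c. \<forall>y. g x y = (\<Sum>b\<in>B. c b * g b y)" if x: "x \<in> X" for x
  proof (cases "x \<in> B")
    case True
    have "g x y = (\<Sum>b\<in>B. (if b = x then 1 else 0) * g b y)" for y
      using finB True by (simp add: if_distrib[of "\<lambda>z. z * _"] cong: if_cong)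
    then show ?thesis by (intro exI[of _ "\<lambda>b. if b = x then 1 else 0"]) blast
  next
    case False
    have "\<not> indep (insert x B)"
      using B(2) False finB by (metis card_insert_disjoint not_less_eq_eq order_refl)
    then obtain c where c: "\<forall>y. (\<Sum>b\<in>insert x B. c b * g b y) = 0" "\<not> (\<forall>b\<in>insert x B. c b = 0)"
      unfolding indep_def using x BX by blast
    have s: "c x * g x y + (\<Sum>b\<in>B. c b * g b y) = 0" for y
      using c(1) False finB by simp
    have "c x \<noteq> 0"
    proof
      assume "c x = 0"
      then have "\<forall>b\<in>B. c b = 0" using s by (intro ind) simp
      then show False using c(2) \<open>c x = 0\<close> by blast
    qed
    have "g x y = (\<Sum>b\<in>B. (- c b / c x) * g b y)" for y
    proof -
      have "(\<Sum>b\<in>B. (- c b / c x) * g b y) = - (\<Sum>b\<in>B. c b * g b y) / c x"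
        by (simp add: sum_divide_distrib sum_negf)
      also have "- (\<Sum>b\<in>B. c b * g b y) = c x * g x y" using s[of y] by (metis add.inverse_unique add.commute minus_minus)
      finally show ?thesis using \<open>c x \<noteq> 0\<close> by simp
    qed
    then show ?thesis by (intro exI[of _ "\<lambda>b. - c b / c x"]) blast
  qed
  then show ?thesis using that BX ind by blast
qed

text \<open>\<open>z\<close> is the zero of the corner cut out by \<open>e\<close>. Once
  \<open>z\<close> is identified with 0, the algebra of the corner is the field itself: the pairing
  takes only the values 0 and 1, and no representation of a group has to be chosen.\<close>

locale two_element_corner = monoid M for M :: "('m, 'r) monoid_scheme" (structure) +
  fixes e z :: 'm
  assumes fin: "finite (carrier M)" and e: "e \<in> carrier M" and z: "z \<in> carrier M" and ez: "e \<noteq> z" "e \<noteq> \<one>"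
    and ee: "e \<otimes> e = e" and corner: "x \<in> carrier M \<Longrightarrow> e \<otimes> x \<otimes> e = e \<or> e \<otimes> x \<otimes> e = z"
    and zs: "e \<otimes> z = z" "z \<otimes> e = z" "z \<otimes> z = z"
begin

definition right_part where "right_part = {x \<in> carrier M. x \<otimes> e = x}"
definition left_part where "left_part = {y \<in> carrier M. e \<otimes> y = y}"
text \<open>The corner elements \<open>e\<close> and \<open>z\<close> are read as 1 and 0. The value
  0 for \<open>y\<close> outside \<open>left_part\<close> makes the pairing with a fixed
  \<open>x\<close> a function on the whole type, as \<open>finite_basis_exists\<close>
  expects.\<close>

definition pairing :: "'m \<Rightarrow> 'm \<Rightarrow> 'k::field" where "pairing x y = (if y \<in> left_part \<and> y \<otimes> x = e then 1 else 0)"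

lemma XY: "x \<in> right_part \<Longrightarrow> x \<in> carrier M" "y \<in> left_part \<Longrightarrow> y \<in> carrier M" "x \<in> right_part \<Longrightarrow> x \<otimes> e = x" "y \<in> left_part \<Longrightarrow> e \<otimes> y = y"
  unfolding right_part_def left_part_def by auto

lemma X_act: "m \<in> carrier M \<Longrightarrow> x \<in> right_part \<Longrightarrow> m \<otimes> x \<in> right_part"
  unfolding right_part_def by (auto simp: m_assoc e)

lemma Y_act: "m \<in> carrier M \<Longrightarrow> y \<in> left_part \<Longrightarrow> y \<otimes> m \<in> left_part"
  unfolding left_part_def by (auto simp: m_assoc[symmetric] e)

lemma e_XY: "e \<in> right_part" "e \<in> left_part"
  unfolding right_part_def left_part_def using e ee by auto

lemma YX: assumes "y \<in> left_part" "x \<in> right_part" shows "y \<otimes> x = e \<or> y \<otimes> x = z"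
proof -
  have "y \<otimes> x = e \<otimes> (y \<otimes> x) \<otimes> e"
    using XY(1,3)[OF assms(2)] XY(2,4)[OF assms(1)] e by (metis m_assoc m_closed)
  then show ?thesis using corner[of "y \<otimes> x"] XY(1)[OF assms(2)] XY(2)[OF assms(1)] by (metis m_closed)
qed

lemma g_act: "m \<in> carrier M \<Longrightarrow> x \<in> right_part \<Longrightarrow> y \<in> left_part \<Longrightarrow> pairing (m \<otimes> x) y = (pairing x (y \<otimes> m) :: 'k::field)"
  unfolding pairing_def using Y_act[of m y] XY by (simp add: m_assoc)

text \<open>A product of two corner elements is \<open>e\<close> only if both factors are. So
  \<open>x1 \<otimes> y1\<close> acts with rank at most one, and such operators are what makes the
  quotient simple.\<close>

lemma g_rank_one:
  assumes "x1 \<in> right_part" "y1 \<in> left_part" "x \<in> right_part" "y \<in> left_part"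
  shows "pairing (x1 \<otimes> y1 \<otimes> x) y = (pairing x1 y * pairing x y1 :: 'k::field)"
proof -
  note c = XY(1)[OF assms(1)] XY(2)[OF assms(2)] XY(1)[OF assms(3)] XY(2)[OF assms(4)]
  have "y \<otimes> (x1 \<otimes> y1 \<otimes> x) = (y \<otimes> x1) \<otimes> (y1 \<otimes> x)" using c by (simp add: m_assoc)
  then show ?thesis
    unfolding pairing_def using YX[OF assms(4,1)] YX[OF assms(2,3)] assms zs ee ez(1) by auto
qed

text \<open>Elements of \<open>right_part\<close> are identified with the functions of
  \<open>y\<close> that they induce through the pairing; \<open>B\<close> is a basis of their span,
  which is the quotient by the radical. An element that acts by a nonzero matrix can be completed to
  \<open>e\<close> by factors on both sides, so no cell strictly above that of \<open>e\<close>
  survives. Since \<open>z\<close> acts by 0 and \<open>e\<close> does not, neither trivial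
  representation arises.\<close>

theorem simple_representation_exists:
  obtains d and \<rho> :: "'m \<Rightarrow> 'k::field mat" where
    "simple_representation M d \<rho>" "\<not> trivial_representation M d \<rho>" "d \<le> card right_part"
    "is_apex M d \<rho> {b \<in> carrier M. le_lr M e b \<and> le_lr M b e}"
proof -
  have M: "monoid M" by (rule monoid_axioms)
  have finX: "finite right_part" unfolding right_part_def using fin by simp
  let ?g = "pairing :: 'm \<Rightarrow> 'm \<Rightarrow> 'k"
  obtain B where B: "B \<subseteq> right_part" and ind: "\<And>c :: 'm \<Rightarrow> 'k. (\<And>y. (\<Sum>b\<in>B. c b * ?g b y) = 0) \<Longrightarrow> \<forall>b\<in>B. c b = 0"
    and span: "\<And>x. x \<in> right_part \<Longrightarrow> \<exists>c. \<forall>y. ?g x y = (\<Sum>b\<in>B. c b * ?g b y)"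
    using finite_basis_exists[OF finX, where g = ?g] by blast
  have finB: "finite B" using B finX finite_subset by blast
  define d where "d = card B"
  obtain bs where bs: "bij_betw bs {0..<d} B" unfolding d_def using ex_bij_betw_nat_finite[OF finB] by blast
  have bsB: "bs i \<in> B" "bs i \<in> right_part" if "i < d" for i
    using bs B that unfolding bij_betw_def by auto
  have sumB: "(\<Sum>b\<in>B. h b) = (\<Sum>i\<in>{0..<d}. h (bs i))" for h :: "'m \<Rightarrow> 'k"
    using sum.reindex_bij_betw[OF bs, of h] by simp
  have ind': "c i = 0" if c: "\<And>y. y \<in> left_part \<Longrightarrow> (\<Sum>i\<in>{0..<d}. c i * ?g (bs i) y) = 0" and i: "i < d" for c i
  proof -
    define c' where "c' b = c (the_inv_into {0..<d} bs b)" for b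
    have inj: "inj_on bs {0..<d}" using bs unfolding bij_betw_def by blast
    have c': "c' (bs i) = c i" if "i < d" for i unfolding c'_def using the_inv_into_f_f[OF inj] that by simp
    have "(\<Sum>b\<in>B. c' b * ?g b y) = 0" for y
    proof (cases "y \<in> left_part")
      case True
      have "(\<Sum>b\<in>B. c' b * ?g b y) = (\<Sum>i\<in>{0..<d}. c i * ?g (bs i) y)"
        unfolding sumB by (rule sum.cong) (use c' in auto)
      then show ?thesis using c[OF True] by simp
    qed (simp add: pairing_def)
    then have "c' (bs i) = 0" using ind bsB(1)[OF i] by blast
    then show ?thesis using c'[OF i] by simp
  qed
  obtain co where "\<forall>x\<in>right_part. \<forall>y. ?g x y = (\<Sum>b\<in>B. co x b * ?g b y)"
    using bchoice[of right_part "\<lambda>x c. \<forall>y. ?g x y = (\<Sum>b\<in>B. c b * ?g b y)"] span by blast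
  then have co: "?g x y = (\<Sum>i\<in>{0..<d}. co x (bs i) * ?g (bs i) y)" if "x \<in> right_part" for x y
    using that unfolding sumB by blast
  \<comment> \<open>Column \<open>j\<close> holds the coordinates of
    \<open>m \<otimes> bs j\<close>. By \<open>ind'\<close> coordinates are unique, so identities
    between matrices are verified after pairing with all \<open>y\<close>.\<close>
  define \<rho> where "\<rho> m = mat d d (\<lambda>(i, j). co (m \<otimes> bs j) (bs i))" for m
  have \<rho>c: "\<rho> m \<in> carrier_mat d d" for m unfolding \<rho>_def by simp
  have \<rho>i: "\<rho> m $$ (i, j) = co (m \<otimes> bs j) (bs i)" if "i < d" "j < d" for m i j
    unfolding \<rho>_def using that by simp
  have rep: "representation M d \<rho>"
    unfolding representation_def
  proof (intro conjI ballI)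
    show "\<rho> \<one> = 1\<^sub>m d"
    proof (rule eq_matI)
      fix i j assume "i < dim_row (1\<^sub>m d :: 'k mat)" "j < dim_col (1\<^sub>m d :: 'k mat)"
      then have ij: "i < d" "j < d" by auto
      have "(\<Sum>i\<in>{0..<d}. (co (bs j) (bs i) - (if i = j then 1 else 0)) * ?g (bs i) y) = 0" for y
      proof -
        have "(\<Sum>i\<in>{0..<d}. (if i = j then 1 else 0) * ?g (bs i) y) = ?g (bs j) y"
          using ij by (simp add: if_distrib[of "\<lambda>z. z * _"] cong: if_cong)
        then show ?thesis using co[OF bsB(2)[OF ij(2)], of y] by (simp add: left_diff_distrib sum_subtractf)
      qed
      then have "co (bs j) (bs i) - (if i = j then 1 else 0) = 0" by (rule ind') (rule ij(1))
      moreover have "\<one> \<otimes> bs j = bs j" using XY(1)[OF bsB(2)[OF ij(2)]] by simp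
      ultimately show "\<rho> \<one> $$ (i, j) = 1\<^sub>m d $$ (i, j)" using \<rho>i[OF ij, of \<one>] ij by simp
    qed (use \<rho>c[of \<one>] in auto)
  next
    fix m m' assume m: "m \<in> carrier M" "m' \<in> carrier M"
    show "\<rho> (m \<otimes> m') = \<rho> m * \<rho> m'"
    proof (rule eq_matI)
      fix i j assume "i < dim_row (\<rho> m * \<rho> m')" "j < dim_col (\<rho> m * \<rho> m')"
      then have ij: "i < d" "j < d" using \<rho>c[of m] \<rho>c[of m'] by auto
      note bj = bsB(2)[OF ij(2)]
      have "(\<Sum>i\<in>{0..<d}. (co (m \<otimes> m' \<otimes> bs j) (bs i) - (\<Sum>l\<in>{0..<d}. co (m \<otimes> bs l) (bs i) * co (m' \<otimes> bs j) (bs l))) * ?g (bs i) y) = 0"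
        if y: "y \<in> left_part" for y
      proof -
        have "(\<Sum>i\<in>{0..<d}. (\<Sum>l\<in>{0..<d}. co (m \<otimes> bs l) (bs i) * co (m' \<otimes> bs j) (bs l)) * ?g (bs i) y) =
           (\<Sum>i\<in>{0..<d}. \<Sum>l\<in>{0..<d}. co (m' \<otimes> bs j) (bs l) * (co (m \<otimes> bs l) (bs i) * ?g (bs i) y))"
          unfolding sum_distrib_right by (intro sum.cong refl) (simp only: mult_ac)
        also have "\<dots> = (\<Sum>l\<in>{0..<d}. \<Sum>i\<in>{0..<d}. co (m' \<otimes> bs j) (bs l) * (co (m \<otimes> bs l) (bs i) * ?g (bs i) y))"
          by (rule sum.swap)
        also have "\<dots> = (\<Sum>l\<in>{0..<d}. co (m' \<otimes> bs j) (bs l) * ?g (bs l) (y \<otimes> m))"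
        proof (rule sum.cong[OF refl])
          fix l assume "l \<in> {0..<d}"
          then have bl: "bs l \<in> right_part" using bsB(2) by simp
          have "(\<Sum>i\<in>{0..<d}. co (m \<otimes> bs l) (bs i) * ?g (bs i) y) = ?g (bs l) (y \<otimes> m)"
            using co[OF X_act[OF m(1) bl], of y] g_act[OF m(1) bl y, where 'k = 'k] by simp
          then show "(\<Sum>i\<in>{0..<d}. co (m' \<otimes> bs j) (bs l) * (co (m \<otimes> bs l) (bs i) * ?g (bs i) y)) =
              co (m' \<otimes> bs j) (bs l) * ?g (bs l) (y \<otimes> m)" by (simp flip: sum_distrib_left)
        qed
        also have "\<dots> = ?g (m' \<otimes> bs j) (y \<otimes> m)" using co[OF X_act[OF m(2) bj], of "y \<otimes> m"] by simp
        also have "\<dots> = ?g (m \<otimes> m' \<otimes> bs j) y"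
          using g_act[OF m(1) X_act[OF m(2) bj] y, where 'k = 'k] m XY(1)[OF bj] by (simp add: m_assoc)
        also have "\<dots> = (\<Sum>i\<in>{0..<d}. co (m \<otimes> m' \<otimes> bs j) (bs i) * ?g (bs i) y)"
          using co[OF X_act[OF m_closed[OF m] bj], of y] .
        finally show ?thesis by (simp add: left_diff_distrib sum_subtractf)
      qed
      then have "co (m \<otimes> m' \<otimes> bs j) (bs i) - (\<Sum>l\<in>{0..<d}. co (m \<otimes> bs l) (bs i) * co (m' \<otimes> bs j) (bs l)) = 0"
        by (rule ind') (simp, rule ij(1))
      then show "\<rho> (m \<otimes> m') $$ (i, j) = (\<rho> m * \<rho> m') $$ (i, j)"
        using \<rho>i[OF ij] \<rho>c[of m] \<rho>c[of m'] ij \<rho>i by (simp add: scalar_prod_def)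
    qed (use \<rho>c[of m] \<rho>c[of m'] \<rho>c[of "m \<otimes> m'"] in auto)
  qed (rule \<rho>c)
  have nonzero: "\<exists>y\<in>left_part. \<exists>b\<in>right_part. y \<otimes> m \<otimes> b = e" if m: "m \<in> carrier M" "\<rho> m \<noteq> 0\<^sub>m d d" for m
  proof (rule ccontr)
    assume *: "\<not> ?thesis"
    have "\<rho> m = 0\<^sub>m d d"
    proof (rule eq_matI)
      fix i j assume "i < dim_row (0\<^sub>m d d :: 'k mat)" "j < dim_col (0\<^sub>m d d :: 'k mat)"
      then have ij: "i < d" "j < d" by auto
      note bj = bsB(2)[OF ij(2)]
      have "?g (m \<otimes> bs j) y = 0" for y
        using * bj m(1) XY unfolding pairing_def by (metis m_assoc)
      then have "(\<Sum>i\<in>{0..<d}. co (m \<otimes> bs j) (bs i) * ?g (bs i) y) = 0" for y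
        using co[OF X_act[OF m(1) bj], of y] by simp
      then have "co (m \<otimes> bs j) (bs i) = 0" by (rule ind') (rule ij(1))
      then show "\<rho> m $$ (i, j) = 0\<^sub>m d d $$ (i, j)" using \<rho>i[OF ij] ij by simp
    qed (use \<rho>c[of m] in auto)
    then show False using m(2) by simp
  qed
  have gee: "?g e e = 1" unfolding pairing_def using e_XY ee by simp
  have \<rho>e: "\<rho> e \<noteq> 0\<^sub>m d d"
  proof
    assume 0: "\<rho> e = 0\<^sub>m d d"
    have "?g (bs i) e = 0" if i: "i < d" for i
    proof -
      have "?g (bs i) (e \<otimes> e) = ?g (e \<otimes> bs i) e" using g_act[OF e bsB(2)[OF i] e_XY(2), where 'k = 'k] by simp
      also have "\<dots> = (\<Sum>l\<in>{0..<d}. \<rho> e $$ (l, i) * ?g (bs l) e)"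
        unfolding co[OF X_act[OF e bsB(2)[OF i]], of e] by (rule sum.cong) (use \<rho>i i in auto)
      also have "\<dots> = 0" unfolding 0 using i by simp
      finally show ?thesis using ee by simp
    qed
    then have "?g e e = 0" unfolding co[OF e_XY(1), of e] by simp
    then show False using gee by simp
  qed
  have d0: "0 < d"
  proof (rule ccontr)
    assume "\<not> 0 < d"
    then have "\<rho> e = 0\<^sub>m d d" using \<rho>c[of e] by (intro eq_matI) auto
    then show False using \<rho>e by simp
  qed
  have yzb: "y \<otimes> z \<otimes> b \<noteq> e" if "y \<in> left_part" "b \<in> right_part" for y b
  proof -
    note c = XY(2,4)[OF that(1)] XY(1,3)[OF that(2)]
    have ye: "y \<otimes> e = e \<or> y \<otimes> e = z" using YX[OF that(1) e_XY(1)] .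
    have eb: "e \<otimes> b = e \<or> e \<otimes> b = z" using YX[OF e_XY(2) that(2)] .
    have "y \<otimes> z \<otimes> b = (y \<otimes> e) \<otimes> z \<otimes> (e \<otimes> b)"
      using c e z zs by (metis m_assoc m_closed)
    also have "\<dots> = z" using ye eb zs by auto
    finally show ?thesis using ez(1) by simp
  qed
  have \<rho>z: "\<rho> z = 0\<^sub>m d d" using nonzero[OF z] yzb by blast
  have simple: "simple_representation M d \<rho>"
    unfolding simple_representation_def vec_subspace_iff
  proof (intro conjI allI impI rep d0; elim conjE)
    fix W :: "'k vec set"
    assume W: "W \<subseteq> carrier_vec d" "0\<^sub>v d \<in> W" "\<forall>v\<in>W. \<forall>w\<in>W. v + w \<in> W" "\<forall>c. \<forall>v\<in>W. c \<cdot>\<^sub>v v \<in> W"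
      and Winv: "\<forall>x\<in>carrier M. \<forall>w\<in>W. \<rho> x *\<^sub>v w \<in> W"
    show "W = {0\<^sub>v d} \<or> W = carrier_vec d"
    proof (cases "W = {0\<^sub>v d}")
      case False
      then obtain w where w: "w \<in> W" "w \<noteq> 0\<^sub>v d" using W(2) by blast
      then have wc: "w \<in> carrier_vec d" using W(1) by blast
      have "\<exists>y\<in>left_part. (\<Sum>i\<in>{0..<d}. w $ i * ?g (bs i) y) \<noteq> 0"
      proof (rule ccontr)
        assume "\<not> ?thesis"
        then have "w $ i = 0" if "i < d" for i using ind'[of "\<lambda>i. w $ i" i] that by blast
        then have "w = 0\<^sub>v d" using wc by (intro eq_vecI) auto
        then show False using w by simp
      qed
      then obtain y where y: "y \<in> left_part" "(\<Sum>i\<in>{0..<d}. w $ i * ?g (bs i) y) \<noteq> 0" by blast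
      define a where "a = (\<Sum>i\<in>{0..<d}. w $ i * ?g (bs i) y)"
      have unit: "unit_vec d j \<in> W" if j: "j < d" for j
      proof -
        \<comment> \<open>By \<open>g_rank_one\<close> this element sends \<open>w\<close> to a
          nonzero multiple of the \<open>j\<close>-th unit vector.\<close>
        define m where "m = bs j \<otimes> y"
        have m: "m \<in> carrier M" unfolding m_def using XY bsB(2)[OF j] y(1) by simp
        have "\<rho> m *\<^sub>v w = a \<cdot>\<^sub>v unit_vec d j"
        proof (rule eq_vecI)
          fix i assume "i < dim_vec (a \<cdot>\<^sub>v unit_vec d j)"
          then have i: "i < d" by simp
          have "(\<Sum>i\<in>{0..<d}. ((\<Sum>l\<in>{0..<d}. co (m \<otimes> bs l) (bs i) * w $ l) - (if i = j then a else 0)) * ?g (bs i) y') = 0"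
            if y': "y' \<in> left_part" for y'
          proof -
            have "(\<Sum>i\<in>{0..<d}. (\<Sum>l\<in>{0..<d}. co (m \<otimes> bs l) (bs i) * w $ l) * ?g (bs i) y') =
               (\<Sum>i\<in>{0..<d}. \<Sum>l\<in>{0..<d}. w $ l * (co (m \<otimes> bs l) (bs i) * ?g (bs i) y'))"
              unfolding sum_distrib_right by (intro sum.cong refl) (simp only: mult_ac)
            also have "\<dots> = (\<Sum>l\<in>{0..<d}. \<Sum>i\<in>{0..<d}. w $ l * (co (m \<otimes> bs l) (bs i) * ?g (bs i) y'))"
              by (rule sum.swap)
            also have "\<dots> = (\<Sum>l\<in>{0..<d}. ?g (bs j) y' * (w $ l * ?g (bs l) y))"
            proof (rule sum.cong[OF refl])
              fix l assume "l \<in> {0..<d}"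
              then have bl: "bs l \<in> right_part" using bsB(2) by simp
              have "(\<Sum>i\<in>{0..<d}. co (m \<otimes> bs l) (bs i) * ?g (bs i) y') = ?g (bs j) y' * ?g (bs l) y"
                using co[OF X_act[OF m bl], of y'] g_rank_one[OF bsB(2)[OF j] y(1) bl y', where 'k = 'k] unfolding m_def by simp
              then show "(\<Sum>i\<in>{0..<d}. w $ l * (co (m \<otimes> bs l) (bs i) * ?g (bs i) y')) = ?g (bs j) y' * (w $ l * ?g (bs l) y)"
                by (simp add: mult.left_commute flip: sum_distrib_left)
            qed
            also have "\<dots> = a * ?g (bs j) y'" unfolding a_def by (simp add: mult.commute flip: sum_distrib_left)
            also have "\<dots> = (\<Sum>i\<in>{0..<d}. (if i = j then a else 0) * ?g (bs i) y')"
              using j by (simp add: if_distrib[of "\<lambda>z. z * _"] cong: if_cong)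
            finally show ?thesis by (simp add: left_diff_distrib sum_subtractf)
          qed
          then have "(\<Sum>l\<in>{0..<d}. co (m \<otimes> bs l) (bs i) * w $ l) - (if i = j then a else 0) = 0"
            by (rule ind') (simp, rule i)
          moreover have "(\<rho> m *\<^sub>v w) $ i = (\<Sum>l\<in>{0..<d}. co (m \<otimes> bs l) (bs i) * w $ l)"
            using \<rho>c[of m] wc i \<rho>i by (simp add: scalar_prod_def)
          ultimately show "(\<rho> m *\<^sub>v w) $ i = (a \<cdot>\<^sub>v unit_vec d j) $ i" using i j by simp
        qed (use \<rho>c[of m] in auto)
        then have "a \<cdot>\<^sub>v unit_vec d j \<in> W" using Winv m w(1) by metis
        then have "inverse a \<cdot>\<^sub>v (a \<cdot>\<^sub>v unit_vec d j) \<in> W" using W(4) by blast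
        then show ?thesis using y(2) unfolding a_def[symmetric] by (simp add: smult_smult_assoc)
      qed
      have part: "vec d (\<lambda>i. if i < k then v $ i else 0) \<in> W" if v: "v \<in> carrier_vec d" for v k
      proof (induction k)
        case 0
        have "vec d (\<lambda>i. if i < 0 then v $ i else 0) = 0\<^sub>v d" by (intro eq_vecI) auto
        then show ?case using W(2) by simp
      next
        case (Suc k)
        show ?case
        proof (cases "k < d")
          case True
          have "vec d (\<lambda>i. if i < Suc k then v $ i else 0) = vec d (\<lambda>i. if i < k then v $ i else 0) + (v $ k) \<cdot>\<^sub>v unit_vec d k"
            by (intro eq_vecI) (auto simp: less_Suc_eq unit_vec_def)
          then show ?thesis using Suc W(3,4) unit[OF True] by metis
        next
          case False
          then have "vec d (\<lambda>i. if i < Suc k then v $ i else 0) = vec d (\<lambda>i. if i < k then v $ i else 0)"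
            by (intro eq_vecI) auto
          then show ?thesis using Suc by simp
        qed
      qed
      have "v \<in> W" if v: "v \<in> carrier_vec d" for v
      proof -
        have "vec d (\<lambda>i. if i < d then v $ i else 0) = v" using v by (intro eq_vecI) auto
        then show ?thesis using part[OF v, of d] by simp
      qed
      then show ?thesis using W(1) by blast
    qed simp
  qed
  have nontrivial: "\<not> trivial_representation M d \<rho>"
  proof
    assume "trivial_representation M d \<rho>"
    then consider P Q where "d = 1" "\<forall>x\<in>carrier M. similar_mat_wit (\<rho> x) (if x \<in> Units M then 1\<^sub>m 1 else 0\<^sub>m 1 1) P Q"
      | P Q where "d = 1" "\<forall>x\<in>carrier M. similar_mat_wit (\<rho> x) (1\<^sub>m 1) P Q"
      unfolding trivial_representation_def isomorphic_representations_def by blast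
    then show False
    proof cases
      case (1 P Q)
      have "e \<notin> Units M"
      proof
        assume u: "e \<in> Units M"
        then have "e = inv e \<otimes> (e \<otimes> e)" using e by (metis Units_inv_closed Units_l_inv l_one m_assoc)
        then show False using u ee ez(2) by (metis Units_l_inv)
      qed
      then have "similar_mat_wit (\<rho> e) (0\<^sub>m 1 1) P Q" using 1(2) e by auto
      then have "{P, Q} \<subseteq> carrier_mat 1 1" "\<rho> e = P * 0\<^sub>m 1 1 * Q"
        using \<rho>c[of e] 1(1) unfolding similar_mat_wit_def Let_def by auto
      then have "\<rho> e = 0\<^sub>m 1 1" by auto
      then show False using \<rho>e 1(1) by simp
    next
      case (2 P Q)
      have "similar_mat_wit (\<rho> z) (1\<^sub>m 1) P Q" using 2(2) z by auto
      then have c: "{P, Q} \<subseteq> carrier_mat 1 1" "\<rho> z = P * 1\<^sub>m 1 * Q" "P * Q = 1\<^sub>m 1"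
        using \<rho>c[of z] 2(1) unfolding similar_mat_wit_def Let_def by auto
      then have "\<rho> z = 1\<^sub>m 1" by auto
      then have "(1\<^sub>m 1 :: 'k mat) $$ (0, 0) = 0\<^sub>m 1 1 $$ (0, 0)" using \<rho>z 2(1) by simp
      then show False by simp
    qed
  qed
  let ?J = "{b \<in> carrier M. le_lr M e b \<and> le_lr M b e}"
  have apex: "is_apex M d \<rho> ?J"
    unfolding is_apex_def
  proof (intro conjI ballI impI; (elim conjE)?)
    show "?J \<in> J_cells M" by (rule J_cell_of[OF e])
    show "\<not> annihilates d \<rho> ?J"
      unfolding annihilates_def using \<rho>e e le_lr_refl[OF M e] by blast
    fix J' assume J': "J' \<in> J_cells M" "\<not> annihilates d \<rho> J'" "J_cell_le M ?J J'"
    then obtain b where b: "b \<in> J'" "\<rho> b \<noteq> 0\<^sub>m d d" unfolding annihilates_def by blast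
    have bM: "b \<in> carrier M" using J_cell_eq(2)[OF M J'(1) b(1)] .
    have "e \<in> ?J" using e le_lr_refl[OF M e] by blast
    then have eb: "le_lr M e b" using J'(3) b(1) unfolding J_cell_le_def by blast
    obtain y x where "y \<in> left_part" "x \<in> right_part" "y \<otimes> b \<otimes> x = e" using nonzero[OF bM b(2)] by blast
    then have be: "le_lr M b e" unfolding le_lr_def using XY by metis
    have "b \<in> ?J" using bM eb be by blast
    then show "J' = ?J"
      using J_cell_eq(1)[OF M J'(1) b(1)] J_cell_eq(1)[OF M J_cell_of[OF e], of b] by simp
  qed
  have "d \<le> card right_part" unfolding d_def by (rule card_mono[OF finX B])
  then show ?thesis using that simple nontrivial apex by blast
qed

end

section \<open>Counting matchings\<close>

text \<open>The rotation starts where the prefix sums are smallest; relative to that place all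
  heights are nonnegative, also after wrapping around because the total is zero.\<close>

lemma rotate_nonneg:
  fixes w :: "'b \<Rightarrow> int"
  assumes z: "sum_list (map w xs) = 0"
  obtains r where "r \<le> length xs" "\<And>k. 0 \<le> sum_list (map w (take k (drop r xs @ take r xs)))"
proof -
  define h where "h k = sum_list (map w (take k xs))" for k
  have hS: "h (r + k) = h r + sum_list (map w (take k (drop r xs)))" for r k
    unfolding h_def by (simp add: take_add)
  obtain r where r: "r \<le> length xs" "\<And>k. k \<le> length xs \<Longrightarrow> h r \<le> h k"
    using ex_min_if_finite[of "h ` {..length xs}"] arg_min_if_finite[of "{..length xs}" h]
    by (metis atMost_iff empty_iff finite_atMost linorder_not_less zero_le)
  have hlen: "h (length xs) = 0" unfolding h_def using z by simp
  have min: "h r \<le> h k" for k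
    by (cases "k \<le> length xs") (use r(2)[of k] r(2)[of "length xs"] in \<open>auto simp: h_def\<close>)
  have "0 \<le> sum_list (map w (take k (drop r xs @ take r xs)))" for k
  proof (cases "k \<le> length xs - r")
    case True
    then show ?thesis using hS[of r k] min[of "r + k"] by simp
  next
    case False
    then have "sum_list (map w (take k (drop r xs @ take r xs))) =
        sum_list (map w (drop r xs)) + sum_list (map w (take (min (k - (length xs - r)) r) xs))"
      by (simp add: take_map[symmetric] min.commute)
    moreover have "sum_list (map w (drop r xs)) = - h r"
      using hS[of r "length xs - r"] hlen r(1) by simp
    moreover have "h r \<le> h (min (k - (length xs - r)) r)" by (rule min)
    ultimately show ?thesis unfolding h_def by simp
  qed
  then show ?thesis using that r(1) by blast
qed

definition words :: "'b set \<Rightarrow> nat \<Rightarrow> 'b list set" where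
  "words B m = {xs. set xs \<subseteq> B \<and> length xs = m}"

definition dyck :: "('b \<Rightarrow> int) \<Rightarrow> 'b set \<Rightarrow> nat \<Rightarrow> 'b list set" where
  "dyck w B m = {xs \<in> words B m. sum_list (map w xs) = 0 \<and> (\<forall>k. 0 \<le> sum_list (map w (take k xs)))}"

lemma words_D: "finite B \<Longrightarrow> finite (words B m)" "finite B \<Longrightarrow> card (words B m) = card B ^ m"
  unfolding words_def by (simp_all add: finite_lists_length_eq card_lists_length_eq)

lemma sum_list_bound:
  fixes w :: "'b \<Rightarrow> int"
  assumes "\<And>b. b \<in> set xs \<Longrightarrow> \<bar>w b\<bar> \<le> 1"
  shows "\<bar>sum_list (map w xs)\<bar> \<le> int (length xs)"
  using assms
proof (induction xs)
  case (Cons x xs)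
  have "\<bar>w x\<bar> \<le> 1" "\<bar>sum_list (map w xs)\<bar> \<le> int (length xs)" using Cons by auto
  then show ?case by simp
qed simp

text \<open>The half-words of the most frequent weight, glued to their negatives, give zero-sum words;
  each of these has a rotation all of whose prefixes are nonnegative.\<close>

lemma card_dyck:
  fixes w :: "'b \<Rightarrow> int"
  assumes B: "finite B" "\<And>b. b \<in> B \<Longrightarrow> \<bar>w b\<bar> \<le> 1" "\<And>b. b \<in> B \<Longrightarrow> \<nu> b \<in> B \<and> w (\<nu> b) = - w b" "inj_on \<nu> B"
  shows "card B ^ (2 * l) \<le> (2 * l + 1) ^ 3 * card (dyck w B (2 * l))"
proof -
  let ?N = "\<lambda>s. {xs \<in> words B l. sum_list (map w xs) = s}"
  let ?S = "{- int l..int l}" and ?Z = "{xs \<in> words B (2 * l). sum_list (map w xs) = 0}"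
  have fin: "finite (words B m)" for m using words_D(1)[OF B(1)] .
  have finN: "finite (?N s)" for s using fin by simp
  have finD: "finite (dyck w B m)" for m unfolding dyck_def using fin by simp
  have "words B l = (\<Union>s\<in>?S. ?N s)"
  proof -
    have "sum_list (map w xs) \<in> ?S" if "xs \<in> words B l" for xs
    proof -
      have "\<bar>sum_list (map w xs)\<bar> \<le> int (length xs)"
        by (rule sum_list_bound) (use that B(2) in \<open>auto simp: words_def\<close>)
      then show ?thesis using that unfolding words_def by auto
    qed
    then show ?thesis by blast
  qed
  then have "card (words B l) \<le> (\<Sum>s\<in>?S. card (?N s))" using card_UN_le[of ?S ?N] by simp
  moreover obtain s where s: "s \<in> ?S" "\<And>t. t \<in> ?S \<Longrightarrow> card (?N t) \<le> card (?N s)"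
  proof -
    have fne: "finite ((\<lambda>t. card (?N t)) ` ?S)" "(\<lambda>t. card (?N t)) ` ?S \<noteq> {}" by simp_all
    obtain s where "Max ((\<lambda>t. card (?N t)) ` ?S) = card (?N s)" "s \<in> ?S" using Max_in[OF fne] by (rule imageE)
    then show ?thesis using Max_ge[OF fne(1)] by (intro that[of s]) auto
  qed
  moreover have "(\<Sum>t\<in>?S. card (?N t)) \<le> card ?S * card (?N s)"
    using sum_bounded_above[of ?S "\<lambda>t. card (?N t)" "card (?N s)"] s(2) by simp
  moreover have "card ?S = 2 * l + 1" by simp
  ultimately have 1: "card B ^ l \<le> (2 * l + 1) * card (?N s)" using words_D(2)[OF B(1)] by simp
  have "card (?N s \<times> ?N s) \<le> card ?Z"
  proof (rule card_inj_on_le[where f = "\<lambda>(us, vs). us @ map \<nu> vs"])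
    show "inj_on (\<lambda>(us, vs). us @ map \<nu> vs) (?N s \<times> ?N s)"
    proof (rule inj_onI, clarify)
      fix a b c d assume *: "a \<in> words B l" "b \<in> words B l" "c \<in> words B l" "d \<in> words B l" "a @ map \<nu> b = c @ map \<nu> d"
      then have "length a = length c" unfolding words_def by simp
      then have "a = c" "map \<nu> b = map \<nu> d" using *(5) by simp_all
      moreover have "inj_on \<nu> (set b \<union> set d)" using * B(4) unfolding words_def by (auto intro: inj_on_subset)
      ultimately show "a = c \<and> b = d" using map_inj_on by blast
    qed
    have neg: "sum_list (map w (map \<nu> vs)) = - sum_list (map w vs)" if "set vs \<subseteq> B" for vs
      using that B(3) by (induction vs) auto
    show "(\<lambda>(us, vs). us @ map \<nu> vs) ` (?N s \<times> ?N s) \<subseteq> ?Z"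
    proof clarify
      fix a b assume *: "a \<in> words B l" "b \<in> words B l" "s = sum_list (map w a)" "sum_list (map w b) = sum_list (map w a)"
      have "set (map \<nu> b) \<subseteq> B" using * B(3) unfolding words_def by auto
      then show "a @ map \<nu> b \<in> words B (2 * l) \<and> sum_list (map w (a @ map \<nu> b)) = 0"
        using * neg[of b] unfolding words_def by (simp del: map_map)
    qed
    show "finite ?Z" using fin by simp
  qed
  then have 2: "card (?N s) * card (?N s) \<le> card ?Z" unfolding card_cartesian_product .
  let ?D = "dyck w B (2 * l)"
  have ex: "\<exists>r\<le>length xs. \<forall>k. 0 \<le> sum_list (map w (take k (drop r xs @ take r xs)))" if "xs \<in> ?Z" for xs
    using rotate_nonneg[of w xs] that by blast
  define rr where "rr xs = (SOME r. r \<le> length xs \<and> (\<forall>k. 0 \<le> sum_list (map w (take k (drop r xs @ take r xs)))))" for xs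
  have rr: "rr xs \<le> length xs" "\<And>k. 0 \<le> sum_list (map w (take k (drop (rr xs) xs @ take (rr xs) xs)))" if "xs \<in> ?Z" for xs
    using someI_ex[OF ex[OF that]] unfolding rr_def by blast+
  have "card ?Z \<le> card ({0..2 * l} \<times> ?D)"
  proof (rule card_inj_on_le[where f = "\<lambda>xs. (rr xs, drop (rr xs) xs @ take (rr xs) xs)"])
    show "inj_on (\<lambda>xs. (rr xs, drop (rr xs) xs @ take (rr xs) xs)) ?Z"
    proof (rule inj_onI, clarify)
      fix x y assume *: "x \<in> words B (2 * l)" "y \<in> words B (2 * l)" "rr x = rr y"
        "drop (rr x) x @ take (rr x) x = drop (rr y) y @ take (rr y) y"
      have "length x = length y" using * unfolding words_def by simp
      then have "drop (rr y) x = drop (rr y) y \<and> take (rr y) x = take (rr y) y"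
        using *(3,4) by (metis append_eq_append_conv length_drop)
      then show "x = y" by (metis append_take_drop_id)
    qed
    show "(\<lambda>xs. (rr xs, drop (rr xs) xs @ take (rr xs) xs)) ` ?Z \<subseteq> {0..2 * l} \<times> ?D"
    proof (rule image_subsetI)
      fix x assume x: "x \<in> ?Z"
      let ?y = "drop (rr x) x @ take (rr x) x"
      have "set ?y \<subseteq> set x" using set_drop_subset[of "rr x" x] set_take_subset[of "rr x" x] by auto
      moreover have "length ?y = length x" using rr(1)[OF x] by simp
      moreover have "sum_list (map w ?y) = sum_list (map w (take (rr x) x @ drop (rr x) x))"
        unfolding map_append sum_list_append by simp
      ultimately have "?y \<in> ?D" using x rr(2)[OF x] unfolding dyck_def words_def by auto
      then show "(rr x, ?y) \<in> {0..2 * l} \<times> ?D" using rr(1)[OF x] x unfolding words_def by auto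
    qed
    show "finite ({0..2 * l} \<times> ?D)" using finD by simp
  qed
  then have 3: "card ?Z \<le> (2 * l + 1) * card ?D" unfolding card_cartesian_product by simp
  \<comment> \<open>Two of the three factors come from the \<open>2 * l + 1\<close> possible weights
    of a half-word, the third from the possible rotations.\<close>
  have "card B ^ (2 * l) = card B ^ l * card B ^ l" by (simp add: power_add mult_2)
  also have "\<dots> \<le> ((2 * l + 1) * card (?N s)) * ((2 * l + 1) * card (?N s))" using 1 by (intro mult_le_mono) auto
  also have "\<dots> = (2 * l + 1) ^ 2 * (card (?N s) * card (?N s))" by (simp add: power2_eq_square algebra_simps)
  also have "\<dots> \<le> (2 * l + 1) ^ 2 * ((2 * l + 1) * card ?D)" using 2 3 by (intro mult_le_mono2) linarith
  also have "\<dots> = (2 * l + 1) ^ 3 * card ?D" by (simp add: power2_eq_square power3_eq_cube algebra_simps)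
  finally show ?thesis .
qed

text \<open>As in \<open>noncrossing_determined\<close>, the last left end is joined to the first
  right end after it. Such a right end exists by the prefix condition just before the last left end,
  and removing the pair preserves the condition.\<close>

lemma matching_exists:
  assumes "finite Op" "finite Cl" "Op \<inter> Cl = {}" "card Op = card Cl"
    and "\<And>x. card {c \<in> Cl. c \<le> x} \<le> card {o' \<in> Op. o' \<le> (x :: nat)}"
  shows "\<exists>f\<in>noncrossing (Op \<union> Cl). {x. x < f x} = Op \<and> {x. f x < x} = Cl"
  using assms
proof (induction "card Op" arbitrary: Op Cl)
  case 0
  then have "Op = {}" "Cl = {}" by auto
  then show ?case by (intro bexI[of _ id]) (auto simp: noncrossing_def)
next
  case (Suc m)
  note fin = Suc.prems(1,2) and pre = Suc.prems(5)
  have ne: "Op \<noteq> {}" "Cl \<noteq> {}" using Suc by auto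
  define a where "a = Max Op"
  have a: "a \<in> Op" "\<And>x. x \<in> Op \<Longrightarrow> x \<le> a" unfolding a_def using ne fin by auto
  have "\<exists>c\<in>Cl. a < c"
  proof (rule ccontr)
    assume n: "\<not> ?thesis"
    have "c < a" if "c \<in> Cl" for c using n that a(1) Suc.prems(3) by (metis disjoint_iff linorder_neqE_nat)
    then have c: "{c \<in> Cl. c \<le> a - 1} = Cl" by fastforce
    have "0 < a" using \<open>\<And>c. c \<in> Cl \<Longrightarrow> c < a\<close> ne by fastforce
    then have "\<not> a \<le> a - 1" by linarith
    then have "a \<notin> {o' \<in> Op. o' \<le> a - 1}" by blast
    then have "{o' \<in> Op. o' \<le> a - 1} \<subset> Op" using a(1) by blast
    then have "card {o' \<in> Op. o' \<le> a - 1} < card Op" using fin psubset_card_mono by blast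
    then show False using pre[of "a - 1"] c Suc.prems(4) by simp
  qed
  then have ne': "{c \<in> Cl. a < c} \<noteq> {}" by blast
  define b where "b = Min {c \<in> Cl. a < c}"
  have b: "b \<in> Cl" "a < b" "\<And>c. c \<in> Cl \<Longrightarrow> a < c \<Longrightarrow> b \<le> c"
    using Min_in[OF _ ne'] fin unfolding b_def by (auto intro: Min_le)
  let ?O = "Op - {a}" and ?C = "Cl - {b}"
  have "\<exists>g\<in>noncrossing (?O \<union> ?C). {x. x < g x} = ?O \<and> {x. g x < x} = ?C"
  proof (rule Suc.hyps(1))
    show "m = card ?O" using Suc.hyps(2) a(1) by simp
    show "card ?O = card ?C" using Suc.prems(4) a(1) b(1) fin by simp
    fix x
    show "card {c \<in> ?C. c \<le> x} \<le> card {o' \<in> ?O. o' \<le> x}"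
    proof (cases "a \<le> x")
      case False
      then have "{c \<in> ?C. c \<le> x} = {c \<in> Cl. c \<le> x}" "{o' \<in> ?O. o' \<le> x} = {o' \<in> Op. o' \<le> x}" using b(2) by auto
      then show ?thesis using pre by simp
    next
      case True
      then have "{o' \<in> ?O. o' \<le> x} = ?O" using a(2) by fastforce
      moreover have "card {c \<in> ?C. c \<le> x} \<le> card ?C" by (rule card_mono) (use fin in auto)
      ultimately show ?thesis using Suc.prems(4) a(1) b(1) fin by simp
    qed
  qed (use Suc.prems in auto)
  then obtain g where g: "g \<in> noncrossing (?O \<union> ?C)" "{x. x < g x} = ?O" "{x. g x < x} = ?C" by blast
  have s: "?O \<union> ?C = (Op \<union> Cl) - {a, b}" using a(1) b(1) Suc.prems(3) by blast
  have ga: "g a = a" "g b = b" using noncrossing_outside[OF g(1)] unfolding s by auto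
  have "g(a := b, b := a) \<in> noncrossing (Op \<union> Cl)"
  proof (rule noncrossing_insert_arc)
    show "g \<in> noncrossing ((Op \<union> Cl) - {a, b})" using g(1) s by simp
  qed (use a b in \<open>auto dest: leD\<close>)
  moreover have "{x. x < (g(a := b, b := a)) x} = Op"
  proof (rule Set.set_eqI)
    fix x show "x \<in> {x. x < (g(a := b, b := a)) x} \<longleftrightarrow> x \<in> Op"
      using g(2) a(1) b(1,2) Suc.prems(3) ga by (cases "x = a"; cases "x = b") auto
  qed
  moreover have "{x. (g(a := b, b := a)) x < x} = Cl"
  proof (rule Set.set_eqI)
    fix x show "x \<in> {x. (g(a := b, b := a)) x < x} \<longleftrightarrow> x \<in> Cl"
      using g(3) a(1) b(1,2) Suc.prems(3) ga by (cases "x = a"; cases "x = b") auto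
  qed
  ultimately show ?case by blast
qed

lemma prefix_sum_eq:
  assumes "set \<delta> \<subseteq> {-1, 0, 1 :: int}" "k \<le> length \<delta>"
  shows "sum_list (take k \<delta>) = int (card {i. i < k \<and> \<delta> ! i = 1}) - int (card {i. i < k \<and> \<delta> ! i = -1})"
  using assms(2)
proof (induction k)
  case (Suc k)
  then have k: "k < length \<delta>" by simp
  have S: "{i. i < Suc k \<and> \<delta> ! i = c} = (if \<delta> ! k = c then insert k {i. i < k \<and> \<delta> ! i = c} else {i. i < k \<and> \<delta> ! i = c})" for c
    by (auto simp: less_Suc_eq)
  have f: "finite {i. i < k \<and> \<delta> ! i = c}" for c by simp
  have "\<delta> ! k \<in> {-1, 0, 1}" using assms(1) k nth_mem by blast
  then show ?case using Suc.IH k unfolding take_Suc_conv_app_nth[OF k] S by (auto simp: f)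
qed simp

lemma dyck_matching:
  assumes \<delta>: "\<delta> \<in> dyck id {-1, 0, 1} m"
  shows "\<exists>f\<in>noncrossing {a + 1..a + m}. \<forall>i<m. (a + 1 + i < f (a + 1 + i) \<longleftrightarrow> \<delta> ! i = 1) \<and> (f (a + 1 + i) < a + 1 + i \<longleftrightarrow> \<delta> ! i = -1)"
proof -
  have d: "set \<delta> \<subseteq> {-1, 0, 1}" "length \<delta> = m" "sum_list \<delta> = 0" "\<And>k. 0 \<le> sum_list (take k \<delta>)"
    using \<delta> unfolding dyck_def words_def by auto
  define E where "E c = (\<lambda>i. a + 1 + i) ` {i. i < m \<and> \<delta> ! i = c}" for c
  have fE: "finite (E c)" for c unfolding E_def by simp
  have E_iff: "a + 1 + i \<in> E c \<longleftrightarrow> i < m \<and> \<delta> ! i = c" for i c unfolding E_def by auto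
  have cE: "card {y \<in> E c. y \<le> x} = card {i. i < min m (x - a) \<and> \<delta> ! i = c}" for c x
  proof -
    have "{y \<in> E c. y \<le> x} = (\<lambda>i. a + 1 + i) ` {i. i < min m (x - a) \<and> \<delta> ! i = c}" unfolding E_def by auto
    then show ?thesis by (simp add: card_image inj_on_def)
  qed
  have pre: "card {y \<in> E (-1). y \<le> x} \<le> card {y \<in> E 1. y \<le> x}" for x
    using d(4)[of "min m (x - a)"] prefix_sum_eq[OF d(1), of "min m (x - a)"] d(2) unfolding cE by simp
  have tot: "card (E 1) = card (E (-1))"
  proof -
    have "card (E c) = card {i. i < m \<and> \<delta> ! i = c}" for c unfolding E_def by (simp add: card_image inj_on_def)
    then show ?thesis using prefix_sum_eq[OF d(1), of m] d(2,3) by simp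
  qed
  have "E 1 \<inter> E (-1) = {}" unfolding E_def by auto
  then obtain f where f: "f \<in> noncrossing (E 1 \<union> E (-1))" "{x. x < f x} = E 1" "{x. f x < x} = E (-1)"
    using matching_exists[OF fE fE _ tot pre] by blast
  have "E 1 \<union> E (-1) \<subseteq> {a + 1..a + m}" unfolding E_def by auto
  then have "f \<in> noncrossing {a + 1..a + m}" using f(1) noncrossing_mono by blast
  moreover have "a + 1 + i < f (a + 1 + i) \<longleftrightarrow> \<delta> ! i = 1" "f (a + 1 + i) < a + 1 + i \<longleftrightarrow> \<delta> ! i = -1" if "i < m" for i
    using f(2,3) E_iff[of i] that by blast+
  ultimately show ?thesis by blast
qed

text \<open>A word is recovered from the left and right ends of the matching that realizes it, so
  \<open>dyck_matching\<close> yields an injection; \<open>Q\<close> collects further properties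
  that can be read off from the word.\<close>

lemma card_dyck_le:
  assumes G: "\<And>x. x \<in> G \<Longrightarrow> \<delta> x \<in> dyck id {-1, 0, 1} m" "inj_on \<delta> G"
    and Q: "\<And>x f. x \<in> G \<Longrightarrow> f \<in> noncrossing {a + 1..a + m} \<Longrightarrow>
      (\<And>i. i < m \<Longrightarrow> a + 1 + i < f (a + 1 + i) \<longleftrightarrow> \<delta> x ! i = 1) \<Longrightarrow>
      (\<And>i. i < m \<Longrightarrow> f (a + 1 + i) < a + 1 + i \<longleftrightarrow> \<delta> x ! i = -1) \<Longrightarrow> Q f"
  shows "card G \<le> card {f \<in> noncrossing {a + 1..a + m}. Q f}"
proof -
  have "\<forall>x\<in>G. \<exists>f. f \<in> noncrossing {a + 1..a + m} \<and> (\<forall>i<m. (a + 1 + i < f (a + 1 + i) \<longleftrightarrow> \<delta> x ! i = 1) \<and> (f (a + 1 + i) < a + 1 + i \<longleftrightarrow> \<delta> x ! i = -1))"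
    using dyck_matching[OF G(1)] by blast
  then obtain F where F: "\<And>x. x \<in> G \<Longrightarrow> F x \<in> noncrossing {a + 1..a + m}"
    "\<And>x i. x \<in> G \<Longrightarrow> i < m \<Longrightarrow> a + 1 + i < F x (a + 1 + i) \<longleftrightarrow> \<delta> x ! i = 1"
    "\<And>x i. x \<in> G \<Longrightarrow> i < m \<Longrightarrow> F x (a + 1 + i) < a + 1 + i \<longleftrightarrow> \<delta> x ! i = -1"
    using bchoice[of G] by metis
  show ?thesis
  proof (rule card_inj_on_le[of F])
    show "inj_on F G"
    proof (rule inj_onI)
      fix x y assume xy: "x \<in> G" "y \<in> G" "F x = F y"
      have l: "length (\<delta> x) = m" "length (\<delta> y) = m" "set (\<delta> x) \<subseteq> {-1, 0, 1}" "set (\<delta> y) \<subseteq> {-1, 0, 1}"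
        using G(1)[OF xy(1)] G(1)[OF xy(2)] unfolding dyck_def words_def by auto
      have "\<delta> x ! i = \<delta> y ! i" if i: "i < m" for i
      proof -
        have "\<delta> x ! i \<in> {-1, 0, 1}" "\<delta> y ! i \<in> {-1, 0, 1}" using l i nth_mem by (metis subsetD)+
        moreover have "\<delta> x ! i = 1 \<longleftrightarrow> \<delta> y ! i = 1" "\<delta> x ! i = -1 \<longleftrightarrow> \<delta> y ! i = -1"
          using F(2,3)[OF xy(1) i] F(2,3)[OF xy(2) i] xy(3) by simp_all
        ultimately show ?thesis by auto
      qed
      then have "\<delta> x = \<delta> y" using l by (simp add: nth_equalityI)
      then show "x = y" using G(2) xy by (metis inj_onD)
    qed
    show "F ` G \<subseteq> {f \<in> noncrossing {a + 1..a + m}. Q f}" using F Q by blast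
    show "finite {f \<in> noncrossing {a + 1..a + m}. Q f}" using finite_noncrossing by simp
  qed
qed

text \<open>\<open>card_dyck\<close> counts words of even length, so an odd \<open>m\<close> loses
  one letter and with it a factor 3.\<close>

lemma card_noncrossing_lower: "3 ^ m \<le> 3 * (m + 1) ^ 3 * card (noncrossing {a + 1..a + m})"
proof -
  define l where "l = m div 2"
  have "card {-1, 0, 1 :: int} = 3" by simp
  moreover have "card {-1, 0, 1 :: int} ^ (2 * l) \<le> (2 * l + 1) ^ 3 * card (dyck id {-1, 0, 1 :: int} (2 * l))"
    by (rule card_dyck[where \<nu> = uminus]) auto
  ultimately have "3 ^ (2 * l) \<le> (2 * l + 1) ^ 3 * card (dyck id {-1, 0, 1 :: int} (2 * l))" by (simp only:)
  moreover have "card (dyck id {-1, 0, 1 :: int} (2 * l)) \<le> card {f \<in> noncrossing {a + 1..a + 2 * l}. True}"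
    by (rule card_dyck_le[where \<delta> = id]) auto
  moreover have "card (noncrossing {a + 1..a + 2 * l}) \<le> card (noncrossing {a + 1..a + m})"
    by (rule card_mono[OF finite_noncrossing noncrossing_mono]) (auto simp: l_def)
  ultimately have "3 ^ (2 * l) \<le> (2 * l + 1) ^ 3 * card (noncrossing {a + 1..a + m})"
    unfolding simp_thms Collect_mem_eq by (meson le_trans mult_le_mono2)
  also have "\<dots> \<le> (m + 1) ^ 3 * card (noncrossing {a + 1..a + m})"
    by (intro mult_le_mono1 power_mono) (auto simp: l_def)
  finally have "3 * (3::nat) ^ (2 * l) \<le> 3 * (m + 1) ^ 3 * card (noncrossing {a + 1..a + m})" by simp
  moreover have "(3::nat) ^ m \<le> 3 ^ Suc (2 * l)" by (rule power_increasing) (auto simp: l_def)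
  ultimately show ?thesis by simp
qed

section \<open>Alternating matchings as words of pairs\<close>

definition flat :: "(int \<times> int) list \<Rightarrow> int list" where
  "flat ps = concat (map (\<lambda>(x, y). [x, y]) ps)"

lemma flat_simps [simp]: "flat [] = []" "flat ((x, y) # ps) = x # y # flat ps"
  unfolding flat_def by simp_all

lemma length_flat: "length (flat ps) = 2 * length ps"
  by (induction ps) auto

lemma sum_flat: "sum_list (flat ps) = sum_list (map (\<lambda>(x, y). x + y) ps)"
  by (induction ps) auto

lemma nth_flat: "i < length ps \<Longrightarrow> flat ps ! (2 * i) = fst (ps ! i) \<and> flat ps ! (2 * i + 1) = snd (ps ! i)"
proof (induction ps arbitrary: i)
  case (Cons p ps)
  then show ?case by (cases p; cases i) auto
qed simp

lemma inj_flat: "flat ps = flat qs \<Longrightarrow> ps = qs"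
proof (induction ps arbitrary: qs)
  case Nil
  then show ?case by (cases qs) auto
next
  case (Cons p ps)
  obtain x y where p: "p = (x, y)" by (cases p)
  then obtain q qs' where q: "qs = q # qs'" using Cons.prems by (cases qs) auto
  then show ?case using Cons p by (cases q) auto
qed

text \<open>In an alternating matching the first position of a pair may open an arc or be a dot, the
  second may close one or be a dot. Each of the four combinations has weight -1, 0 or 1, so
  \<open>card_dyck\<close> applies with pairs as letters.\<close>

definition pairs :: "(int \<times> int) set" where "pairs = {(0, 0), (1, 0), (0, -1), (1, -1)}"

text \<open>The first entry of a pair is nonnegative, so a prefix that cuts a pair in two is not
  lower than the one before this pair.\<close>

lemma flat_prefix:
  assumes "set ps \<subseteq> pairs" "\<And>k. 0 \<le> s + sum_list (map (\<lambda>(x, y). x + y) (take k ps))"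
  shows "0 \<le> s + sum_list (take k (flat ps))"
  using assms
proof (induction ps arbitrary: s k)
  case Nil
  then show ?case by simp
next
  case (Cons p ps)
  obtain x y where p: "p = (x, y)" by (cases p)
  have s: "0 \<le> s" using Cons.prems(2)[of 0] by simp
  have x: "0 \<le> x" using Cons.prems(1) p unfolding pairs_def by auto
  have IH: "0 \<le> (s + (x + y)) + sum_list (take j (flat ps))" for j
  proof (rule Cons.IH)
    show "set ps \<subseteq> pairs" using Cons.prems(1) by simp
    show "0 \<le> (s + (x + y)) + sum_list (map (\<lambda>(x, y). x + y) (take k ps))" for k
      using Cons.prems(2)[of "Suc k"] p by (simp add: algebra_simps)
  qed
  consider "k = 0" | "k = 1" | j where "k = Suc (Suc j)" by (metis One_nat_def not0_implies_Suc)
  then show ?case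
  proof cases
    case (3 j)
    then show ?thesis using IH[of j] p by (simp add: algebra_simps)
  qed (use s x p in simp_all)
qed

lemma flat_dyck:
  assumes "ps \<in> dyck (\<lambda>(x, y). x + y) pairs t" shows "flat ps \<in> dyck id {-1, 0, 1} (2 * t)"
proof -
  have p: "set ps \<subseteq> pairs" "length ps = t" "sum_list (map (\<lambda>(x, y). x + y) ps) = 0"
    "\<And>k. 0 \<le> sum_list (map (\<lambda>(x, y). x + y) (take k ps))"
    using assms unfolding dyck_def words_def by auto
  have "set (flat ps) \<subseteq> {-1, 0, 1}" using p(1) unfolding flat_def pairs_def by auto
  moreover have "0 \<le> sum_list (take k (flat ps))" for k using flat_prefix[OF p(1), of 0 k] p(4) by simp
  ultimately show ?thesis using p(2,3) sum_flat[of ps] unfolding dyck_def words_def by (auto simp: length_flat)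
qed

text \<open>The offset \<open>a\<close> sets the parity: \<open>a = 0\<close> serves for top halves,
  an odd \<open>a\<close> for bottom halves, whose arcs lead from even to odd positions. Rounding
  \<open>t\<close> down to an even number costs a factor 4.\<close>

lemma card_alternating_lower:
  "4 ^ t \<le> 4 * (t + 1) ^ 3 * card {f \<in> noncrossing {a + 1..a + 2 * t}.
     \<forall>x. (x < f x \<longrightarrow> odd (x - a)) \<and> (f x < x \<longrightarrow> even (x - a))}" (is "_ \<le> _ * card ?F")
proof -
  define l where "l = t div 2"
  let ?w = "\<lambda>(x, y). x + y :: int"
  let ?Q = "\<lambda>f :: nat \<Rightarrow> nat. \<forall>x. (x < f x \<longrightarrow> odd (x - a)) \<and> (f x < x \<longrightarrow> even (x - a))"
  \<comment> \<open>Negating a weight must also exchange the two entries of the pair, since only the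
    first may be positive and only the second negative.\<close>
  have "card pairs ^ (2 * l) \<le> (2 * l + 1) ^ 3 * card (dyck ?w pairs (2 * l))"
    by (rule card_dyck[where \<nu> = "\<lambda>(x, y). (- y, - x)"]) (auto simp: pairs_def inj_on_def)
  moreover have "card pairs = 4" unfolding pairs_def by simp
  moreover have "card (dyck ?w pairs (2 * l)) \<le> card {f \<in> noncrossing {a + 1..a + 2 * (2 * l)}. ?Q f}"
  proof (rule card_dyck_le[where \<delta> = flat])
    show "flat x \<in> dyck id {-1, 0, 1} (2 * (2 * l))" if "x \<in> dyck ?w pairs (2 * l)" for x
      by (rule flat_dyck[OF that])
    show "inj_on flat (dyck ?w pairs (2 * l))" using inj_flat by (auto intro: inj_onI)
    fix ps f assume ps: "ps \<in> dyck ?w pairs (2 * l)" and f: "f \<in> noncrossing {a + 1..a + 2 * (2 * l)}"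
      and up: "\<And>i. i < 2 * (2 * l) \<Longrightarrow> a + 1 + i < f (a + 1 + i) \<longleftrightarrow> flat ps ! i = 1"
      and down: "\<And>i. i < 2 * (2 * l) \<Longrightarrow> f (a + 1 + i) < a + 1 + i \<longleftrightarrow> flat ps ! i = -1"
    have len: "length ps = 2 * l" and mem: "set ps \<subseteq> pairs" using ps unfolding dyck_def words_def by auto
    have ev: "flat ps ! (2 * j) \<noteq> -1" "flat ps ! (2 * j + 1) \<noteq> 1" if "j < 2 * l" for j
    proof -
      have "ps ! j \<in> pairs" using mem that len nth_mem by (metis subsetD)
      then show "flat ps ! (2 * j) \<noteq> -1" "flat ps ! (2 * j + 1) \<noteq> 1"
        using nth_flat[of j ps] that len unfolding pairs_def by auto
    qed
    show "?Q f"
    proof (intro allI conjI impI)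
      fix x
      have dec: "\<exists>i<2 * (2 * l). x = a + 1 + i" if "f x \<noteq> x"
      proof -
        have "x \<in> {a + 1..a + 2 * (2 * l)}" using noncrossing_outside[OF f] that by blast
        then show ?thesis by (intro exI[of _ "x - a - 1"]) auto
      qed
      show "odd (x - a)" if xf: "x < f x"
      proof -
        obtain i where i: "i < 2 * (2 * l)" "x = a + 1 + i" using dec[OF less_imp_neq[OF xf, symmetric]] by blast
        then have "flat ps ! i = 1" using up xf by blast
        then have "i \<noteq> 2 * (i div 2) + 1" using ev(2)[of "i div 2"] i(1) by auto
        then have "even i" by presburger
        then show ?thesis using i(2) by simp
      qed
      show "even (x - a)" if xf: "f x < x"
      proof -
        obtain i where i: "i < 2 * (2 * l)" "x = a + 1 + i" using dec[OF less_imp_neq[OF xf]] by blast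
        then have "flat ps ! i = -1" using down xf by blast
        then have "i \<noteq> 2 * (i div 2)" using ev(1)[of "i div 2"] i(1) by auto
        then have "odd i" by presburger
        then show ?thesis using i(2) by simp
      qed
    qed
  qed
  moreover have "card {f \<in> noncrossing {a + 1..a + 2 * (2 * l)}. ?Q f} \<le> card ?F"
  proof (rule card_mono)
    show "finite ?F" using finite_noncrossing by simp
    have "noncrossing {a + 1..a + 2 * (2 * l)} \<subseteq> noncrossing {a + 1..a + 2 * t}"
      by (rule noncrossing_mono) (auto simp: l_def)
    then show "{f \<in> noncrossing {a + 1..a + 2 * (2 * l)}. ?Q f} \<subseteq> ?F" by blast
  qed
  ultimately have "4 ^ (2 * l) \<le> (2 * l + 1) ^ 3 * card ?F"
    by (metis (no_types, lifting) le_trans mult_le_mono2)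
  also have "\<dots> \<le> (t + 1) ^ 3 * card ?F" by (intro mult_le_mono1 power_mono) (auto simp: l_def)
  finally have "4 * (4::nat) ^ (2 * l) \<le> 4 * (t + 1) ^ 3 * card ?F" by simp
  moreover have "(4::nat) ^ t \<le> 4 ^ Suc (2 * l)" by (rule power_increasing) (auto simp: l_def)
  ultimately show ?thesis by simp
qed

text \<open>Every position opens an arc, closes one or does neither, and this ternary word
  determines the matching.\<close>

lemma card_noncrossing_upper: "card (noncrossing {1..2 * n}) \<le> 9 ^ n"
proof -
  let ?A = "{1..2 * n}" and ?B = "{0, 1, 2 :: nat}"
  let ?h = "\<lambda>f. restrict (\<lambda>x. if x < f x then 1 else if f x < x then 2 else 0 :: nat) ?A"
  have "card (noncrossing ?A) \<le> card (?A \<rightarrow>\<^sub>E ?B)"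
  proof (rule card_inj_on_le[of ?h])
    show "inj_on ?h (noncrossing ?A)"
    proof (rule inj_onI)
      fix f g assume f: "f \<in> noncrossing ?A" and g: "g \<in> noncrossing ?A" and h: "?h f = ?h g"
      have *: "(x < f x \<longleftrightarrow> x < g x) \<and> (f x < x \<longleftrightarrow> g x < x)" for x
      proof (cases "x \<in> ?A")
        case True
        then have "(if x < f x then 1 else if f x < x then 2 else 0 :: nat) = (if x < g x then 1 else if g x < x then 2 else 0)"
          using fun_cong[OF h, of x] by simp
        then show ?thesis by (auto split: if_splits)
      next
        case False
        then show ?thesis using noncrossing_outside[OF f False] noncrossing_outside[OF g False] by simp
      qed
      show "f = g" by (rule noncrossing_determined[OF f g]) (use * in auto)
    qed
  qed (auto intro: finite_PiE split: if_splits)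
  also have "\<dots> = 3 ^ (2 * n)" by (simp add: card_PiE numeral_3_eq_3)
  finally show ?thesis by (simp add: power_mult)
qed

text \<open>If openers and closers occupy positions of opposite parity, then each of the \<open>2n\<close> positions
  offers only two choices.\<close>

lemma card_alternating_upper:
  assumes F: "F \<subseteq> noncrossing {1..2 * n}"
    and alt: "\<And>f x. f \<in> F \<Longrightarrow> x < f x \<Longrightarrow> odd x = b" "\<And>f x. f \<in> F \<Longrightarrow> f x < x \<Longrightarrow> odd x \<noteq> b"
  shows "card F \<le> 4 ^ n"
proof -
  let ?A = "{1..2 * n}"
  have "card F \<le> card (Pow ?A)"
  proof (rule card_inj_on_le[of "\<lambda>f. {x. f x \<noteq> x}"])
    show "inj_on (\<lambda>f. {x. f x \<noteq> x}) F"
    proof (rule inj_onI)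
      fix f g assume f: "f \<in> F" and g: "g \<in> F" and h: "{x. f x \<noteq> x} = {x. g x \<noteq> x}"
      have *: "(x < f x \<longleftrightarrow> x < g x) \<and> (f x < x \<longleftrightarrow> g x < x)" for x
      proof -
        have "f x \<noteq> x \<longleftrightarrow> g x \<noteq> x" using h by blast
        then show ?thesis using alt[OF f, of x] alt[OF g, of x] by (metis linorder_neqE_nat less_asym)
      qed
      show "f = g" by (rule noncrossing_determined[OF subsetD[OF F f] subsetD[OF F g]]) (use * in auto)
    qed
    show "(\<lambda>f. {x. f x \<noteq> x}) ` F \<subseteq> Pow ?A" using F noncrossing_outside by blast
  qed simp
  also have "\<dots> = 4 ^ n" by (simp add: card_Pow power_mult)
  finally show ?thesis .
qed

text \<open>Subsets are coded by words of length \<open>K\<close> over the numbers from 0 to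
  \<open>N\<close>, the letter 0 being padding.\<close>

lemma card_small_subsets: "card {I. I \<subseteq> {1..N} \<and> card I \<le> K} \<le> (N + 1) ^ K"
proof -
  let ?L = "words {0..N} K"
  have "{I. I \<subseteq> {1..N} \<and> card I \<le> K} \<subseteq> (\<lambda>xs. set xs - {0}) ` ?L"
  proof clarify
    fix I assume I: "I \<subseteq> {1..N}" "card I \<le> K"
    then have fin: "finite I" using finite_subset by blast
    obtain xs where xs: "set xs = I" "distinct xs" using finite_distinct_list[OF fin] by blast
    then have "length xs = card I" using distinct_card by metis
    then have "xs @ replicate (K - card I) 0 \<in> ?L" using I xs unfolding words_def by auto
    moreover have "I = set (xs @ replicate (K - card I) 0) - {0}" using I xs by auto
    ultimately show "I \<in> (\<lambda>xs. set xs - {0}) ` ?L" by blast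
  qed
  moreover have "finite ?L" by (rule words_D(1)) simp
  ultimately have "card {I. I \<subseteq> {1..N} \<and> card I \<le> K} \<le> card ?L"
    by (meson card_image_le card_mono finite_imageI le_trans)
  then show ?thesis using words_D(2)[of "{0..N}" K] by simp
qed

section \<open>Upper bounds\<close>

definition idp :: "nat \<Rightarrow> point \<Rightarrow> point" where
  "idp k = strand_map id id {1..k} id"

definition idem :: "nat \<Rightarrow> nat \<Rightarrow> diagram" where
  "idem n k = diagram_of n (idp k)"

lemma idem_mkd: "idem n k = diagram_from n id id {1..k} id"
  unfolding idem_def idp_def ..

lemma data_idem: "k \<le> 2 * n \<Longrightarrow> half_diagrams n id id {1..k} id"
  by (rule data_id) auto

lemma idp_PI: "k \<le> 2 * n \<Longrightarrow> idp k \<in> planar_involutions n"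
  unfolding idp_def by (rule mk_PI[OF data_idem])

lemma idp_simps:
  "idp k (Top i) = (if 1 \<le> i \<and> i \<le> k then Bot i else Top i)"
  "idp k (Bot i) = (if 1 \<le> i \<and> i \<le> k then Top i else Bot i)"
  using mk_simps(1)[of i "{1..k}" id id id] mk_simps(2)[of i "{1..k}" id id id] mk_simps(3)[of i id "{1..k}" id id]
    mk_Bot[of id "{1..k}" i id id] unfolding idp_def by auto

lemma through_idem: "k \<le> 2 * n \<Longrightarrow> through_strands (idem n k) = k"
  unfolding idem_mkd using through_mkd[OF data_idem] by simp

lemma one_idem: "diagram_one n = idem n (2 * n)"
  unfolding idem_mkd by (rule one_mkd)

lemma idem_rigid: "k \<le> 2 * n \<Longrightarrow> idem n k \<in> rigid_motzkin_diagrams n"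
  unfolding idem_mkd mkd_rigid_iff[OF data_idem] by (simp add: rigid_top_def rigid_bot_def)

lemma idem_motzkin: "k \<le> 2 * n \<Longrightarrow> idem n k \<in> motzkin_diagrams n"
  using idem_rigid unfolding rigid_motzkin_diagrams_def by blast

lemma idem_inject: "k \<le> 2 * n \<Longrightarrow> l \<le> 2 * n \<Longrightarrow> idem n k = idem n l \<Longrightarrow> k = l"
  using through_idem by metis

text \<open>Top arcs and dots of the upper factor, and bottom ones of the lower factor, are already
  complete strings of the product.\<close>

lemma dead_mult:
  assumes "\<phi> \<in> planar_involutions n" "\<psi> \<in> planar_involutions n"
  obtains \<chi> where "\<chi> \<in> planar_involutions n" "diagram_mult n (diagram_of n \<phi>) (diagram_of n \<psi>) = diagram_of n \<chi>"
    "\<And>i j. \<phi> (Top i) = Top j \<Longrightarrow> \<chi> (Top i) = Top j" "\<And>i j. \<psi> (Bot i) = Bot j \<Longrightarrow> \<chi> (Bot i) = Bot j"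
proof -
  interpret stacked n \<phi> \<psi> by unfold_locales (use assms in auto)
  show ?thesis by (rule that[OF mu_PI mult_dg mu_Top mu_Bot])
qed

text \<open>Only the two points numbered 1 can be joined, and only to each other.\<close>

lemma corner_cases:
  assumes \<phi>: "\<phi> \<in> planar_involutions n" and top: "\<And>i. 2 \<le> i \<Longrightarrow> \<phi> (Top i) = Top i" and bot: "\<And>i. 2 \<le> i \<Longrightarrow> \<phi> (Bot i) = Bot i"
  shows "diagram_of n \<phi> = idem n 1 \<or> diagram_of n \<phi> = idem n 0"
proof -
  note invp = PI_D(1)[OF \<phi>]
  have 0: "\<phi> (Top 0) = Top 0" "\<phi> (Bot 0) = Bot 0" using PI_D(2)[OF \<phi>] by auto
  have fixed: "\<phi> (Top i) = Top i" "\<phi> (Bot i) = Bot i" if "i \<noteq> 1" for i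
    using that 0 top[of i] bot[of i] by (cases "i = 0"; simp)+
  have val: "\<phi> p = q \<Longrightarrow> q = Top j \<Longrightarrow> p = Top 1 \<or> p = Bot 1 \<Longrightarrow> j = 1"
     "\<phi> p = q \<Longrightarrow> q = Bot j \<Longrightarrow> p = Top 1 \<or> p = Bot 1 \<Longrightarrow> j = 1" for p q j
    using fixed invp by (metis point.inject point.distinct(1))+
  consider "\<phi> (Top 1) = Top 1" | "\<phi> (Top 1) = Bot 1" using val by (cases "\<phi> (Top 1)") auto
  then show ?thesis
  proof cases
    case 1
    have "\<phi> (Bot 1) = Bot 1"
    proof (cases "\<phi> (Bot 1)")
      case (Top j)
      then have "\<phi> (Bot 1) = Top 1" using val(1) by metis
      then have "\<phi> (Top 1) = Bot 1" using invp by metis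
      then show ?thesis using 1 by simp
    next
      case (Bot j)
      then show ?thesis using val(2) by metis
    qed
    then have "\<phi> p = idp 0 p" for p
      using 1 fixed idp_simps[of 0] by (cases p; cases "p = Top 1 \<or> p = Bot 1") auto
    then show ?thesis by (metis ext idem_def)
  next
    case 2
    then have "\<phi> (Bot 1) = Top 1" using invp by metis
    then have "\<phi> p = idp 1 p" for p
      using 2 fixed idp_simps[of 1] by (cases p; cases "p = Top 1 \<or> p = Bot 1") auto
    then show ?thesis by (metis ext idem_def)
  qed
qed

lemma idem_mult_corner:
  assumes n: "1 \<le> n" and "k \<le> 1" "l \<le> 1"
  shows "diagram_mult n (idem n k) (idem n l) = idem n (min k l)"
proof -
  have kn: "k \<le> 2 * n" "l \<le> 2 * n" using assms by auto
  note P = idp_PI[OF kn(1)] idp_PI[OF kn(2)]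
  obtain \<chi> where \<chi>: "\<chi> \<in> planar_involutions n" "diagram_mult n (idem n k) (idem n l) = diagram_of n \<chi>"
    "\<And>i j. idp k (Top i) = Top j \<Longrightarrow> \<chi> (Top i) = Top j"
    "\<And>i j. idp l (Bot i) = Bot j \<Longrightarrow> \<chi> (Bot i) = Bot j"
    using dead_mult[OF P] unfolding idem_def by metis
  have c: "diagram_of n \<chi> = idem n 1 \<or> diagram_of n \<chi> = idem n 0"
    by (rule corner_cases[OF \<chi>(1)]) (use assms in \<open>auto intro!: \<chi>(3,4) simp: idp_simps\<close>)
  have t: "through_strands (diagram_of n \<chi>) \<le> k" "through_strands (diagram_of n \<chi>) \<le> l"
    using motzkin_mult(2,3)[OF idem_motzkin[OF kn(1)] idem_motzkin[OF kn(2)]] through_idem[OF kn(1)] through_idem[OF kn(2)] \<chi>(2) by simp_all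
  show ?thesis
  proof (cases "k = 1 \<and> l = 1")
    case True
    have d: "half_diagrams n id id {1..1} id" using n by (intro data_idem) simp
    show ?thesis using mult_mkd(1)[of n id id "{1..1}" id id id id] d True by (simp add: idem_mkd)
  next
    case False
    then have "min k l = 0" using assms by linarith
    then have "through_strands (diagram_of n \<chi>) = 0" using t by linarith
    then have "diagram_of n \<chi> \<noteq> idem n 1" using through_idem[of 1 n] n by auto
    then show ?thesis using c \<chi>(2) \<open>min k l = 0\<close> by simp
  qed
qed

text \<open>Multiplication by \<open>idem n 1\<close> from both sides leaves dots at all points with
  number at least 2, which is the situation of \<open>corner_cases\<close>.\<close>

lemma two_element_corner_motzkin:
  fixes M :: "diagram monoid"
  assumes M: "monoid M" "finite (carrier M)" "carrier M \<subseteq> motzkin_diagrams n"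
    and mult: "\<And>a b. a \<otimes>\<^bsub>M\<^esub> b = diagram_mult n a b" and one: "\<one>\<^bsub>M\<^esub> = diagram_one n"
    and n: "1 \<le> n" and idem: "idem n 1 \<in> carrier M" "idem n 0 \<in> carrier M"
  shows "two_element_corner M (idem n 1) (idem n 0)"
proof -
  interpret monoid M by fact
  have k: "1 \<le> 2 * n" "0 \<le> 2 * n" using n by auto
  show ?thesis
  proof unfold_locales
    show "finite (carrier M)" "idem n 1 \<in> carrier M" "idem n 0 \<in> carrier M" by fact+
    show "idem n 1 \<noteq> idem n 0" using idem_inject[OF k] by auto
    show "idem n 1 \<noteq> \<one>\<^bsub>M\<^esub>" unfolding one one_idem using idem_inject[OF k(1), of "2 * n"] by auto
    show "idem n 1 \<otimes>\<^bsub>M\<^esub> idem n 1 = idem n 1" "idem n 1 \<otimes>\<^bsub>M\<^esub> idem n 0 = idem n 0"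
      "idem n 0 \<otimes>\<^bsub>M\<^esub> idem n 1 = idem n 0" "idem n 0 \<otimes>\<^bsub>M\<^esub> idem n 0 = idem n 0"
      unfolding mult using idem_mult_corner[OF n] by simp_all
    fix x assume "x \<in> carrier M"
    then have "x \<in> motzkin_diagrams n" using M(3) by blast
    then obtain \<phi> where \<phi>: "\<phi> \<in> planar_involutions n" "x = diagram_of n \<phi>" using motzkin_dg by metis
    note e = idp_PI[OF k(1)]
    obtain \<chi> where \<chi>: "\<chi> \<in> planar_involutions n" "diagram_mult n (idem n 1) x = diagram_of n \<chi>"
      "\<And>i j. idp 1 (Top i) = Top j \<Longrightarrow> \<chi> (Top i) = Top j"
      using dead_mult[OF e \<phi>(1)] \<phi>(2) unfolding idem_def by metis
    obtain \<eta> where \<eta>: "\<eta> \<in> planar_involutions n" "diagram_mult n (diagram_of n \<chi>) (idem n 1) = diagram_of n \<eta>"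
      "\<And>i j. \<chi> (Top i) = Top j \<Longrightarrow> \<eta> (Top i) = Top j"
      "\<And>i j. idp 1 (Bot i) = Bot j \<Longrightarrow> \<eta> (Bot i) = Bot j"
      using dead_mult[OF \<chi>(1) e] unfolding idem_def by metis
    have "diagram_of n \<eta> = idem n 1 \<or> diagram_of n \<eta> = idem n 0"
      by (rule corner_cases[OF \<eta>(1)]) (auto intro!: \<eta>(3,4) \<chi>(3) simp: idp_simps)
    then show "idem n 1 \<otimes>\<^bsub>M\<^esub> x \<otimes>\<^bsub>M\<^esub> idem n 1 = idem n 1 \<or> idem n 1 \<otimes>\<^bsub>M\<^esub> x \<otimes>\<^bsub>M\<^esub> idem n 1 = idem n 0"
      unfolding mult \<chi>(2) \<eta>(2) .
  qed
qed

lemma idem_carrier: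
  assumes "real k \<le> 2 * sqrt (2 * real n)" "k \<le> 2 * n"
  shows "idem n k \<in> carrier (MoT n)" "idem n k \<in> carrier (rMoT n)"
  using assms through_idem[OF assms(2)] idem_motzkin[OF assms(2)] idem_rigid[OF assms(2)] by simp_all

lemma sqrt_ge_one: "1 \<le> n \<Longrightarrow> real 1 \<le> 2 * sqrt (2 * real n)"
proof -
  assume "1 \<le> n"
  then have "1 \<le> 2 * real n" by linarith
  then have "1 \<le> sqrt (2 * real n)" by (rule real_sqrt_ge_one)
  then show "real 1 \<le> 2 * sqrt (2 * real n)" unfolding of_nat_1 by linarith
qed

lemma two_element_corner_MoT:
  assumes n: "1 \<le> n"
  shows "two_element_corner (MoT n) (idem n 1) (idem n 0)" "two_element_corner (rMoT n) (idem n 1) (idem n 0)"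
proof -
  note c = idem_carrier[OF sqrt_ge_one[OF n]]
  have c0: "idem n 0 \<in> carrier (MoT n)" "idem n 0 \<in> carrier (rMoT n)" by (rule idem_carrier; simp)+
  have n2: "1 \<le> 2 * n" using n by simp
  show "two_element_corner (MoT n) (idem n 1) (idem n 0)"
    by (rule two_element_corner_motzkin[OF monoid_MoT(1) finite_MoT(1) _ MoT_simps(2,3) n c(1)[OF n2] c0(1)])
      (use MoT_motzkin in blast)
  show "two_element_corner (rMoT n) (idem n 1) (idem n 0)"
    by (rule two_element_corner_motzkin[OF monoid_MoT(2) finite_MoT(2) _ MoT_simps(5,6) n c(2)[OF n2] c0(2)])
      (use MoT_motzkin rMoT_subset in blast)
qed

section \<open>Sizes of one-sided ideals and upper bounds for the gaps\<close>

lemma rigid_sided: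
  assumes f: "f \<in> noncrossing A"
  shows "rigid_top f \<longleftrightarrow> (\<forall>x. (x < f x \<longrightarrow> odd x) \<and> (f x < x \<longrightarrow> even x))"
    "rigid_bot f \<longleftrightarrow> (\<forall>x. (x < f x \<longrightarrow> even x) \<and> (f x < x \<longrightarrow> odd x))"
  unfolding rigid_top_def rigid_bot_def using noncrossing_invol[OF f] by metis+

definition tops :: "nat \<Rightarrow> (nat \<Rightarrow> nat) set" where
  "tops n = {f \<in> noncrossing {1..2 * n}. rigid_top f}"

definition bots :: "nat \<Rightarrow> (nat \<Rightarrow> nat) set" where
  "bots n = {f \<in> noncrossing {1..2 * n}. rigid_bot f}"

lemma finite_tops: "finite (tops n)" "finite (bots n)"
  unfolding tops_def bots_def using finite_noncrossing by simp_all

lemma card_tops_upper: "card (tops n) \<le> 4 ^ n" "card (bots n) \<le> 4 ^ n"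
proof -
  show "card (tops n) \<le> 4 ^ n"
    by (rule card_alternating_upper[where b = True]) (auto simp: tops_def rigid_sided)
  show "card (bots n) \<le> 4 ^ n"
    by (rule card_alternating_upper[where b = False]) (auto simp: bots_def rigid_sided)
qed

text \<open>Multiplication by \<open>idem n 1\<close> from below clears the bottom row except for a
  possible strand to its first point. A diagram that survives unchanged is given by its top half and
  the start of that strand, if there is one.\<close>

lemma card_right_ideal:
  assumes n: "1 \<le> n" shows "card {x \<in> motzkin_diagrams n. diagram_mult n x (idem n 1) = x} \<le> 9 ^ n * (2 * n + 1)"
proof -
  let ?N = "noncrossing {1..2 * n}" and ?S = "{I. I \<subseteq> {1..2 * n} \<and> card I \<le> 1}"
  have k: "1 \<le> 2 * n" using n by simp
  have sub: "{x \<in> motzkin_diagrams n. diagram_mult n x (idem n 1) = x} \<subseteq> (\<lambda>(f, I). diagram_from n f id I (\<lambda>_. 1)) ` (?N \<times> ?S)"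
  proof clarify
    fix x assume x: "x \<in> motzkin_diagrams n" "diagram_mult n x (idem n 1) = x"
    obtain f g I \<sigma> where d: "half_diagrams n f g I \<sigma>" "x = diagram_from n f g I \<sigma>" using motzkin_mkd[OF x(1)] by metis
    note D = data_D[OF d(1)]
    obtain \<chi> where \<chi>: "\<chi> \<in> planar_involutions n" "diagram_mult n x (idem n 1) = diagram_of n \<chi>"
      "\<And>i j. idp 1 (Bot i) = Bot j \<Longrightarrow> \<chi> (Bot i) = Bot j"
      using dead_mult[OF mk_PI[OF d(1)] idp_PI[OF k]] d(2) unfolding idem_def by metis
    have "\<chi> = strand_map f g I \<sigma>" by (rule dg_inject[OF \<chi>(1) mk_PI[OF d(1)]]) (use \<chi>(2) x(2) d(2) in simp)
    then have b: "strand_map f g I \<sigma> (Bot j) = Bot j" if "2 \<le> j" for j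
      using \<chi>(3)[of j j] idp_simps(2)[of 1 j] that by simp
    have bb: "j \<notin> \<sigma> ` I" "g j = j" if "2 \<le> j" for j
    proof -
      show "j \<notin> \<sigma> ` I" using b[OF that] unfolding strand_map_def by auto
      then show "g j = j" using b[OF that] mk_simps(3) by (metis point.inject(2))
    qed
    have "g j = j" for j
    proof -
      have "g 0 = 0" using noncrossing_outside[OF D(2), of 0] by simp
      moreover have "g 1 = 1"
        using noncrossing_invol[OF D(2), of 1] bb(2)[of "g 1"] \<open>g 0 = 0\<close> by (metis One_nat_def Suc_1 less_2_cases not_less)
      ultimately show ?thesis using bb(2)[of j] by (metis One_nat_def less_2_cases not_less)
    qed
    then have g: "g = id" by auto
    have J: "\<sigma> ` I \<subseteq> {1}"
    proof
      fix j assume j: "j \<in> \<sigma> ` I"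
      then have "1 \<le> j" using D(4) by auto
      moreover have "\<not> 2 \<le> j" using bb(1) j by blast
      ultimately show "j \<in> {1}" by simp
    qed
    have "card I = card (\<sigma> ` I)" using D(5) by (simp add: card_image)
    also have "\<dots> \<le> card {1 :: nat}" by (rule card_mono[OF _ J]) simp
    finally have I: "I \<in> ?S" using D(3) by simp
    have s: "\<sigma> i = 1" if "i \<in> I" for i using J that by blast
    then have "half_diagrams n f id I (\<lambda>_. 1)" using data_cong[OF s d(1)] g by simp
    then have "x = diagram_from n f id I (\<lambda>_. 1)" using mk_cong[of I \<sigma> "\<lambda>_. 1" n f id] s d g by simp
    then show "x \<in> (\<lambda>(f, I). diagram_from n f id I (\<lambda>_. 1)) ` (?N \<times> ?S)" using I D(1) by blast
  qed
  have fS: "finite ?S" by (rule finite_subset[of _ "Pow {1..2 * n}"]) auto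
  have "card {x \<in> motzkin_diagrams n. diagram_mult n x (idem n 1) = x} \<le> card (?N \<times> ?S)"
    by (rule surj_card_le[OF _ sub]) (use finite_noncrossing fS in simp)
  also have "\<dots> \<le> 9 ^ n * (2 * n + 1)"
    unfolding card_cartesian_product using card_small_subsets[of "2 * n" 1] card_noncrossing_upper[of n]
    by (intro mult_le_mono) simp_all
  finally show ?thesis .
qed

text \<open>The mirror image of the previous count, with rigid bottom halves. \<open>J\<close> is
  empty or consists of the lower end of the strand, which \<open>the_elem\<close> extracts.\<close>

lemma card_left_ideal:
  assumes n: "1 \<le> n" shows "card {x \<in> rigid_motzkin_diagrams n. diagram_mult n (idem n 1) x = x} \<le> 4 ^ n * (2 * n + 1)"
proof -
  let ?S = "{J. J \<subseteq> {1..2 * n} \<and> card J \<le> 1}"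
  let ?F = "\<lambda>(g, J). diagram_from n id g (if J = {} then {} else {1}) (\<lambda>_. the_elem J)"
  have k: "1 \<le> 2 * n" using n by simp
  have sub: "{x \<in> rigid_motzkin_diagrams n. diagram_mult n (idem n 1) x = x} \<subseteq> ?F ` (bots n \<times> ?S)"
  proof
    fix x assume "x \<in> {x \<in> rigid_motzkin_diagrams n. diagram_mult n (idem n 1) x = x}"
    then have xr: "x \<in> rigid_motzkin_diagrams n" and x: "x \<in> motzkin_diagrams n" "diagram_mult n (idem n 1) x = x"
      unfolding rigid_motzkin_diagrams_def by auto
    obtain f g I \<sigma> where d: "half_diagrams n f g I \<sigma>" "x = diagram_from n f g I \<sigma>" using motzkin_mkd[OF x(1)] by metis
    note D = data_D[OF d(1)]
    obtain \<chi> where \<chi>: "\<chi> \<in> planar_involutions n" "diagram_mult n (idem n 1) x = diagram_of n \<chi>"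
      "\<And>i j. idp 1 (Top i) = Top j \<Longrightarrow> \<chi> (Top i) = Top j"
      using dead_mult[OF idp_PI[OF k] mk_PI[OF d(1)]] d(2) unfolding idem_def by metis
    have "\<chi> = strand_map f g I \<sigma>" by (rule dg_inject[OF \<chi>(1) mk_PI[OF d(1)]]) (use \<chi>(2) x(2) d(2) in simp)
    then have b: "strand_map f g I \<sigma> (Top j) = Top j" if "2 \<le> j" for j
      using \<chi>(3)[of j j] idp_simps(1)[of 1 j] that by simp
    have bb: "j \<notin> I" "f j = j" if "2 \<le> j" for j
    proof -
      show "j \<notin> I" using b[OF that] unfolding strand_map_def by auto
      then show "f j = j" using b[OF that] mk_simps(2) by (metis point.inject(1))
    qed
    have "f j = j" for j
    proof -
      have "f 0 = 0" using noncrossing_outside[OF D(1), of 0] by simp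
      moreover have "f 1 = 1"
        using noncrossing_invol[OF D(1), of 1] bb(2)[of "f 1"] \<open>f 0 = 0\<close> by (metis One_nat_def Suc_1 less_2_cases not_less)
      ultimately show ?thesis using bb(2)[of j] by (metis One_nat_def less_2_cases not_less)
    qed
    then have f: "f = id" by auto
    have I: "I \<subseteq> {1}"
    proof
      fix j assume j: "j \<in> I"
      then have "1 \<le> j" using D(3) by auto
      moreover have "\<not> 2 \<le> j" using bb(1) j by blast
      ultimately show "j \<in> {1}" by simp
    qed
    have g: "g \<in> bots n" using xr D(2) mkd_rigid_iff[OF d(1)] unfolding d(2) bots_def by blast
    define J where "J = \<sigma> ` I"
    have "card J \<le> card I" unfolding J_def by (rule card_image_le[OF D(9)])
    also have "\<dots> \<le> card {1 :: nat}" by (rule card_mono[OF _ I]) simp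
    finally have J: "J \<in> ?S" using D(4) unfolding J_def by simp
    have IJ: "I = (if J = {} then {} else {1})" using I unfolding J_def by auto
    have s: "\<sigma> i = the_elem J" if "i \<in> I" for i
    proof -
      have "I = {i}" using I that by blast
      then show ?thesis unfolding J_def by simp
    qed
    have "x = diagram_from n f g I (\<lambda>_. the_elem J)" using mk_cong[OF s d(1) data_cong[OF s d(1)]] d(2) by simp
    then have "x = ?F (g, J)" using f IJ by simp
    then show "x \<in> ?F ` (bots n \<times> ?S)" using g J by blast
  qed
  have fS: "finite ?S" by (rule finite_subset[of _ "Pow {1..2 * n}"]) auto
  have "card {x \<in> rigid_motzkin_diagrams n. diagram_mult n (idem n 1) x = x} \<le> card (bots n \<times> ?S)"
    by (rule surj_card_le[OF _ sub]) (use finite_tops fS in simp)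
  also have "\<dots> \<le> 4 ^ n * (2 * n + 1)"
    unfolding card_cartesian_product using card_small_subsets[of "2 * n" 1] card_tops_upper(2)[of n]
    by (intro mult_le_mono) simp_all
  finally show ?thesis .
qed

text \<open>The representation of the corner gives the bound and also shows that a nontrivial simple
  representation exists; hence the minimum is attained, and the lower bound can be proved for a
  representation of that dimension.\<close>

lemma Gap_MoT:
  fixes K :: "'k::field itself"
  assumes n: "1 \<le> n"
  shows "Gap K (MoT n) \<le> 9 ^ n * (2 * n + 1)"
    "\<exists>\<rho> :: diagram \<Rightarrow> 'k mat. simple_representation (MoT n) (Gap K (MoT n)) \<rho> \<and> \<not> trivial_representation (MoT n) (Gap K (MoT n)) \<rho>"
proof -
  interpret two_element_corner "MoT n" "idem n 1" "idem n 0" by (rule two_element_corner_MoT(1)[OF n])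
  obtain d and \<rho> :: "diagram \<Rightarrow> 'k mat" where d: "simple_representation (MoT n) d \<rho>" "\<not> trivial_representation (MoT n) d \<rho>" "d \<le> card right_part"
    using simple_representation_exists[where 'k = 'k] by metis
  have "right_part \<subseteq> {x \<in> motzkin_diagrams n. diagram_mult n x (idem n 1) = x}"
    unfolding right_part_def MoT_simps(2) using MoT_motzkin by blast
  then have "card right_part \<le> 9 ^ n * (2 * n + 1)"
    using card_mono[of "{x \<in> motzkin_diagrams n. diagram_mult n x (idem n 1) = x}" right_part] card_right_ideal[OF n] finite_motzkin[of n] by simp
  moreover let ?P = "\<lambda>d. \<exists>\<rho> :: diagram \<Rightarrow> 'k mat. simple_representation (MoT n) d \<rho> \<and> \<not> trivial_representation (MoT n) d \<rho>"
  have P: "?P d" using d(1,2) by blast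
  have "Gap K (MoT n) \<le> d" unfolding Gap_def by (rule Least_le[of ?P, OF P])
  ultimately show "Gap K (MoT n) \<le> 9 ^ n * (2 * n + 1)" using d(3) by (meson le_trans)
  show "?P (Gap K (MoT n))" unfolding Gap_def by (rule LeastI[of ?P, OF P])
qed

lemma ssGap_rMoT:
  fixes K :: "'k::field itself"
  assumes n: "1 \<le> n"
  shows "ssGap K (rMoT n) \<le> 4 ^ n * (2 * n + 1)"
    "\<exists>d. \<exists>\<rho> :: diagram \<Rightarrow> 'k mat. \<exists>J R. simple_representation (rMoT n) d \<rho> \<and> \<not> trivial_representation (rMoT n) d \<rho> \<and>
       is_apex (rMoT n) d \<rho> J \<and> R \<in> right_cells (rMoT n) \<and> R \<subseteq> J \<and> ssGap K (rMoT n) = card R"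
proof -
  interpret two_element_corner "rMoT n" "idem n 1" "idem n 0" by (rule two_element_corner_MoT(2)[OF n])
  let ?M = "rMoT n" and ?e = "idem n 1"
  let ?J = "{b \<in> carrier ?M. le_lr ?M ?e b \<and> le_lr ?M b ?e}" and ?R = "{b \<in> carrier ?M. le_r ?M ?e b \<and> le_r ?M b ?e}"
  obtain d and \<rho> :: "diagram \<Rightarrow> 'k mat" where d: "simple_representation ?M d \<rho>" "\<not> trivial_representation ?M d \<rho>"
    "is_apex ?M d \<rho> ?J"
    by (rule simple_representation_exists[where 'k = 'k], rule that)
  have R: "?R \<in> right_cells ?M" by (rule right_cell_of[OF e])
  have RJ: "?R \<subseteq> ?J" using le_r_le_lr[OF monoid_axioms] e by blast
  let ?P = "\<lambda>s. \<exists>d. \<exists>\<rho> :: diagram \<Rightarrow> 'k mat. \<exists>J R. simple_representation ?M d \<rho> \<and> \<not> trivial_representation ?M d \<rho> \<and>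
       is_apex ?M d \<rho> J \<and> R \<in> right_cells ?M \<and> R \<subseteq> J \<and> s = card R"
  have P: "?P (card ?R)" by (intro exI conjI) (rule d R RJ refl)+
  have "?R \<subseteq> {x \<in> rigid_motzkin_diagrams n. diagram_mult n ?e x = x}"
  proof
    fix b assume b: "b \<in> ?R"
    then obtain c where c: "c \<in> carrier ?M" "b = ?e \<otimes>\<^bsub>?M\<^esub> c" unfolding le_r_def by blast
    have "?e \<otimes>\<^bsub>?M\<^esub> b = b" unfolding c(2) using m_assoc[OF e e c(1)] ee by simp
    then show "b \<in> {x \<in> rigid_motzkin_diagrams n. diagram_mult n ?e x = x}"
      using b rMoT_rigid unfolding MoT_simps(5) by blast
  qed
  moreover have "finite {x \<in> rigid_motzkin_diagrams n. diagram_mult n ?e x = x}"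
    by (rule finite_subset[OF _ finite_motzkin[of n]]) (auto simp: rigid_motzkin_diagrams_def)
  ultimately have "card ?R \<le> 4 ^ n * (2 * n + 1)" using card_mono card_left_ideal[OF n] by (meson le_trans)
  moreover have "ssGap K ?M \<le> card ?R" unfolding ssGap_def by (rule Least_le[of ?P, OF P])
  ultimately show "ssGap K ?M \<le> 4 ^ n * (2 * n + 1)" by (meson le_trans)
  show "?P (ssGap K ?M)" unfolding ssGap_def by (rule LeastI[of ?P, OF P])
qed

section \<open>Lower bound for the gap\<close>

text \<open>Ranks are counted from 1, to match the numbering of points in a row.\<close>

definition rank :: "nat set \<Rightarrow> nat \<Rightarrow> nat" where
  "rank I x = card {y \<in> I. y \<le> x}"

lemma rank_less: assumes "finite I" "y \<in> I" "x < y" shows "rank I x < rank I y"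
proof -
  have "{z \<in> I. z \<le> x} \<subseteq> {z \<in> I. z \<le> y}" "y \<in> {z \<in> I. z \<le> y} - {z \<in> I. z \<le> x}" using assms by auto
  then have "{z \<in> I. z \<le> x} \<subset> {z \<in> I. z \<le> y}" by blast
  then show ?thesis unfolding rank_def by (rule psubset_card_mono[rotated]) (use assms in simp)
qed

lemma rank_image: assumes "finite I" shows "rank I ` I = {1..card I}"
proof -
  have inj: "inj_on (rank I) I"
    by (rule linorder_inj_onI') (use rank_less[OF assms] in \<open>metis less_irrefl\<close>)
  have "rank I ` I \<subseteq> {1..card I}"
  proof (rule image_subsetI)
    fix x assume x: "x \<in> I"
    have "{y \<in> I. y \<le> x} \<noteq> {}" "{y \<in> I. y \<le> x} \<subseteq> I" using x by auto
    then show "rank I x \<in> {1..card I}" unfolding rank_def using assms card_mono[of I] by (simp add: Suc_le_eq card_gt_0_iff)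
  qed
  then show ?thesis using card_subset_eq[of "{1..card I}"] card_image[OF inj] by simp
qed

lemma rank_inj: "finite I \<Longrightarrow> inj_on (rank I) I"
  by (rule linorder_inj_onI') (use rank_less in \<open>metis less_irrefl\<close>)

lemma free_at_id: "free_at id i"
  unfolding free_at_def by simp

text \<open>The strands are squeezed into the \<open>card I\<close> leftmost positions and spread
  again, with nothing but dots elsewhere in between. The first factor absorbs
  \<open>idem n (card I)\<close>, so a representation that does not kill the diagram does not kill
  this idempotent either.\<close>

lemma rank_factor:
  assumes d: "half_diagrams n f g I \<sigma>"
  defines "\<tau> \<equiv> inv_into I (rank I)"
  shows "half_diagrams n f id I (rank I)" "half_diagrams n id g {1..card I} (\<sigma> \<circ> \<tau>)"
    "diagram_from n f g I \<sigma> = diagram_mult n (diagram_from n f id I (rank I)) (diagram_from n id g {1..card I} (\<sigma> \<circ> \<tau>))"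
    "diagram_mult n (diagram_from n f id I (rank I)) (idem n (card I)) = diagram_from n f id I (rank I)"
proof -
  note D = data_D[OF d]
  note im = rank_image[OF D(9)] and inj = rank_inj[OF D(9)]
  have cI: "card I \<le> 2 * n" using card_mono[OF _ D(3)] by simp
  have \<tau>: "\<tau> (rank I i) = i" if "i \<in> I" for i unfolding \<tau>_def using inv_into_f_f[OF inj that] .
  show 1: "half_diagrams n f id I (rank I)"
    unfolding half_diagrams_def im using D(1,3,7) cI rank_less[OF D(9)] by (auto simp: id_noncrossing free_at_id)
  have \<tau>I: "\<tau> ` {1..card I} = I" unfolding im[symmetric] image_image using \<tau> by simp
  have lt: "\<tau> x < \<tau> y" if xy: "x \<in> {1..card I}" "y \<in> {1..card I}" "x < y" for x y
  proof -
    have "x \<in> rank I ` I" "y \<in> rank I ` I" using xy im by simp_all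
    then obtain i j where ij: "i \<in> I" "j \<in> I" "x = rank I i" "y = rank I j" by (elim imageE)
    have "\<not> j \<le> i" using rank_less[OF D(9) ij(1), of j] xy(3) ij(3,4) by (cases "j = i") auto
    then show ?thesis using \<tau> ij by simp
  qed
  have sim: "(\<sigma> \<circ> \<tau>) ` {1..card I} = \<sigma> ` I" unfolding image_comp[symmetric] \<tau>I ..
  have tI: "\<tau> x \<in> I" if "x \<in> {1..card I}" for x using \<tau>I that by blast
  show 2: "half_diagrams n id g {1..card I} (\<sigma> \<circ> \<tau>)"
    unfolding half_diagrams_def sim using D(2,4,6,8) cI lt tI by (auto simp: id_noncrossing free_at_id)
  have db: "half_diagrams n id g (rank I ` I) (\<sigma> \<circ> \<tau>)" using 2 im by simp
  have s: "(\<sigma> \<circ> \<tau> \<circ> rank I) i = \<sigma> i" if "i \<in> I" for i using \<tau>[OF that] by simp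
  show "diagram_from n f g I \<sigma> = diagram_mult n (diagram_from n f id I (rank I)) (diagram_from n id g {1..card I} (\<sigma> \<circ> \<tau>))"
    using mult_mkd(1)[OF 1 db] mk_cong[OF s mult_mkd(2)[OF 1 db] d] unfolding im by simp
  have 3: "half_diagrams n id id (rank I ` I) id" unfolding im by (rule data_idem[OF cI])
  show "diagram_mult n (diagram_from n f id I (rank I)) (idem n (card I)) = diagram_from n f id I (rank I)"
    using mult_mkd(1)[OF 1 3] im unfolding idem_mkd by simp
qed

text \<open>A matching \<open>f\<close> with one defect encodes the diagram with top \<open>f\<close>, whose last strand starts at
  the point paired with \<open>0\<close>; \<open>bra\<close> is its mirror image.\<close>

definition ket :: "nat \<Rightarrow> nat \<Rightarrow> (nat \<Rightarrow> nat) \<Rightarrow> diagram" where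
  "ket n k f = diagram_from n (dot 0 f) id (insert (f 0) {1..<k}) (\<lambda>t. if t < k then t else k)"

definition bra :: "nat \<Rightarrow> nat \<Rightarrow> (nat \<Rightarrow> nat) \<Rightarrow> diagram" where
  "bra n k g = diagram_from n id (dot 0 g) {1..k} (\<lambda>t. if t < k then t else g 0)"

text \<open>No arc crosses the arc from \<open>0\<close> to \<open>f 0\<close>, hence none passes
  over \<open>f 0\<close>; the positive points before \<open>k\<close> are not moved by
  \<open>f\<close>.\<close>

lemma one_defect_dot:
  assumes f: "f \<in> one_defect {k..2 * n}" and k: "1 \<le> k"
  shows "dot 0 f \<in> noncrossing {1..2 * n}" "free_at (dot 0 f) (f 0)" "t < k \<Longrightarrow> free_at (dot 0 f) t" "k \<le> f 0" "f 0 \<le> 2 * n"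
proof -
  have F: "f \<in> noncrossing (insert 0 {k..2 * n})" "f 0 \<noteq> 0" "f 0 \<in> {k..2 * n}" using one_defectD[OF f] by auto
  have "dot 0 f \<in> noncrossing (insert 0 {k..2 * n} - {0})" by (rule dot_noncrossing[OF F(1)])
  then show "dot 0 f \<in> noncrossing {1..2 * n}" using noncrossing_mono[of "insert 0 {k..2 * n} - {0}" "{1..2 * n}"] k by auto
  show "k \<le> f 0" "f 0 \<le> 2 * n" using F(3) by auto
  show "free_at (dot 0 f) (f 0)"
    unfolding free_at_def
  proof (intro conjI allI)
    show "dot 0 f (f 0) = f 0" unfolding dot_def using noncrossing_invol[OF F(1)] by simp
    fix x show "x < f 0 \<longleftrightarrow> dot 0 f x < f 0"
    proof (cases "x = 0 \<or> f x = 0")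
      case False
      then have "x \<noteq> f 0" using noncrossing_invol[OF F(1), of 0] by metis
      then show ?thesis using noncrossing_cond[OF F(1), of x 0] False unfolding dot_def by simp
    qed (simp add: dot_def)
  qed
  assume t: "t < k"
  show "free_at (dot 0 f) t"
    unfolding free_at_def
  proof (intro conjI allI)
    have out: "f x = x" if "x \<noteq> 0" "x \<notin> {k..2 * n}" for x using noncrossing_outside[OF F(1), of x] that by simp
    show "dot 0 f t = t"
      using out[of t] t unfolding dot_def by (cases "t = 0") auto
    fix x show "x < t \<longleftrightarrow> dot 0 f x < t"
    proof (cases "x = 0 \<or> f x = 0 \<or> x \<notin> {k..2 * n}")
      case True
      then have "dot 0 f x = x" using out[of x] unfolding dot_def by auto
      then show ?thesis by simp
    next
      case False
      then have "f x \<in> {k..2 * n}" using noncrossing_in[OF F(1), of x] by blast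
      then show ?thesis using False t unfolding dot_def by auto
    qed
  qed
qed

lemma ket_image:
  fixes k p :: nat
  assumes "1 \<le> k" "k \<le> p" shows "(\<lambda>t. if t < k then t else k) ` insert p {1..<k} = {1..k}"
proof -
  have "(\<lambda>t. if t < k then t else k) ` {1..<k} = id ` {1..<k}" by (rule image_cong) auto
  then show ?thesis using assms by auto
qed

lemma bra_image:
  fixes k p :: nat
  assumes "1 \<le> k" shows "(\<lambda>t. if t < k then t else p) ` {1..k} = insert p {1..<k}"
proof -
  have "{1..k} = insert k {1..<k}" using assms by auto
  moreover have "(\<lambda>t. if t < k then t else p) ` {1..<k} = id ` {1..<k}" by (rule image_cong) auto
  ultimately show ?thesis by (simp only: image_insert image_id id_apply less_irrefl if_False)
qed

lemma data_ket:
  assumes f: "f \<in> one_defect {k..2 * n}" and k: "1 \<le> k" "k \<le> 2 * n"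
  shows "half_diagrams n (dot 0 f) id (insert (f 0) {1..<k}) (\<lambda>t. if t < k then t else k)"
proof -
  note F = one_defect_dot[OF f k(1)]
  have im: "(\<lambda>t. if t < k then t else k) ` insert (f 0) {1..<k} = {1..k}" by (rule ket_image[OF k(1) F(4)])
  show ?thesis unfolding half_diagrams_def im using F k by (auto simp: id_noncrossing free_at_id)
qed

lemma data_bra:
  assumes g: "g \<in> one_defect {k..2 * n}" and k: "1 \<le> k" "k \<le> 2 * n"
  shows "half_diagrams n id (dot 0 g) {1..k} (\<lambda>t. if t < k then t else g 0)"
proof -
  note G = one_defect_dot[OF g k(1)]
  have im: "(\<lambda>t. if t < k then t else g 0) ` {1..k} = insert (g 0) {1..<k}" by (rule bra_image[OF k(1)])
  show ?thesis unfolding half_diagrams_def im using G k by (auto simp: id_noncrossing free_at_id)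
qed

text \<open>The first \<open>k - 1\<close> strands run straight through. The last one enters the
  middle row at \<open>g 0\<close>, follows arcs of \<open>f\<close> and \<open>g\<close> in turn
  and leaves if it arrives at \<open>f 0\<close>; otherwise at most \<open>k - 1\<close> strands
  remain.\<close>

lemma bra_ket:
  assumes f: "f \<in> one_defect {k..2 * n}" and g: "g \<in> one_defect {k..2 * n}" and k: "1 \<le> k" "k \<le> 2 * n"
  shows "meets g f \<Longrightarrow> diagram_mult n (bra n k g) (ket n k f) = idem n k"
    "\<not> meets g f \<Longrightarrow> through_strands (diagram_mult n (bra n k g) (ket n k f)) < k"
proof -
  note F = one_defect_dot[OF f k(1)] and G = one_defect_dot[OF g k(1)]
  have fA: "f \<in> noncrossing (insert 0 {k..2 * n})" "f 0 \<noteq> 0" and gA: "g \<in> noncrossing (insert 0 {k..2 * n})" "g 0 \<noteq> 0"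
    using one_defectD[OF f] one_defectD[OF g] by auto
  note finv = noncrossing_invol[OF fA(1)] and ginv = noncrossing_invol[OF gA(1)]
  let ?I = "insert (f 0) {1..<k}" and ?s = "\<lambda>t. if t < k then t else k" and ?t = "\<lambda>t. if t < k then t else g 0"
  define P where "P = strand_map id (dot 0 g) {1..k} ?t"
  define Q where "Q = strand_map (dot 0 f) id ?I ?s"
  have planar_involutions: "P \<in> planar_involutions n" "Q \<in> planar_involutions n" unfolding P_def Q_def
    by (rule mk_PI[OF data_bra[OF g k]], rule mk_PI[OF data_ket[OF f k]])
  interpret stacked n P Q by unfold_locales (use planar_involutions in auto)
  have bk: "diagram_mult n (bra n k g) (ket n k f) = diagram_of n mu"
    unfolding bra_def ket_def P_def[symmetric] Q_def[symmetric] by (rule mult_dg)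
  have imP: "?t ` {1..k} = insert (g 0) {1..<k}" by (rule bra_image[OF k(1)])
  have imQ: "?s ` ?I = {1..k}" by (rule ket_image[OF k(1) F(4)])
  have P_top: "P (Top i) = (if 1 \<le> i \<and> i < k then Bot i else if i = k then Bot (g 0) else Top i)" for i
    unfolding P_def strand_map_def using k by auto
  have Q_low: "Q (Bot i) = Bot i" if "i = 0 \<or> k < i" for i
  proof -
    have "i \<notin> ?s ` ?I" unfolding imQ using that by auto
    then show ?thesis unfolding Q_def using mk_simps(3) by (metis id_apply)
  qed
  have Q_top: "Q (Top i) = (if 1 \<le> i \<and> i < k then Bot i else if i = f 0 then Bot k else Top (dot 0 f i))" for i
    unfolding Q_def strand_map_def using F(4) by auto
  have P_bot: "P (Bot i) = Bot (dot 0 g i)" if "i \<noteq> g 0" "i = 0 \<or> k \<le> i" for i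
  proof -
    have "i \<notin> ?t ` {1..k}" unfolding imP using that by auto
    then show ?thesis unfolding P_def using mk_simps(3) by metis
  qed
  have P_bot': "P (Bot (g 0)) = Top k" using PI_D(1)[OF planar_involutions(1), of "Top k"] P_top[of k] by simp
  have small: "mu (Top i) = Bot i" "mu (Bot i) = Top i" if "1 \<le> i" "i < k" for i
  proof -
    show "mu (Top i) = Bot i" using mu_through[of i i i] P_top[of i] Q_top[of i] that by simp
    then show "mu (Bot i) = Top i" using mu_mu[of "Top i"] by simp
  qed
  have big: "mu (Top i) = Top i" "mu (Bot i) = Bot i" if "i = 0 \<or> k < i" for i
    using mu_Top[of i i] mu_Bot[of i i] P_top[of i] Q_low[OF that] that k by auto
  have sym: "(y, x) \<in> (link f \<union> link g)\<^sup>*" if "(x, y) \<in> (link f \<union> link g)\<^sup>*" for x y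
  proof -
    have "sym (link f \<union> link g)" by (rule symI) (auto simp: link_iff finv ginv)
    then show ?thesis using that sym_rtrancl symD by metis
  qed
  have up: "(Upper k, Middle (g 0)) \<in> C" using conn_step(1)[of "Upper k" al be] P_top[of k] by simp
  have low: "(Middle (f 0), Lower k) \<in> C" using conn_step(2)[of "Middle (f 0)" be al] Q_top[of "f 0"] F(4) by simp
  show "diagram_mult n (bra n k g) (ket n k f) = idem n k" if m: "meets g f"
  proof -
    have "(g 0, f 0) \<in> (link f \<union> link g)\<^sup>*" using m sym unfolding meets_def by blast
    moreover have "x \<noteq> 0 \<Longrightarrow> (Middle (g 0), Middle x) \<in> C" if "(g 0, x) \<in> (link f \<union> link g)\<^sup>*" for x
      using that
    proof (induction rule: rtrancl_induct)
      case base
      then show ?case using conn_refl by metis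
    next
      case (step y z)
      have y: "y \<noteq> 0" "z \<noteq> 0" using step(2) by (auto simp: link_iff)
      have "(Middle y, Middle z) \<in> C"
      proof (cases "z = y")
        case True then show ?thesis using conn_refl by metis
      next
        case False
        from step(2) consider "z = f y" | "z = g y" by (auto simp: link_iff)
        then show ?thesis
        proof cases
          case 1
          have "y \<in> {k..2 * n}" using noncrossing_outside[OF fA(1), of y] 1 False y(1) by blast
          then have "Q (Top y) = Top z" using Q_top[of y] 1 y finv[of 0] unfolding dot_def by auto
          then show ?thesis using conn_step(2)[of "Middle y" be al] by simp
        next
          case 2
          have "y \<in> {k..2 * n}" using noncrossing_outside[OF gA(1), of y] 2 False y(1) by blast
          moreover have "y \<noteq> g 0" using 2 y(2) ginv[of 0] by metis
          ultimately have "P (Bot y) = Bot z" using P_bot[of y] 2 y unfolding dot_def by auto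
          then show ?thesis using conn_step(1)[of "Middle y" al be] by simp
        qed
      qed
      then show ?case using step(3) y conn_trans by metis
    qed
    ultimately have "(Upper k, Lower k) \<in> C" using up low conn_trans fA(2) by metis
    then have "(ou (Top k), ou (Bot k)) \<in> C" by simp
    then have tk: "mu (Top k) = Bot k" using mu_unique by auto
    then have bk': "mu (Bot k) = Top k" using mu_mu[of "Top k"] by simp
    have "mu p = idp k p" for p
    proof (cases p)
      case (Top i)
      consider "i = 0 \<or> k < i" | "1 \<le> i" "i < k" | "i = k" by linarith
      then show ?thesis using small(1)[of i] big(1)[of i] tk Top k(1) by cases (auto simp: idp_simps)
    next
      case (Bot i)
      consider "i = 0 \<or> k < i" | "1 \<le> i" "i < k" | "i = k" by linarith
      then show ?thesis using small(2)[of i] big(2)[of i] bk' Bot k(1) by cases (auto simp: idp_simps)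
    qed
    then show ?thesis unfolding bk idem_def by (metis ext)
  qed
  show "through_strands (diagram_mult n (bra n k g) (ket n k f)) < k" if m: "\<not> meets g f"
  proof -
    have nc: "(Upper k, Lower k) \<notin> C"
    proof
      assume c: "(Upper k, Lower k) \<in> C"
      \<comment> \<open>The sites that the string of the \<open>k\<close>-th top point can visit. If
        the matchings do not meet, \<open>f 0\<close> is not among them, and the lower row is out of
        reach.\<close>
      define V where "V s \<longleftrightarrow> s = Upper k \<or> (\<exists>x\<in>{k..2 * n}. s = Middle x \<and> (g 0, x) \<in> (link f \<union> link g)\<^sup>*)" for s
      have "V (Lower k)"
      proof (rule conn_invariant[OF c])
        show "V (Upper k)" unfolding V_def by simp
        fix s assume "V s"
        then consider "s = Upper k" | x where "x \<in> {k..2 * n}" "s = Middle x" "(g 0, x) \<in> (link f \<union> link g)\<^sup>*"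
          unfolding V_def by blast
        then show "V (al s)"
        proof cases
          case 1
          have "al s = Middle (g 0)" using 1 P_top[of k] by simp
          then show ?thesis unfolding V_def using G(4,5) by auto
        next
          case (2 x)
          show ?thesis
          proof (cases "x = g 0")
            case True
            then show ?thesis using P_bot' 2(2) unfolding V_def by simp
          next
            case False
            have x0: "x \<noteq> 0" using 2(1) k by auto
            have gx: "g x \<noteq> 0" using False ginv[of x] by metis
            have "g x \<in> {k..2 * n}" using noncrossing_in[OF gA(1), of x] gx 2(1) by blast
            moreover have "al s = Middle (g x)" using P_bot[OF False] 2(1,2) x0 gx unfolding dot_def by simp
            moreover have "(x, g x) \<in> link f \<union> link g" using x0 gx by (simp add: link_iff)
            ultimately show ?thesis unfolding V_def using 2(3) by (meson rtrancl.rtrancl_into_rtrancl)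
          qed
        qed
        from \<open>V s\<close> consider "s = Upper k" | x where "x \<in> {k..2 * n}" "s = Middle x" "(g 0, x) \<in> (link f \<union> link g)\<^sup>*"
          unfolding V_def by blast
        then show "V (be s)"
        proof cases
          case 1
          then show ?thesis unfolding V_def by simp
        next
          case (2 x)
          have False': "x \<noteq> f 0" using 2(3) m sym fA(2) gA(2) unfolding meets_def by blast
          have x0: "x \<noteq> 0" using 2(1) k by auto
          have fx: "f x \<noteq> 0" using False' finv[of x] by metis
          have "f x \<in> {k..2 * n}" using noncrossing_in[OF fA(1), of x] fx 2(1) by blast
          moreover have "be s = Middle (f x)" using Q_top[of x] False' 2(1,2) x0 fx unfolding dot_def by simp
          moreover have "(x, f x) \<in> link f \<union> link g" using x0 fx by (simp add: link_iff)
          ultimately show ?thesis unfolding V_def using 2(3) by (meson rtrancl.rtrancl_into_rtrancl)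
        qed
      qed
      then show False unfolding V_def by simp
    qed
    have "through_tops mu \<subseteq> {1..<k}"
    proof
      fix i assume "i \<in> through_tops mu"
      then obtain j where j: "mu (Top i) = Bot j" unfolding through_tops_def by blast
      then have j': "mu (Bot j) = Top i" using mu_mu[of "Top i"] by simp
      have i: "1 \<le> i" "i \<le> k" using big(1)[of i] j by (cases "i = 0 \<or> k < i"; simp)+
      have jk: "1 \<le> j" "j \<le> k" using big(2)[of j] j' by (cases "j = 0 \<or> k < j"; simp)+
      have "i \<noteq> k"
      proof
        assume "i = k"
        then have "j = k" using small(2)[of j] j' jk by (cases "j < k") auto
        then have "(Upper k, Lower k) \<in> C" using mu_conn[of "Top k"] j \<open>i = k\<close> by simp
        then show False using nc by blast
      qed
      then show "i \<in> {1..<k}" using i by simp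
    qed
    then have "card (through_tops mu) \<le> k - 1" using card_mono[of "{1..<k}"] by fastforce
    then show ?thesis unfolding bk through_strands_dg[OF mu_PI] using k by linarith
  qed
qed

lemma truncation_less: assumes "3 \<le> n" shows "2 * sqrt (2 * real n) < 2 * real n"
proof -
  have "real n * 3 \<le> real n * real n" using assms by (intro mult_left_mono) auto
  then have "2 * real n < (real n)\<^sup>2" using assms unfolding power2_eq_square by simp
  then have "sqrt (2 * real n) < real n" using real_less_lsqrt[of "real n" "2 * real n"] by simp
  then show ?thesis by simp
qed

lemma through_one: "through_strands (diagram_one n) = 2 * n"
  unfolding one_idem by (rule through_idem) simp

lemma finite_one_defect: "finite A \<Longrightarrow> finite (one_defect A)"
  unfolding one_defect_def using finite_noncrossing[of "insert 0 A"] by simp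

theorem nontrivial_dim:
  fixes \<rho> :: "diagram \<Rightarrow> 'k::field_char_0 mat"
  assumes n: "3 \<le> n" and simple: "simple_representation (MoT n) d \<rho>" and nontriv: "\<not> trivial_representation (MoT n) d \<rho>"
  obtains k where "1 \<le> k" "k \<le> 2 * n" "real k \<le> 2 * sqrt (2 * real n)" "card (one_defect {k..2 * n}) \<le> d"
proof -
  let ?M = "MoT n"
  note R = representation_D[OF simple_representation_D(1)[OF simple]]
  have M: "monoid ?M" by (rule monoid_MoT)
  interpret two_element_corner ?M "idem n 1" "idem n 0" by (rule two_element_corner_MoT(1)) (use n in simp)
  define bad where "bad x \<longleftrightarrow> x \<in> carrier ?M \<and> x \<noteq> diagram_one n \<and> \<rho> x \<noteq> 0\<^sub>m d d" for x
  have "\<exists>x. bad x"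
  proof (rule ccontr)
    assume no: "\<not> ?thesis"
    have "\<rho> x = 0\<^sub>m d d" if "x \<in> carrier ?M" "x \<noteq> \<one>\<^bsub>?M\<^esub>" for x
      using no that unfolding bad_def MoT_simps(3) by blast
    then show False using trivial_of_units_only[OF M simple] nontriv by blast
  qed
  then obtain x where x: "bad x" "\<And>y. bad y \<Longrightarrow> through_strands x \<le> through_strands y"
    using ex_has_least_nat[of bad _ through_strands] by blast
  define k where "k = through_strands x"
  have kK: "real k \<le> 2 * sqrt (2 * real n)" using x(1) unfolding bad_def k_def by auto
  then have "real k < real (2 * n)" using truncation_less[OF n] by simp
  then have k2: "k < 2 * n" by simp
  have kill: "\<rho> y = 0\<^sub>m d d" if "y \<in> carrier ?M" "through_strands y < k" for y
  proof (rule ccontr)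
    assume "\<rho> y \<noteq> 0\<^sub>m d d"
    then have "bad y" using that k2 through_one[of n] unfolding bad_def by auto
    then show False using x(2) that(2) unfolding k_def by fastforce
  qed
  have xm: "x \<in> motzkin_diagrams n" using x(1) MoT_motzkin unfolding bad_def by blast
  obtain f g I \<sigma> where d: "half_diagrams n f g I \<sigma>" "x = diagram_from n f g I \<sigma>" using motzkin_mkd[OF xm] by metis
  have cI: "card I = k" using through_mkd[OF d(1)] d(2) unfolding k_def by simp
  note fac = rank_factor[OF d(1), unfolded cI]
  let ?a = "diagram_from n f id I (rank I)" and ?b = "diagram_from n id g {1..k} (\<sigma> \<circ> inv_into I (rank I))"
  have a: "?a \<in> carrier ?M" using mkd_motzkin[OF fac(1)] through_mkd[OF fac(1)] cI kK by simp
  have b: "?b \<in> carrier ?M" using mkd_motzkin[OF fac(2)] through_mkd[OF fac(2)] kK by simp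
  have ek: "idem n k \<in> carrier ?M" by (rule idem_carrier[OF kK]) (use k2 in simp)
  have "\<rho> x = \<rho> ?a * \<rho> ?b" using R(3)[OF a b] fac(3) d(2) unfolding MoT_simps(2) by simp
  also have "\<rho> ?a = \<rho> ?a * \<rho> (idem n k)" using R(3)[OF a ek] fac(4) unfolding MoT_simps(2) by simp
  finally have "\<rho> x = \<rho> ?a * \<rho> (idem n k) * \<rho> ?b" .
  then have \<rho>e: "\<rho> (idem n k) \<noteq> 0\<^sub>m d d" using x(1) R(1)[OF a] R(1)[OF b] unfolding bad_def by auto
  have "1 \<le> k"
  proof (rule ccontr)
    assume "\<not> 1 \<le> k"
    then have k0: "k = 0" by simp
    have "idem n 0 \<otimes>\<^bsub>?M\<^esub> m \<otimes>\<^bsub>?M\<^esub> idem n 0 = idem n 0" if m: "m \<in> carrier ?M" for m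
    proof -
      let ?w = "idem n 0 \<otimes>\<^bsub>?M\<^esub> m \<otimes>\<^bsub>?M\<^esub> idem n 0"
      have w: "?w \<in> carrier ?M" using m z by blast
      \<comment> \<open>The product lies in the corner of \<open>idem n 1\<close>; having no through
        strand, it can only be \<open>idem n 0\<close>.\<close>
      have "idem n 1 \<otimes>\<^bsub>?M\<^esub> ?w \<otimes>\<^bsub>?M\<^esub> idem n 1 = ?w"
        using m z e zs by (metis m_assoc m_closed)
      then have c: "?w = idem n 1 \<or> ?w = idem n 0" using corner[OF w] by metis
      have "through_strands ?w \<le> through_strands (idem n 0)"
        using motzkin_mult(3)[of "idem n 0 \<otimes>\<^bsub>?M\<^esub> m" n "idem n 0"] MoT_motzkin[OF m_closed[OF z m]] MoT_motzkin[OF z]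
        unfolding MoT_simps(2) by blast
      then have "?w \<noteq> idem n 1" using through_idem[of 0 n] through_idem[of 1 n] n by auto
      then show ?thesis using c by blast
    qed
    then have "trivial_representation ?M d \<rho>"
      using trivial_of_zero[OF M simple z] \<rho>e k0 by blast
    then show False using nontriv by blast
  qed
  have kn: "k \<le> 2 * n" using k2 by simp
  have ck: "card (insert p {1..<k}) = k" if "k \<le> p" for p using that \<open>1 \<le> k\<close> by simp
  have ket: "ket n k f \<in> carrier ?M" if "f \<in> one_defect {k..2 * n}" for f
    using mkd_motzkin[OF data_ket[OF that \<open>1 \<le> k\<close> kn]] through_mkd[OF data_ket[OF that \<open>1 \<le> k\<close> kn]]
      ck[OF one_defect_dot(4)[OF that \<open>1 \<le> k\<close>]] kK unfolding ket_def by simp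
  have bra: "bra n k f \<in> carrier ?M" if "f \<in> one_defect {k..2 * n}" for f
    using mkd_motzkin[OF data_bra[OF that \<open>1 \<le> k\<close> kn]] through_mkd[OF data_bra[OF that \<open>1 \<le> k\<close> kn]]
      kK unfolding bra_def by simp
  have "card (one_defect {k..2 * n}) \<le> d"
  proof (rule representation_dim_lower_bound[OF simple_representation_D(1)[OF simple] ek \<rho>e, where x = "ket n k" and y = "bra n k" and Y = "one_defect {k..2 * n}" and G = meets])
    show "finite (one_defect {k..2 * n})" by (rule finite_one_defect) simp
    show "ket n k f \<in> carrier ?M" if "f \<in> one_defect {k..2 * n}" for f by (rule ket[OF that])
    show "bra n k f \<in> carrier ?M" if "f \<in> one_defect {k..2 * n}" for f by (rule bra[OF that])
    show "\<rho> (bra n k g \<otimes>\<^bsub>?M\<^esub> ket n k f) = (if meets g f then \<rho> (idem n k) else 0\<^sub>m d d)"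
      if f: "f \<in> one_defect {k..2 * n}" and g: "g \<in> one_defect {k..2 * n}" for f g
      using bra_ket[OF f g \<open>1 \<le> k\<close> kn] kill[OF m_closed[OF bra[OF g] ket[OF f]]] unfolding MoT_simps(2) by simp
    show "\<forall>f\<in>one_defect {k..2 * n}. c f = 0"
      if "\<And>g. g \<in> one_defect {k..2 * n} \<Longrightarrow> (\<Sum>f\<in>{f \<in> one_defect {k..2 * n}. meets g f}. c f) = 0" for c :: "(nat \<Rightarrow> nat) \<Rightarrow> 'k"
      using meets_nondegenerate[of "{k..2 * n}" c] that \<open>1 \<le> k\<close> by auto
  qed
  then show ?thesis using that \<open>1 \<le> k\<close> kn kK by blast
qed

text \<open>Joining \<open>0\<close> to \<open>k\<close>, the first available point, leaves the
  points after \<open>k\<close> to an arbitrary matching.\<close>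

lemma card_one_defect:
  assumes k: "1 \<le> k" "k \<le> 2 * n" shows "card (noncrossing {k + 1..2 * n}) \<le> card (one_defect {k..2 * n})"
proof (rule card_inj_on_le[of "\<lambda>h. h(0 := k, k := 0)"])
  have fixed: "h 0 = 0 \<and> h k = k" if "h \<in> noncrossing {k + 1..2 * n}" for h
    using noncrossing_outside[OF that] by simp
  show "inj_on (\<lambda>h. h(0 := k, k := 0)) (noncrossing {k + 1..2 * n})"
  proof (rule inj_onI, rule ext)
    fix h h' x assume *: "h \<in> noncrossing {k + 1..2 * n}" "h' \<in> noncrossing {k + 1..2 * n}" "h(0 := k, k := 0) = h'(0 := k, k := 0)"
    show "h x = h' x"
      using fun_cong[OF *(3), of x] fixed[OF *(1)] fixed[OF *(2)] by (cases "x = 0"; cases "x = k") auto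
  qed
  show "(\<lambda>h. h(0 := k, k := 0)) ` noncrossing {k + 1..2 * n} \<subseteq> one_defect {k..2 * n}"
  proof (rule image_subsetI)
    fix h assume h: "h \<in> noncrossing {k + 1..2 * n}"
    have "insert 0 {k..2 * n} - {0, k} = {k + 1..2 * n}" using k by auto
    then have h': "h \<in> noncrossing (insert 0 {k..2 * n} - {0, k})" using h by simp
    have "h(0 := k, k := 0) \<in> noncrossing (insert 0 {k..2 * n})"
      by (rule noncrossing_insert_arc[OF h']) (use k in auto)
    then show "h(0 := k, k := 0) \<in> one_defect {k..2 * n}" unfolding one_defect_def using k by simp
  qed
  show "finite (one_defect {k..2 * n})" by (rule finite_one_defect) simp
qed

section \<open>Lower bound for the semisimple gap\<close>

lemma rank_mono_image:
  assumes I: "finite I" and s: "\<And>x y. x \<in> I \<Longrightarrow> y \<in> I \<Longrightarrow> x < y \<longleftrightarrow> \<sigma> x < \<sigma> (y :: nat)" "inj_on \<sigma> I" and i: "i \<in> I"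
  shows "rank (\<sigma> ` I) (\<sigma> i) = rank I i"
proof -
  have "{y \<in> \<sigma> ` I. y \<le> \<sigma> i} = \<sigma> ` {x \<in> I. x \<le> i}"
    using s(1)[OF i] by (fastforce simp: not_less[symmetric])
  moreover have "inj_on \<sigma> {x \<in> I. x \<le> i}" using s(2) by (rule inj_on_subset) blast
  ultimately show ?thesis unfolding rank_def by (simp add: card_image)
qed

text \<open>Strands do not cross, so the map from upper to lower ends is the increasing bijection,
  and a diagram is determined by its two halves and the two sets of ends, each of size at most
  \<open>N\<close>. The summand 1 is for the identity.\<close>

lemma card_rMoT_upper:
  assumes N: "N = nat \<lfloor>2 * sqrt (2 * real n)\<rfloor>"
  shows "card (carrier (rMoT n)) \<le> 16 ^ n * (2 * n + 1) ^ (2 * N) + 1"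
proof -
  let ?S = "{I. I \<subseteq> {1..2 * n} \<and> card I \<le> N}"
  let ?F = "\<lambda>((f, g), (I, J)). diagram_from n f g I (inv_into J (rank J) \<circ> rank I)"
  let ?D = "(tops n \<times> bots n) \<times> (?S \<times> ?S)"
  have fS: "finite ?S" by (rule finite_subset[of _ "Pow {1..2 * n}"]) auto
  have fin: "finite ?D" using fS finite_tops by simp
  have "carrier (rMoT n) \<subseteq> insert (diagram_one n) (?F ` ?D)"
  proof
    fix x assume "x \<in> carrier (rMoT n)"
    then consider "x = diagram_one n" | "x \<in> rigid_motzkin_diagrams n" "real (through_strands x) \<le> 2 * sqrt (2 * real n)" by auto
    then show "x \<in> insert (diagram_one n) (?F ` ?D)"
    proof cases
      case 2
      have xm: "x \<in> motzkin_diagrams n" using 2(1) unfolding rigid_motzkin_diagrams_def by blast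
      obtain f g I \<sigma> where d: "half_diagrams n f g I \<sigma>" "x = diagram_from n f g I \<sigma>" using motzkin_mkd[OF xm] by metis
      note D = data_D[OF d(1)]
      have fg: "f \<in> tops n" "g \<in> bots n"
        using 2(1) D(1,2) mkd_rigid_iff[OF d(1)] unfolding d(2) tops_def bots_def by blast+
      have "real (card I) \<le> 2 * sqrt (2 * real n)" using 2(2) through_mkd[OF d(1)] d(2) by simp
      then have cI: "card I \<le> N" unfolding N by (simp add: le_nat_floor)
      have cJ: "card (\<sigma> ` I) \<le> N" using card_image_le[OF D(9), of \<sigma>] cI by linarith
      have s: "\<sigma> i = (inv_into (\<sigma> ` I) (rank (\<sigma> ` I)) \<circ> rank I) i" if i: "i \<in> I" for i
      proof -
        have "rank (\<sigma> ` I) (\<sigma> i) = rank I i" by (rule rank_mono_image[OF D(9,6,5) i])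
        then have "(inv_into (\<sigma> ` I) (rank (\<sigma> ` I)) \<circ> rank I) i = inv_into (\<sigma> ` I) (rank (\<sigma> ` I)) (rank (\<sigma> ` I) (\<sigma> i))" by simp
        also have "\<dots> = \<sigma> i" by (rule inv_into_f_f[OF rank_inj]) (use D(9) i in auto)
        finally show ?thesis by simp
      qed
      have "x = ?F ((f, g), (I, \<sigma> ` I))"
        using mk_cong[OF s d(1) data_cong[OF s d(1)]] d(2) by (simp add: comp_def)
      moreover have "((f, g), (I, \<sigma> ` I)) \<in> ?D" using fg cI cJ D(3,4) by blast
      ultimately show ?thesis by blast
    qed blast
  qed
  then have "card (carrier (rMoT n)) \<le> card (insert (diagram_one n) (?F ` ?D))"
    by (rule card_mono[rotated]) (use fin in simp)
  also have "\<dots> \<le> card (?F ` ?D) + 1"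
  proof -
    have "card (insert x A) \<le> card A + 1" if "finite A" for x and A :: "diagram set"
      using that by (simp add: card_insert_if)
    then show ?thesis using fin by blast
  qed
  also have "card (?F ` ?D) \<le> card ?D" by (rule card_image_le[OF fin])
  also have "card ?D = (card (tops n) * card (bots n)) * (card ?S * card ?S)" by (simp only: card_cartesian_product)
  also have "\<dots> \<le> (4 ^ n * 4 ^ n) * ((2 * n + 1) ^ N * (2 * n + 1) ^ N)"
    by (intro mult_le_mono card_tops_upper card_small_subsets)
  also have "\<dots> = 16 ^ n * (2 * n + 1) ^ (2 * N)"
    by (simp add: mult_2 power_add flip: power_mult_distrib)
  finally show ?thesis by simp
qed

lemma data_empty: "f \<in> noncrossing {1..2 * n} \<Longrightarrow> g \<in> noncrossing {1..2 * n} \<Longrightarrow> half_diagrams n f g {} id"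
  unfolding half_diagrams_def by simp

lemma inj_mkd_empty:
  assumes "F \<subseteq> noncrossing {1..2 * n}" "G \<subseteq> noncrossing {1..2 * n}"
  shows "inj_on (\<lambda>(f, g). diagram_from n f g {} id) (F \<times> G)"
proof (rule inj_onI, clarify)
  fix f g f' g' assume *: "f \<in> F" "g \<in> G" "f' \<in> F" "g' \<in> G" "diagram_from n f g {} id = diagram_from n f' g' {} id"
  have "half_diagrams n f g {} id" "half_diagrams n f' g' {} id" using assms * by (auto intro!: data_empty)
  then show "f = f' \<and> g = g'" using mkd_eq_D(1,2) *(5) by metis
qed

text \<open>Diagrams without through strands already suffice, being arbitrary pairs of
  halves.\<close>

lemma card_rMoT_lower: "card (tops n) * card (bots n) \<le> card (carrier (rMoT n))"
proof -
  have "card (tops n \<times> bots n) \<le> card (carrier (rMoT n))"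
  proof (rule card_inj_on_le[of "\<lambda>(f, g). diagram_from n f g {} id"])
    show "inj_on (\<lambda>(f, g). diagram_from n f g {} id) (tops n \<times> bots n)"
      by (rule inj_mkd_empty) (auto simp: tops_def bots_def)
    show "(\<lambda>(f, g). diagram_from n f g {} id) ` (tops n \<times> bots n) \<subseteq> carrier (rMoT n)"
    proof clarify
      fix f g assume fg: "f \<in> tops n" "g \<in> bots n"
      then have d: "half_diagrams n f g {} id" by (intro data_empty) (auto simp: tops_def bots_def)
      have "diagram_from n f g {} id \<in> rigid_motzkin_diagrams n"
        unfolding mkd_rigid_iff[OF d] using fg by (auto simp: tops_def bots_def)
      then show "diagram_from n f g {} id \<in> carrier (rMoT n)" using through_mkd[OF d] by simp
    qed
  qed (rule finite_MoT)
  then show ?thesis unfolding card_cartesian_product .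
qed

lemma card_Mo_lower: "card (noncrossing {1..2 * n}) * card (noncrossing {1..2 * n}) \<le> card (carrier (Mo n))"
proof -
  let ?N = "noncrossing {1..2 * n}"
  have "card (?N \<times> ?N) \<le> card (motzkin_diagrams n)"
  proof (rule card_inj_on_le[of "\<lambda>(f, g). diagram_from n f g {} id"])
    show "inj_on (\<lambda>(f, g). diagram_from n f g {} id) (?N \<times> ?N)" by (rule inj_mkd_empty) auto
    show "(\<lambda>(f, g). diagram_from n f g {} id) ` (?N \<times> ?N) \<subseteq> motzkin_diagrams n"
      by (auto intro!: mkd_motzkin data_empty)
  qed (rule finite_motzkin)
  then show ?thesis unfolding card_cartesian_product Mo_def by simp
qed

lemma card_tops_lower: "4 ^ n \<le> 4 * (n + 1) ^ 3 * card (tops n)"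
proof -
  have "{f \<in> noncrossing {0 + 1..0 + 2 * n}. \<forall>x. (x < f x \<longrightarrow> odd (x - 0)) \<and> (f x < x \<longrightarrow> even (x - 0))} = tops n"
    unfolding tops_def by (auto simp: rigid_sided)
  then show ?thesis using card_alternating_lower[of n 0] by simp
qed

lemma rigid_bot_shift:
  assumes a: "odd a" and f: "f \<in> noncrossing {a + 1..a + 2 * t}"
    and alt: "\<forall>x. (x < f x \<longrightarrow> odd (x - a)) \<and> (f x < x \<longrightarrow> even (x - a))"
  shows "rigid_bot f"
  unfolding rigid_sided(2)[OF f]
proof (intro allI conjI impI)
  fix x
  have "a < x" if "f x \<noteq> x" using noncrossing_outside[OF f, of x] that by fastforce
  then have "even (x - a) \<longleftrightarrow> odd x" if "f x \<noteq> x" using that a by (simp add: even_diff_nat)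
  then show "even x" if "x < f x" using alt that by fastforce
  show "odd x" if "f x < x" using \<open>f x \<noteq> x \<Longrightarrow> even (x - a) \<longleftrightarrow> odd x\<close> alt that by fastforce
qed

text \<open>Bottom arcs lead from even to odd positions, so the first and the last position must be
  dots and \<open>n - 1\<close> pairs remain.\<close>

lemma card_bots_lower: assumes "1 \<le> n" shows "4 ^ (n - 1) \<le> 4 * n ^ 3 * card (bots n)"
proof -
  let ?B = "{f \<in> noncrossing {1 + 1..1 + 2 * (n - 1)}. \<forall>x. (x < f x \<longrightarrow> odd (x - 1)) \<and> (f x < x \<longrightarrow> even (x - 1))}"
  have "?B \<subseteq> bots n"
  proof
    fix f assume f: "f \<in> ?B"
    then have "rigid_bot f" using rigid_bot_shift[of 1 f "n - 1"] by auto
    moreover have "noncrossing {1 + 1..1 + 2 * (n - 1)} \<subseteq> noncrossing {1..2 * n}"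
      by (rule noncrossing_mono) (use assms in auto)
    ultimately show "f \<in> bots n" using f unfolding bots_def by blast
  qed
  then have "card ?B \<le> card (bots n)" by (rule card_mono[OF finite_tops(2)])
  moreover have "4 ^ (n - 1) \<le> 4 * (n - 1 + 1) ^ 3 * card ?B" by (rule card_alternating_lower)
  ultimately have "4 ^ (n - 1) \<le> 4 * (n - 1 + 1) ^ 3 * card (bots n)" by (meson le_trans mult_le_mono2)
  then show ?thesis using assms by simp
qed

text \<open>The cell of the identity lies below all cells. If it were the apex, maximality would put
  every surviving element into it; such an element has all \<open>2 * n\<close> strands, and the
  truncation leaves only the identity. Then everything else acts by 0 and the representation is
  trivial.\<close>

lemma apex_not_one:
  fixes \<rho> :: "diagram \<Rightarrow> 'k::field mat"
  assumes n: "3 \<le> n" and simple: "simple_representation (rMoT n) d \<rho>" and nontriv: "\<not> trivial_representation (rMoT n) d \<rho>"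
    and apex: "is_apex (rMoT n) d \<rho> J"
  shows "diagram_one n \<notin> J"
proof
  let ?M = "rMoT n"
  have M: "monoid ?M" by (rule monoid_MoT)
  interpret monoid ?M by (rule M)
  assume one: "diagram_one n \<in> J"
  have JJ: "J \<in> J_cells ?M" and max: "\<And>J'. J' \<in> J_cells ?M \<Longrightarrow> \<not> annihilates d \<rho> J' \<Longrightarrow> J_cell_le ?M J J' \<Longrightarrow> J' = J"
    using apex unfolding is_apex_def by blast+
  note J = J_cell_eq[OF M JJ one]
  have "\<rho> x = 0\<^sub>m d d" if x: "x \<in> carrier ?M" "x \<noteq> \<one>\<^bsub>?M\<^esub>" for x
  proof (rule ccontr)
    assume nz: "\<rho> x \<noteq> 0\<^sub>m d d"
    let ?J = "{b \<in> carrier ?M. le_lr ?M x b \<and> le_lr ?M b x}"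
    have xJ: "x \<in> ?J" using x(1) le_lr_refl[OF M x(1)] by blast
    have "J_cell_le ?M J ?J"
      unfolding J_cell_le_def
    proof (intro ballI)
      fix a b assume a: "a \<in> J" and b: "b \<in> ?J"
      have "a \<in> carrier ?M" "le_lr ?M a (diagram_one n)" using a J(1) by blast+
      moreover have "le_lr ?M (diagram_one n) b"
        unfolding le_lr_def using b one_closed l_one r_one unfolding MoT_simps(6) by (metis (no_types, lifting) mem_Collect_eq)
      ultimately show "le_lr ?M a b" using le_lr_trans[OF M] by blast
    qed
    then have "?J = J" using max[OF J_cell_of[OF x(1)]] nz xJ unfolding annihilates_def by blast
    then have "x \<in> J" using xJ by (rule subst)
    then have "le_lr ?M x (diagram_one n)" using J(1) by blast
    then obtain c c' where c: "c \<in> carrier ?M" "c' \<in> carrier ?M" "diagram_one n = diagram_mult n (diagram_mult n c x) c'"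
      unfolding le_lr_def MoT_simps(5) by blast
    note m = MoT_motzkin[OF subsetD[OF rMoT_subset]]
    have "through_strands (diagram_one n) \<le> through_strands (diagram_mult n c x)"
      using motzkin_mult(2)[OF motzkin_mult(1)[OF m[OF c(1)] m[OF x(1)]] m[OF c(2)]] c(3) by metis
    also have "\<dots> \<le> through_strands x" by (rule motzkin_mult(3)[OF m[OF c(1)] m[OF x(1)]])
    finally have "real (2 * n) \<le> 2 * sqrt (2 * real n)" using x through_one[of n] by auto
    then show False using truncation_less[OF n] by simp
  qed
  then show False using trivial_of_units_only[OF M simple] nontriv by blast
qed

text \<open>Right multiplication can replace the bottom half of a diagram: first squeeze the \<open>k\<close> strands
  into the leftmost \<open>2k\<close> positions, keeping parities, and then fill the rest arbitrarily.\<close>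

lemma card_right_cell_lower:
  fixes \<rho> :: "diagram \<Rightarrow> 'k::field mat"
  assumes n: "3 \<le> n" and Kn: "2 * sqrt (2 * real n) \<le> real n"
    and simple: "simple_representation (rMoT n) d \<rho>" and nontriv: "\<not> trivial_representation (rMoT n) d \<rho>"
    and apex: "is_apex (rMoT n) d \<rho> J" and R: "R \<in> right_cells (rMoT n)" "R \<subseteq> J"
  obtains k where "real k \<le> 2 * sqrt (2 * real n)" "4 ^ (n - k - 1) \<le> 4 * (n - k - 1 + 1) ^ 3 * card R"
proof -
  let ?M = "rMoT n"
  have M: "monoid ?M" by (rule monoid_MoT)
  obtain a where a: "a \<in> R" using right_cell_nonempty[OF M R(1)] by blast
  note RR = right_cell_eq[OF M R(1) a]
  have "a \<noteq> diagram_one n" using apex_not_one[OF n simple nontriv apex] a R(2) by blast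
  then have ar: "a \<in> rigid_motzkin_diagrams n" "real (through_strands a) \<le> 2 * sqrt (2 * real n)" using RR(2) by auto
  have am: "a \<in> motzkin_diagrams n" using ar(1) unfolding rigid_motzkin_diagrams_def by blast
  obtain f g I \<sigma> where d: "half_diagrams n f g I \<sigma>" "a = diagram_from n f g I \<sigma>" using motzkin_mkd[OF am] by metis
  note D = data_D[OF d(1)]
  have rg: "rigid_top f" "rigid_bot g" "\<And>i. i \<in> I \<Longrightarrow> odd i = odd (\<sigma> i)"
    using ar(1) mkd_rigid_iff[OF d(1)] unfolding d(2) by blast+
  define k where "k = card I"
  have kK: "real k \<le> 2 * sqrt (2 * real n)" using ar(2) through_mkd[OF d(1)] d(2) unfolding k_def by simp
  then have "real k \<le> real n" using Kn by linarith
  then have kn: "k \<le> n" by simp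
  let ?J = "\<sigma> ` I"
  have fJ: "finite ?J" using D(9) by simp
  have cJ: "card ?J = k" using D(5) unfolding k_def by (simp add: card_image)
  \<comment> \<open>The strand of rank r goes to that one of the positions 2r - 1 and 2r which has
    the same parity as its lower end.\<close>
  define pos where "pos j = (if odd j then 2 * rank ?J j - 1 else 2 * rank ?J j)" for j
  have rk: "1 \<le> rank ?J j" "rank ?J j \<le> k" if "j \<in> ?J" for j
    using rank_image[OF fJ] that cJ by auto
  have pos: "1 \<le> pos j" "pos j \<le> 2 * k" "odd (pos j) = odd j" if "j \<in> ?J" for j
    using rk[OF that] unfolding pos_def by auto
  have pos_less: "pos i < pos j" if "i \<in> ?J" "j \<in> ?J" "i < j" for i j
    using rank_less[OF fJ that(2,3)] rk[OF that(1)] rk[OF that(2)] unfolding pos_def by auto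
  have pos_inj: "inj_on pos ?J" by (rule linorder_inj_onI') (use pos_less in \<open>metis less_irrefl\<close>)
  \<comment> \<open>Position \<open>2 * k + 1\<close> is skipped because bottom arcs start at even
    positions; the last position is lost as well, so \<open>n - k - 1\<close> pairs are
    left.\<close>
  define t where "t = n - k - 1"
  let ?Q = "{f \<in> noncrossing {(2 * k + 1) + 1..(2 * k + 1) + 2 * t}.
     \<forall>x. (x < f x \<longrightarrow> odd (x - (2 * k + 1))) \<and> (f x < x \<longrightarrow> even (x - (2 * k + 1)))}"
  have Q: "q \<in> noncrossing {1..2 * n}" "rigid_bot q" "\<And>j. j \<le> 2 * k \<Longrightarrow> free_at q j" if q: "q \<in> ?Q" for q
  proof -
    have q1: "q \<in> noncrossing {(2 * k + 1) + 1..(2 * k + 1) + 2 * t}" using q by blast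
    have "{(2 * k + 1) + 1..(2 * k + 1) + 2 * t} \<subseteq> {1..2 * n}" unfolding t_def using kn by auto
    then show "q \<in> noncrossing {1..2 * n}" using q1 noncrossing_mono by blast
    show "rigid_bot q" by (rule rigid_bot_shift[OF _ q1]) (use q in simp_all)
    have out: "q x = x" if "x \<le> 2 * k + 1" for x using noncrossing_outside[OF q1, of x] that by simp
    have ins: "2 * k + 1 < q x" if "2 * k + 1 < x" for x
    proof (cases "x \<in> {(2 * k + 1) + 1..(2 * k + 1) + 2 * t}")
      case True
      then have "q x \<in> {(2 * k + 1) + 1..(2 * k + 1) + 2 * t}" by (rule noncrossing_in[OF q1])
      then show ?thesis by simp
    next
      case False
      then show ?thesis using noncrossing_outside[OF q1 False] that by simp
    qed
    show "free_at q j" if "j \<le> 2 * k" for j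
      unfolding free_at_def
    proof (intro conjI allI)
      show "q j = j" using out that by simp
      fix x show "x < j \<longleftrightarrow> q x < j"
        using out[of x] ins[of x] that by (cases "x \<le> 2 * k + 1") auto
    qed
  qed
  have J12: "?J \<subseteq> {1..2 * n}" by (rule D(4))
  have posJ: "pos ` ?J \<subseteq> {1..2 * n}" using pos kn by fastforce
  have db: "half_diagrams n id q ?J pos" if q: "q \<in> ?Q" for q
    unfolding half_diagrams_def using J12 posJ pos_less pos(2) Q[OF q] by (auto simp: id_noncrossing free_at_id)
  \<comment> \<open>Moving the strands back undoes the squeezing and restores \<open>g\<close>, so
    each new diagram generates the same right ideal as \<open>a\<close>.\<close>
  define ip where "ip = inv_into ?J pos"
  have ip: "ip (pos j) = j" if "j \<in> ?J" for j unfolding ip_def by (rule inv_into_f_f[OF pos_inj that])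
  have ipJ: "ip ` pos ` ?J = ?J" using ip by (simp add: image_image)
  have dc: "half_diagrams n id g (pos ` ?J) ip"
    unfolding half_diagrams_def ipJ
  proof (intro conjI ballI impI)
    show "ip x < ip y" if xy: "x \<in> pos ` ?J" "y \<in> pos ` ?J" "x < y" for x y
    proof -
      obtain i j where ij: "i \<in> ?J" "j \<in> ?J" "x = pos i" "y = pos j" using xy by blast
      have "\<not> j \<le> i" using pos_less[of j i] ij xy(3) by (cases "j = i") auto
      then show ?thesis using ip ij by simp
    qed
    show "free_at g (ip x)" if "x \<in> pos ` ?J" for x using that ip D(8) by auto
  qed (use D posJ in \<open>auto simp: id_noncrossing free_at_id\<close>)
  have c: "diagram_from n id g (pos ` ?J) ip \<in> carrier ?M"
  proof -
    have "\<forall>i\<in>pos ` ?J. odd i = odd (ip i)" using pos(3) ip by auto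
    then have "diagram_from n id g (pos ` ?J) ip \<in> rigid_motzkin_diagrams n"
      unfolding mkd_rigid_iff[OF dc] using rg(2) by (simp add: rigid_top_def)
    moreover have "through_strands (diagram_from n id g (pos ` ?J) ip) = k"
      using through_mkd[OF dc] card_image[OF pos_inj] cJ by simp
    ultimately show ?thesis using kK by simp
  qed
  have b: "diagram_from n id q ?J pos \<in> carrier ?M" if q: "q \<in> ?Q" for q
  proof -
    have "\<forall>i\<in>?J. odd i = odd (pos i)" using pos(3) by blast
    then have "diagram_from n id q ?J pos \<in> rigid_motzkin_diagrams n"
      unfolding mkd_rigid_iff[OF db[OF q]] using Q(2)[OF q] by (simp add: rigid_top_def)
    moreover have "through_strands (diagram_from n id q ?J pos) = k" using through_mkd[OF db[OF q]] cJ by simp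
    ultimately show ?thesis using kK by simp
  qed
  let ?a = "\<lambda>q. diagram_from n f q I (pos \<circ> \<sigma>)"
  have aq: "?a q = diagram_mult n a (diagram_from n id q ?J pos)" "half_diagrams n f q I (pos \<circ> \<sigma>)" if q: "q \<in> ?Q" for q
    using mult_mkd[OF d(1) db[OF q]] d(2) by simp_all
  have restore: "a = diagram_mult n (?a q) (diagram_from n id g (pos ` ?J) ip)" if q: "q \<in> ?Q" for q
  proof -
    have dc': "half_diagrams n id g ((pos \<circ> \<sigma>) ` I) ip" using dc by (simp add: image_comp)
    have s: "\<sigma> i = (ip \<circ> (pos \<circ> \<sigma>)) i" if "i \<in> I" for i using ip that by simp
    have "a = diagram_from n f g I (ip \<circ> (pos \<circ> \<sigma>))"
      using mk_cong[OF s d(1) data_cong[OF s d(1)]] d(2) by (simp add: comp_def)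
    also have "\<dots> = diagram_mult n (?a q) (diagram_from n id g ((pos \<circ> \<sigma>) ` I) ip)"
      using mult_mkd(1)[OF aq(2)[OF q] dc'] by simp
    finally show ?thesis by (simp add: image_comp)
  qed
  have "card ?Q \<le> card R"
  proof (rule card_inj_on_le[of ?a])
    show "inj_on ?a ?Q" by (rule inj_onI) (use mkd_eq_D(2)[OF aq(2) aq(2)] in blast)
    show "?a ` ?Q \<subseteq> R"
    proof (rule image_subsetI)
      fix q assume q: "q \<in> ?Q"
      have "le_r ?M a (?a q)" unfolding le_r_def MoT_simps(5) using aq(1)[OF q] b[OF q] by blast
      moreover have "le_r ?M (?a q) a" unfolding le_r_def MoT_simps(5) using restore[OF q] c by blast
      moreover have "?a q \<in> carrier ?M" using rMoT_closed[OF RR(2) b[OF q]] aq(1)[OF q] by simp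
      ultimately show "?a q \<in> R" using RR(1) by blast
    qed
    show "finite R" using RR(1) finite_MoT(2) by (metis (no_types, lifting) finite_subset mem_Collect_eq subsetI)
  qed
  moreover have "4 ^ t \<le> 4 * (t + 1) ^ 3 * card ?Q" by (rule card_alternating_lower)
  ultimately have "4 ^ t \<le> 4 * (t + 1) ^ 3 * card R" by (meson le_trans mult_le_mono2)
  then show ?thesis using that kK unfolding t_def by blast
qed

section \<open>Asymptotics\<close>

text \<open>All polynomial factors and the factors caused by the at most \<open>2 * sqrt (2 * n)\<close> through strands
  are absorbed into the following subexponential function.\<close>

definition slack :: "nat \<Rightarrow> real" where
  "slack n = (2 * real n + 1) powr (4 * sqrt (2 * real n) + 10)"

text \<open>The logarithm of \<open>slack n\<close> is of order \<open>sqrt n * ln n\<close>, hence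
  negligible against any positive multiple of \<open>n\<close>.\<close>

lemma slack_eventually:
  assumes "1 < \<delta>" shows "\<forall>\<^sub>F n in sequentially. slack n \<le> \<delta> ^ n"
proof -
  define a where "a = ln \<delta>"
  have a: "0 < a" unfolding a_def using assms by simp
  have "((\<lambda>n. (2 * real n + 1) powr (4 * sqrt (2 * real n) + 10) * exp (- (a * real n))) \<longlongrightarrow> 0) sequentially"
    using a by real_asymp
  then have "\<forall>\<^sub>F n in sequentially. (2 * real n + 1) powr (4 * sqrt (2 * real n) + 10) * exp (- (a * real n)) < 1"
    by (rule order_tendstoD) simp
  then show ?thesis
  proof eventually_elim
    case (elim n)
    have "\<delta> ^ n = exp (a * real n)" unfolding a_def using assms by (simp add: powr_realpow[symmetric] powr_def mult.commute)
    then show ?case using elim unfolding slack_def by (simp add: exp_minus field_simps)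
  qed
qed

lemma slack_pos: "0 < slack n"
  unfolding slack_def by (simp add: add_pos_nonneg)

lemma slack_ge_one: "1 \<le> slack n"
  unfolding slack_def by (rule ge_one_powr_ge_zero) simp_all

text \<open>The exponent of \<open>slack\<close> is made for this: twice the bound on the number of
  strands, with a reserve of 10 for the polynomial factors of the counting lemmas.\<close>

lemma power_le_slack:
  assumes "N = nat \<lfloor>2 * sqrt (2 * real n)\<rfloor>" "m \<le> 2 * N + 10"
  shows "real ((2 * n + 1) ^ m) \<le> slack n"
proof -
  have "real N \<le> 2 * sqrt (2 * real n)" unfolding assms(1) by (simp add: of_nat_floor)
  then have "real m \<le> 4 * sqrt (2 * real n) + 10" using assms(2) by linarith
  then have "(2 * real n + 1) powr real m \<le> slack n" unfolding slack_def by (rule powr_mono) simp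
  then show ?thesis by (simp add: powr_realpow add_pos_nonneg add.commute)
qed

lemma ssGap_upper: "1 \<le> n \<Longrightarrow> real (ssGap K (rMoT n)) \<le> 4 ^ n * slack n"
proof -
  assume n: "1 \<le> n"
  have "real (ssGap K (rMoT n)) \<le> real (4 ^ n * (2 * n + 1))" using ssGap_rMoT(1)[OF n] by (simp only: of_nat_le_iff)
  also have "\<dots> = 4 ^ n * real ((2 * n + 1) ^ 1)" by (simp add: algebra_simps)
  also have "\<dots> \<le> 4 ^ n * slack n" by (rule mult_left_mono[OF power_le_slack[OF refl]]) simp_all
  finally show ?thesis .
qed

lemma Gap_upper: "1 \<le> n \<Longrightarrow> real (Gap K (MoT n)) \<le> 9 ^ n * slack n"
proof -
  assume n: "1 \<le> n"
  have "real (Gap K (MoT n)) \<le> real (9 ^ n * (2 * n + 1))" using Gap_MoT(1)[OF n] by (simp only: of_nat_le_iff)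
  also have "\<dots> = 9 ^ n * real ((2 * n + 1) ^ 1)" by (simp add: algebra_simps)
  also have "\<dots> \<le> 9 ^ n * slack n" by (rule mult_left_mono[OF power_le_slack[OF refl]]) simp_all
  finally show ?thesis .
qed

lemma truncation_le: assumes "8 \<le> n" shows "2 * sqrt (2 * real n) \<le> real n"
proof -
  have "real n * 8 \<le> real n * real n" using assms by (intro mult_left_mono) auto
  then have "2 * real n \<le> (real n / 2)\<^sup>2" by (simp add: power2_eq_square)
  then have "sqrt (2 * real n) \<le> real n / 2" by (intro real_le_lsqrt) auto
  then show ?thesis by simp
qed

text \<open>Numerical constants are generously bounded by \<open>2 * n + 1\<close>; these are the
  exponents that result in the four estimates below.\<close>

lemma collect_powers:
  fixes b c :: nat
  shows "b ^ (k + 1) * (b * b ^ 3 * c) = b ^ (k + 5) * c" "b ^ k * (b * b ^ 3 * c) = b ^ (k + 4) * c"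
    "b ^ 2 * (b ^ 3 * b ^ 3) * c = b ^ 8 * c" "b * (b ^ 3 * b ^ 3) * c = b ^ 7 * c"
  by (simp_all add: power_add numeral_eq_Suc mult_ac)

lemma slackI:
  assumes "N = nat \<lfloor>2 * sqrt (2 * real n)\<rfloor>" "x \<le> (2 * n + 1) ^ m * (y :: nat)" "m \<le> 2 * N + 10"
  shows "real x \<le> slack n * real y"
proof -
  have "real x \<le> real ((2 * n + 1) ^ m * y)" using assms(2) by (simp only: of_nat_le_iff)
  also have "\<dots> = real ((2 * n + 1) ^ m) * real y" by simp
  also have "\<dots> \<le> slack n * real y" by (rule mult_right_mono[OF power_le_slack[OF assms(1,3)]]) simp
  finally show ?thesis .
qed

lemma ssGap_lower:
  fixes K :: "'k::field itself"
  assumes n: "8 \<le> n" shows "4 ^ n \<le> slack n * real (ssGap K (rMoT n))"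
proof -
  define N where "N = nat \<lfloor>2 * sqrt (2 * real n)\<rfloor>"
  let ?B = "2 * n + 1"
  obtain d \<rho> J R where r: "simple_representation (rMoT n) d (\<rho> :: diagram \<Rightarrow> 'k mat)" "\<not> trivial_representation (rMoT n) d \<rho>"
    "is_apex (rMoT n) d \<rho> J" "R \<in> right_cells (rMoT n)" "R \<subseteq> J" "ssGap K (rMoT n) = card R"
    using ssGap_rMoT(2)[of n K] n by auto
  have n3: "3 \<le> n" using n by simp
  obtain k where k: "real k \<le> 2 * sqrt (2 * real n)" "4 ^ (n - k - 1) \<le> 4 * (n - k - 1 + 1) ^ 3 * card R"
    using card_right_cell_lower[OF n3 truncation_le[OF n] r(1-5)] by metis
  have kN: "k \<le> N" unfolding N_def using k(1) by (simp add: le_nat_floor)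
  have "(4::nat) ^ n \<le> 4 ^ (k + 1 + (n - k - 1))" by (rule power_increasing) auto
  also have "\<dots> = 4 ^ (k + 1) * 4 ^ (n - k - 1)" by (rule power_add)
  also have "\<dots> \<le> 4 ^ (k + 1) * (4 * (n - k - 1 + 1) ^ 3 * card R)" by (rule mult_le_mono2[OF k(2)])
  also have "\<dots> \<le> ?B ^ (k + 1) * (?B * ?B ^ 3 * card R)"
    by (intro mult_le_mono power_mono) (use n in auto)
  also have "\<dots> = ?B ^ (k + 5) * card R" by (rule collect_powers)
  finally have "real (4 ^ n) \<le> slack n * real (card R)" by (rule slackI[OF N_def]) (use kN in simp)
  then show ?thesis using r(6) by simp
qed

lemma Gap_lower:
  fixes K :: "'k::field_char_0 itself"
  assumes n: "8 \<le> n" shows "9 ^ n \<le> slack n * real (Gap K (MoT n))"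
proof -
  define N where "N = nat \<lfloor>2 * sqrt (2 * real n)\<rfloor>"
  let ?B = "2 * n + 1" and ?G = "Gap K (MoT n)"
  obtain \<rho> where r: "simple_representation (MoT n) ?G (\<rho> :: diagram \<Rightarrow> 'k mat)" "\<not> trivial_representation (MoT n) ?G \<rho>"
    using Gap_MoT(2)[of n K] n by auto
  have n3: "3 \<le> n" using n by simp
  obtain k where k: "1 \<le> k" "k \<le> 2 * n" "real k \<le> 2 * sqrt (2 * real n)" "card (one_defect {k..2 * n}) \<le> ?G"
    using nontrivial_dim[OF n3 r] by metis
  have kN: "k \<le> N" unfolding N_def using k(3) by (simp add: le_nat_floor)
  have le: "card (noncrossing {k + 1..2 * n}) \<le> ?G" using card_one_defect[OF k(1,2)] k(4) by (rule le_trans)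
  have e: "k + (2 * n - k) = 2 * n" using k(2) by simp
  have "3 ^ (2 * n - k) \<le> 3 * (2 * n - k + 1) ^ 3 * card (noncrossing {k + 1..2 * n})"
    using card_noncrossing_lower[of "2 * n - k" k] unfolding e .
  then have c: "3 ^ (2 * n - k) \<le> 3 * (2 * n - k + 1) ^ 3 * ?G" using mult_le_mono2[OF le] by (rule le_trans)
  have "(9::nat) ^ n = 3 ^ (2 * n)" by (simp add: power_mult)
  also have "\<dots> = 3 ^ (k + (2 * n - k))" using k(2) by simp
  also have "\<dots> = 3 ^ k * 3 ^ (2 * n - k)" by (rule power_add)
  also have "\<dots> \<le> 3 ^ k * (3 * (2 * n - k + 1) ^ 3 * ?G)" by (rule mult_le_mono2[OF c])
  also have "\<dots> \<le> ?B ^ k * (?B * ?B ^ 3 * ?G)"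
    by (intro mult_le_mono power_mono) (use n in auto)
  also have "\<dots> = ?B ^ (k + 4) * ?G" by (rule collect_powers)
  finally have "real (9 ^ n) \<le> slack n * real ?G" by (rule slackI[OF N_def]) (use kN in simp)
  then show ?thesis by simp
qed

lemma sqrt_card_rMoT:
  assumes n: "8 \<le> n"
  shows "4 ^ n \<le> slack n * sqrt (real (card (carrier (rMoT n))))" "sqrt (real (card (carrier (rMoT n)))) \<le> 4 ^ n * slack n"
proof -
  define N where "N = nat \<lfloor>2 * sqrt (2 * real n)\<rfloor>"
  let ?B = "2 * n + 1" and ?c = "card (carrier (rMoT n))"
  \<comment> \<open>With the square of the factor, \<open>slack n\<close> itself comes out of the
    square root.\<close>
  have s2: "slack n \<le> (slack n)\<^sup>2" using slack_ge_one[of n] by (simp add: power2_eq_square mult_left_mono)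
  have p16: "((4::real) ^ n)\<^sup>2 = 16 ^ n" by (simp add: power2_eq_square flip: power_mult_distrib)
  \<comment> \<open>Bottom halves provide only \<open>n - 1\<close> pairs, which accounts for the
    additional factor 4.\<close>
  have "(16::nat) ^ n = 4 ^ n * 4 ^ Suc (n - 1)" using n by (simp flip: power_mult_distrib)
  also have "\<dots> = 4 * 4 ^ n * 4 ^ (n - 1)" by simp
  also have "\<dots> \<le> 4 * (4 * (n + 1) ^ 3 * card (tops n)) * (4 * n ^ 3 * card (bots n))"
    using card_tops_lower[of n] card_bots_lower[of n] n by (intro mult_le_mono) auto
  also have "\<dots> = 64 * ((n + 1) ^ 3 * n ^ 3) * (card (tops n) * card (bots n))" by simp
  also have "\<dots> \<le> ?B ^ 2 * (?B ^ 3 * ?B ^ 3) * ?c"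
  proof (intro mult_le_mono card_rMoT_lower power_mono)
    have "8 ^ 2 \<le> ?B ^ 2" using n by (intro power_mono) auto
    then show "64 \<le> ?B ^ 2" by simp
  qed auto
  also have "\<dots> = ?B ^ 8 * ?c" by (rule collect_powers)
  finally have "real (16 ^ n) \<le> slack n * real ?c" by (rule slackI[OF N_def]) simp
  also have "\<dots> \<le> (slack n)\<^sup>2 * real ?c" by (rule mult_right_mono[OF s2]) simp
  finally have "(4 ^ n)\<^sup>2 \<le> (slack n)\<^sup>2 * real ?c" using p16 by simp
  then have "sqrt ((4 ^ n)\<^sup>2) \<le> sqrt ((slack n)\<^sup>2 * real ?c)" by (rule real_sqrt_le_mono)
  then show "4 ^ n \<le> slack n * sqrt (real ?c)" using slack_pos[of n] by (simp add: real_sqrt_mult)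
  have "?c \<le> 16 ^ n * ?B ^ (2 * N) + 1" by (rule card_rMoT_upper[OF N_def])
  also have "\<dots> \<le> 16 ^ n * ?B ^ (2 * N) + 16 ^ n * ?B ^ (2 * N)" by simp
  also have "\<dots> \<le> ?B * (16 ^ n * ?B ^ (2 * N))" using n by simp
  also have "\<dots> = ?B ^ (2 * N + 1) * 16 ^ n" by (simp add: algebra_simps)
  finally have "real ?c \<le> slack n * real (16 ^ n)" by (rule slackI[OF N_def]) simp
  also have "\<dots> \<le> (slack n)\<^sup>2 * real (16 ^ n)" by (rule mult_right_mono[OF s2]) simp
  finally have "real ?c \<le> (slack n)\<^sup>2 * (4 ^ n)\<^sup>2" using p16 by simp
  then have "sqrt (real ?c) \<le> sqrt ((slack n)\<^sup>2 * (4 ^ n)\<^sup>2)" by (rule real_sqrt_le_mono)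
  then show "sqrt (real ?c) \<le> 4 ^ n * slack n" using slack_pos[of n] by (simp add: real_sqrt_mult mult.commute)
qed

lemma sqrt_card_Mo:
  assumes n: "8 \<le> n" shows "9 ^ n \<le> slack n * sqrt (real (card (carrier (Mo n))))"
proof -
  define N where "N = nat \<lfloor>2 * sqrt (2 * real n)\<rfloor>"
  let ?B = "2 * n + 1" and ?c = "card (carrier (Mo n))" and ?N = "card (noncrossing {1..2 * n})"
  have s2: "slack n \<le> (slack n)\<^sup>2" using slack_ge_one[of n] by (simp add: power2_eq_square mult_left_mono)
  have p81: "((9::real) ^ n)\<^sup>2 = 81 ^ n" by (simp add: power2_eq_square flip: power_mult_distrib)
  have c: "3 ^ (2 * n) \<le> 3 * ?B ^ 3 * ?N" using card_noncrossing_lower[of "2 * n" 0] by simp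
  have "(81::nat) ^ n = 3 ^ (2 * n) * 3 ^ (2 * n)" by (simp add: power_mult flip: power_mult_distrib)
  also have "\<dots> \<le> (3 * ?B ^ 3 * ?N) * (3 * ?B ^ 3 * ?N)" by (rule mult_le_mono[OF c c])
  also have "\<dots> = 9 * (?B ^ 3 * ?B ^ 3) * (?N * ?N)" by simp
  also have "\<dots> \<le> ?B * (?B ^ 3 * ?B ^ 3) * ?c" using n by (intro mult_le_mono card_Mo_lower) auto
  also have "\<dots> = ?B ^ 7 * ?c" by (rule collect_powers)
  finally have "real (81 ^ n) \<le> slack n * real ?c" by (rule slackI[OF N_def]) simp
  also have "\<dots> \<le> (slack n)\<^sup>2 * real ?c" by (rule mult_right_mono[OF s2]) simp
  finally have "(9 ^ n)\<^sup>2 \<le> (slack n)\<^sup>2 * real ?c" using p81 by simp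
  then have "sqrt ((9 ^ n)\<^sup>2) \<le> sqrt ((slack n)\<^sup>2 * real ?c)" by (rule real_sqrt_le_mono)
  then show ?thesis using slack_pos[of n] by (simp add: real_sqrt_mult)
qed

lemma bigo_I:
  assumes "\<forall>\<^sub>F n in sequentially. 0 \<le> f n \<and> f n \<le> (g n :: real)" shows "f \<in> O(g)"
  by (rule bigoI[where c = 1]) (use assms in \<open>auto elim!: eventually_mono\<close>)

lemma omega_I:
  assumes "\<forall>\<^sub>F n in sequentially. 0 \<le> g n \<and> g n \<le> (f n :: real)" shows "f \<in> \<Omega>(g)"
  unfolding bigomega_iff_bigo by (rule bigo_I[OF assms])

text \<open>The quotient \<open>b / a\<close> exceeds 1, so its powers eventually dominate
  \<open>slack\<close>.\<close>

lemma power_lower_of_slack: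
  assumes ab: "0 < a" "a < (b :: real)"
    and f: "\<forall>\<^sub>F n in sequentially. b ^ n \<le> slack n * f n"
  shows "\<forall>\<^sub>F n in sequentially. a ^ n \<le> f n"
proof -
  have "1 < b / a" using ab by simp
  from slack_eventually[OF this] f show ?thesis
  proof eventually_elim
    case (elim n)
    have bp: "0 < b ^ n" using ab by simp
    then have "0 < slack n * f n" using elim(2) by linarith
    then have "0 \<le> f n" using slack_pos[of n] by (simp add: zero_less_mult_iff)
    then have "b ^ n \<le> (b / a) ^ n * f n" using mult_right_mono[OF elim(1)] elim(2) by fastforce
    then show ?case using ab bp by (simp add: power_divide field_simps)
  qed
qed

lemma power_upper_of_slack:
  assumes ab: "0 < a" "a < (b :: real)"
    and f: "\<forall>\<^sub>F n in sequentially. f n \<le> a ^ n * slack n"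
  shows "\<forall>\<^sub>F n in sequentially. f n \<le> b ^ n"
proof -
  have "1 < b / a" using ab by simp
  from slack_eventually[OF this] f show ?thesis
  proof eventually_elim
    case (elim n)
    have ap: "0 < a ^ n" using ab by simp
    have "f n \<le> a ^ n * (b / a) ^ n" using mult_left_mono[OF elim(1), of "a ^ n"] elim(2) ap by linarith
    then show ?case using ab by (simp add: power_divide)
  qed
qed

lemma ratio_bounds:
  fixes a g s :: real
  assumes "0 < s"
  shows "s \<le> (a * g) * a \<Longrightarrow> 1 \<le> a\<^sup>2 * (g / s)" "g \<le> (a * s) * a \<Longrightarrow> g / s \<le> a\<^sup>2"
  using assms by (simp_all add: power2_eq_square field_simps)

lemma pos_of_le_mult:
  fixes a c s :: real
  assumes "0 < c" "c \<le> a * s" "0 < a" shows "0 < s"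
  by (rule zero_less_mult_pos[of a s]) (use assms in auto)

theorem corollary5p3p8:
  fixes K :: "'k::field_char_0 itself"
  shows "(\<forall>\<epsilon>::real. 0 < \<epsilon> \<and> \<epsilon> < 1 \<longrightarrow>
            (\<lambda>n. real (ssGap K (rMoT n))) \<in> \<Omega>(\<lambda>n. (4 - \<epsilon>) ^ n) \<and>
            (\<lambda>n. real (ssGap K (rMoT n))) \<in> O(\<lambda>n. (4 + \<epsilon>) ^ n) \<and>
            (\<lambda>n. real (Gap K (MoT n))) \<in> \<Omega>(\<lambda>n. (9 - \<epsilon>) ^ n)) \<and>
         (\<forall>\<^sub>F n in sequentially. ssGap K (rMoT n) < Gap K (MoT n)) \<and>
         (\<forall>\<epsilon>::real. 0 < \<epsilon> \<and> \<epsilon> < 1 \<longrightarrow>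
            (\<lambda>n. ssRatio_rMoT K n) \<in> \<Omega>(\<lambda>n. (1 - \<epsilon>) ^ n) \<and>
            (\<lambda>n. ssRatio_rMoT K n) \<in> O(\<lambda>n. (1 + \<epsilon>) ^ n) \<and>
            (\<lambda>n. Ratio_MoT K n) \<in> O(\<lambda>n. (1 + \<epsilon>) ^ n))"
proof -
  have big: "\<forall>\<^sub>F n in sequentially. P n" if "\<And>n. 8 \<le> n \<Longrightarrow> P n" for P :: "nat \<Rightarrow> bool"
    unfolding eventually_sequentially using that by blast
  have ss_low: "\<forall>\<^sub>F n in sequentially. (4 - \<epsilon>) ^ n \<le> real (ssGap K (rMoT n))" if "0 < \<epsilon>" "\<epsilon> < 1" for \<epsilon> :: real
    by (rule power_lower_of_slack[OF _ _ big[OF ssGap_lower]]) (use that in auto)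
  have ss_up: "\<forall>\<^sub>F n in sequentially. real (ssGap K (rMoT n)) \<le> (4 + \<epsilon>) ^ n" if "0 < \<epsilon>" "\<epsilon> < 1" for \<epsilon> :: real
    by (rule power_upper_of_slack[OF _ _ big[OF ssGap_upper]]) (use that in auto)
  have gap_low: "\<forall>\<^sub>F n in sequentially. (9 - \<epsilon>) ^ n \<le> real (Gap K (MoT n))" if "0 < \<epsilon>" "\<epsilon> < 1" for \<epsilon> :: real
    by (rule power_lower_of_slack[OF _ _ big[OF Gap_lower]]) (use that in auto)
  have ratio_low: "\<forall>\<^sub>F n in sequentially. (1 - \<epsilon>) ^ n \<le> ssRatio_rMoT K n" if e: "0 < \<epsilon>" "\<epsilon> < 1" for \<epsilon> :: real
  proof -
    \<comment> \<open>Numerator and denominator of the ratio each cost a factor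
      \<open>slack n\<close>, hence the square root.\<close>
    have "\<forall>\<^sub>F n in sequentially. slack n \<le> (1 / sqrt (1 - \<epsilon>)) ^ n"
      by (rule slack_eventually) (use e in simp)
    moreover have "\<forall>\<^sub>F n in sequentially. 1 \<le> (slack n)\<^sup>2 * ssRatio_rMoT K n"
    proof (rule big)
      fix n :: nat assume n: "8 \<le> n"
      let ?s = "sqrt (real (card (carrier (rMoT n))))"
      have s: "0 < ?s" by (rule pos_of_le_mult[OF _ sqrt_card_rMoT(1)[OF n] slack_pos]) simp
      have "4 ^ n * slack n \<le> (slack n * real (ssGap K (rMoT n))) * slack n"
        by (rule mult_right_mono[OF ssGap_lower[OF n]]) (use slack_pos[of n] in simp)
      with sqrt_card_rMoT(2)[OF n] have "?s \<le> (slack n * real (ssGap K (rMoT n))) * slack n" by (rule order_trans)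
      then show "1 \<le> (slack n)\<^sup>2 * ssRatio_rMoT K n"
        unfolding ssRatio_rMoT_def by (rule ratio_bounds(1)[OF s])
    qed
    ultimately show ?thesis
    proof eventually_elim
      case (elim n)
      have "ssRatio_rMoT K n \<ge> 0" unfolding ssRatio_rMoT_def by simp
      moreover have "(slack n)\<^sup>2 \<le> ((1 / sqrt (1 - \<epsilon>)) ^ n)\<^sup>2"
        using elim(1) slack_pos[of n] by (intro power_mono) auto
      moreover have "((1 / sqrt (1 - \<epsilon>)) ^ n)\<^sup>2 = ((1 / sqrt (1 - \<epsilon>))\<^sup>2) ^ n"
        by (simp only: power_mult[symmetric] mult.commute)
      moreover have "(1 / sqrt (1 - \<epsilon>))\<^sup>2 = 1 / (1 - \<epsilon>)" using e by (simp add: power_divide)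
      ultimately have "1 \<le> (1 / (1 - \<epsilon>)) ^ n * ssRatio_rMoT K n"
        using elim(2) mult_right_mono[of "(slack n)\<^sup>2" "(1 / (1 - \<epsilon>)) ^ n" "ssRatio_rMoT K n"] by simp
      then show ?case using e by (simp add: power_divide field_simps)
    qed
  qed
  have square: "\<forall>\<^sub>F n in sequentially. h n \<le> (1 + \<epsilon>) ^ n" if e: "0 < \<epsilon>"
    and h: "\<And>n. 8 \<le> n \<Longrightarrow> h n \<le> (slack n)\<^sup>2" for h :: "nat \<Rightarrow> real" and \<epsilon> :: real
  proof -
    have "\<forall>\<^sub>F n in sequentially. slack n \<le> sqrt (1 + \<epsilon>) ^ n"
      by (rule slack_eventually) (use e in simp)
    moreover have "\<forall>\<^sub>F n in sequentially. h n \<le> (slack n)\<^sup>2" by (rule big[OF h])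
    ultimately show ?thesis
    proof eventually_elim
      case (elim n)
      have "(slack n)\<^sup>2 \<le> (sqrt (1 + \<epsilon>) ^ n)\<^sup>2" using elim(1) slack_pos[of n] by (intro power_mono) auto
      also have "\<dots> = ((sqrt (1 + \<epsilon>))\<^sup>2) ^ n" by (simp only: power_mult[symmetric] mult.commute)
      also have "\<dots> = (1 + \<epsilon>) ^ n" using e by simp
      finally show ?case using elim(2) by linarith
    qed
  qed
  have ratio_up: "\<forall>\<^sub>F n in sequentially. ssRatio_rMoT K n \<le> (1 + \<epsilon>) ^ n" if e: "0 < \<epsilon>" for \<epsilon> :: real
  proof (rule square[OF e])
    fix n :: nat assume n: "8 \<le> n"
    let ?s = "sqrt (real (card (carrier (rMoT n))))"
    have s: "0 < ?s" by (rule pos_of_le_mult[OF _ sqrt_card_rMoT(1)[OF n] slack_pos]) simp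
    have "real (ssGap K (rMoT n)) \<le> 4 ^ n * slack n" using n by (intro ssGap_upper) simp
    also have "\<dots> \<le> (slack n * ?s) * slack n" by (rule mult_right_mono[OF sqrt_card_rMoT(1)[OF n]]) (use slack_pos[of n] in simp)
    finally show "ssRatio_rMoT K n \<le> (slack n)\<^sup>2"
      unfolding ssRatio_rMoT_def by (rule ratio_bounds(2)[OF s])
  qed
  have Ratio_up: "\<forall>\<^sub>F n in sequentially. Ratio_MoT K n \<le> (1 + \<epsilon>) ^ n" if e: "0 < \<epsilon>" for \<epsilon> :: real
  proof (rule square[OF e])
    fix n :: nat assume n: "8 \<le> n"
    let ?s = "sqrt (real (card (carrier (Mo n))))"
    have s: "0 < ?s" by (rule pos_of_le_mult[OF _ sqrt_card_Mo[OF n] slack_pos]) simp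
    have "real (Gap K (MoT n)) \<le> 9 ^ n * slack n" using n by (intro Gap_upper) simp
    also have "\<dots> \<le> (slack n * ?s) * slack n" by (rule mult_right_mono[OF sqrt_card_Mo[OF n]]) (use slack_pos[of n] in simp)
    finally show "Ratio_MoT K n \<le> (slack n)\<^sup>2"
      unfolding Ratio_MoT_def by (rule ratio_bounds(2)[OF s])
  qed
  have strict: "\<forall>\<^sub>F n in sequentially. ssGap K (rMoT n) < Gap K (MoT n)"
  proof -
    \<comment> \<open>The choice of one half is arbitrary:
      \<open>4 + \<epsilon> < 9 - \<epsilon>\<close> holds for every \<epsilon> below 1.\<close>
    have 1: "\<forall>\<^sub>F n in sequentially. real (ssGap K (rMoT n)) \<le> (4 + 1 / 2) ^ n" by (rule ss_up) simp_all
    have 2: "\<forall>\<^sub>F n in sequentially. (9 - 1 / 2) ^ n \<le> real (Gap K (MoT n))" by (rule gap_low) simp_all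
    \<comment> \<open>For \<open>n = 0\<close> both powers are 1; strictness needs a positive
      exponent.\<close>
    from 1 2 eventually_gt_at_top[of 0] show ?thesis
    proof eventually_elim
      case (elim n)
      have "(4 + 1 / 2 :: real) ^ n < (9 - 1 / 2) ^ n" by (rule power_strict_mono) (use elim(3) in auto)
      then have "real (ssGap K (rMoT n)) < real (Gap K (MoT n))" using elim(1,2) by linarith
      then show ?case by simp
    qed
  qed
  show ?thesis
  proof (intro conjI allI impI strict; (elim conjE)?)
    fix \<epsilon> :: real assume e: "0 < \<epsilon>" "\<epsilon> < 1"
    show "(\<lambda>n. real (ssGap K (rMoT n))) \<in> \<Omega>(\<lambda>n. (4 - \<epsilon>) ^ n)"
      by (rule omega_I) (use ss_low[OF e] e in \<open>auto elim!: eventually_mono\<close>)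
    show "(\<lambda>n. real (ssGap K (rMoT n))) \<in> O(\<lambda>n. (4 + \<epsilon>) ^ n)"
      by (rule bigo_I) (use ss_up[OF e] in \<open>auto elim!: eventually_mono\<close>)
    show "(\<lambda>n. real (Gap K (MoT n))) \<in> \<Omega>(\<lambda>n. (9 - \<epsilon>) ^ n)"
      by (rule omega_I) (use gap_low[OF e] e in \<open>auto elim!: eventually_mono\<close>)
    show "(\<lambda>n. ssRatio_rMoT K n) \<in> \<Omega>(\<lambda>n. (1 - \<epsilon>) ^ n)"
      by (rule omega_I) (use ratio_low[OF e] e in \<open>auto elim!: eventually_mono\<close>)
    show "(\<lambda>n. ssRatio_rMoT K n) \<in> O(\<lambda>n. (1 + \<epsilon>) ^ n)"
      by (rule bigo_I) (use ratio_up[OF e(1)] in \<open>auto elim!: eventually_mono simp: ssRatio_rMoT_def\<close>)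
    show "(\<lambda>n. Ratio_MoT K n) \<in> O(\<lambda>n. (1 + \<epsilon>) ^ n)"
      by (rule bigo_I) (use Ratio_up[OF e(1)] in \<open>auto elim!: eventually_mono simp: Ratio_MoT_def\<close>)
  qed
qed

end
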